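(* Let $0<\theta_0\le\pi$ and $\Omega=\{\boldsymbol{x}=(r\cos\theta,r\sin\theta)\in\mathbb{R}^2 : r>0,\ |\theta|<\theta_0\}$. For $R>0$ let $\Omega_R=\{\boldsymbol{x}\in\Omega: 0<r<R\}$ and let $u_R\in H^1_0(\Omega_R)$ be the unique variational solution of $-\Delta u_R=\mathrm{e}^{-u_R}$ in $\Omega_R$, $u_R=0$ on $\partial\Omega_R$. Then $u(\boldsymbol{x}):=\sup_{R} u_R(\boldsymbol{x})$ is finite for every $\boldsymbol{x}\in\Omega$ and is a non-negative local variational solution of $$-\Delta\varphi=\mathrm{e}^{-\varphi}\ \text{ in }\Omega,\qquad \varphi=0\ \text{ on }\partial\Omega. \qquad (P)$$ It is symmetric with respect to $\theta\mapsto-\theta$. It is the minimal solution: every non-negative local variational solution $\varphi$ of $(P)$ satisfies $u\le\varphi$ in $\Omega$; in particular a solution with this minimality property is unique. Similarly, every non-negative supersolution $\overline\varphi$ of $(P)$ of local variational regularity satisfies $u\le\overline\varphi$. Moreover there exists $C\ge0$ such that $u(\boldsymbol{x})\le C+4\log(1+|\boldsymbol{x}|)$ for all $\boldsymbol{x}\in\Omega$.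
   Context: A local variational solution of $(P)$ is a function $\varphi$ with $\varphi\in H^1(\mathcal{O})$ for every bounded open $\mathcal{O}\subset\Omega$, with zero trace on $\partial\Omega$, such that $\int_\Omega\nabla\varphi\cdot\nabla v=\int_\Omega\mathrm{e}^{-\varphi}v$ for all $v\in H^1_0(\Omega)$ with bounded support. A supersolution of local variational regularity is a function $\overline\varphi$ with $\overline\varphi\in H^1(\mathcal{O})$ for every bounded open $\mathcal{O}\subset\Omega$, with non-negative trace on $\partial\Omega$, such that $\int_\Omega\nabla\overline\varphi\cdot\nabla v\ge\int_\Omega\mathrm{e}^{-\overline\varphi}v$ for all $v\in H^1_0(\Omega)$ with $v\ge0$ and bounded support. When $\theta_0=\pi$, $\Omega$ is the plane slit along the non-positive $x_1$-axis, and traces are taken on each side of the slit. It is known that $u_R$ exists, is unique and positive, and that $u_R\le u_{R'}$ in $\Omega_R$ for $R\le R'$. *)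

theory Defs
  imports "HOL-Analysis.Analysis"
begin

section \<open>Smooth functions and test functions\<close>

primrec Ck :: "nat \<Rightarrow> ('a::euclidean_space \<Rightarrow> real) \<Rightarrow> bool" where
  "Ck 0 f \<longleftrightarrow> continuous_on UNIV f"
| "Ck (Suc k) f \<longleftrightarrow> (\<exists>g. (\<forall>x. GDERIV f x :> g x) \<and> (\<forall>b\<in>Basis. Ck k (\<lambda>x. g x \<bullet> b)))"

definition smooth :: "('a::euclidean_space \<Rightarrow> real) \<Rightarrow> bool" where
  "smooth f \<longleftrightarrow> (\<forall>k. Ck k f)"

definition grad :: "('a::euclidean_space \<Rightarrow> real) \<Rightarrow> 'a \<Rightarrow> 'a" where
  "grad f x = (THE D. GDERIV f x :> D)"

definition test_function :: "'a::euclidean_space set \<Rightarrow> ('a \<Rightarrow> real) \<Rightarrow> bool" where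
  "test_function U \<psi> \<longleftrightarrow> smooth \<psi> \<and> (\<exists>K. compact K \<and> K \<subseteq> U \<and> (\<forall>x. x \<notin> K \<longrightarrow> \<psi> x = 0))"


section \<open>Sobolev spaces\<close>

text \<open>Elements of Lebesgue and Sobolev spaces over \<open>U\<close> are represented by total functions;
  only their values on \<open>U\<close>, up to null sets, matter.\<close>

definition L2_on :: "'a::euclidean_space set \<Rightarrow> ('a \<Rightarrow> 'b::euclidean_space) \<Rightarrow> bool" where
  "L2_on U f \<longleftrightarrow> f \<in> borel_measurable (lebesgue_on U) \<and>
     integrable (lebesgue_on U) (\<lambda>x. (norm (f x))\<^sup>2)"

definition locally_integrable_on ::
    "'a::euclidean_space set \<Rightarrow> ('a \<Rightarrow> 'b::euclidean_space) \<Rightarrow> bool" where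
  "locally_integrable_on U f \<longleftrightarrow> (\<forall>K. compact K \<and> K \<subseteq> U \<longrightarrow> integrable (lebesgue_on K) f)"

definition weak_gradient ::
    "'a::euclidean_space set \<Rightarrow> ('a \<Rightarrow> real) \<Rightarrow> ('a \<Rightarrow> 'a) \<Rightarrow> bool" where
  "weak_gradient U f G \<longleftrightarrow> locally_integrable_on U f \<and> locally_integrable_on U G \<and>
     (\<forall>\<psi>. test_function U \<psi> \<longrightarrow>
        (LINT x|lebesgue_on U. f x *\<^sub>R grad \<psi> x) = - (LINT x|lebesgue_on U. \<psi> x *\<^sub>R G x))"

text \<open>Weak gradients are unique up to null sets, so the choice below is immaterial in integrals.\<close>

definition wgrad :: "'a::euclidean_space set \<Rightarrow> ('a \<Rightarrow> real) \<Rightarrow> 'a \<Rightarrow> 'a" where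
  "wgrad U f = (SOME G. weak_gradient U f G)"

definition H1 :: "'a::euclidean_space set \<Rightarrow> ('a \<Rightarrow> real) set" where
  "H1 U = {f. L2_on U f \<and> (\<exists>G. weak_gradient U f G \<and> L2_on U G)}"

text \<open>Convergence in \<open>H1 U\<close> of smooth functions that, with their gradients, are square
  integrable on \<open>U\<close>. In both uses below this integrability is automatic: the approximants are
  test functions, or \<open>U\<close> is bounded.\<close>

definition H1_converges ::
    "'a::euclidean_space set \<Rightarrow> (nat \<Rightarrow> 'a \<Rightarrow> real) \<Rightarrow> ('a \<Rightarrow> real) \<Rightarrow> bool" where
  "H1_converges U \<psi> f \<longleftrightarrow>
     (\<lambda>n. LINT x|lebesgue_on U. (\<psi> n x - f x)\<^sup>2) \<longlonglongrightarrow> 0 \<and>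
     (\<lambda>n. LINT x|lebesgue_on U. (norm (grad (\<psi> n) x - wgrad U f x))\<^sup>2) \<longlonglongrightarrow> 0"

definition H10 :: "'a::euclidean_space set \<Rightarrow> ('a \<Rightarrow> real) set" where
  "H10 U = {f \<in> H1 U. \<exists>\<psi>. (\<forall>n. test_function U (\<psi> n)) \<and> H1_converges U \<psi> f}"

definition bounded_support_on :: "'a::euclidean_space set \<Rightarrow> ('a \<Rightarrow> real) \<Rightarrow> bool" where
  "bounded_support_on U v \<longleftrightarrow> (\<exists>M. AE x in lebesgue_on U. M < norm x \<longrightarrow> v x = 0)"


section \<open>Traces\<close>

text \<open>\<open>g\<close> is the trace of \<open>f \<in> H1 D\<close> along the part \<open>\<gamma> ` I\<close> of the boundary of the bounded
  Lipschitz domain \<open>D\<close>, where \<open>\<gamma>\<close> is an arc-length parametrisation: the trace operator is the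
  continuous extension to \<open>H1 D\<close>, with values in \<open>L\<^sup>2\<close> of the boundary, of the restriction of
  smooth functions.\<close>

definition has_trace_along ::
    "'a::euclidean_space set \<Rightarrow> (real \<Rightarrow> 'a) \<Rightarrow> real set \<Rightarrow> ('a \<Rightarrow> real) \<Rightarrow> (real \<Rightarrow> real) \<Rightarrow> bool" where
  "has_trace_along D \<gamma> I f g \<longleftrightarrow> f \<in> H1 D \<and> L2_on I g \<and>
     (\<exists>\<psi>. (\<forall>n. smooth (\<psi> n)) \<and> H1_converges D \<psi> f \<and>
        (\<lambda>n. LINT t|lebesgue_on I. (\<psi> n (\<gamma> t) - g t)\<^sup>2) \<longlonglongrightarrow> 0)"


section \<open>The sector\<close>

definition polar :: "real \<Rightarrow> real \<Rightarrow> real^2" where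
  "polar r \<theta> = vector [r * cos \<theta>, r * sin \<theta>]"

definition sector :: "real \<Rightarrow> (real^2) set" where
  "sector \<theta>0 = {polar r \<theta> |r \<theta>. 0 < r \<and> \<bar>\<theta>\<bar> < \<theta>0}"

definition sector_trunc :: "real \<Rightarrow> real \<Rightarrow> (real^2) set" where
  "sector_trunc \<theta>0 R = {x \<in> sector \<theta>0. norm x < R}"

text \<open>For \<open>\<sigma> = 1\<close> and \<open>\<sigma> = -1\<close>, the two halves of the truncated sector. They are bounded convex
  domains, hence Lipschitz, also when \<open>\<theta>0 = pi\<close>. Traces on the boundary ray at angle \<open>\<sigma> * \<theta>0\<close>
  are taken from the adjacent half, which for \<open>\<theta>0 = pi\<close> separates the two sides of the slit.\<close>

definition half_sector :: "real \<Rightarrow> real \<Rightarrow> real \<Rightarrow> (real^2) set" where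
  "half_sector \<theta>0 \<sigma> R = {polar r (\<sigma> * \<theta>) |r \<theta>. 0 < r \<and> r < R \<and> 0 < \<theta> \<and> \<theta> < \<theta>0}"

definition has_ray_trace ::
    "real \<Rightarrow> real \<Rightarrow> (real^2 \<Rightarrow> real) \<Rightarrow> (real \<Rightarrow> real) \<Rightarrow> bool" where
  "has_ray_trace \<theta>0 \<sigma> f g \<longleftrightarrow>
     (\<forall>R>0. has_trace_along (half_sector \<theta>0 \<sigma> R) (\<lambda>r. polar r (\<sigma> * \<theta>0)) {0<..<R} f g)"

definition zero_trace :: "real \<Rightarrow> (real^2 \<Rightarrow> real) \<Rightarrow> bool" where
  "zero_trace \<theta>0 f \<longleftrightarrow> (\<forall>\<sigma>\<in>{-1, 1}. has_ray_trace \<theta>0 \<sigma> f (\<lambda>r. 0))"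

definition nonneg_trace :: "real \<Rightarrow> (real^2 \<Rightarrow> real) \<Rightarrow> bool" where
  "nonneg_trace \<theta>0 f \<longleftrightarrow>
     (\<forall>\<sigma>\<in>{-1, 1}. \<exists>g. has_ray_trace \<theta>0 \<sigma> f g \<and> (AE r in lebesgue_on {0<..}. 0 \<le> g r))"


section \<open>Variational solutions\<close>

text \<open>Integrability of \<open>exp (- \<phi> x) * v x\<close> is stated explicitly in the following definitions
  because the Bochner integral of a non-integrable function is \<open>0\<close>. It is automatic when \<open>\<phi>\<close> is
  non-negative.\<close>

definition variational_solution :: "(real^2) set \<Rightarrow> (real^2 \<Rightarrow> real) \<Rightarrow> bool" where
  "variational_solution U w \<longleftrightarrow> w \<in> H10 U \<and>
     (\<forall>v\<in>H10 U. integrable (lebesgue_on U) (\<lambda>x. exp (- w x) * v x) \<and>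
        (LINT x|lebesgue_on U. wgrad U w x \<bullet> wgrad U v x) =
        (LINT x|lebesgue_on U. exp (- w x) * v x))"

definition local_H1 :: "(real^2) set \<Rightarrow> (real^2 \<Rightarrow> real) set" where
  "local_H1 U = {f. \<forall>V. open V \<and> bounded V \<and> V \<subseteq> U \<longrightarrow> f \<in> H1 V}"

definition local_variational_solution :: "real \<Rightarrow> (real^2 \<Rightarrow> real) \<Rightarrow> bool" where
  "local_variational_solution \<theta>0 \<phi> \<longleftrightarrow> (let \<Omega> = sector \<theta>0 in
     \<phi> \<in> local_H1 \<Omega> \<and> zero_trace \<theta>0 \<phi> \<and>
     (\<forall>v\<in>H10 \<Omega>. bounded_support_on \<Omega> v \<longrightarrow>
        integrable (lebesgue_on \<Omega>) (\<lambda>x. exp (- \<phi> x) * v x) \<and>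
        (LINT x|lebesgue_on \<Omega>. wgrad \<Omega> \<phi> x \<bullet> wgrad \<Omega> v x) =
        (LINT x|lebesgue_on \<Omega>. exp (- \<phi> x) * v x)))"

definition local_variational_supersolution :: "real \<Rightarrow> (real^2 \<Rightarrow> real) \<Rightarrow> bool" where
  "local_variational_supersolution \<theta>0 \<phi> \<longleftrightarrow> (let \<Omega> = sector \<theta>0 in
     \<phi> \<in> local_H1 \<Omega> \<and> nonneg_trace \<theta>0 \<phi> \<and>
     (\<forall>v\<in>H10 \<Omega>. bounded_support_on \<Omega> v \<and> (AE x in lebesgue_on \<Omega>. 0 \<le> v x) \<longrightarrow>
        integrable (lebesgue_on \<Omega>) (\<lambda>x. exp (- \<phi> x) * v x) \<and>
        (LINT x|lebesgue_on \<Omega>. wgrad \<Omega> \<phi> x \<bullet> wgrad \<Omega> v x) \<ge>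
        (LINT x|lebesgue_on \<Omega>. exp (- \<phi> x) * v x)))"

definition nonneg_solution :: "real \<Rightarrow> (real^2 \<Rightarrow> real) \<Rightarrow> bool" where
  "nonneg_solution \<theta>0 \<phi> \<longleftrightarrow>
     local_variational_solution \<theta>0 \<phi> \<and> (AE x in lebesgue_on (sector \<theta>0). 0 \<le> \<phi> x)"

definition nonneg_supersolution :: "real \<Rightarrow> (real^2 \<Rightarrow> real) \<Rightarrow> bool" where
  "nonneg_supersolution \<theta>0 \<phi> \<longleftrightarrow>
     local_variational_supersolution \<theta>0 \<phi> \<and> (AE x in lebesgue_on (sector \<theta>0). 0 \<le> \<phi> x)"

text \<open>Inequality between a pointwise defined function and a Sobolev function: almost everywhere,
  and everywhere as soon as the Sobolev function is given by a continuous representative.\<close>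

definition le_on :: "(real^2) set \<Rightarrow> (real^2 \<Rightarrow> real) \<Rightarrow> (real^2 \<Rightarrow> real) \<Rightarrow> bool" where
  "le_on U f \<phi> \<longleftrightarrow> (AE x in lebesgue_on U. f x \<le> \<phi> x) \<and>
     (continuous_on U \<phi> \<longrightarrow> (\<forall>x\<in>U. f x \<le> \<phi> x))"

end

theory Submission
  imports Defs
begin

text \<open>Testing with \<open>h (\<psi> - \<phi>)\<close>, where \<open>\<psi>\<close> is a test function approximating \<open>u\<^sub>R\<close> and
  \<open>h t = exp (- 1 / t)\<close> for \<open>t > 0\<close>, \<open>h t = 0\<close> otherwise, compares \<open>u\<^sub>R\<close> with any non-negative
  supersolution \<open>\<phi>\<close>: as \<open>\<phi> \<ge> 0\<close>, the test function vanishes outside the support of \<open>\<psi>\<close>, so the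
  boundary values of \<open>\<phi>\<close> are irrelevant. In the limit
  \<open>(exp (- u\<^sub>R) - exp (- \<phi>)) * h (u\<^sub>R - \<phi>)\<close> has non-negative integral although it is nowhere
  positive, hence \<open>u\<^sub>R \<le> \<phi>\<close>. This gives monotonicity in \<open>R\<close>, minimality, the symmetry, and, with an
  explicit smooth supersolution on the slit plane, the logarithmic bound. A Caccioppoli estimate for
  \<open>u\<^sub>R - u\<^sub>R'\<close> makes the gradients converge strongly in \<open>L\<^sup>2\<close> on bounded sets, so that the equation
  passes to the limit; the approximating test functions vanish on the boundary rays, which yields
  the zero trace.\<close>

section \<open>Smooth functions\<close>

text \<open>The test function contains \<open>\<psi>\<close> instead of \<open>u_R\<close> because
  \<open>h (u_R - \<phi>)\<close> would be known to lie in \<open>H10\<close> only through a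
  statement about traces. The price is an error bounded by the squared \<open>L2\<close> norm of
  \<open>grad \<psi> - grad u_R\<close>, since \<open>h'\<close> is at most 2. Smoothness of
  \<open>h\<close> turns test functions into test functions, and its boundedness keeps the products
  integrable. The order is read off from the zeroth order term: \<open>exp (- t)\<close> is strictly
  decreasing, and \<open>h\<close> vanishes exactly on the non-positive half line.

  Every sector lies in the slit plane, so one barrier serves all angles and radii. Its terms
  \<open>ln (2 + r)\<close> and \<open>6 * ln (1 + re_sqrt x)\<close> grow at most like
  \<open>ln r\<close> and \<open>3 * ln r\<close>, whence the factor 4.

  Strong convergence of the gradients is demanded by the trace, which is defined through
  approximation in \<open>H1\<close>. Since \<open>wgrad\<close> is a choice determined only up to
  null sets, most arguments carry a gradient explicitly, as the second member of a pair.\<close>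

lemma GDERIV_unique:
  assumes "GDERIV f x :> D" "GDERIV f x :> E" shows "D = E"
proof -
  have "(\<lambda>h. inner h D) = (\<lambda>h. inner h E)"
    using assms has_derivative_unique unfolding gderiv_def by blast
  then show ?thesis by (metis vector_eq_ldot)
qed

lemma grad_eqI: "GDERIV f x :> D \<Longrightarrow> grad f x = D"
  unfolding grad_def by (blast intro: the_equality GDERIV_unique)

lemma GDERIV_continuous_at: "GDERIV f x :> D \<Longrightarrow> isCont f x"
  unfolding gderiv_def by (rule has_derivative_continuous)

lemma Ck_continuous: "Ck k f \<Longrightarrow> continuous_on UNIV f"
proof (cases k)
  case (Suc n)
  moreover assume "Ck k f"
  ultimately obtain g where "\<And>x. GDERIV f x :> g x" by auto
  then show ?thesis by (meson GDERIV_continuous_at continuous_at_imp_continuous_on)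
qed simp

lemma Ck_SucI:
  "(\<And>x. GDERIV f x :> g x) \<Longrightarrow> (\<And>b. b \<in> Basis \<Longrightarrow> Ck k (\<lambda>x. g x \<bullet> b)) \<Longrightarrow> Ck (Suc k) f"
  unfolding Ck.simps by blast

lemma Ck_Suc_imp_Ck: "Ck (Suc k) f \<Longrightarrow> Ck k f"
proof (induction k arbitrary: f)
  case 0 then show ?case using Ck_continuous Ck.simps(1) by blast
next
  case (Suc k)
  from Suc.prems obtain g where "\<forall>x. GDERIV f x :> g x" "\<forall>b\<in>Basis. Ck (Suc k) (\<lambda>x. g x \<bullet> b)"
    by (auto simp only: Ck.simps(2)[of "Suc k"])
  with Suc.IH show ?case by auto
qed

lemma Ck_const: "Ck k (\<lambda>x. c)"
proof (induction k arbitrary: c)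
  case (Suc k)
  then show ?case by (auto intro!: exI[of _ "\<lambda>x. 0"] GDERIV_const)
qed simp

lemma Ck_inner: "Ck k (\<lambda>x. x \<bullet> c)"
proof (cases k)
  case (Suc n)
  have "Ck (Suc n) (\<lambda>x. x \<bullet> c)"
    by (rule Ck_SucI[where g="\<lambda>_. c"]) (auto simp: gderiv_def Ck_const intro!: derivative_eq_intros)
  with Suc show ?thesis by simp
qed (auto intro!: continuous_intros)

lemma Ck_add: "Ck k f \<Longrightarrow> Ck k g \<Longrightarrow> Ck k (\<lambda>x. f x + g x)"
proof (induction k arbitrary: f g)
  case (Suc k)
  then obtain f' g' where "\<forall>x. GDERIV f x :> f' x" "\<forall>b\<in>Basis. Ck k (\<lambda>x. f' x \<bullet> b)"
    "\<forall>x. GDERIV g x :> g' x" "\<forall>b\<in>Basis. Ck k (\<lambda>x. g' x \<bullet> b)" by auto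
  then show ?case using Suc.IH
    by (auto intro!: exI[of _ "\<lambda>x. f' x + g' x"] GDERIV_add simp: inner_add_left)
qed (auto intro: continuous_intros)

lemma Ck_mult: "Ck k f \<Longrightarrow> Ck k g \<Longrightarrow> Ck k (\<lambda>x. f x * g x)"
proof (induction k arbitrary: f g)
  case (Suc k)
  then obtain f' g' where *: "\<forall>x. GDERIV f x :> f' x" "\<forall>b\<in>Basis. Ck k (\<lambda>x. f' x \<bullet> b)"
    "\<forall>x. GDERIV g x :> g' x" "\<forall>b\<in>Basis. Ck k (\<lambda>x. g' x \<bullet> b)" by auto
  have "Ck k f" "Ck k g" using Suc.prems Ck_Suc_imp_Ck by auto
  with * show ?case
    by (auto intro!: exI[of _ "\<lambda>x. f x *\<^sub>R g' x + g x *\<^sub>R f' x"] GDERIV_mult Ck_add Suc.IH simp: inner_add_left)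
qed (auto intro: continuous_intros)

lemma Ck_compose:
  fixes H :: "real \<Rightarrow> real"
  shows "Ck k H \<Longrightarrow> Ck k f \<Longrightarrow> Ck k (\<lambda>x. H (f x))"
proof (induction k arbitrary: H f)
  case 0
  then show ?case by (auto intro: continuous_on_compose2)
next
  case (Suc k)
  from Suc.prems(1) obtain H' where H': "\<And>x. DERIV H x :> H' x" "Ck k H'" by auto
  from Suc.prems(2) obtain f' where f': "\<And>x. GDERIV f x :> f' x" "\<And>b. b \<in> Basis \<Longrightarrow> Ck k (\<lambda>x. f' x \<bullet> b)" by auto
  have "Ck k f" using Suc.prems Ck_Suc_imp_Ck by blast
  from Suc.IH[OF H'(2) this] have H'f: "Ck k (\<lambda>x. H' (f x))" .
  have "Ck k (\<lambda>x. (H' (f x) *\<^sub>R f' x) \<bullet> b)" if "b \<in> Basis" for b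
    using Ck_mult[OF H'f f'(2)[OF that]] by simp
  then show ?case
    by (intro Ck_SucI[where g="\<lambda>x. H' (f x) *\<^sub>R f' x"] GDERIV_DERIV_compose f'(1) H'(1))
qed

text \<open>Diagonal affine maps cover both substitutions that occur: \<open>c - x\<close> in a
  mollification kernel and sign changes of coordinates in the symmetry argument. The linear part is
  self-adjoint, so it also transports the gradient of \<open>f\<close>.\<close>

lemma Ck_affine:
  fixes f :: "'a::euclidean_space \<Rightarrow> real" and s :: "'a \<Rightarrow> real"
  shows "Ck k f \<Longrightarrow> Ck k (\<lambda>x. f (c + (\<Sum>j\<in>Basis. (s j * (x \<bullet> j)) *\<^sub>R j)))"
proof (induction k arbitrary: f)
  case 0
  then show ?case by (auto intro!: continuous_on_compose2[of UNIV f] continuous_intros)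
next
  case (Suc k)
  define T where "T x = c + (\<Sum>j\<in>Basis. (s j * (x \<bullet> j)) *\<^sub>R j)" for x
  obtain f' where f': "\<forall>x. GDERIV f x :> f' x" "\<forall>b\<in>Basis. Ck k (\<lambda>x. f' x \<bullet> b)" using Suc.prems by auto
  have T: "(T has_derivative (\<lambda>h. \<Sum>j\<in>Basis. (s j * (h \<bullet> j)) *\<^sub>R j)) (at x)" for x
    unfolding T_def[abs_def] by (auto intro!: derivative_eq_intros)
  have "GDERIV (\<lambda>x. f (T x)) x :> (\<Sum>j\<in>Basis. (s j * (f' (T x) \<bullet> j)) *\<^sub>R j)" for x
  proof -
    have "((\<lambda>x. f (T x)) has_derivative (\<lambda>h. (\<Sum>j\<in>Basis. (s j * (h \<bullet> j)) *\<^sub>R j) \<bullet> f' (T x))) (at x)"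
      using f'(1) unfolding gderiv_def by (intro has_derivative_compose[OF T]) blast
    moreover have "(\<Sum>j\<in>Basis. (s j * (h \<bullet> j)) *\<^sub>R j) \<bullet> y = h \<bullet> (\<Sum>j\<in>Basis. (s j * (y \<bullet> j)) *\<^sub>R j)" for h y :: 'a
      by (auto simp: inner_sum_left inner_sum_right inner_commute[of _ y] ac_simps intro!: sum.cong)
    ultimately show ?thesis unfolding gderiv_def by simp
  qed
  moreover have "Ck k (\<lambda>x. (\<Sum>j\<in>Basis. (s j * (f' (T x) \<bullet> j)) *\<^sub>R j) \<bullet> b)" if "b \<in> Basis" for b
  proof -
    have "Ck k (\<lambda>x. f' (T x) \<bullet> b)" using Suc.IH[OF f'(2)[rule_format, OF that]] by (simp add: T_def)
    then show ?thesis using that by (simp add: Ck_mult Ck_const)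
  qed
  ultimately have "Ck (Suc k) (\<lambda>x. f (T x))"
    by (intro Ck_SucI[where g="\<lambda>x. \<Sum>j\<in>Basis. (s j * (f' (T x) \<bullet> j)) *\<^sub>R j"]) blast+
  then show ?case unfolding T_def .
qed

lemma smooth_const [simp]: "smooth (\<lambda>x. c)"
  unfolding smooth_def by (rule allI) (rule Ck_const)

lemma smooth_inner [simp]: "smooth (\<lambda>x. x \<bullet> b)"
  unfolding smooth_def by (rule allI) (rule Ck_inner)

lemma smooth_add: "smooth f \<Longrightarrow> smooth g \<Longrightarrow> smooth (\<lambda>x. f x + g x)"
  using Ck_add[of _ f g] unfolding smooth_def by blast

lemma smooth_mult: "smooth f \<Longrightarrow> smooth g \<Longrightarrow> smooth (\<lambda>x. f x * g x)"
  using Ck_mult[of _ f g] unfolding smooth_def by blast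

lemma smooth_compose:
  fixes H :: "real \<Rightarrow> real"
  assumes "smooth H" "smooth f" shows "smooth (\<lambda>x. H (f x))"
  using assms Ck_compose[of _ H f] unfolding smooth_def by blast

lemma smooth_affine:
  fixes f :: "'a::euclidean_space \<Rightarrow> real" and s :: "'a \<Rightarrow> real"
  shows "smooth f \<Longrightarrow> smooth (\<lambda>x. f (c + (\<Sum>j\<in>Basis. (s j * (x \<bullet> j)) *\<^sub>R j)))"
  using Ck_affine[of _ f c s] unfolding smooth_def by blast

lemma smooth_uminus: "smooth f \<Longrightarrow> smooth (\<lambda>x. - f x)"
  using smooth_mult[of "\<lambda>x. -1" f] by simp

lemma smooth_diff: "smooth f \<Longrightarrow> smooth g \<Longrightarrow> smooth (\<lambda>x. f x - g x)"
  using smooth_add[of f "\<lambda>x. - g x"] smooth_uminus[of g] by simp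

lemma smooth_reflect:
  fixes f :: "'a::euclidean_space \<Rightarrow> real"
  assumes "smooth f" shows "smooth (\<lambda>x. f (c - x))"
proof -
  have "c + (\<Sum>j\<in>Basis. (- 1 * (x \<bullet> j)) *\<^sub>R j) = c - x" for x
    by (simp add: sum_negf euclidean_representation)
  with smooth_affine[OF assms, of c "\<lambda>_. -1"] show ?thesis by simp
qed

lemma smooth_sum: "finite A \<Longrightarrow> (\<And>i. i \<in> A \<Longrightarrow> smooth (f i)) \<Longrightarrow> smooth (\<lambda>x. \<Sum>i\<in>A. f i x)"
  by (induction A rule: finite_induct) (auto intro: smooth_add)

lemma smooth_inner_self: "smooth (\<lambda>x::'a::euclidean_space. x \<bullet> x)"
proof -
  have "(\<lambda>x::'a. x \<bullet> x) = (\<lambda>x. \<Sum>b\<in>Basis. (x \<bullet> b) * (x \<bullet> b))"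
    by (auto simp: euclidean_inner[of x x for x])
  then show ?thesis by (auto intro!: smooth_sum smooth_mult)
qed

lemma smooth_GDERIV: "smooth f \<Longrightarrow> GDERIV f x :> grad f x"
proof -
  assume "smooth f"
  then have "Ck (Suc 0) f" unfolding smooth_def by blast
  then obtain g where "\<forall>x. GDERIV f x :> g x" by auto
  then show ?thesis using grad_eqI by metis
qed

lemma smooth_continuous: "smooth f \<Longrightarrow> continuous_on UNIV f"
  using Ck_continuous smooth_def by blast

lemma smooth_grad_component:
  assumes "smooth f" "b \<in> Basis" shows "smooth (\<lambda>x. grad f x \<bullet> b)"
  unfolding smooth_def
proof
  fix k
  have "Ck (Suc k) f" using assms unfolding smooth_def by blast
  then obtain g where g: "\<forall>x. GDERIV f x :> g x" "\<forall>b\<in>Basis. Ck k (\<lambda>x. g x \<bullet> b)" by auto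
  then have "grad f = g" using grad_eqI by blast
  with g assms show "Ck k (\<lambda>x. grad f x \<bullet> b)" by simp
qed

lemma smooth_grad_continuous: "smooth f \<Longrightarrow> continuous_on UNIV (grad f)"
  by (subst continuous_on_componentwise) (auto intro: smooth_continuous smooth_grad_component)

lemma grad_diff: "smooth f \<Longrightarrow> smooth g \<Longrightarrow> grad (\<lambda>x. f x - g x) x = grad f x - grad g x"
  and grad_mult: "smooth f \<Longrightarrow> smooth g \<Longrightarrow> grad (\<lambda>x. f x * g x) x = f x *\<^sub>R grad g x + g x *\<^sub>R grad f x"
  by (auto intro!: grad_eqI GDERIV_diff GDERIV_mult smooth_GDERIV)

lemma grad_reflect:
  assumes "smooth f" shows "grad (\<lambda>x. f (c - x)) x = - grad f (c - x)"
proof -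
  have "((\<lambda>x. f (c - x)) has_derivative (\<lambda>h. (- h) \<bullet> grad f (c - x))) (at x)"
    by (rule has_derivative_compose[of "\<lambda>x. c - x" _ _ _ f])
       (use smooth_GDERIV[OF assms] in \<open>auto intro!: derivative_eq_intros simp: gderiv_def\<close>)
  then show ?thesis by (intro grad_eqI) (simp add: gderiv_def)
qed

lemma GDERIV_zero_open:
  assumes "open S" "x \<in> S" "\<And>y. y \<in> S \<Longrightarrow> f y = 0" shows "GDERIV f x :> 0"
proof -
  have "((\<lambda>y. 0) has_derivative (\<lambda>h. inner h 0)) (at x)" by simp
  then show ?thesis unfolding gderiv_def
    by (rule has_derivative_transform_within_open[OF _ assms(1,2)]) (simp add: assms(3))
qed

lemma grad_zero_open:
  assumes "open S" "x \<in> S" "\<And>y. y \<in> S \<Longrightarrow> f y = 0" shows "grad f x = 0"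
  by (rule grad_eqI) (rule GDERIV_zero_open[OF assms])

subsection \<open>A smooth function vanishing exactly on the negative half line\<close>

text \<open>The powers of \<open>inverse t\<close> close the family under differentiation up to
  linear combinations, so a single induction proves all members smooth. The function used for
  testing is \<open>flat 0\<close>, and \<open>flat 2\<close> is its derivative.\<close>

definition flat :: "nat \<Rightarrow> real \<Rightarrow> real" where
  "flat m t = (if 0 < t then inverse t ^ m * exp (- inverse t) else 0)"

text \<open>A single term of the exponential series is at most its sum.\<close>

lemma power_exp_bound: "0 \<le> s \<Longrightarrow> s ^ n * exp (- s) \<le> fact n" for s :: real
proof -
  assume s: "0 \<le> s"
  have "(\<Sum>k\<in>{n}. s ^ k /\<^sub>R fact k) \<le> (\<Sum>k. s ^ k /\<^sub>R fact k)"
    by (rule sum_le_suminf[OF summable_exp_generic]) (use s in auto)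
  then have "s ^ n / fact n \<le> exp s" by (simp add: exp_def divide_inverse mult.commute)
  then show ?thesis by (simp add: exp_minus field_simps)
qed

lemma flat_nonneg: "0 \<le> flat m t" by (simp add: flat_def)
lemma flat_pos: "0 < t \<Longrightarrow> 0 < flat m t" by (simp add: flat_def)
lemma flat_zero [simp]: "t \<le> 0 \<Longrightarrow> flat m t = 0" by (simp add: flat_def)
lemma flat_eq_0_iff: "flat m t = 0 \<longleftrightarrow> t \<le> 0" by (simp add: flat_def)
lemma flat_bound: "flat m t \<le> fact m"
  using power_exp_bound[of "inverse t" m] by (simp add: flat_def)

text \<open>A quadratic bound makes the difference quotient at 0 tend to 0, which is the only
  delicate point in differentiating \<open>flat m\<close>. It is \<open>power_exp_bound\<close> with
  two extra powers.\<close>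

lemma flat_quadratic: "\<bar>flat m t\<bar> \<le> fact (m + 2) * t\<^sup>2"
proof (cases "t > 0")
  case True
  have "inverse t ^ (m + 2) * exp (- inverse t) \<le> fact (m + 2)" using True by (intro power_exp_bound) simp
  moreover have "flat m t / t\<^sup>2 = inverse t ^ (m + 2) * exp (- inverse t)"
    using True by (simp add: flat_def power_add field_simps power2_eq_square)
  ultimately have "flat m t / t\<^sup>2 \<le> fact (m + 2)" by simp
  with True show ?thesis by (simp add: flat_nonneg divide_le_eq)
qed (simp add: zero_le_mult_iff del: fact_Suc)

lemma flat_DERIV: "DERIV (flat m) t :> flat (m + 2) t - real m * flat (m + 1) t"
proof -
  consider "t > 0" | "t < 0" | "t = 0" by linarith
  then show ?thesis
  proof cases
    case 1
    have "((\<lambda>t. inverse t ^ m * exp (- inverse t)) has_real_derivative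
        (flat (m + 2) t - real m * flat (m + 1) t)) (at t)"
    proof -
      have p: "((\<lambda>t. inverse t ^ m) has_real_derivative - real m * inverse t ^ (m + 1)) (at t)"
        by (rule DERIV_cong[OF DERIV_power[OF DERIV_inverse]]) (use 1 in simp, insert 1, cases m, auto simp: power2_eq_square algebra_simps)
      have e: "((\<lambda>t. exp (- inverse t)) has_real_derivative exp (- inverse t) * inverse t ^ 2) (at t)"
        using 1 by (auto intro!: derivative_eq_intros simp: power2_eq_square)
      show ?thesis
        by (rule DERIV_cong[OF DERIV_mult[OF p e]]) (use 1 in \<open>simp add: flat_def algebra_simps power_add power2_eq_square\<close>)
    qed
    then show ?thesis
      by (rule has_field_derivative_transform_within_open[of _ _ _ "{0<..}"])
         (use 1 in \<open>auto simp: flat_def\<close>)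
  next
    case 2
    have "((\<lambda>t. 0) has_real_derivative 0) (at t)" by simp
    then have "(flat m has_real_derivative 0) (at t)"
      by (rule has_field_derivative_transform_within_open[of _ _ _ "{..<0}"])
         (use 2 in \<open>auto simp: flat_def\<close>)
    with 2 show ?thesis by simp
  next
    case 3
    have "((\<lambda>h. (flat m (0 + h) - flat m 0) / h) \<longlongrightarrow> 0) (at 0)"
    proof (rule Lim_null_comparison)
      show "\<forall>\<^sub>F h in at 0. norm ((flat m (0 + h) - flat m 0) / h) \<le> fact (m + 2) * \<bar>h\<bar>"
      proof (rule always_eventually, rule allI)
        fix h :: real
        show "norm ((flat m (0 + h) - flat m 0) / h) \<le> fact (m + 2) * \<bar>h\<bar>"
          using flat_quadratic[of m h]
          by (cases "h = 0") (simp_all add: abs_divide divide_le_eq power2_eq_square abs_mult_self_eq mult.assoc del: fact_Suc)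
      qed
      show "((\<lambda>h. fact (m + 2) * \<bar>h\<bar>) \<longlongrightarrow> 0) (at (0::real))"
        by (auto intro!: tendsto_eq_intros simp del: fact_Suc)
    qed
    then show ?thesis using 3 by (simp add: DERIV_def)
  qed
qed

lemma smooth_flat: "smooth (flat m)"
proof -
  have "Ck k (flat m)" for k
  proof (induction k arbitrary: m)
    case 0
    then show ?case by (auto intro!: continuous_at_imp_continuous_on DERIV_isCont flat_DERIV)
  next
    case (Suc k)
    have "Ck k (\<lambda>t. flat (m + 2) t + (- real m) * flat (m + 1) t)"
      by (intro Ck_add Ck_mult Suc.IH Ck_const)
    then show ?case using flat_DERIV[of m]
      by (auto intro!: exI[of _ "\<lambda>t. flat (m + 2) t - real m * flat (m + 1) t"])
  qed
  then show ?thesis by (simp add: smooth_def)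
qed

lemma flat0_DERIV: "DERIV (flat 0) t :> flat 2 t"
  using flat_DERIV[of 0 t] by (simp add: numeral_2_eq_2)

lemma flat_continuous: "continuous_on S (flat m)"
  using smooth_continuous[OF smooth_flat] continuous_on_subset by blast

lemma flat_borel [measurable]: "flat m \<in> borel_measurable borel"
  by (intro borel_measurable_continuous_onI flat_continuous)

section \<open>Convergence in \<open>L\<^sup>2\<close>\<close>

text \<open>Measurability is listed separately because integrability of the squared norm does not
  imply it. The measure is arbitrary, so that the lemmas apply on the whole space, where
  mollification takes place, as well as on subsets.\<close>

definition sq_integrable :: "'a measure \<Rightarrow> ('a \<Rightarrow> 'b::euclidean_space) \<Rightarrow> bool" where
  "sq_integrable M f \<longleftrightarrow> f \<in> borel_measurable M \<and> integrable M (\<lambda>x. (norm (f x))\<^sup>2)"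

lemma L2_on_iff_sq_integrable: "L2_on U f \<longleftrightarrow> sq_integrable (lebesgue_on U) f"
  by (simp add: L2_on_def sq_integrable_def)

lemma sq_integrable_measurable: "sq_integrable M f \<Longrightarrow> f \<in> borel_measurable M"
  and sq_integrable_integrable: "sq_integrable M f \<Longrightarrow> integrable M (\<lambda>x. (norm (f x))\<^sup>2)"
  by (auto simp: sq_integrable_def)

lemma norm_add_sq_le: "(norm (a + b))\<^sup>2 \<le> 2 * (norm a)\<^sup>2 + 2 * (norm (b::'b::real_normed_vector))\<^sup>2"
proof -
  have "(norm (a + b))\<^sup>2 \<le> (norm a + norm b)\<^sup>2"
    by (intro power_mono norm_triangle_ineq) simp
  also have "\<dots> \<le> 2 * (norm a)\<^sup>2 + 2 * (norm b)\<^sup>2"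
    using sum_squares_bound[of "norm a" "norm b"] by (simp add: power2_sum)
  finally show ?thesis .
qed

lemma norm_diff_sq_le: "(norm (a - b))\<^sup>2 \<le> 2 * (norm a)\<^sup>2 + 2 * (norm (b::'b::real_normed_vector))\<^sup>2"
  using norm_add_sq_le[of a "- b"] by simp

lemma sq_integrable_dominated:
  assumes "f \<in> borel_measurable M" "AE x in M. (norm (f x))\<^sup>2 \<le> w x" "integrable M w"
  shows "sq_integrable M f"
  unfolding sq_integrable_def
proof
  have [measurable]: "f \<in> borel_measurable M" by fact
  show "integrable M (\<lambda>x. (norm (f x))\<^sup>2)"
  proof (rule Bochner_Integration.integrable_bound[OF assms(3)])
    show "AE x in M. norm ((norm (f x))\<^sup>2) \<le> norm (w x)"
      using assms(2) by eventually_elim auto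
  qed simp
qed fact

lemma sq_integrable_add: assumes "sq_integrable M f" "sq_integrable M g" shows "sq_integrable M (\<lambda>x. f x + g x)"
  by (rule sq_integrable_dominated[where w="\<lambda>x. 2 * (norm (f x))\<^sup>2 + 2 * (norm (g x))\<^sup>2"])
     (use assms in \<open>auto simp: sq_integrable_def norm_add_sq_le\<close>)

lemma sq_integrable_diff: assumes "sq_integrable M f" "sq_integrable M g" shows "sq_integrable M (\<lambda>x. f x - g x)"
  by (rule sq_integrable_dominated[where w="\<lambda>x. 2 * (norm (f x))\<^sup>2 + 2 * (norm (g x))\<^sup>2"])
     (use assms in \<open>auto simp: sq_integrable_def norm_diff_sq_le\<close>)

lemma sq_integrable_zero [simp]: "sq_integrable M (\<lambda>x. 0)" by (simp add: sq_integrable_def)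

lemma sq_integrable_scaleR_bounded:
  fixes b :: "'a \<Rightarrow> real"
  assumes "b \<in> borel_measurable M" "AE x in M. \<bar>b x\<bar> \<le> B" "sq_integrable M f"
  shows "sq_integrable M (\<lambda>x. b x *\<^sub>R f x)"
proof (rule sq_integrable_dominated[where w="\<lambda>x. B\<^sup>2 * (norm (f x))\<^sup>2"])
  show "AE x in M. (norm (b x *\<^sub>R f x))\<^sup>2 \<le> B\<^sup>2 * (norm (f x))\<^sup>2"
    using assms(2)
  proof eventually_elim
    case (elim x)
    then have "\<bar>b x\<bar>\<^sup>2 \<le> B\<^sup>2" by (intro power_mono) auto
    then show ?case by (simp add: power_mult_distrib mult_right_mono)
  qed
qed (use assms in \<open>auto simp: sq_integrable_def\<close>)

lemma sq_integrable_bounded: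
  assumes "finite_measure M" "f \<in> borel_measurable M" "AE x in M. norm (f x) \<le> B"
  shows "sq_integrable M f"
proof (rule sq_integrable_dominated[where w="\<lambda>_. B\<^sup>2"])
  show "AE x in M. (norm (f x))\<^sup>2 \<le> B\<^sup>2"
    using assms(3) by eventually_elim (auto intro: power_mono)
qed (use assms finite_measure.integrable_const in auto)

lemma sq_integrable_norm_prod_integrable:
  assumes "sq_integrable M f" "sq_integrable M g" shows "integrable M (\<lambda>x. norm (f x) * norm (g x))"
proof (rule Bochner_Integration.integrable_bound[where f="\<lambda>x. (norm (f x))\<^sup>2 + (norm (g x))\<^sup>2"])
  have "norm a * norm b \<le> (norm a)\<^sup>2 + (norm b)\<^sup>2" for a :: 'b and b :: 'c
    using sum_squares_bound[of "norm a" "norm b"] mult_nonneg_nonneg[OF norm_ge_zero norm_ge_zero, of a b] by linarith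
  then show "AE x in M. norm (norm (f x) * norm (g x)) \<le> norm ((norm (f x))\<^sup>2 + (norm (g x))\<^sup>2)"
    by (auto simp: abs_mult)
qed (use assms in \<open>auto simp: sq_integrable_def\<close>)

lemma sq_integrable_bilinear_integrable:
  fixes prod :: "'b::euclidean_space \<Rightarrow> 'c::euclidean_space \<Rightarrow> 'd::euclidean_space"
  assumes "bounded_bilinear prod" "sq_integrable M f" "sq_integrable M g"
  shows "integrable M (\<lambda>x. prod (f x) (g x))"
proof -
  interpret bounded_bilinear prod by fact
  obtain K where K: "\<And>a b. norm (prod a b) \<le> norm a * norm b * K" using bounded by blast
  show ?thesis
  proof (rule Bochner_Integration.integrable_bound[where f="\<lambda>x. norm (f x) * norm (g x) * K"])
    have "continuous_on UNIV (\<lambda>p. prod (fst p) (snd p))" by (intro continuous_on continuous_intros)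
    then have "(\<lambda>p. prod (fst p) (snd p)) \<in> borel_measurable borel" by (rule borel_measurable_continuous_onI)
    then have "(\<lambda>p. prod (fst p) (snd p)) \<circ> (\<lambda>x. (f x, g x)) \<in> borel_measurable M"
      using assms by (intro measurable_comp[where N=borel]) (auto simp: sq_integrable_def)
    then show "(\<lambda>x. prod (f x) (g x)) \<in> borel_measurable M" by (simp add: o_def)
    show "AE x in M. norm (prod (f x) (g x)) \<le> norm (norm (f x) * norm (g x) * K)"
      using K by (intro AE_I2) (smt (verit) real_norm_def)
  qed (use sq_integrable_norm_prod_integrable[OF assms(2,3)] in auto)
qed

lemma sq_integrable_inner_integrable: "sq_integrable M f \<Longrightarrow> sq_integrable M g \<Longrightarrow> integrable M (\<lambda>x. f x \<bullet> g x)"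
  by (rule sq_integrable_bilinear_integrable[OF bounded_bilinear_inner])

lemma sq_integrable_scaleR_integrable: "sq_integrable M f \<Longrightarrow> sq_integrable M g \<Longrightarrow> integrable M (\<lambda>x. f x *\<^sub>R g x)"
  by (rule sq_integrable_bilinear_integrable[OF bounded_bilinear_scaleR])

lemma sq_integrable_finite_integrable:
  assumes "finite_measure M" "sq_integrable M f" shows "integrable M f"
  using sq_integrable_scaleR_integrable[OF sq_integrable_bounded[OF assms(1), of "\<lambda>_. 1" 1] assms(2)] by simp

text \<open>Transferred from the inequality for non-negative extended integrals, all of which are
  finite here. A product of norms, rather than an inner product, lets the lemma control every
  bounded bilinear product.\<close>

lemma L2_Cauchy_Schwarz:
  assumes "sq_integrable M f" "sq_integrable M g"
  shows "(LINT x|M. norm (f x) * norm (g x)) \<le> sqrt (LINT x|M. (norm (f x))\<^sup>2) * sqrt (LINT x|M. (norm (g x))\<^sup>2)"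
proof -
  let ?A = "LINT x|M. (norm (f x))\<^sup>2" and ?B = "LINT x|M. (norm (g x))\<^sup>2" and ?C = "LINT x|M. norm (f x) * norm (g x)"
  have nn: "0 \<le> ?A" "0 \<le> ?B" "0 \<le> ?C" by (auto intro!: integral_nonneg_AE)
  have "(\<integral>\<^sup>+x. ennreal (norm (f x)) * ennreal (norm (g x)) \<partial>M)\<^sup>2
     \<le> (\<integral>\<^sup>+x. (ennreal (norm (f x)))\<^sup>2 \<partial>M) * (\<integral>\<^sup>+x. (ennreal (norm (g x)))\<^sup>2 \<partial>M)"
    by (rule Cauchy_Schwarz_nn_integral) (use assms in \<open>auto simp: sq_integrable_def\<close>)
  moreover have "(\<integral>\<^sup>+x. (ennreal (norm (f x)))\<^sup>2 \<partial>M) = ennreal ?A"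
    using assms by (simp add: ennreal_power nn_integral_eq_integral sq_integrable_def)
  moreover have "(\<integral>\<^sup>+x. (ennreal (norm (g x)))\<^sup>2 \<partial>M) = ennreal ?B"
    using assms by (simp add: ennreal_power nn_integral_eq_integral sq_integrable_def)
  moreover have "(\<integral>\<^sup>+x. ennreal (norm (f x)) * ennreal (norm (g x)) \<partial>M) = ennreal ?C"
    using sq_integrable_norm_prod_integrable[OF assms] by (simp add: ennreal_mult[symmetric] nn_integral_eq_integral)
  ultimately have "ennreal (?C\<^sup>2) \<le> ennreal (?A * ?B)"
    using nn by (simp add: ennreal_power ennreal_mult)
  then have "?C\<^sup>2 \<le> ?A * ?B" using nn by (simp add: ennreal_le_iff)
  then have "?C \<le> sqrt (?A * ?B)" using nn by (simp add: real_le_rsqrt)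
  then show ?thesis by (simp add: real_sqrt_mult)
qed

text \<open>Membership in \<open>L2\<close> belongs to the notion: the integral of a non-integrable
  difference would be 0 by convention and would count as convergence.\<close>

definition L2_conv :: "'a measure \<Rightarrow> (nat \<Rightarrow> 'a \<Rightarrow> 'b::euclidean_space) \<Rightarrow> ('a \<Rightarrow> 'b) \<Rightarrow> bool" where
  "L2_conv M F f \<longleftrightarrow> (\<forall>n. sq_integrable M (F n)) \<and> sq_integrable M f \<and> (\<lambda>n. LINT x|M. (norm (F n x - f x))\<^sup>2) \<longlonglongrightarrow> 0"

lemma L2_conv_sq_integrable: "L2_conv M F f \<Longrightarrow> sq_integrable M (F n)" "L2_conv M F f \<Longrightarrow> sq_integrable M f"
  and L2_conv_tendsto: "L2_conv M F f \<Longrightarrow> (\<lambda>n. LINT x|M. (norm (F n x - f x))\<^sup>2) \<longlonglongrightarrow> 0"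
  by (auto simp: L2_conv_def)

lemma L2_conv_const: "sq_integrable M f \<Longrightarrow> L2_conv M (\<lambda>n. f) f" by (simp add: L2_conv_def)

lemma L2_conv_boundI:
  assumes "\<And>n. sq_integrable M (F n)" "sq_integrable M f" "\<And>n. integrable M (d n)"
    and "\<And>n. AE x in M. (norm (F n x - f x))\<^sup>2 \<le> d n x" and "(\<lambda>n. LINT x|M. d n x) \<longlonglongrightarrow> 0"
  shows "L2_conv M F f"
  unfolding L2_conv_def
proof (intro conjI allI assms)
  show "(\<lambda>n. LINT x|M. (norm (F n x - f x))\<^sup>2) \<longlonglongrightarrow> 0"
  proof (rule tendsto_sandwich[OF _ _ tendsto_const assms(5)])
    show "\<forall>\<^sub>F n in sequentially. 0 \<le> (LINT x|M. (norm (F n x - f x))\<^sup>2)" by simp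
    show "\<forall>\<^sub>F n in sequentially. (LINT x|M. (norm (F n x - f x))\<^sup>2) \<le> (LINT x|M. d n x)"
      by (intro always_eventually allI integral_mono_AE assms sq_integrable_integrable sq_integrable_diff)
  qed
qed

lemma L2_conv_add:
  assumes "L2_conv M F f" "L2_conv M G g" shows "L2_conv M (\<lambda>n x. F n x + G n x) (\<lambda>x. f x + g x)"
proof (rule L2_conv_boundI[where d="\<lambda>n x. 2 * (norm (F n x - f x))\<^sup>2 + 2 * (norm (G n x - g x))\<^sup>2"])
  have i: "integrable M (\<lambda>x. (norm (F n x - f x))\<^sup>2)" "integrable M (\<lambda>x. (norm (G n x - g x))\<^sup>2)" for n
    using assms by (auto intro!: sq_integrable_integrable sq_integrable_diff simp: L2_conv_def)
  then show "integrable M (\<lambda>x. 2 * (norm (F n x - f x))\<^sup>2 + 2 * (norm (G n x - g x))\<^sup>2)" for n by auto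
  show "AE x in M. (norm (F n x + G n x - (f x + g x)))\<^sup>2 \<le> 2 * (norm (F n x - f x))\<^sup>2 + 2 * (norm (G n x - g x))\<^sup>2" for n
    using norm_add_sq_le[of "F n x - f x" "G n x - g x" for x] by (simp add: algebra_simps)
  show "(\<lambda>n. LINT x|M. 2 * (norm (F n x - f x))\<^sup>2 + 2 * (norm (G n x - g x))\<^sup>2) \<longlonglongrightarrow> 0"
    using i tendsto_add[OF tendsto_mult_left[OF L2_conv_tendsto[OF assms(1)], of 2] tendsto_mult_left[OF L2_conv_tendsto[OF assms(2)], of 2]]
    by simp
qed (use assms in \<open>auto simp: L2_conv_def intro: sq_integrable_add\<close>)

text \<open>The limit inherits the majorant, so the squared difference is at most
  \<open>4 * w\<close> and dominated convergence applies to it.\<close>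

lemma L2_conv_dominated:
  assumes "\<And>n. F n \<in> borel_measurable M" "f \<in> borel_measurable M"
    and "AE x in M. (\<lambda>n. F n x) \<longlonglongrightarrow> f x"
    and "\<And>n. AE x in M. (norm (F n x))\<^sup>2 \<le> w x" and "integrable M w"
  shows "L2_conv M F f"
proof -
  have F: "sq_integrable M (F n)" for n by (rule sq_integrable_dominated[OF assms(1,4,5)])
  have "AE x in M. \<forall>n. (norm (F n x))\<^sup>2 \<le> w x" using assms(4) by (simp add: AE_all_countable)
  with assms(3) have fw: "AE x in M. (norm (f x))\<^sup>2 \<le> w x"
  proof eventually_elim
    case (elim x)
    have "(\<lambda>n. (norm (F n x))\<^sup>2) \<longlonglongrightarrow> (norm (f x))\<^sup>2" by (intro tendsto_intros elim)
    then show ?case using elim(2) by (intro Lim_bounded) auto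
  qed
  then have f: "sq_integrable M f" by (rule sq_integrable_dominated[OF assms(2) _ assms(5)])
  have "(\<lambda>n. LINT x|M. (norm (F n x - f x))\<^sup>2) \<longlonglongrightarrow> (LINT x|M. 0)"
  proof (rule integral_dominated_convergence[where w="\<lambda>x. 4 * w x"])
    show "AE x in M. (\<lambda>n. (norm (F n x - f x))\<^sup>2) \<longlonglongrightarrow> 0"
      using assms(3)
    proof eventually_elim
      case (elim x)
      have "(\<lambda>n. (norm (F n x - f x))\<^sup>2) \<longlonglongrightarrow> (norm (f x - f x))\<^sup>2" by (intro tendsto_intros elim)
      then show ?case by simp
    qed
    show "AE x in M. norm ((norm (F n x - f x))\<^sup>2) \<le> 4 * w x" for n
      using assms(4)[of n] fw
    proof eventually_elim
      case (elim x)
      then show ?case using norm_diff_sq_le[of "F n x" "f x"] by simp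
    qed
  qed (use assms in \<open>auto intro!: borel_measurable_power borel_measurable_norm borel_measurable_diff\<close>)
  then show ?thesis using F f by (simp add: L2_conv_def)
qed

text \<open>The product is split as \<open>b n * (F n - f) + b n * f\<close>. The first part is
  small by the uniform bound on \<open>b n\<close>, the second converges by dominated convergence.
  This is how the factors \<open>flat 2\<close> pass to the limit next to gradients.\<close>

lemma L2_conv_scaleR_AE:
  fixes b :: "nat \<Rightarrow> 'a \<Rightarrow> real"
  assumes "\<And>n. b n \<in> borel_measurable M" "c \<in> borel_measurable M"
    and "\<And>n. AE x in M. \<bar>b n x\<bar> \<le> B" and "AE x in M. (\<lambda>n. b n x) \<longlonglongrightarrow> c x" and "L2_conv M F f"
  shows "L2_conv M (\<lambda>n x. b n x *\<^sub>R F n x) (\<lambda>x. c x *\<^sub>R f x)"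
proof -
  have "L2_conv M (\<lambda>n x. b n x *\<^sub>R (F n x - f x)) (\<lambda>x. 0)"
  proof (rule L2_conv_boundI[where d="\<lambda>n x. B\<^sup>2 * (norm (F n x - f x))\<^sup>2"])
    show s: "sq_integrable M (\<lambda>x. b n x *\<^sub>R (F n x - f x))" for n
      by (rule sq_integrable_scaleR_bounded[OF assms(1,3)]) (use assms in \<open>auto intro: sq_integrable_diff simp: L2_conv_def\<close>)
    show "integrable M (\<lambda>x. B\<^sup>2 * (norm (F n x - f x))\<^sup>2)" for n
      using sq_integrable_diff assms(5) by (auto simp: L2_conv_def sq_integrable_def)
    show "AE x in M. (norm (b n x *\<^sub>R (F n x - f x) - 0))\<^sup>2 \<le> B\<^sup>2 * (norm (F n x - f x))\<^sup>2" for n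
      using assms(3)[of n]
    proof eventually_elim
      case (elim x)
      then have "\<bar>b n x\<bar>\<^sup>2 \<le> B\<^sup>2" by (intro power_mono) auto
      then show ?case by (simp add: power_mult_distrib mult_right_mono)
    qed
    show "(\<lambda>n. LINT x|M. B\<^sup>2 * (norm (F n x - f x))\<^sup>2) \<longlonglongrightarrow> 0"
      using tendsto_mult_left[OF L2_conv_tendsto[OF assms(5)], of "B\<^sup>2"] by simp
  qed simp
  moreover have "L2_conv M (\<lambda>n x. b n x *\<^sub>R f x) (\<lambda>x. c x *\<^sub>R f x)"
  proof (rule L2_conv_dominated[where w="\<lambda>x. B\<^sup>2 * (norm (f x))\<^sup>2"])
    show "AE x in M. (\<lambda>n. b n x *\<^sub>R f x) \<longlonglongrightarrow> c x *\<^sub>R f x"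
      using assms(4) by eventually_elim (intro tendsto_intros)
    show "AE x in M. (norm (b n x *\<^sub>R f x))\<^sup>2 \<le> B\<^sup>2 * (norm (f x))\<^sup>2" for n
      using assms(3)[of n]
    proof eventually_elim
      case (elim x)
      then have "\<bar>b n x\<bar>\<^sup>2 \<le> B\<^sup>2" by (intro power_mono) auto
      then show ?case by (simp add: power_mult_distrib mult_right_mono)
    qed
  qed (use assms in \<open>auto simp: L2_conv_def sq_integrable_def\<close>)
  ultimately show ?thesis
    using L2_conv_add[of M "\<lambda>n x. b n x *\<^sub>R (F n x - f x)" "\<lambda>x. 0" "\<lambda>n x. b n x *\<^sub>R f x" "\<lambda>x. c x *\<^sub>R f x"]
    by (simp add: scaleR_diff_right)
qed

lemma L2_conv_scaleR:
  fixes b :: "'a \<Rightarrow> real"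
  assumes "b \<in> borel_measurable M" "AE x in M. \<bar>b x\<bar> \<le> B" "L2_conv M F f"
  shows "L2_conv M (\<lambda>n x. b x *\<^sub>R F n x) (\<lambda>x. b x *\<^sub>R f x)"
  by (rule L2_conv_scaleR_AE) (use assms in auto)

lemma L2_conv_diff:
  assumes "L2_conv M F f" "L2_conv M G g" shows "L2_conv M (\<lambda>n x. F n x - G n x) (\<lambda>x. f x - g x)"
  using L2_conv_add[OF assms(1) L2_conv_scaleR[OF _ _ assms(2), of "\<lambda>_. -1" 1]] by simp

lemma L2_conv_cong_AE:
  assumes "L2_conv M F f" "\<And>n. AE x in M. F n x = G n x" "AE x in M. f x = g x"
    "\<And>n. G n \<in> borel_measurable M" "g \<in> borel_measurable M"
  shows "L2_conv M G g"
proof -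
  have "sq_integrable M (G n)" for n
  proof (rule sq_integrable_dominated[where w="\<lambda>x. (norm (F n x))\<^sup>2"])
    show "AE x in M. (norm (G n x))\<^sup>2 \<le> (norm (F n x))\<^sup>2"
      using assms(2)[of n] by eventually_elim simp
  qed (use assms in \<open>auto simp: L2_conv_def sq_integrable_def\<close>)
  moreover have "sq_integrable M g"
  proof (rule sq_integrable_dominated[where w="\<lambda>x. (norm (f x))\<^sup>2"])
    show "AE x in M. (norm (g x))\<^sup>2 \<le> (norm (f x))\<^sup>2"
      using assms(3) by eventually_elim simp
  qed (use assms in \<open>auto simp: L2_conv_def sq_integrable_def\<close>)
  moreover have [measurable]: "F n \<in> borel_measurable M" "f \<in> borel_measurable M"
      "G n \<in> borel_measurable M" "g \<in> borel_measurable M" for n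
    using assms by (auto simp: L2_conv_def sq_integrable_def)
  have "(LINT x|M. (norm (F n x - f x))\<^sup>2) = (LINT x|M. (norm (G n x - g x))\<^sup>2)" for n
  proof (rule integral_cong_AE)
    show "AE x in M. (norm (F n x - f x))\<^sup>2 = (norm (G n x - g x))\<^sup>2"
      using assms(2)[of n] assms(3) by eventually_elim simp
  qed simp_all
  ultimately show ?thesis using assms(1) by (simp add: L2_conv_def)
qed

lemma L2_conv_subseq: "L2_conv M F f \<Longrightarrow> strict_mono r \<Longrightarrow> L2_conv M (\<lambda>n. F (r n)) f"
  using LIMSEQ_subseq_LIMSEQ[of "\<lambda>n. LINT x|M. (norm (F n x - f x))\<^sup>2" 0 r]
  by (auto simp: L2_conv_def o_def)

text \<open>The squared differences converge to 0 in \<open>L1\<close>, and a sequence with this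
  property has a subsequence tending to 0 almost everywhere.\<close>

lemma L2_conv_AE_subseq:
  assumes "L2_conv M F f"
  obtains r :: "nat \<Rightarrow> nat" where "strict_mono r" "AE x in M. (\<lambda>n. F (r n) x) \<longlonglongrightarrow> f x"
proof -
  have "\<exists>r::nat\<Rightarrow>nat. strict_mono r \<and> (AE x in M. (\<lambda>n. (norm (F (r n) x - f x))\<^sup>2) \<longlonglongrightarrow> 0)"
    by (rule tendsto_L1_AE_subseq)
       (use L2_conv_tendsto[OF assms] sq_integrable_integrable[OF sq_integrable_diff[OF L2_conv_sq_integrable[OF assms]]] in auto)
  then obtain r :: "nat \<Rightarrow> nat" where r: "strict_mono r" "AE x in M. (\<lambda>n. (norm (F (r n) x - f x))\<^sup>2) \<longlonglongrightarrow> 0" by blast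
  from r(2) have "AE x in M. (\<lambda>n. F (r n) x) \<longlonglongrightarrow> f x"
  proof eventually_elim
    case (elim x)
    have "(\<lambda>n. sqrt ((norm (F (r n) x - f x))\<^sup>2)) \<longlonglongrightarrow> sqrt 0" by (intro tendsto_intros elim)
    then have "(\<lambda>n. norm (F (r n) x - f x)) \<longlonglongrightarrow> 0" by simp
    then show ?case using LIM_zero_iff tendsto_norm_zero_iff by blast
  qed
  with r(1) that show ?thesis by blast
qed

lemma L2_conv_norm_sqrt_tendsto:
  assumes "L2_conv M F f" shows "(\<lambda>n. sqrt (LINT x|M. (norm (F n x - f x))\<^sup>2)) \<longlonglongrightarrow> 0"
  using tendsto_real_sqrt[OF L2_conv_tendsto[OF assms]] by simp

text \<open>The difference of the products is expanded into three terms, each with at least one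
  small factor, and each is bounded by Cauchy-Schwarz.\<close>

lemma L2_conv_bilinear:
  fixes prod :: "'b::euclidean_space \<Rightarrow> 'c::euclidean_space \<Rightarrow> 'd::euclidean_space"
  assumes "bounded_bilinear prod" "L2_conv M F f" "L2_conv M G g"
  shows "(\<lambda>n. LINT x|M. prod (F n x) (G n x)) \<longlonglongrightarrow> (LINT x|M. prod (f x) (g x))"
proof -
  interpret bounded_bilinear prod by fact
  obtain K where K: "0 < K" "\<And>a b. norm (prod a b) \<le> norm a * norm b * K" using pos_bounded by blast
  note s = L2_conv_sq_integrable[OF assms(2)] L2_conv_sq_integrable[OF assms(3)]
  have bound: "norm (LINT x|M. prod (a x) (b x)) \<le> K * (sqrt (LINT x|M. (norm (a x))\<^sup>2) * sqrt (LINT x|M. (norm (b x))\<^sup>2))"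
    if "sq_integrable M a" "sq_integrable M b" for a b
  proof -
    have "norm (LINT x|M. prod (a x) (b x)) \<le> (LINT x|M. norm (prod (a x) (b x)))" by (rule integral_norm_bound)
    also have "\<dots> \<le> (LINT x|M. norm (a x) * norm (b x) * K)"
      using that K by (intro integral_mono integrable_norm sq_integrable_bilinear_integrable[OF assms(1)] integrable_mult_left sq_integrable_norm_prod_integrable) auto
    also have "\<dots> = K * (LINT x|M. norm (a x) * norm (b x))" by (simp add: mult.commute)
    finally show ?thesis using L2_Cauchy_Schwarz[OF that] K(1) by (smt (verit) mult_left_mono)
  qed
  define \<alpha> where "\<alpha> n = sqrt (LINT x|M. (norm (F n x - f x))\<^sup>2)" for n
  define \<beta> where "\<beta> n = sqrt (LINT x|M. (norm (G n x - g x))\<^sup>2)" for n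
  define A where "A = sqrt (LINT x|M. (norm (f x))\<^sup>2)"
  define B where "B = sqrt (LINT x|M. (norm (g x))\<^sup>2)"
  have lim: "\<alpha> \<longlonglongrightarrow> 0" "\<beta> \<longlonglongrightarrow> 0"
    using L2_conv_norm_sqrt_tendsto[OF assms(2)] L2_conv_norm_sqrt_tendsto[OF assms(3)] by (simp_all add: \<alpha>_def[abs_def] \<beta>_def[abs_def])
  have "norm ((LINT x|M. prod (F n x) (G n x)) - (LINT x|M. prod (f x) (g x))) \<le> K * (\<alpha> n * \<beta> n) + K * (\<alpha> n * B) + K * (A * \<beta> n)" for n
  proof -
    have d: "sq_integrable M (\<lambda>x. F n x - f x)" "sq_integrable M (\<lambda>x. G n x - g x)" using s by (auto intro: sq_integrable_diff)
    note I = sq_integrable_bilinear_integrable[OF assms(1)]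
    have "(LINT x|M. prod (F n x) (G n x)) - (LINT x|M. prod (f x) (g x))
       = (LINT x|M. prod (F n x) (G n x) - prod (f x) (g x))"
      using I[OF s(1) s(3)] I[OF s(2) s(4)] by simp
    also have "\<dots> = (LINT x|M. prod (F n x - f x) (G n x - g x) + prod (F n x - f x) (g x) + prod (f x) (G n x - g x))"
      by (rule Bochner_Integration.integral_cong) (auto simp: diff_left diff_right)
    also have "\<dots> = (LINT x|M. prod (F n x - f x) (G n x - g x)) + (LINT x|M. prod (F n x - f x) (g x)) + (LINT x|M. prod (f x) (G n x - g x))"
      using I[OF d(1) d(2)] I[OF d(1) s(4)] I[OF s(2) d(2)] by simp
    finally show ?thesis
      using bound[OF d(1) d(2)] bound[OF d(1) s(4)] bound[OF s(2) d(2)]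
      unfolding \<alpha>_def[symmetric] \<beta>_def[symmetric] A_def[symmetric] B_def[symmetric]
      by (smt (verit) norm_triangle_ineq)
  qed
  moreover have "(\<lambda>n. K * (\<alpha> n * \<beta> n) + K * (\<alpha> n * B) + K * (A * \<beta> n)) \<longlonglongrightarrow> 0"
    using lim by (auto intro!: tendsto_eq_intros)
  ultimately have "(\<lambda>n. (LINT x|M. prod (F n x) (G n x)) - (LINT x|M. prod (f x) (g x))) \<longlonglongrightarrow> 0"
    by (rule Lim_null_comparison[OF always_eventually[OF allI]])
  then show ?thesis by (rule LIM_zero_cancel)
qed

lemmas L2_conv_inner = L2_conv_bilinear[OF bounded_bilinear_inner]
lemmas L2_conv_integral_scaleR = L2_conv_bilinear[OF bounded_bilinear_scaleR]

text \<open>On a finite measure space a Cauchy sequence in \<open>L2\<close> is Cauchy in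
  \<open>L1\<close> and hence has a subsequence converging almost everywhere. Fatou's lemma then
  shows that its pointwise limit is the limit in \<open>L2\<close> of the whole sequence.\<close>

lemma L2_conv_complete:
  fixes F :: "nat \<Rightarrow> 'a \<Rightarrow> 'b::euclidean_space"
  assumes "finite_measure M" "\<And>n. sq_integrable M (F n)"
    and "\<And>e. e > 0 \<Longrightarrow> \<exists>N. \<forall>i\<ge>N. \<forall>j\<ge>N. (LINT x|M. (norm (F i x - F j x))\<^sup>2) < e"
  shows "\<exists>f. L2_conv M F f"
proof -
  interpret finite_measure M by fact
  have one: "sq_integrable M (\<lambda>x. 1::real)" by (rule sq_integrable_bounded[OF assms(1)]) auto
  define m where "m = sqrt (LINT x|M. (norm (1::real))\<^sup>2)"
  have m: "m \<ge> 0" by (simp add: m_def)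
  have L1: "(LINT x|M. norm (F i x - F j x)) \<le> sqrt (LINT x|M. (norm (F i x - F j x))\<^sup>2) * m" for i j
    using L2_Cauchy_Schwarz[OF sq_integrable_diff[OF assms(2)[of i] assms(2)[of j]] one] by (simp add: m_def)
  have cau: "\<exists>N. \<forall>i\<ge>N. \<forall>j\<ge>N. (LINT x|M. norm (F i x - F j x)) < e" if "e > 0" for e
  proof -
    \<comment> \<open>The summand 1 guards against a measure of total mass 0, for which
      \<open>m = 0\<close>.\<close>
    have "(e / (m + 1))\<^sup>2 > 0" using that m by (simp add: add_nonneg_pos)
    from assms(3)[OF this] obtain N where N: "\<forall>i\<ge>N. \<forall>j\<ge>N. (LINT x|M. (norm (F i x - F j x))\<^sup>2) < (e / (m + 1))\<^sup>2" by blast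
    have "(LINT x|M. norm (F i x - F j x)) < e" if "i \<ge> N" "j \<ge> N" for i j
    proof -
      have "sqrt (LINT x|M. (norm (F i x - F j x))\<^sup>2) < e / (m + 1)"
        using N that \<open>e > 0\<close> m by (intro real_less_lsqrt) (auto intro!: divide_pos_pos less_imp_le)
      then have "sqrt (LINT x|M. (norm (F i x - F j x))\<^sup>2) * m \<le> e / (m + 1) * m"
        using m by (intro mult_right_mono) auto
      also have "\<dots> < e" using m \<open>e > 0\<close> by (simp add: field_simps)
      finally show ?thesis using L1[of i j] by linarith
    qed
    then show ?thesis by blast
  qed
  obtain r where r: "strict_mono r" "AE x in M. Cauchy (\<lambda>i. F (r i) x)"
    using cauchy_L1_AE_cauchy_subseq[OF sq_integrable_finite_integrable[OF assms(1,2)] cau] by blast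
  have meas [measurable]: "F n \<in> borel_measurable M" for n using assms(2) by (simp add: sq_integrable_def)
  define f where "f x = lim (\<lambda>i. F (r i) x)" for x
  have f [measurable]: "f \<in> borel_measurable M" unfolding f_def[abs_def]
    by (rule borel_measurable_lim_metric) simp
  have lim: "AE x in M. (\<lambda>i. F (r i) x) \<longlonglongrightarrow> f x"
    using r(2) by eventually_elim (auto simp: f_def Cauchy_convergent_iff convergent_LIMSEQ_iff)
  \<comment> \<open>Fatou's lemma along the subsequence turns the Cauchy estimate between members
    into the same estimate against the limit.\<close>
  have key: "(\<integral>\<^sup>+x. ennreal ((norm (F n x - f x))\<^sup>2) \<partial>M) \<le> ennreal e"
    if "\<forall>i\<ge>N. \<forall>j\<ge>N. (LINT x|M. (norm (F i x - F j x))\<^sup>2) < e" "n \<ge> N" for n N e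
  proof -
    have "(\<integral>\<^sup>+x. ennreal ((norm (F n x - f x))\<^sup>2) \<partial>M) = (\<integral>\<^sup>+x. liminf (\<lambda>i. ennreal ((norm (F n x - F (r i) x))\<^sup>2)) \<partial>M)"
    proof (rule nn_integral_cong_AE)
      show "AE x in M. ennreal ((norm (F n x - f x))\<^sup>2) = liminf (\<lambda>i. ennreal ((norm (F n x - F (r i) x))\<^sup>2))"
        using lim
      proof eventually_elim
        case (elim x)
        have "(\<lambda>i. ennreal ((norm (F n x - F (r i) x))\<^sup>2)) \<longlonglongrightarrow> ennreal ((norm (F n x - f x))\<^sup>2)"
          by (intro tendsto_intros elim)
        then show ?case by (rule lim_imp_Liminf[OF sequentially_bot, symmetric])
      qed
    qed
    also have "\<dots> \<le> liminf (\<lambda>i. \<integral>\<^sup>+x. ennreal ((norm (F n x - F (r i) x))\<^sup>2) \<partial>M)"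
      by (rule nn_integral_liminf) measurable
    also have "\<dots> \<le> ennreal e"
    proof (rule Liminf_le)
      show "\<forall>\<^sub>F i in sequentially. (\<integral>\<^sup>+x. ennreal ((norm (F n x - F (r i) x))\<^sup>2) \<partial>M) \<le> ennreal e"
        using eventually_ge_at_top[of N]
      proof eventually_elim
        case (elim i)
        then have "r i \<ge> N" using seq_suble[OF r(1), of i] by linarith
        then have "(LINT x|M. (norm (F n x - F (r i) x))\<^sup>2) \<le> e" using that by (auto intro: less_imp_le)
        then show ?case
          using sq_integrable_integrable[OF sq_integrable_diff[OF assms(2)[of n] assms(2)[of "r i"]]]
          by (simp add: nn_integral_eq_integral ennreal_leI)
      qed
    qed simp
    finally show ?thesis .
  qed
  have sf: "sq_integrable M f"
  proof -
    obtain N where N: "\<forall>i\<ge>N. \<forall>j\<ge>N. (LINT x|M. (norm (F i x - F j x))\<^sup>2) < 1" using assms(3)[of 1] by auto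
    have "sq_integrable M (\<lambda>x. F N x - f x)"
      unfolding sq_integrable_def integrable_iff_bounded
      using le_less_trans[OF key[OF N order_refl] ennreal_less_top] by simp
    from sq_integrable_diff[OF assms(2)[of N] this] show ?thesis by simp
  qed
  have "(\<lambda>n. LINT x|M. (norm (F n x - f x))\<^sup>2) \<longlonglongrightarrow> 0"
  proof (rule LIMSEQ_I)
    fix e :: real assume e: "e > 0"
    obtain N where N: "\<forall>i\<ge>N. \<forall>j\<ge>N. (LINT x|M. (norm (F i x - F j x))\<^sup>2) < e / 2" using assms(3)[of "e / 2"] e by auto
    have "norm ((LINT x|M. (norm (F n x - f x))\<^sup>2) - 0) < e" if "n \<ge> N" for n
    proof -
      have "ennreal (LINT x|M. (norm (F n x - f x))\<^sup>2) \<le> ennreal (e / 2)"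
        using key[OF N that] sq_integrable_integrable[OF sq_integrable_diff[OF assms(2)[of n] sf]] by (simp add: nn_integral_eq_integral)
      then have "(LINT x|M. (norm (F n x - f x))\<^sup>2) \<le> e / 2" using e by (simp add: ennreal_le_iff)
      then show ?thesis using e by (simp add: integral_nonneg_AE)
    qed
    then show "\<exists>no. \<forall>n\<ge>no. norm ((LINT x|M. (norm (F n x - f x))\<^sup>2) - 0) < e" by blast
  qed
  with sf assms(2) have "L2_conv M F f" unfolding L2_conv_def by blast
  then show ?thesis by (rule exI[of _ f])
qed

section \<open>Integration over Lebesgue measurable sets\<close>

lemma if_eq_if: "(\<And>x. x \<in> U - V \<Longrightarrow> F x = 0) \<Longrightarrow> (\<And>x. x \<in> V - U \<Longrightarrow> F x = 0)
   \<Longrightarrow> (\<lambda>x. if x \<in> U then F x else 0) = (\<lambda>x. if x \<in> V then F x else 0)"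
  by fastforce

context
  fixes U V :: "'a::euclidean_space set" and F :: "'a \<Rightarrow> 'b::euclidean_space"
  assumes UV: "U \<in> sets lebesgue" "V \<in> sets lebesgue"
    and F0: "\<And>x. x \<in> U - V \<Longrightarrow> F x = 0" "\<And>x. x \<in> V - U \<Longrightarrow> F x = 0"
begin

text \<open>Both sides are the integral over the whole space of the same extension by zero.
  Integrals against compactly supported functions move in this way between the sector, its
  truncations and the supports.\<close>

lemma LINT_on_eq: "(LINT x|lebesgue_on U. F x) = (LINT x|lebesgue_on V. F x)"
proof -
  have "(LINT x|lebesgue. (if x \<in> U then F x else 0)) = (LINT x|lebesgue. (if x \<in> V then F x else 0))"
    by (simp only: if_eq_if[of U V F, OF F0])
  then show ?thesis using UV by (simp add: Lebesgue_Measure.integral_restrict_UNIV)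
qed

lemma integrable_on_eq: "integrable (lebesgue_on U) F \<longleftrightarrow> integrable (lebesgue_on V) F"
proof -
  have "integrable lebesgue (\<lambda>x. (if x \<in> U then F x else 0)) \<longleftrightarrow> integrable lebesgue (\<lambda>x. (if x \<in> V then F x else 0))"
    by (simp only: if_eq_if[of U V F, OF F0])
  then show ?thesis using UV by (simp add: Lebesgue_Measure.integrable_restrict_UNIV)
qed

lemma measurable_on_eq: "F \<in> borel_measurable (lebesgue_on U) \<longleftrightarrow> F \<in> borel_measurable (lebesgue_on V)"
proof -
  have "(\<lambda>x. (if x \<in> U then F x else 0)) \<in> borel_measurable lebesgue \<longleftrightarrow> (\<lambda>x. (if x \<in> V then F x else 0)) \<in> borel_measurable lebesgue"
    by (simp only: if_eq_if[of U V F, OF F0])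
  then show ?thesis using UV by (simp add: borel_measurable_if)
qed

end

lemma sq_integrable_on_eq:
  fixes F :: "'a::euclidean_space \<Rightarrow> 'b::euclidean_space"
  assumes "U \<in> sets lebesgue" "V \<in> sets lebesgue"
    and "\<And>x. x \<in> U - V \<Longrightarrow> F x = 0" "\<And>x. x \<in> V - U \<Longrightarrow> F x = 0"
  shows "sq_integrable (lebesgue_on U) F \<longleftrightarrow> sq_integrable (lebesgue_on V) F"
  unfolding sq_integrable_def using measurable_on_eq[OF assms] integrable_on_eq[of U V "\<lambda>x. (norm (F x))\<^sup>2"] assms by auto

lemma L2_conv_on_eq:
  fixes F :: "nat \<Rightarrow> 'a::euclidean_space \<Rightarrow> 'b::euclidean_space"
  assumes UV: "U \<in> sets lebesgue" "V \<in> sets lebesgue"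
    and "\<And>n x. x \<in> U - V \<Longrightarrow> F n x = 0" "\<And>n x. x \<in> V - U \<Longrightarrow> F n x = 0"
    and "\<And>x. x \<in> U - V \<Longrightarrow> f x = 0" "\<And>x. x \<in> V - U \<Longrightarrow> f x = 0"
  shows "L2_conv (lebesgue_on U) F f \<longleftrightarrow> L2_conv (lebesgue_on V) F f"
proof -
  have "(LINT x|lebesgue_on U. (norm (F n x - f x))\<^sup>2) = (LINT x|lebesgue_on V. (norm (F n x - f x))\<^sup>2)" for n
    by (rule LINT_on_eq[OF UV]) (use assms in auto)
  moreover have "sq_integrable (lebesgue_on U) (F n) \<longleftrightarrow> sq_integrable (lebesgue_on V) (F n)" for n
    by (rule sq_integrable_on_eq[OF UV]) (use assms in auto)
  moreover have "sq_integrable (lebesgue_on U) f \<longleftrightarrow> sq_integrable (lebesgue_on V) f"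
    by (rule sq_integrable_on_eq[OF UV]) (use assms in auto)
  ultimately show ?thesis by (simp add: L2_conv_def)
qed

lemma integrable_on_subset:
  fixes F :: "'a::euclidean_space \<Rightarrow> 'b::euclidean_space"
  assumes "U \<in> sets lebesgue" "V \<in> sets lebesgue" "U \<subseteq> V" "integrable (lebesgue_on V) F"
  shows "integrable (lebesgue_on U) F"
proof -
  have "integrable lebesgue (\<lambda>x. indicator U x *\<^sub>R (if x \<in> V then F x else 0))"
    using assms by (intro integrable_mult_indicator) (simp_all add: Lebesgue_Measure.integrable_restrict_UNIV)
  moreover have "(\<lambda>x. indicator U x *\<^sub>R (if x \<in> V then F x else 0)) = (\<lambda>x. if x \<in> U then F x else 0)"
    using assms(3) by (auto simp: fun_eq_iff)
  ultimately show ?thesis using assms(1) by (simp add: Lebesgue_Measure.integrable_restrict_UNIV)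
qed

lemma sq_integrable_on_subset:
  fixes F :: "'a::euclidean_space \<Rightarrow> 'b::euclidean_space"
  assumes "U \<in> sets lebesgue" "V \<in> sets lebesgue" "U \<subseteq> V" "sq_integrable (lebesgue_on V) F"
  shows "sq_integrable (lebesgue_on U) F"
  unfolding sq_integrable_def
proof
  show "F \<in> borel_measurable (lebesgue_on U)"
    using sq_integrable_measurable[OF assms(4)] assms(3) by (rule measurable_restrict_mono)
  show "integrable (lebesgue_on U) (\<lambda>x. (norm (F x))\<^sup>2)"
    using assms(1-3) sq_integrable_integrable[OF assms(4)] by (rule integrable_on_subset)
qed

lemma L2_conv_on_subset:
  fixes F :: "nat \<Rightarrow> 'a::euclidean_space \<Rightarrow> 'b::euclidean_space"
  assumes UV: "U \<in> sets lebesgue" "V \<in> sets lebesgue" "U \<subseteq> V" and c: "L2_conv (lebesgue_on V) F f"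
  shows "L2_conv (lebesgue_on U) F f"
proof -
  have d: "sq_integrable (lebesgue_on V) (\<lambda>x. F n x - f x)" for n using c by (auto intro: sq_integrable_diff L2_conv_sq_integrable)
  have "(\<lambda>n. LINT x|lebesgue_on U. (norm (F n x - f x))\<^sup>2) \<longlonglongrightarrow> 0"
  proof (rule tendsto_sandwich[OF _ _ tendsto_const L2_conv_tendsto[OF c]])
    show "\<forall>\<^sub>F n in sequentially. (LINT x|lebesgue_on U. (norm (F n x - f x))\<^sup>2) \<le> (LINT x|lebesgue_on V. (norm (F n x - f x))\<^sup>2)"
      using UV by (intro always_eventually allI integral_mono_lebesgue_on_AE sq_integrable_integrable[OF d]) auto
  qed simp
  then show ?thesis using c sq_integrable_on_subset[OF UV] by (auto simp: L2_conv_def)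
qed

lemma open_in_lebesgue: "open S \<Longrightarrow> S \<in> sets lebesgue" by (intro sets_completionI_sets) simp
lemma compact_in_lebesgue: "compact S \<Longrightarrow> S \<in> sets lebesgue"
  using lmeasurable_compact by (blast dest: fmeasurableD)

lemma finite_measure_on_compact: "compact K \<Longrightarrow> finite_measure (lebesgue_on K)"
  by (simp add: finite_measure_lebesgue_on lmeasurable_compact)

lemma finite_measure_on_bounded_open: "open U \<Longrightarrow> bounded U \<Longrightarrow> finite_measure (lebesgue_on U)"
  by (simp add: finite_measure_lebesgue_on lmeasurable_open)

lemma AE_on_iff: "S \<in> sets lebesgue \<Longrightarrow> (AE x in lebesgue_on S. P x) \<longleftrightarrow> (AE x in lebesgue. x \<in> S \<longrightarrow> P x)"
  by (simp add: AE_restrict_space_iff)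

lemma AE_on_subset:
  assumes "S \<in> sets lebesgue" "T \<in> sets lebesgue" "S \<subseteq> T" "AE x in lebesgue_on T. P x"
  shows "AE x in lebesgue_on S. P x"
  using assms(3,4) unfolding AE_on_iff[OF assms(1)] AE_on_iff[OF assms(2)] by (auto elim: AE_mp)

lemma AE_on_UN:
  assumes "S \<in> sets lebesgue" "\<And>n::nat. A n \<in> sets lebesgue" "S \<subseteq> (\<Union>n. A n)" "\<And>n. AE x in lebesgue_on (A n). P x"
  shows "AE x in lebesgue_on S. P x"
proof -
  have "AE x in lebesgue. \<forall>n. x \<in> A n \<longrightarrow> P x"
    using assms(4) unfolding AE_on_iff[OF assms(2)] by (subst AE_all_countable) blast
  then show ?thesis unfolding AE_on_iff[OF assms(1)]
    by eventually_elim (use assms(3) in auto)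
qed

text \<open>Rests on the completeness of Lebesgue measure. It gives measurability to
  \<open>wgrad\<close>, which is controlled only up to null sets.\<close>

lemma borel_measurable_on_cong_AE:
  fixes f g :: "'a::euclidean_space \<Rightarrow> 'b::euclidean_space"
  assumes "S \<in> sets lebesgue" "f \<in> borel_measurable (lebesgue_on S)" "AE x in lebesgue_on S. f x = g x"
  shows "g \<in> borel_measurable (lebesgue_on S)"
proof -
  have "AE x in lebesgue. x \<in> S \<longrightarrow> f x = g x" using assms by (simp add: AE_on_iff)
  then obtain N where N: "negligible N" "{x. \<not> (x \<in> S \<longrightarrow> f x = g x)} \<subseteq> N"
    unfolding eventually_ae_filter negligible_iff_null_sets by auto
  have "f measurable_on S" using assms measurable_on_iff_borel_measurable by blast
  then have "g measurable_on S" by (rule measurable_on_spike[OF _ N(1)]) (use N in auto)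
  then show ?thesis using assms measurable_on_iff_borel_measurable by blast
qed

text \<open>The set where the inequality fails is open, and a non-empty open set is not negligible.
  Comparison results are turned into pointwise ones by this lemma.\<close>

lemma AE_le_imp_le_on_open:
  fixes f g :: "'a::euclidean_space \<Rightarrow> real"
  assumes "open U" "continuous_on U f" "continuous_on U g" "AE x in lebesgue_on U. f x \<le> g x" "x \<in> U"
  shows "f x \<le> g x"
proof (rule ccontr)
  let ?S = "U \<inter> (\<lambda>x. f x - g x) -` {0<..}"
  assume "\<not> f x \<le> g x"
  then have "x \<in> ?S" using assms by auto
  moreover have "open ?S"
    by (intro continuous_open_preimage assms continuous_intros open_greaterThan)
  ultimately have "\<not> negligible ?S" using open_not_negligible by blast
  moreover have "AE x in lebesgue. x \<notin> ?S"
    using assms(4) unfolding AE_on_iff[OF open_in_lebesgue[OF assms(1)]] by eventually_elim auto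
  then have "negligible ?S"
    unfolding negligible_iff_null_sets using AE_iff_null_sets[of ?S lebesgue] open_in_lebesgue[OF \<open>open ?S\<close>] by blast
  ultimately show False by blast
qed

section \<open>Compactly supported functions\<close>

text \<open>The prefix \<open>cc\<close> stands for continuous with compact support, the support
  being controlled by a radius \<open>R\<close>.\<close>

lemma cc_integrable_lborel:
  fixes f :: "'a::euclidean_space \<Rightarrow> 'b::euclidean_space"
  assumes "continuous_on UNIV f" "\<And>x. R < norm x \<Longrightarrow> f x = 0"
  shows "integrable lborel f"
proof -
  have "integrable lborel (\<lambda>x. indicator (cball 0 R) x *\<^sub>R f x)"
    by (intro borel_integrable_compact continuous_on_subset[OF assms(1)]) auto
  moreover have "(\<lambda>x. indicator (cball 0 R) x *\<^sub>R f x) = f" using assms(2) by (fastforce simp: indicator_def)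
  ultimately show ?thesis by simp
qed

lemma cc_measurable:
  fixes f :: "'a::euclidean_space \<Rightarrow> 'b::euclidean_space"
  assumes "continuous_on UNIV f" shows "f \<in> borel_measurable lebesgue"
proof -
  have "f \<in> borel_measurable lborel" using borel_measurable_continuous_onI[OF assms] by simp
  then show ?thesis by (rule measurable_completion)
qed

lemma continuous_measurable_on:
  fixes f :: "'a::euclidean_space \<Rightarrow> 'b::euclidean_space"
  shows "continuous_on UNIV f \<Longrightarrow> f \<in> borel_measurable (lebesgue_on S)"
  by (simp add: cc_measurable measurable_restrict_space1)

lemma cc_integrable:
  fixes f :: "'a::euclidean_space \<Rightarrow> 'b::euclidean_space"
  assumes "continuous_on UNIV f" "\<And>x. R < norm x \<Longrightarrow> f x = 0"
  shows "integrable lebesgue f"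
  using cc_integrable_lborel[OF assms] borel_measurable_continuous_onI[OF assms(1)] by (simp add: integrable_completion)

lemma cc_bounded:
  fixes f :: "'a::euclidean_space \<Rightarrow> 'b::euclidean_space"
  assumes "continuous_on UNIV f" "\<And>x. R < norm x \<Longrightarrow> f x = 0"
  obtains B where "B > 0" "\<And>x. norm (f x) \<le> B"
proof -
  have "bounded (f ` cball 0 R)"
    by (intro compact_imp_bounded compact_continuous_image continuous_on_subset[OF assms(1)]) auto
  then obtain B where B: "B > 0" "\<forall>y\<in>f ` cball 0 R. norm y \<le> B" using bounded_pos by metis
  have "norm (f x) \<le> B" for x using B assms(2)[of x] by (cases "norm x \<le> R") (auto simp: not_le)
  with B(1) that show ?thesis by blast
qed

lemma cc_uniformly_continuous:
  fixes f :: "'a::euclidean_space \<Rightarrow> 'b::euclidean_space"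
  assumes "continuous_on UNIV f" "\<And>x. R < norm x \<Longrightarrow> f x = 0" "e > 0"
  obtains d where "d > 0" "\<And>x y. dist x y < d \<Longrightarrow> norm (f x - f y) \<le> e"
proof -
  have "uniformly_continuous_on (cball 0 (R + 1)) f"
    by (intro compact_uniformly_continuous continuous_on_subset[OF assms(1)]) auto
  then obtain d where d: "d > 0" "\<And>x y. x \<in> cball 0 (R + 1) \<Longrightarrow> y \<in> cball 0 (R + 1) \<Longrightarrow> dist y x < d \<Longrightarrow> dist (f y) (f x) < e"
    using assms(3) unfolding uniformly_continuous_on_def by metis
  \<comment> \<open>Distance below 1 ensures that two points either both lie in the enlarged ball or
    both lie outside the ball of radius \<open>R\<close>, where \<open>f\<close> vanishes.\<close>
  have "norm (f x - f y) \<le> e" if xy: "dist x y < min d 1" for x y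
  proof (cases "norm x \<le> R + 1 \<and> norm y \<le> R + 1")
    case True
    then show ?thesis using d(2)[of y x] xy by (auto simp: dist_norm norm_minus_commute)
  next
    case False
    have "\<bar>norm x - norm y\<bar> < 1" using xy norm_triangle_ineq3[of x y] by (simp add: dist_norm)
    then have "f x = 0" "f y = 0" using False by (auto intro!: assms(2))
    then show ?thesis using assms(3) by simp
  qed
  then show ?thesis using that[of "min d 1"] d(1) by auto
qed

lemma cc_sq_integrable:
  fixes f :: "'a::euclidean_space \<Rightarrow> 'b::euclidean_space"
  assumes "continuous_on UNIV f" "\<And>x. R < norm x \<Longrightarrow> f x = 0"
  shows "sq_integrable lebesgue f"
  unfolding sq_integrable_def
proof
  show "integrable lebesgue (\<lambda>x. (norm (f x))\<^sup>2)"
    by (rule cc_integrable[where R=R]) (use assms in \<open>auto intro!: continuous_intros\<close>)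
qed (rule cc_measurable[OF assms(1)])

lemma cc_sq_integrable_on:
  fixes f :: "'a::euclidean_space \<Rightarrow> 'b::euclidean_space"
  assumes "continuous_on UNIV f" "\<And>x. R < norm x \<Longrightarrow> f x = 0" "S \<in> sets lebesgue"
  shows "sq_integrable (lebesgue_on S) f"
  using sq_integrable_on_subset[of S UNIV f] cc_sq_integrable[OF assms(1,2)] assms(3) by (simp add: lebesgue_on_UNIV_eq)

text \<open>Uniform first order Taylor estimate, from uniform continuity of the gradient and the
  mean value inequality. The uniformity in \<open>x\<close> allows integration of the estimate, both
  for difference quotients and for convolutions.\<close>

lemma C1_uniform:
  fixes f :: "'a::euclidean_space \<Rightarrow> real"
  assumes D: "\<And>x. GDERIV f x :> g x" and g: "continuous_on UNIV g" "\<And>x. R < norm x \<Longrightarrow> g x = 0" and "e > 0"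
  obtains d where "d > 0" "\<And>x y. norm (y - x) < d \<Longrightarrow> \<bar>f y - f x - (y - x) \<bullet> g x\<bar> \<le> e * norm (y - x)"
proof -
  obtain d where d: "d > 0" "\<And>x y. dist x y < d \<Longrightarrow> norm (g x - g y) \<le> e"
    using cc_uniformly_continuous[OF g \<open>e > 0\<close>] by metis
  have "\<bar>f y - f x - (y - x) \<bullet> g x\<bar> \<le> e * norm (y - x)" if yx: "norm (y - x) < d" for x y
  proof -
    have "norm (f y - f x - (\<lambda>h. h \<bullet> g x) (y - x)) \<le> norm (y - x) * e"
    proof (rule differentiable_bound_linearization[where S="ball x d" and f'="\<lambda>z h. h \<bullet> g z"])
      show "x + t *\<^sub>R (y - x) \<in> ball x d" if "t \<in> {0..1}" for t
      proof -
        have "t * norm (y - x) \<le> norm (y - x)" using that by (simp add: mult_left_le_one_le)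
        then show ?thesis using yx that by (simp add: dist_norm)
      qed
      show "(f has_derivative (\<lambda>h. h \<bullet> g z)) (at z within ball x d)" for z
        using D[of z] unfolding gderiv_def by (rule has_derivative_at_withinI)
      show "onorm ((\<lambda>h. h \<bullet> g z) - (\<lambda>h. h \<bullet> g x)) \<le> e" if "z \<in> ball x d" for z
      proof (rule onorm_le)
        fix h
        have "\<bar>h \<bullet> (g z - g x)\<bar> \<le> norm h * norm (g z - g x)" by (rule Cauchy_Schwarz_ineq2)
        also have "\<dots> \<le> norm h * e" using d(2)[of z x] that by (intro mult_left_mono) (auto simp: dist_commute)
        finally show "norm (((\<lambda>h. h \<bullet> g z) - (\<lambda>h. h \<bullet> g x)) h) \<le> e * norm h"
          by (simp add: inner_diff_right mult.commute)
      qed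
      show "x \<in> ball x d" using d(1) by simp
    qed
    then show ?thesis by (simp add: mult.commute)
  qed
  with d(1) that show ?thesis by blast
qed

section \<open>Integrals of gradients of compactly supported functions\<close>

lemma LINT_translate:
  fixes f :: "'a::euclidean_space \<Rightarrow> real"
  assumes "continuous_on UNIV f"
  shows "(LINT x|lebesgue. f (x + c)) = (LINT x|lebesgue. f x)"
proof -
  have f: "f \<in> borel_measurable borel" using assms by (rule borel_measurable_continuous_onI)
  have "(LINT x|lborel. f x) = (LINT x|distr lborel borel ((+) c). f x)" by (simp add: lborel_distr_plus)
  also have "\<dots> = (LINT x|lborel. f (c + x))" by (rule integral_distr) (use f in auto)
  finally have "(LINT x|lborel. f (x + c)) = (LINT x|lborel. f x)" by (simp add: add.commute)
  then show ?thesis using f by (simp add: integral_completion)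
qed

text \<open>The difference quotients have vanishing integral by translation invariance and converge
  uniformly to the directional derivative.\<close>

lemma LINT_gradient_eq_0:
  fixes f :: "'a::euclidean_space \<Rightarrow> real"
  assumes D: "\<And>x. GDERIV f x :> g x" and g: "continuous_on UNIV g" and f0: "\<And>x. R < norm x \<Longrightarrow> f x = 0"
  shows "(LINT x|lebesgue. g x) = 0"
proof -
  have g0: "g x = 0" if "R < norm x" for x
  proof -
    have "open {x. R < norm x}" by (intro open_Collect_less continuous_intros)
    then have "GDERIV f x :> 0" by (rule GDERIV_zero_open) (use that f0 in auto)
    with D GDERIV_unique show ?thesis by blast
  qed
  have fc: "continuous_on UNIV f"
    using D by (meson GDERIV_continuous_at continuous_at_imp_continuous_on)
  have ig: "integrable lebesgue g" by (rule cc_integrable[OF g(1) g0])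
  have iF: "integrable lebesgue f" by (rule cc_integrable[OF fc f0])
  have comp: "(LINT x|lebesgue. g x) \<bullet> b = 0" if "b \<in> Basis" for b
  proof -
    let ?I = "LINT x|lebesgue. g x \<bullet> b"
    let ?B = "cball 0 (R + 1) :: 'a set"
    have "\<bar>?I\<bar> \<le> e * measure lebesgue ?B" if "e > 0" for e
    proof -
      obtain d where d: "d > 0" "\<And>x y. norm (y - x) < d \<Longrightarrow> \<bar>f y - f x - (y - x) \<bullet> g x\<bar> \<le> e * norm (y - x)"
        using C1_uniform[OF D g g0 \<open>e > 0\<close>] by metis
      \<comment> \<open>Below \<open>d\<close> for the Taylor estimate, and at most 1 so that the
        translated function still vanishes outside the ball of radius \<open>R + 1\<close>.\<close>
      define t where "t = min (d / 2) 1"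
      have t: "t > 0" "t < d" "t \<le> 1" using d(1) by (auto simp: t_def)
      have ift: "integrable lebesgue (\<lambda>x. f (x + t *\<^sub>R b))"
      proof (rule cc_integrable[where R="R + 1"])
        show "f (x + t *\<^sub>R b) = 0" if "R + 1 < norm x" for x
        proof (rule f0)
          have "norm x \<le> norm (x + t *\<^sub>R b) + norm (t *\<^sub>R b)" using norm_triangle_ineq4[of "x + t *\<^sub>R b" "t *\<^sub>R b"] by simp
          then show "R < norm (x + t *\<^sub>R b)" using that t \<open>b \<in> Basis\<close> by simp
        qed
      qed (auto intro!: continuous_on_compose2[OF fc] continuous_intros)
      let ?q = "\<lambda>x. f (x + t *\<^sub>R b) - f x - t * (g x \<bullet> b)"
      have iq: "integrable lebesgue ?q" using ift iF ig by auto
      have "(LINT x|lebesgue. ?q x) = - t * ?I"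
        using ift iF ig LINT_translate[OF fc, of "t *\<^sub>R b"] by simp
      moreover have "\<bar>LINT x|lebesgue. ?q x\<bar> \<le> (LINT x|lebesgue. e * t * indicator ?B x)"
      proof -
        have "\<bar>LINT x|lebesgue. ?q x\<bar> \<le> (LINT x|lebesgue. \<bar>?q x\<bar>)" by (rule integral_abs_bound)
        also have "\<dots> \<le> (LINT x|lebesgue. e * t * indicator ?B x)"
        proof (rule integral_mono)
          show "integrable lebesgue (\<lambda>x. e * t * indicator ?B x)"
            using lmeasurable_cball[of 0 "R + 1"] by (auto simp: fmeasurable_def)
          fix x
          show "\<bar>?q x\<bar> \<le> e * t * indicator ?B x"
          proof (cases "norm x \<le> R + 1")
            case True
            have "\<bar>?q x\<bar> \<le> e * norm (t *\<^sub>R b)"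
              using d(2)[of "x + t *\<^sub>R b" x] t \<open>b \<in> Basis\<close> by (simp add: inner_commute)
            then show ?thesis using True t \<open>b \<in> Basis\<close> by simp
          next
            case False
            have "norm x \<le> norm (x + t *\<^sub>R b) + norm (t *\<^sub>R b)" using norm_triangle_ineq4[of "x + t *\<^sub>R b" "t *\<^sub>R b"] by simp
            then have "R < norm (x + t *\<^sub>R b)" "R < norm x" using False t \<open>b \<in> Basis\<close> by auto
            then show ?thesis using f0 g0 False by simp
          qed
        qed (use iq in auto)
        finally show ?thesis .
      qed
      moreover have "(LINT x|lebesgue. e * t * indicator ?B x) = e * t * measure lebesgue ?B" by simp
      ultimately have "t * \<bar>?I\<bar> \<le> t * (e * measure lebesgue ?B)" using t by (simp add: abs_mult ac_simps)
      then show ?thesis using t by simp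
    qed note bound = this
    have "?I = 0"
    proof (rule ccontr)
      assume "?I \<noteq> 0"
      define m where "m = measure lebesgue ?B"
      have m: "0 \<le> m" "m / (2 * (m + 1)) < 1" by (auto simp: m_def divide_less_eq add_nonneg_pos)
      \<comment> \<open>The bound holds for every positive \<open>e\<close>; this particular
        \<open>e\<close> makes the right-hand side smaller than
        \<open>\<bar>?I\<bar>\<close>.\<close>
      have "\<bar>?I\<bar> \<le> \<bar>?I\<bar> / (2 * (m + 1)) * m"
        unfolding m_def using \<open>?I \<noteq> 0\<close> by (intro bound) (simp add: add_nonneg_pos)
      also have "\<dots> = \<bar>?I\<bar> * (m / (2 * (m + 1)))" by simp
      also have "\<dots> < \<bar>?I\<bar> * 1" using \<open>?I \<noteq> 0\<close> m(2) by (intro mult_strict_left_mono) auto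
      finally show False by simp
    qed
    then show ?thesis using ig by simp
  qed
  show ?thesis by (rule euclidean_eqI) (simp only: comp inner_zero_left)
qed

text \<open>The sets \<open>U\<close> and \<open>- K\<close> form an open cover, and on each of them
  the extension by zero is continuously differentiable. This handles functions such as those built
  from the barrier, which are differentiable only on an open set.\<close>

lemma C1_compact_extension:
  fixes f :: "'a::euclidean_space \<Rightarrow> real"
  assumes U: "open U" "compact K" "K \<subseteq> U" and f0: "\<And>x. x \<in> U - K \<Longrightarrow> f x = 0"
    and D: "\<And>x. x \<in> U \<Longrightarrow> GDERIV f x :> g x" and g: "continuous_on U g"
  defines "f' \<equiv> \<lambda>x. if x \<in> K then f x else 0" and "g' \<equiv> \<lambda>x. if x \<in> K then g x else 0"
  shows "GDERIV f' x :> g' x" and "continuous_on UNIV g'" and "x \<in> U \<Longrightarrow> f' x = f x" and "x \<in> U \<Longrightarrow> g' x = g x"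
proof -
  have oK: "open (- K)" using U by (simp add: compact_imp_closed open_Compl)
  show f'eq: "f' x = f x" if "x \<in> U" for x using that f0 by (auto simp: f'_def)
  show g'eq: "g' x = g x" if "x \<in> U" for x
  proof (cases "x \<in> K")
    case False
    have "GDERIV f x :> 0"
      by (rule GDERIV_zero_open[where S="U \<inter> - K"]) (use U oK that False f0 in auto)
    then have "g x = 0" using D[OF that] GDERIV_unique by blast
    then show ?thesis by (simp add: g'_def)
  qed (simp add: g'_def)
  show "GDERIV f' x :> g' x"
  proof (cases "x \<in> U")
    case True
    have "(f has_derivative (\<lambda>h. h \<bullet> g x)) (at x)" using D[OF True] by (simp add: gderiv_def)
    then have "(f' has_derivative (\<lambda>h. h \<bullet> g x)) (at x)"
      by (rule has_derivative_transform_within_open[OF _ U(1) True]) (simp add: f'eq)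
    then show ?thesis using g'eq[OF True] by (simp add: gderiv_def)
  next
    case False
    then have "GDERIV f' x :> 0"
      by (intro GDERIV_zero_open[OF oK]) (use U in \<open>auto simp: f'_def\<close>)
    then show ?thesis using False U by (auto simp: g'_def)
  qed
  have "continuous_on U g'" using g by (rule continuous_on_eq) (simp add: g'eq)
  moreover have "continuous_on (- K) g'"
    by (rule continuous_on_eq[of _ "\<lambda>x. 0"]) (auto simp: g'_def)
  ultimately have "continuous_on (U \<union> - K) g'" using U(1) oK by (intro continuous_on_open_Un)
  moreover have "U \<union> - K = UNIV" using U(3) by blast
  ultimately show "continuous_on UNIV g'" by simp
qed

text \<open>The form in which integration by parts is used: applied to a product, it moves the
  derivative from one factor to the other without boundary term.\<close>

lemma LINT_gradient_eq_0_on: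
  fixes f :: "'a::euclidean_space \<Rightarrow> real"
  assumes U: "open U" "compact K" "K \<subseteq> U" and f0: "\<And>x. x \<in> U - K \<Longrightarrow> f x = 0"
    and D: "\<And>x. x \<in> U \<Longrightarrow> GDERIV f x :> g x" and g: "continuous_on U g"
  shows "(LINT x|lebesgue_on U. g x) = 0" and "integrable (lebesgue_on U) g"
proof -
  let ?f = "\<lambda>x. if x \<in> K then f x else 0" and ?g = "\<lambda>x. if x \<in> K then g x else 0"
  note ext = C1_compact_extension[OF assms]
  obtain R where R: "\<forall>x\<in>K. norm x \<le> R" using compact_imp_bounded[OF U(2)] bounded_iff by blast
  have eq: "(if x \<in> U then g x else 0) = ?g x" for x using ext(4)[of x] U(3) by auto
  have "(LINT x|lebesgue. ?g x) = 0"
    by (rule LINT_gradient_eq_0[OF ext(1,2), where R=R]) (use R in auto)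
  then show "(LINT x|lebesgue_on U. g x) = 0"
    using Lebesgue_Measure.integral_restrict_UNIV[OF open_in_lebesgue[OF U(1)], of g] by (simp add: eq)
  have "integrable lebesgue ?g" by (rule cc_integrable[OF ext(2), where R=R]) (use R in auto)
  then show "integrable (lebesgue_on U) g"
    using Lebesgue_Measure.integrable_restrict_UNIV[OF open_in_lebesgue[OF U(1)], of g] by (simp add: eq)
qed

section \<open>Mollification\<close>

definition conv :: "('a::euclidean_space \<Rightarrow> real) \<Rightarrow> ('a \<Rightarrow> real) \<Rightarrow> 'a \<Rightarrow> real" where
  "conv \<rho> f x = (LINT y|lebesgue. \<rho> (x - y) * f y)"

lemma conv_integrable:
  fixes \<rho> f :: "'a::euclidean_space \<Rightarrow> real"
  assumes \<rho>: "continuous_on UNIV \<rho>" "\<And>x. norm (\<rho> x) \<le> B" and f: "integrable lebesgue f"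
  shows "integrable lebesgue (\<lambda>y. \<rho> (x - y) * f y)"
proof (rule Bochner_Integration.integrable_bound[where f="\<lambda>y. B * f y"])
  have "continuous_on UNIV (\<lambda>y. \<rho> (x - y))"
    by (intro continuous_on_compose2[OF \<rho>(1)] continuous_intros) auto
  then have "(\<lambda>y. \<rho> (x - y)) \<in> borel_measurable lebesgue" by (rule cc_measurable)
  with f show "(\<lambda>y. \<rho> (x - y) * f y) \<in> borel_measurable lebesgue"
    by (intro borel_measurable_times) auto
  have "norm (\<rho> (x - y) * f y) \<le> norm (B * f y)" for y
    using \<rho>(2)[of "x - y"] by (simp add: abs_mult mult_right_mono)
  then show "AE y in lebesgue. norm (\<rho> (x - y) * f y) \<le> norm (B * f y)" by (intro AE_I2)
qed (use f in auto)

text \<open>The Taylor remainder of the kernel is small uniformly in its argument, so integrating it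
  against \<open>f\<close> leaves a remainder proportional to the \<open>L1\<close> norm of
  \<open>f\<close>. The gradient is written by components because \<open>conv\<close> acts on
  real-valued kernels.\<close>

lemma conv_GDERIV:
  fixes \<rho> f :: "'a::euclidean_space \<Rightarrow> real"
  assumes \<rho>: "smooth \<rho>" "\<And>x. R < norm x \<Longrightarrow> \<rho> x = 0" and f: "integrable lebesgue f"
  shows "GDERIV (conv \<rho> f) x :> (\<Sum>b\<in>Basis. conv (\<lambda>z. grad \<rho> z \<bullet> b) f x *\<^sub>R b)" (is "GDERIV _ _ :> ?G")
proof -
  have c: "continuous_on UNIV \<rho>" "continuous_on UNIV (grad \<rho>)"
    using \<rho>(1) by (auto intro: smooth_continuous smooth_grad_continuous)
  have "open {x::'a. R < norm x}" by (intro open_Collect_less continuous_intros)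
  then have g0: "grad \<rho> x = 0" if "R < norm x" for x
    by (rule grad_zero_open) (use that \<rho>(2) in auto)
  obtain B where B: "\<And>x. norm (\<rho> x) \<le> B" using cc_bounded[OF c(1) \<rho>(2)] by metis
  obtain B' where B': "\<And>x. norm (grad \<rho> x) \<le> B'" using cc_bounded[OF c(2) g0] by metis
  have cb: "continuous_on UNIV (\<lambda>z. grad \<rho> z \<bullet> b)" "norm (grad \<rho> z \<bullet> b) \<le> B'" if "b \<in> Basis" for b z
    using Basis_le_norm[OF that, of "grad \<rho> z"] B'[of z] by (auto intro!: continuous_intros c)
  note I = conv_integrable[OF c(1) B f] and Ib = conv_integrable[OF cb f]
  define F where "F = (LINT y|lebesgue. \<bar>f y\<bar>)"
  have F: "F \<ge> 0" by (simp add: F_def)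
  have eq: "h \<bullet> grad \<rho> (x - y) * f y = (\<Sum>b\<in>Basis. (h \<bullet> b) * ((grad \<rho> (x - y) \<bullet> b) * f y))" for h x y
    by (subst euclidean_inner) (simp add: sum_distrib_right mult.assoc)
  have inner_int: "integrable lebesgue (\<lambda>y. h \<bullet> grad \<rho> (x - y) * f y)" for h x
    unfolding eq using Ib by auto
  have inner: "h \<bullet> ?G = (LINT y|lebesgue. h \<bullet> grad \<rho> (x - y) * f y)" for h
    unfolding eq using Ib
    by (subst Bochner_Integration.integral_sum) (auto simp: inner_sum_right conv_def mult.commute intro!: sum.cong)
  have "((conv \<rho> f) has_derivative (\<lambda>h. h \<bullet> ?G)) (at x)"
    unfolding has_derivative_at_alt
  proof (intro conjI allI impI)
    show "bounded_linear (\<lambda>h. h \<bullet> ?G)" by (rule bounded_linear_inner_left)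
    fix e :: real assume e: "e > 0"
    \<comment> \<open>Here \<open>F\<close> is the \<open>L1\<close> norm of \<open>f\<close>; the
      summand 1 covers \<open>F = 0\<close>.\<close>
    then have "e / (F + 1) > 0" using F by (simp add: add_nonneg_pos)
    from C1_uniform[OF smooth_GDERIV[OF \<rho>(1)] c(2) g0 this]
    obtain d where d: "d > 0" "\<And>x y. norm (y - x) < d \<Longrightarrow> \<bar>\<rho> y - \<rho> x - (y - x) \<bullet> grad \<rho> x\<bar> \<le> e / (F + 1) * norm (y - x)"
      by metis
    have "norm (conv \<rho> f y - conv \<rho> f x - (y - x) \<bullet> ?G) \<le> e * norm (y - x)" if "norm (y - x) < d" for y
    proof -
      have eq': "conv \<rho> f y - conv \<rho> f x - (y - x) \<bullet> ?G
         = (LINT z|lebesgue. \<rho> (y - z) * f z - \<rho> (x - z) * f z - (y - x) \<bullet> grad \<rho> (x - z) * f z)"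
        unfolding inner unfolding conv_def using I inner_int by simp
      have "norm (conv \<rho> f y - conv \<rho> f x - (y - x) \<bullet> ?G) \<le> (LINT z|lebesgue. norm (\<rho> (y - z) * f z - \<rho> (x - z) * f z - (y - x) \<bullet> grad \<rho> (x - z) * f z))"
        unfolding eq' by (rule integral_norm_bound)
      also have "\<dots> \<le> (LINT z|lebesgue. e / (F + 1) * norm (y - x) * \<bar>f z\<bar>)"
      proof (rule integral_mono)
        fix z
        have "\<bar>\<rho> (y - z) - \<rho> (x - z) - (y - x) \<bullet> grad \<rho> (x - z)\<bar> \<le> e / (F + 1) * norm (y - x)"
          using d(2)[of "y - z" "x - z"] that by simp
        then have "\<bar>\<rho> (y - z) - \<rho> (x - z) - (y - x) \<bullet> grad \<rho> (x - z)\<bar> * \<bar>f z\<bar> \<le> e / (F + 1) * norm (y - x) * \<bar>f z\<bar>"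
          by (rule mult_right_mono) simp
        then show "norm (\<rho> (y - z) * f z - \<rho> (x - z) * f z - (y - x) \<bullet> grad \<rho> (x - z) * f z) \<le> e / (F + 1) * norm (y - x) * \<bar>f z\<bar>"
          unfolding left_diff_distrib[symmetric] real_norm_def abs_mult .
        show "integrable lebesgue (\<lambda>z. norm (\<rho> (y - z) * f z - \<rho> (x - z) * f z - (y - x) \<bullet> grad \<rho> (x - z) * f z))"
          by (intro integrable_norm Bochner_Integration.integrable_diff I inner_int)
      qed (use f in auto)
      also have "\<dots> = e / (F + 1) * norm (y - x) * F" by (simp add: F_def)
      also have "\<dots> = e * norm (y - x) * (F / (F + 1))" by simp
      also have "\<dots> \<le> e * norm (y - x) * 1" using F e by (intro mult_left_mono) auto
      finally show ?thesis by simp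
    qed
    with d(1) show "\<exists>d>0. \<forall>y. norm (y - x) < d \<longrightarrow> norm (conv \<rho> f y - conv \<rho> f x - (y - x) \<bullet> ?G) \<le> e * norm (y - x)"
      by blast
  qed
  then show ?thesis by (simp add: gderiv_def)
qed

lemma conv_smooth:
  fixes \<rho> f :: "'a::euclidean_space \<Rightarrow> real"
  assumes \<rho>: "smooth \<rho>" "\<And>x. R < norm x \<Longrightarrow> \<rho> x = 0" and f: "integrable lebesgue f"
  shows "smooth (conv \<rho> f)"
proof -
  have "Ck k (conv \<rho> f)" if "smooth \<rho>" "\<And>x. R < norm x \<Longrightarrow> \<rho> x = 0" for k \<rho>
    using that
  proof (induction k arbitrary: \<rho>)
    case 0
    have "isCont (conv \<rho> f) x" for x
      by (rule GDERIV_continuous_at[OF conv_GDERIV[OF 0 f]])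
    then show ?case by (simp add: continuous_at_imp_continuous_on)
  next
    case (Suc k)
    show ?case
    proof (rule Ck_SucI)
      show "GDERIV (conv \<rho> f) x :> (\<Sum>b\<in>Basis. conv (\<lambda>z. grad \<rho> z \<bullet> b) f x *\<^sub>R b)" for x
        by (rule conv_GDERIV[OF Suc.prems f])
      fix b :: 'a assume b: "b \<in> Basis"
      have "open {x::'a. R < norm x}" by (intro open_Collect_less continuous_intros)
      then have "grad \<rho> x = 0" if "R < norm x" for x
        by (rule grad_zero_open) (use that Suc.prems(2) in auto)
      then have "Ck k (conv (\<lambda>z. grad \<rho> z \<bullet> b) f)"
        by (intro Suc.IH smooth_grad_component Suc.prems(1) b) simp
      then show "Ck k (\<lambda>x. (\<Sum>b\<in>Basis. conv (\<lambda>z. grad \<rho> z \<bullet> b) f x *\<^sub>R b) \<bullet> b)"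
        using b by simp
    qed
  qed
  with \<rho> show ?thesis unfolding smooth_def by blast
qed

section \<open>Standard mollifiers, supported in balls of radius \<open>1 / (n + 1)\<close>\<close>

definition bump :: "nat \<Rightarrow> 'a::euclidean_space \<Rightarrow> real" where
  "bump n x = flat 0 ((inverse (real (Suc n)))\<^sup>2 - x \<bullet> x)"

definition mollifier :: "nat \<Rightarrow> 'a::euclidean_space \<Rightarrow> real" where
  "mollifier n x = bump n x / (LINT y|lebesgue. bump n (y::'a))"

lemma bump_nonneg: "0 \<le> bump n x" by (simp add: bump_def flat_nonneg)

lemma bump_eq_0: "inverse (real (Suc n)) \<le> norm x \<Longrightarrow> bump n x = 0"
  unfolding bump_def by (rule flat_zero) (simp add: power_mono flip: power2_norm_eq_inner)

lemma bump_pos: "norm x < inverse (real (Suc n)) \<Longrightarrow> 0 < bump n x"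
  unfolding bump_def by (rule flat_pos) (simp add: power_strict_mono flip: power2_norm_eq_inner)

lemma smooth_bump: "smooth (bump n :: 'a::euclidean_space \<Rightarrow> real)"
proof -
  have "smooth (\<lambda>x::'a. (inverse (real (Suc n)))\<^sup>2 - x \<bullet> x)" by (intro smooth_diff smooth_const smooth_inner_self)
  then show ?thesis unfolding bump_def[abs_def] by (intro smooth_compose[OF smooth_flat])
qed

lemma bump_integral_pos: "0 < (LINT y|lebesgue. bump n (y::'a::euclidean_space))"
proof -
  have i: "integrable lebesgue (bump n :: 'a \<Rightarrow> real)"
    by (rule cc_integrable[OF smooth_continuous[OF smooth_bump], of "inverse (real (Suc n))"]) (auto intro: bump_eq_0)
  have "(LINT y|lebesgue. bump n (y::'a)) \<noteq> 0"
  proof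
    assume "(LINT y|lebesgue. bump n (y::'a)) = 0"
    then have "AE y::'a in lebesgue. bump n y = 0"
      using i by (subst (asm) integral_nonneg_eq_0_iff_AE) (auto simp: bump_nonneg)
    then have "AE y::'a in lebesgue. y \<notin> ball 0 (inverse (real (Suc n)))"
      by eventually_elim (use bump_pos in \<open>fastforce\<close>)
    then have "negligible (ball (0::'a) (inverse (real (Suc n))))"
      unfolding negligible_iff_null_sets by (subst (asm) AE_iff_null_sets[symmetric]) auto
    then show False using open_not_negligible[of "ball (0::'a) (inverse (real (Suc n)))"] by simp
  qed
  moreover have "0 \<le> (LINT y|lebesgue. bump n (y::'a))" by (simp add: bump_nonneg)
  ultimately show ?thesis by simp
qed

lemma mollifier_nonneg: "0 \<le> mollifier n x"
  unfolding mollifier_def by (intro divide_nonneg_pos bump_nonneg bump_integral_pos)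

lemma mollifier_eq_0: "inverse (real (Suc n)) \<le> norm x \<Longrightarrow> mollifier n x = 0"
  by (simp add: mollifier_def bump_eq_0)

lemma smooth_mollifier: "smooth (mollifier n :: 'a::euclidean_space \<Rightarrow> real)"
  unfolding mollifier_def[abs_def] divide_inverse by (intro smooth_mult smooth_bump smooth_const)

lemma mollifier_minus: "mollifier n (x - y) = mollifier n (y - x)"
  unfolding mollifier_def bump_def power2_norm_eq_inner[symmetric] by (simp add: norm_minus_commute)

lemma mollifier_reflect_integral: "(LINT y|lebesgue. mollifier n (x - y)) = 1"
proof -
  have "(LINT y|lebesgue. mollifier n (x - y)) = (LINT y|lebesgue. mollifier n (y + - x))"
    by (intro Bochner_Integration.integral_cong) (auto simp: mollifier_minus[of n x])
  also have "\<dots> = (LINT y|lebesgue. mollifier n (y::'a))"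
    by (rule LINT_translate[OF smooth_continuous[OF smooth_mollifier]])
  also have "\<dots> = 1" using bump_integral_pos[of n, where 'a='a] by (simp add: mollifier_def)
  finally show ?thesis .
qed

lemma mollifier_bounded: obtains B where "\<And>x::'a::euclidean_space. norm (mollifier n x) \<le> B"
proof -
  have z: "mollifier n x = 0" if "inverse (real (Suc n)) < norm x" for x :: 'a
    using that by (intro mollifier_eq_0) simp
  show ?thesis using cc_bounded[OF smooth_continuous[OF smooth_mollifier] z] that by metis
qed

abbreviation moll :: "nat \<Rightarrow> ('a::euclidean_space \<Rightarrow> real) \<Rightarrow> 'a \<Rightarrow> real" where
  "moll n f \<equiv> conv (mollifier n) f"

lemma moll_integrable:
  assumes "integrable lebesgue f" shows "integrable lebesgue (\<lambda>y. mollifier n (x - y) * f y)"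
  using conv_integrable[OF smooth_continuous[OF smooth_mollifier] _ assms] mollifier_bounded by metis

lemma mollifier_integrable:
  fixes x :: "'a::euclidean_space"
  shows "integrable lebesgue (\<lambda>y. mollifier n (x - y))"
proof (rule cc_integrable[where R="norm x + inverse (real (Suc n))"])
  show "continuous_on UNIV (\<lambda>y. mollifier n (x - y))"
    by (intro continuous_on_compose2[OF smooth_continuous[OF smooth_mollifier]] continuous_intros) auto
  fix y :: 'a assume "norm x + inverse (real (Suc n)) < norm y"
  moreover have "norm y - norm x \<le> norm (x - y)"
    using norm_triangle_ineq2[of y x] by (simp add: norm_minus_commute)
  ultimately have "inverse (real (Suc n)) \<le> norm (x - y)" by linarith
  then show "mollifier n (x - y) = 0" by (rule mollifier_eq_0)
qed

lemma moll_smooth: "integrable lebesgue f \<Longrightarrow> smooth (moll n f)"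
  by (rule conv_smooth[OF smooth_mollifier, of "inverse (real (Suc n))"]) (auto intro: mollifier_eq_0)

lemma moll_diff:
  assumes "integrable lebesgue f" "integrable lebesgue g"
  shows "moll n (\<lambda>x. f x - g x) x = moll n f x - moll n g x"
  using moll_integrable[OF assms(1), of n x] moll_integrable[OF assms(2), of n x]
  by (simp add: conv_def right_diff_distrib)

lemma moll_cong_ball:
  fixes x :: "'a::euclidean_space"
  assumes "AE y in lebesgue. norm (x - y) < inverse (real (Suc n)) \<longrightarrow> f y = g y"
    "f \<in> borel_measurable lebesgue" "g \<in> borel_measurable lebesgue"
  shows "moll n f x = moll n g x"
  unfolding conv_def
proof (rule integral_cong_AE)
  have m: "(\<lambda>y. mollifier n (x - y)) \<in> borel_measurable lebesgue"
    using mollifier_integrable by (rule borel_measurable_integrable)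
  show "(\<lambda>y. mollifier n (x - y) * f y) \<in> borel_measurable lebesgue"
    "(\<lambda>y. mollifier n (x - y) * g y) \<in> borel_measurable lebesgue"
    using m assms(2,3) by auto
  show "AE y in lebesgue. mollifier n (x - y) * f y = mollifier n (x - y) * g y"
    using assms(1)
  proof eventually_elim
    case (elim y)
    then show ?case using mollifier_eq_0[of n "x - y"] by (cases "norm (x - y) < inverse (real (Suc n))") auto
  qed
qed

lemma moll_const_ball:
  assumes "\<And>y. norm (x - y) < inverse (real (Suc n)) \<Longrightarrow> f y = c" "f \<in> borel_measurable lebesgue"
  shows "moll n f x = c"
proof -
  have "moll n f x = moll n (\<lambda>_. c) x" by (rule moll_cong_ball) (use assms in auto)
  also have "\<dots> = c" using mollifier_reflect_integral[of n x] by (simp add: conv_def)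
  finally show ?thesis .
qed

text \<open>The mollified value is a weighted mean of the values in a ball of radius
  \<open>inverse (real (Suc n))\<close>, with total weight 1.\<close>

lemma moll_close:
  assumes f: "integrable lebesgue f" and "\<And>y. norm (x - y) < inverse (real (Suc n)) \<Longrightarrow> \<bar>f y - c\<bar> \<le> e"
  shows "\<bar>moll n f x - c\<bar> \<le> e"
proof -
  note i = moll_integrable[OF f, of n x] mollifier_integrable[of n x]
  have "moll n f x - c = (LINT y|lebesgue. mollifier n (x - y) * f y) - c * (LINT y|lebesgue. mollifier n (x - y))"
    by (simp add: conv_def mollifier_reflect_integral)
  also have "\<dots> = (LINT y|lebesgue. mollifier n (x - y) * f y - mollifier n (x - y) * c)"
    using i by (simp add: mult.commute)
  finally have eq: "moll n f x - c = (LINT y|lebesgue. mollifier n (x - y) * f y - mollifier n (x - y) * c)" .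
  have "\<bar>moll n f x - c\<bar> \<le> (LINT y|lebesgue. \<bar>mollifier n (x - y) * f y - mollifier n (x - y) * c\<bar>)"
    unfolding eq by (rule integral_abs_bound)
  also have "\<dots> \<le> (LINT y|lebesgue. mollifier n (x - y) * e)"
  proof (rule integral_mono)
    fix y
    show "\<bar>mollifier n (x - y) * f y - mollifier n (x - y) * c\<bar> \<le> mollifier n (x - y) * e"
    proof (cases "norm (x - y) < inverse (real (Suc n))")
      case True
      then show ?thesis using assms(2)[OF True] mollifier_nonneg[of n "x - y"]
        by (simp add: abs_mult mult_left_mono flip: right_diff_distrib)
    qed (simp add: mollifier_eq_0)
  qed (use i in auto)
  also have "\<dots> = e" by (simp add: mollifier_reflect_integral)
  finally show ?thesis .
qed

text \<open>Jensen's inequality for the probability density \<open>mollifier n (x - y)\<close>,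
  obtained from Cauchy-Schwarz by splitting the density into two square roots.\<close>

lemma moll_square_le:
  fixes f :: "'a::euclidean_space \<Rightarrow> real"
  assumes f: "sq_integrable lebesgue f" "integrable lebesgue f"
  shows "(moll n f x)\<^sup>2 \<le> (LINT y|lebesgue. mollifier n (x - y) * (f y)\<^sup>2)"
proof -
  obtain B where B: "\<And>x::'a. norm (mollifier n x) \<le> B" using mollifier_bounded by blast
  define s where "s y = sqrt (mollifier n (x - y))" for y
  have s2: "s y * s y = mollifier n (x - y)" for y by (simp add: mollifier_nonneg s_def)
  have sm: "s \<in> borel_measurable lebesgue"
    unfolding s_def[abs_def] using borel_measurable_integrable[OF mollifier_integrable] by measurable
  have s1: "sq_integrable lebesgue s" unfolding sq_integrable_def using sm mollifier_integrable[of n x] by (simp add: mollifier_nonneg s_def)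
  have "sq_integrable lebesgue (\<lambda>y. s y *\<^sub>R f y)"
  proof (rule sq_integrable_scaleR_bounded[OF sm _ f(1)])
    show "AE y in lebesgue. \<bar>s y\<bar> \<le> sqrt B" using B by (auto simp: mollifier_nonneg s_def)
  qed
  note CS = L2_Cauchy_Schwarz[OF s1 this]
  have "\<bar>moll n f x\<bar> \<le> (LINT y|lebesgue. \<bar>mollifier n (x - y) * f y\<bar>)"
    unfolding conv_def by (rule integral_abs_bound)
  also have "\<dots> = (LINT y|lebesgue. norm (s y) * norm (s y *\<^sub>R f y))"
    by (simp add: abs_mult mult.assoc[symmetric] flip: s2)
  also have "\<dots> \<le> sqrt (LINT y|lebesgue. (norm (s y))\<^sup>2) * sqrt (LINT y|lebesgue. (norm (s y *\<^sub>R f y))\<^sup>2)" by (rule CS)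
  also have "(LINT y|lebesgue. (norm (s y))\<^sup>2) = 1"
    using mollifier_reflect_integral[of n x] by (simp add: mollifier_nonneg s_def)
  also have "(LINT y|lebesgue. (norm (s y *\<^sub>R f y))\<^sup>2) = (LINT y|lebesgue. mollifier n (x - y) * (f y)\<^sup>2)"
    by (simp add: mollifier_nonneg s_def power_mult_distrib)
  finally have "\<bar>moll n f x\<bar> \<le> sqrt (LINT y|lebesgue. mollifier n (x - y) * (f y)\<^sup>2)" by simp
  then have "\<bar>moll n f x\<bar>\<^sup>2 \<le> (sqrt (LINT y|lebesgue. mollifier n (x - y) * (f y)\<^sup>2))\<^sup>2" by (rule power_mono) simp
  then show ?thesis by (simp add: mollifier_nonneg)
qed

text \<open>Jensen's inequality is integrated in \<open>x\<close> and the order of integration is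
  exchanged; the kernel has integral 1 in either variable.\<close>

lemma moll_contraction:
  fixes f :: "'a::euclidean_space \<Rightarrow> real"
  assumes f: "sq_integrable lebesgue f" "integrable lebesgue f"
  shows "sq_integrable lebesgue (moll n f)" and "(LINT x|lebesgue. (moll n f x)\<^sup>2) \<le> (LINT x|lebesgue. (f x)\<^sup>2)"
proof -
  \<comment> \<open>The exchange of integrals takes place for the product of Borel measures, so
    \<open>f\<close> is replaced by a Borel representative with the same mollification.\<close>
  obtain g where g: "g \<in> borel_measurable lborel" "AE x in lborel. f x = g x"
    using completion_ex_borel_measurable_real[of f lborel] sq_integrable_measurable[OF f(1)] by blast
  have fg: "AE x in lebesgue. f x = g x" using g(2) by (rule AE_completion)
  have mg: "moll n f = moll n g"
    by (rule ext, rule moll_cong_ball) (use fg f g in \<open>auto intro: measurable_completion simp: sq_integrable_def\<close>)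
  have gl: "g \<in> borel_measurable lebesgue" using g(1) by (rule measurable_completion)
  have [measurable]: "g \<in> borel_measurable borel" using g(1) by simp
  have [measurable]: "mollifier n \<in> borel_measurable (borel :: 'a measure)"
    by (intro borel_measurable_continuous_onI smooth_continuous smooth_mollifier)
  have sg: "integrable lebesgue (\<lambda>x. (g x)\<^sup>2)"
    using sq_integrable_integrable[OF f(1)] fg gl
    by (subst (asm) integrable_cong_AE[where g="\<lambda>x. (g x)\<^sup>2"]) (use f in \<open>auto simp: sq_integrable_def\<close>)
  have "integrable lebesgue g"
    using f(2) fg gl by (subst (asm) integrable_cong_AE[where g=g]) (use f in \<open>auto simp: sq_integrable_def\<close>)
  have mm: "moll n f \<in> borel_measurable borel"
    by (intro borel_measurable_continuous_onI smooth_continuous moll_smooth f)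
  have mint: "integrable lebesgue (\<lambda>y. mollifier n (x - y) * (g y)\<^sup>2)" for x
    by (rule moll_integrable[OF sg])
  have sg': "sq_integrable lebesgue g" using sg gl by (simp add: sq_integrable_def)
  have "(\<integral>\<^sup>+x. ennreal ((moll n f x)\<^sup>2) \<partial>lborel) \<le> (\<integral>\<^sup>+x. (\<integral>\<^sup>+y. ennreal (mollifier n (x - y) * (g y)\<^sup>2) \<partial>lborel) \<partial>lborel)"
  proof (rule nn_integral_mono)
    fix x :: 'a
    have "ennreal ((moll n f x)\<^sup>2) \<le> ennreal (LINT y|lebesgue. mollifier n (x - y) * (g y)\<^sup>2)"
      unfolding mg by (intro ennreal_leI moll_square_le sg' \<open>integrable lebesgue g\<close>)
    also have "\<dots> = (\<integral>\<^sup>+y. ennreal (mollifier n (x - y) * (g y)\<^sup>2) \<partial>lebesgue)"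
      by (rule nn_integral_eq_integral[symmetric, OF mint]) (simp add: mollifier_nonneg)
    finally show "ennreal ((moll n f x)\<^sup>2) \<le> (\<integral>\<^sup>+y. ennreal (mollifier n (x - y) * (g y)\<^sup>2) \<partial>lborel)"
      by (simp add: nn_integral_completion)
  qed
  also have "\<dots> = (\<integral>\<^sup>+y. (\<integral>\<^sup>+x. ennreal (mollifier n (x - y) * (g y)\<^sup>2) \<partial>lborel) \<partial>lborel)"
    by (rule lborel_pair.Fubini') measurable
  also have "\<dots> = (\<integral>\<^sup>+y. ennreal ((g y)\<^sup>2) \<partial>lborel)"
  proof (rule nn_integral_cong)
    fix y :: 'a
    have "(\<integral>\<^sup>+x. ennreal (mollifier n (x - y) * (g y)\<^sup>2) \<partial>lborel) = (\<integral>\<^sup>+x. ennreal (mollifier n (y - x)) * ennreal ((g y)\<^sup>2) \<partial>lborel)"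
      by (intro nn_integral_cong) (simp add: ennreal_mult' mollifier_nonneg mollifier_minus[of n y])
    also have "\<dots> = (\<integral>\<^sup>+x. ennreal (mollifier n (y - x)) \<partial>lborel) * ennreal ((g y)\<^sup>2)"
      by (rule nn_integral_multc) measurable
    also have "(\<integral>\<^sup>+x. ennreal (mollifier n (y - x)) \<partial>lborel) = (\<integral>\<^sup>+x. ennreal (mollifier n (y - x)) \<partial>lebesgue)"
      by (simp add: nn_integral_completion)
    also have "\<dots> = ennreal (LINT x|lebesgue. mollifier n (y - x))"
      by (rule nn_integral_eq_integral[OF mollifier_integrable]) (simp add: mollifier_nonneg)
    finally show "(\<integral>\<^sup>+x. ennreal (mollifier n (x - y) * (g y)\<^sup>2) \<partial>lborel) = ennreal ((g y)\<^sup>2)"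
      by (simp add: mollifier_reflect_integral)
  qed
  also have "\<dots> = ennreal (LINT y|lebesgue. (g y)\<^sup>2)"
    using nn_integral_eq_integral[OF sg] by (simp add: nn_integral_completion)
  also have "(LINT y|lebesgue. (g y)\<^sup>2) = (LINT x|lebesgue. (f x)\<^sup>2)"
  proof (rule integral_cong_AE)
    show "AE x in lebesgue. (g x)\<^sup>2 = (f x)\<^sup>2" using fg by eventually_elim simp
  qed (use f gl in \<open>auto simp: sq_integrable_def\<close>)
  finally have le: "(\<integral>\<^sup>+x. ennreal ((moll n f x)\<^sup>2) \<partial>lebesgue) \<le> ennreal (LINT x|lebesgue. (f x)\<^sup>2)"
    by (simp add: nn_integral_completion)
  have ml: "moll n f \<in> borel_measurable lebesgue" using mm by (intro measurable_completion) simp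
  have i: "integrable lebesgue (\<lambda>x. (moll n f x)\<^sup>2)"
    unfolding integrable_iff_bounded using ml le_less_trans[OF le ennreal_less_top] by simp
  show "sq_integrable lebesgue (moll n f)" using ml i by (simp add: sq_integrable_def)
  show "(LINT x|lebesgue. (moll n f x)\<^sup>2) \<le> (LINT x|lebesgue. (f x)\<^sup>2)"
    using le by (simp add: nn_integral_eq_integral[OF i] ennreal_le_iff)
qed

section \<open>Density of continuous functions in \<open>L2\<close> and convergence of
  mollifications\<close>

lemma clip_tendsto:
  fixes a :: "nat \<Rightarrow> real"
  assumes "a \<longlonglongrightarrow> l" "\<bar>l\<bar> \<le> M"
  shows "(\<lambda>n. max (- M) (min M (a n))) \<longlonglongrightarrow> l"
proof -
  have "(\<lambda>n. max (- M) (min M (a n))) \<longlonglongrightarrow> max (- M) (min M l)" by (intro tendsto_intros assms)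
  moreover have "max (- M) (min M l) = l" using assms(2) by auto
  ultimately show ?thesis by simp
qed

lemma abs_clip: "0 \<le> M \<Longrightarrow> \<bar>max (- M) (min M a)\<bar> \<le> (M::real)" by auto

text \<open>A measurable function is an almost everywhere limit of continuous ones. Clipping to
  \<open>[-M, M]\<close> and multiplying by a cutoff around \<open>K\<close> adds a uniform bound
  and a common compact support, which dominated convergence requires later.\<close>

lemma bounded_approx_continuous:
  fixes f :: "'a::euclidean_space \<Rightarrow> real"
  assumes f: "f \<in> borel_measurable lebesgue" "\<And>x. \<bar>f x\<bar> \<le> M" "\<And>x. x \<notin> K \<Longrightarrow> f x = 0"
    and K: "compact K" "open V" "K \<subseteq> V" and M: "0 \<le> M"
  obtains g C where "compact C" "C \<subseteq> V" "\<And>n. continuous_on UNIV (g n)" "\<And>n x. \<bar>g n x\<bar> \<le> M" "\<And>n x. x \<notin> C \<Longrightarrow> g n x = 0"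
    "AE x in lebesgue. (\<lambda>n. g n x) \<longlonglongrightarrow> f x"
proof -
  obtain e where e: "e > 0" "(\<Union>x\<in>K. cball x e) \<subseteq> V"
    using compact_subset_open_imp_cball_epsilon_subset[OF K] by metis
  define C where "C = {x + y |x y. x \<in> K \<and> y \<in> cball 0 e}"
  have C: "compact C" unfolding C_def by (intro compact_sums K) auto
  have CV: "C \<subseteq> V"
  proof
    fix z assume "z \<in> C"
    then obtain x y where "z = x + y" "x \<in> K" "norm y \<le> e" by (auto simp: C_def)
    then have "z \<in> cball x e" by (simp add: dist_norm)
    then show "z \<in> V" using e \<open>x \<in> K\<close> by blast
  qed
  \<comment> \<open>The empty set is treated apart: \<open>infdist\<close> to it is 0 by convention,
    and the cutoff would then be 1 everywhere.\<close>
  show ?thesis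
  proof (cases "K = {}")
    case True
    then have "f = (\<lambda>x. 0)" using f by auto
    then show ?thesis using that[of "{}" "\<lambda>n x. 0"] M by auto
  next
    case False
    define \<zeta> where "\<zeta> x = max 0 (1 - infdist x K / e)" for x
    have \<zeta>: "0 \<le> \<zeta> x" "\<zeta> x \<le> 1" for x using e infdist_nonneg[of x K] by (auto simp: \<zeta>_def)
    have \<zeta>K: "\<zeta> x = 1" if "x \<in> K" for x using that by (simp add: \<zeta>_def)
    have \<zeta>C: "\<zeta> x = 0" if "x \<notin> C" for x
    proof -
      obtain a where a: "a \<in> K" "infdist x K = dist x a"
        using infdist_attains_inf[OF compact_imp_closed[OF K(1)] False] by metis
      have "\<not> dist x a \<le> e"
      proof
        assume "dist x a \<le> e"
        then have "x = a + (x - a)" "x - a \<in> cball 0 e" by (auto simp: dist_norm norm_minus_commute)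
        then have "x \<in> C" unfolding C_def using a(1) by blast
        with that show False by simp
      qed
      then show ?thesis using a e by (simp add: \<zeta>_def field_simps)
    qed
    have \<zeta>c: "continuous_on UNIV \<zeta>" unfolding \<zeta>_def[abs_def] using e by (intro continuous_intros) auto
    have "f measurable_on UNIV" using lebesgue_measurable_imp_measurable_on_real[OF f(1), of UNIV] by simp
    then obtain N g where N: "negligible N" and g: "\<And>n. continuous_on UNIV (g n)" "\<And>x. x \<notin> N \<Longrightarrow> (\<lambda>n. g n x) \<longlonglongrightarrow> f x"
      unfolding measurable_on_def by auto
    define h where "h n x = max (- M) (min M (g n x)) * \<zeta> x" for n x
    have "continuous_on UNIV (h n)" for n unfolding h_def[abs_def] by (intro continuous_intros g \<zeta>c)
    moreover have "\<bar>h n x\<bar> \<le> M" for n x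
    proof -
      have "\<bar>h n x\<bar> = \<bar>max (- M) (min M (g n x))\<bar> * \<zeta> x" unfolding h_def abs_mult using \<zeta>[of x] by simp
      also have "\<dots> \<le> M * 1" by (rule mult_mono) (use \<zeta>[of x] M in auto)
      finally show ?thesis by simp
    qed
    moreover have "h n x = 0" if "x \<notin> C" for n x using \<zeta>C[OF that] by (simp add: h_def)
    moreover have "(\<lambda>n. h n x) \<longlonglongrightarrow> f x" if "x \<notin> N" for x
    proof -
      have "(\<lambda>n. h n x) \<longlonglongrightarrow> f x * \<zeta> x"
        unfolding h_def by (intro tendsto_intros clip_tendsto g that f)
      moreover have "f x * \<zeta> x = f x" using \<zeta>K f(3) by (cases "x \<in> K") auto
      ultimately show ?thesis by simp
    qed
    then have "AE x in lebesgue. (\<lambda>n. h n x) \<longlonglongrightarrow> f x"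
      using N unfolding negligible_iff_null_sets by (intro AE_I'[of N]) auto
    ultimately show ?thesis using that[OF C CV] by blast
  qed
qed

lemma sq_integrable_bounded_support_integrable:
  fixes f :: "'a::euclidean_space \<Rightarrow> 'b::euclidean_space"
  assumes "sq_integrable lebesgue f" "\<And>x. R < norm x \<Longrightarrow> f x = 0"
  shows "integrable lebesgue f"
proof -
  have "sq_integrable (lebesgue_on (cball 0 R)) f"
    using sq_integrable_on_subset[of "cball 0 R" UNIV f] assms(1) by (simp add: lebesgue_on_UNIV_eq)
  then have "integrable (lebesgue_on (cball 0 R)) f"
    by (rule sq_integrable_finite_integrable[OF finite_measure_on_compact[OF compact_cball]])
  then have "integrable lebesgue (\<lambda>x. if x \<in> cball 0 R then f x else 0)"
    by (subst Lebesgue_Measure.integrable_restrict_UNIV) auto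
  moreover have "(\<lambda>x. if x \<in> cball 0 R then f x else 0) = f" using assms(2) by auto
  ultimately show ?thesis by simp
qed

text \<open>First \<open>f\<close> is truncated to bounded values, then the truncation is
  approximated by continuous functions. Each step costs \<open>e / 4\<close>, and the inequality for
  the square of a sum doubles both.\<close>

lemma L2_density:
  fixes f :: "'a::euclidean_space \<Rightarrow> real"
  assumes f: "sq_integrable lebesgue f" "\<And>x. R < norm x \<Longrightarrow> f x = 0" and "e > 0"
  obtains g where "continuous_on UNIV g" "\<And>x. R + 1 < norm x \<Longrightarrow> g x = 0" "(LINT x|lebesgue. (f x - g x)\<^sup>2) < e"
proof -
  define F where "F M x = max (- real M) (min (real M) (f x))" for M :: nat and x
  have mf [measurable]: "f \<in> borel_measurable lebesgue" using f by (simp add: sq_integrable_def)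
  have [measurable]: "F M \<in> borel_measurable lebesgue" for M unfolding F_def[abs_def] by measurable
  have F0: "F M x = 0" if "R < norm x" for M x using f(2)[OF that] by (simp add: F_def)
  have "L2_conv lebesgue F f"
  proof (rule L2_conv_dominated[where w="\<lambda>x. (f x)\<^sup>2"])
    show "AE x in lebesgue. (\<lambda>n. F n x) \<longlonglongrightarrow> f x"
    proof (rule AE_I2)
      fix x
      obtain N :: nat where N: "\<bar>f x\<bar> \<le> real N" using real_arch_simple by blast
      have "F n x = f x" if "n \<ge> N" for n
      proof -
        have "\<bar>f x\<bar> \<le> real n" using N that by linarith
        then show ?thesis by (auto simp: F_def)
      qed
      then show "(\<lambda>n. F n x) \<longlonglongrightarrow> f x" by (intro tendsto_eventually eventually_sequentiallyI[of N])
    qed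
    have "\<bar>F n x\<bar> \<le> \<bar>f x\<bar>" for n x by (auto simp: F_def)
    then show "AE x in lebesgue. (norm (F n x))\<^sup>2 \<le> (f x)\<^sup>2" for n by (simp add: abs_le_square_iff)
  qed (use sq_integrable_integrable[OF f(1)] in auto)
  then have "\<forall>\<^sub>F n in sequentially. (LINT x|lebesgue. (norm (F n x - f x))\<^sup>2) < e / 4"
    using \<open>e > 0\<close> by (intro order_tendstoD(2)[OF L2_conv_tendsto]) auto
  then obtain M where M: "(LINT x|lebesgue. (norm (F M x - f x))\<^sup>2) < e / 4" by (auto simp: eventually_sequentially)
  have FM: "sq_integrable lebesgue (F M)" using \<open>L2_conv lebesgue F f\<close> by (simp add: L2_conv_def)
  obtain g C where C: "compact C" "C \<subseteq> ball 0 (R + 1)"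
    and g: "\<And>n. continuous_on UNIV (g n)" "\<And>n x. \<bar>g n x\<bar> \<le> real M" "\<And>n x. x \<notin> C \<Longrightarrow> g n x = 0"
      "AE x in lebesgue. (\<lambda>n. g n x) \<longlonglongrightarrow> F M x"
  proof (rule bounded_approx_continuous[of "F M" "real M" "cball 0 R" "ball 0 (R + 1)"])
    show "F M x = 0" if "x \<notin> cball 0 R" for x using that by (intro F0) simp
    show "\<bar>F M x\<bar> \<le> real M" for x by (simp add: F_def abs_clip)
  qed auto
  have "L2_conv lebesgue g (F M)"
  proof (rule L2_conv_dominated[where w="\<lambda>x. (real M)\<^sup>2 * indicator C x"])
    show "AE x in lebesgue. (norm (g n x))\<^sup>2 \<le> (real M)\<^sup>2 * indicator C x" for n
    proof (rule AE_I2)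
      fix x
      show "(norm (g n x))\<^sup>2 \<le> (real M)\<^sup>2 * indicator C x"
        using g(2)[of n x] g(3)[of x n] by (cases "x \<in> C") (auto simp: abs_le_square_iff[symmetric])
    qed
    show "integrable lebesgue (\<lambda>x. (real M)\<^sup>2 * indicator C x)"
      using lmeasurable_compact[OF C(1)] by (auto simp: fmeasurable_def)
  qed (use g in \<open>auto intro: cc_measurable\<close>)
  then have "\<forall>\<^sub>F n in sequentially. (LINT x|lebesgue. (norm (g n x - F M x))\<^sup>2) < e / 4"
    using \<open>e > 0\<close> by (intro order_tendstoD(2)[OF L2_conv_tendsto]) auto
  then obtain n where n: "(LINT x|lebesgue. (norm (g n x - F M x))\<^sup>2) < e / 4" by (auto simp: eventually_sequentially)
  have g0: "g n x = 0" if "R + 1 < norm x" for x using C(2) that by (intro g(3)) auto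
  have gs: "sq_integrable lebesgue (g n)" by (rule cc_sq_integrable[OF g(1) g0])
  have "(LINT x|lebesgue. (f x - g n x)\<^sup>2) \<le> (LINT x|lebesgue. 2 * (norm (F M x - f x))\<^sup>2 + 2 * (norm (g n x - F M x))\<^sup>2)"
  proof (rule integral_mono)
    show "integrable lebesgue (\<lambda>x. (f x - g n x)\<^sup>2)" using sq_integrable_integrable[OF sq_integrable_diff[OF f(1) gs]] by simp
    show "integrable lebesgue (\<lambda>x. 2 * (norm (F M x - f x))\<^sup>2 + 2 * (norm (g n x - F M x))\<^sup>2)"
      using sq_integrable_integrable[OF sq_integrable_diff[OF FM f(1)]] sq_integrable_integrable[OF sq_integrable_diff[OF gs FM]] by simp
    show "(f x - g n x)\<^sup>2 \<le> 2 * (norm (F M x - f x))\<^sup>2 + 2 * (norm (g n x - F M x))\<^sup>2" for x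
      using norm_add_sq_le[of "F M x - f x" "g n x - F M x"] by (simp add: power2_commute)
  qed
  also have "\<dots> = 2 * (LINT x|lebesgue. (norm (F M x - f x))\<^sup>2) + 2 * (LINT x|lebesgue. (norm (g n x - F M x))\<^sup>2)"
    using sq_integrable_integrable[OF sq_integrable_diff[OF FM f(1)]] sq_integrable_integrable[OF sq_integrable_diff[OF gs FM]] by simp
  also have "\<dots> < e" using M n by simp
  finally show ?thesis using that[OF g(1) g0] by blast
qed

lemma moll_uniform:
  fixes g :: "'a::euclidean_space \<Rightarrow> real"
  assumes g: "continuous_on UNIV g" "\<And>x. R < norm x \<Longrightarrow> g x = 0" and "e > 0"
  obtains N where "\<And>n x. n \<ge> N \<Longrightarrow> \<bar>moll n g x - g x\<bar> \<le> e"
proof -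
  obtain d where d: "d > 0" "\<And>x y. dist x y < d \<Longrightarrow> norm (g x - g y) \<le> e"
    using cc_uniformly_continuous[OF g \<open>e > 0\<close>] by metis
  obtain N where N: "inverse (real (Suc N)) < d" using reals_Archimedean[OF d(1)] by auto
  have "\<bar>moll n g x - g x\<bar> \<le> e" if "n \<ge> N" for n x
  proof (rule moll_close[OF cc_integrable[OF g]])
    fix y assume y: "norm (x - y) < inverse (real (Suc n))"
    have "inverse (real (Suc n)) \<le> inverse (real (Suc N))" using that by (intro le_imp_inverse_le) auto
    then have "norm (x - y) < d" using N y by linarith
    then have "norm (g y - g x) \<le> e" by (intro d(2)) (simp add: dist_norm norm_minus_commute)
    then show "\<bar>g y - g x\<bar> \<le> e" by simp
  qed
  with that show ?thesis by blast
qed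

lemma moll_support:
  assumes "\<And>x. R < norm x \<Longrightarrow> f x = 0" "f \<in> borel_measurable lebesgue" "R + 1 < norm x"
  shows "moll n f x = 0"
proof (rule moll_const_ball[OF _ assms(2)])
  fix y assume y: "norm (x - y) < inverse (real (Suc n))"
  have "inverse (real (Suc n)) \<le> 1" by (simp add: inverse_le_1_iff)
  moreover have "norm x \<le> norm (x - y) + norm y" using norm_triangle_ineq[of "x - y" y] by simp
  ultimately show "f y = 0" using y assms(3) by (intro assms(1)) linarith
qed

text \<open>Mollification converges uniformly on a continuous \<open>g\<close> close to
  \<open>f\<close>, while the contraction property controls it on \<open>f - g\<close> uniformly in
  \<open>n\<close>.\<close>

lemma moll_L2_conv:
  fixes f :: "'a::euclidean_space \<Rightarrow> real"
  assumes f: "sq_integrable lebesgue f" "\<And>x. R < norm x \<Longrightarrow> f x = 0"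
  shows "L2_conv lebesgue (\<lambda>n. moll n f) f"
proof -
  have fi: "integrable lebesgue f" by (rule sq_integrable_bounded_support_integrable[OF f])
  note ms = moll_contraction(1)[OF f(1) fi]
  have "(\<lambda>n. LINT x|lebesgue. (norm (moll n f x - f x))\<^sup>2) \<longlonglongrightarrow> 0"
  proof (rule LIMSEQ_I)
    fix e :: real assume e: "e > 0"
    obtain g where g: "continuous_on UNIV g" "\<And>x. R + 1 < norm x \<Longrightarrow> g x = 0" "(LINT x|lebesgue. (f x - g x)\<^sup>2) < e / 16"
      by (rule L2_density[OF f, where e="e / 16"]) (use e in auto)
    let ?B = "cball 0 (R + 2) :: 'a set"
    define m where "m = measure lebesgue ?B"
    have m: "m \<ge> 0" by (simp add: m_def)
    \<comment> \<open>Chosen so that the uniform error contributes at most \<open>e / 16\<close>.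
      The three contributions, each multiplied by 4, then stay below
      \<open>12 / 16 * e\<close>.\<close>
    define d where "d = sqrt (e / (16 * (m + 1)))"
    have d: "d > 0" "d\<^sup>2 = e / (16 * (m + 1))" using e m by (auto simp: d_def)
    obtain N where N: "\<And>n x. n \<ge> N \<Longrightarrow> \<bar>moll n g x - g x\<bar> \<le> d" using moll_uniform[OF g(1,2) d(1)] by metis
    have gs: "sq_integrable lebesgue g" by (rule cc_sq_integrable[OF g(1,2)])
    have gi: "integrable lebesgue g" by (rule cc_integrable[OF g(1,2)])
    have s: "sq_integrable lebesgue (\<lambda>x. f x - g x)" "integrable lebesgue (\<lambda>x. f x - g x)"
      using sq_integrable_diff[OF f(1) gs] fi gi by auto
    have "norm ((LINT x|lebesgue. (norm (moll n f x - f x))\<^sup>2) - 0) < e" if "n \<ge> N" for n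
    proof -
      let ?u = "\<lambda>x. (moll n (\<lambda>x. f x - g x) x)\<^sup>2" and ?v = "\<lambda>x. d\<^sup>2 * indicator ?B x" and ?w = "\<lambda>x. (f x - g x)\<^sup>2"
      have iu: "integrable lebesgue ?u" using sq_integrable_integrable[OF moll_contraction(1)[OF s]] by simp
      have iv: "integrable lebesgue ?v" using lmeasurable_cball[of 0 "R + 2"] by (auto simp: fmeasurable_def)
      have iw: "integrable lebesgue ?w" using sq_integrable_integrable[OF s(1)] by simp
      have "(LINT x|lebesgue. (norm (moll n f x - f x))\<^sup>2) \<le> (LINT x|lebesgue. 4 * ?u x + 4 * ?v x + 4 * ?w x)"
      proof (rule integral_mono)
        show "integrable lebesgue (\<lambda>x. (norm (moll n f x - f x))\<^sup>2)" using sq_integrable_integrable[OF sq_integrable_diff[OF ms f(1)]] .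
        show "integrable lebesgue (\<lambda>x. 4 * ?u x + 4 * ?v x + 4 * ?w x)" using iu iv iw by auto
        fix x
        have v: "(moll n g x - g x)\<^sup>2 \<le> ?v x"
        proof (cases "norm x \<le> R + 2")
          case True
          then show ?thesis using N[OF that, of x] d(1) by (simp add: abs_le_square_iff[symmetric])
        next
          case False
          then have "moll n g x = 0" by (intro moll_support[of "R + 1"] g cc_measurable) auto
          with False g(2)[of x] show ?thesis by simp
        qed
        have eq: "moll n f x - f x = (moll n (\<lambda>x. f x - g x) x - (f x - g x)) + (moll n g x - g x)"
          by (simp add: moll_diff[OF fi gi])
        have "(norm (moll n f x - f x))\<^sup>2 \<le> 2 * (norm (moll n (\<lambda>x. f x - g x) x - (f x - g x)))\<^sup>2 + 2 * (norm (moll n g x - g x))\<^sup>2"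
          unfolding eq by (rule norm_add_sq_le)
        moreover have "(norm (moll n (\<lambda>x. f x - g x) x - (f x - g x)))\<^sup>2 \<le> 2 * ?u x + 2 * ?w x"
          using norm_diff_sq_le[of "moll n (\<lambda>x. f x - g x) x" "f x - g x"] by simp
        moreover have "0 \<le> ?v x" by simp
        ultimately show "(norm (moll n f x - f x))\<^sup>2 \<le> 4 * ?u x + 4 * ?v x + 4 * ?w x"
          using v unfolding real_norm_def power2_abs by linarith
      qed
      also have "\<dots> = 4 * (LINT x|lebesgue. ?u x) + 4 * (LINT x|lebesgue. ?v x) + 4 * (LINT x|lebesgue. ?w x)"
        using iu iv iw by simp
      also have "(LINT x|lebesgue. ?v x) = d\<^sup>2 * m" by (simp add: m_def)
      finally have le: "(LINT x|lebesgue. (norm (moll n f x - f x))\<^sup>2) \<le> 4 * (LINT x|lebesgue. ?u x) + 4 * (d\<^sup>2 * m) + 4 * (LINT x|lebesgue. ?w x)" .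
      have "(LINT x|lebesgue. ?u x) \<le> (LINT x|lebesgue. ?w x)" by (rule moll_contraction(2)[OF s])
      moreover have "d\<^sup>2 * m \<le> e / 16"
      proof -
        have "d\<^sup>2 * m = e / 16 * (m / (m + 1))" using d(2) by simp
        also have "\<dots> \<le> e / 16 * 1" using e m by (intro mult_left_mono) auto
        finally show ?thesis by simp
      qed
      ultimately show ?thesis using le g(3) e by (simp add: integral_nonneg_AE)
    qed
    then show "\<exists>no. \<forall>n\<ge>no. norm ((LINT x|lebesgue. (norm (moll n f x - f x))\<^sup>2) - 0) < e" by blast
  qed
  with ms f(1) show ?thesis by (simp add: L2_conv_def)
qed

definition vmoll :: "nat \<Rightarrow> ('a::euclidean_space \<Rightarrow> 'a) \<Rightarrow> 'a \<Rightarrow> 'a" where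
  "vmoll n G x = (\<Sum>b\<in>Basis. moll n (\<lambda>y. G y \<bullet> b) x *\<^sub>R b)"

lemma L2_conv_sum:
  assumes "finite A" "\<And>i. i \<in> A \<Longrightarrow> L2_conv M (F i) (f i)"
  shows "L2_conv M (\<lambda>n x. \<Sum>i\<in>A. F i n x) (\<lambda>x. \<Sum>i\<in>A. f i x)"
  using assms by (induction A rule: finite_induct) (auto intro: L2_conv_add simp: L2_conv_const)

lemma L2_conv_scaleR_vector:
  fixes f :: "'a \<Rightarrow> real" and b :: "'b::euclidean_space"
  assumes "L2_conv M F f" shows "L2_conv M (\<lambda>n x. F n x *\<^sub>R b) (\<lambda>x. f x *\<^sub>R b)"
proof -
  have s: "sq_integrable M (\<lambda>x. g x *\<^sub>R b)" if "sq_integrable M g" for g :: "'a \<Rightarrow> real"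
    using that by (auto simp: sq_integrable_def power_mult_distrib)
  have "(LINT x|M. (norm (F n x *\<^sub>R b - f x *\<^sub>R b))\<^sup>2) = (LINT x|M. (norm (F n x - f x))\<^sup>2) * (norm b)\<^sup>2" for n
    by (simp add: power_mult_distrib flip: scaleR_diff_left)
  moreover have "(\<lambda>n. (LINT x|M. (norm (F n x - f x))\<^sup>2) * (norm b)\<^sup>2) \<longlonglongrightarrow> 0 * (norm b)\<^sup>2"
    by (intro tendsto_intros L2_conv_tendsto assms)
  ultimately show ?thesis using assms s by (simp add: L2_conv_def)
qed

lemma sq_integrable_component:
  fixes G :: "'a \<Rightarrow> 'b::euclidean_space"
  assumes "sq_integrable M G" "b \<in> Basis" shows "sq_integrable M (\<lambda>x. G x \<bullet> b)"
proof (rule sq_integrable_dominated[where w="\<lambda>x. (norm (G x))\<^sup>2"])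
  show "AE x in M. (norm (G x \<bullet> b))\<^sup>2 \<le> (norm (G x))\<^sup>2"
    using Basis_le_norm[OF assms(2)] by (intro AE_I2 power_mono) auto
qed (use assms in \<open>auto simp: sq_integrable_def\<close>)

lemma vmoll_L2_conv:
  fixes G :: "'a::euclidean_space \<Rightarrow> 'a"
  assumes "sq_integrable lebesgue G" "\<And>x. R < norm x \<Longrightarrow> G x = 0"
  shows "L2_conv lebesgue (\<lambda>n. vmoll n G) G"
proof -
  have "L2_conv lebesgue (\<lambda>n x. \<Sum>b\<in>Basis. moll n (\<lambda>y. G y \<bullet> b) x *\<^sub>R b) (\<lambda>x. \<Sum>b\<in>Basis. (G x \<bullet> b) *\<^sub>R b)"
    by (intro L2_conv_sum L2_conv_scaleR_vector moll_L2_conv[where R=R] sq_integrable_component assms(1)) (auto simp: assms(2))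
  then show ?thesis by (simp add: vmoll_def[abs_def] euclidean_representation)
qed

section \<open>Weak gradients\<close>

lemma test_functionE:
  assumes "test_function U \<psi>"
  obtains K where "smooth \<psi>" "compact K" "K \<subseteq> U" "\<And>x. x \<notin> K \<Longrightarrow> \<psi> x = 0" "\<And>x. x \<notin> K \<Longrightarrow> grad \<psi> x = 0"
proof -
  obtain K where K: "smooth \<psi>" "compact K" "K \<subseteq> U" "\<And>x. x \<notin> K \<Longrightarrow> \<psi> x = 0"
    using assms unfolding test_function_def by blast
  have "open (- K)" using K by (simp add: compact_imp_closed open_Compl)
  then have "grad \<psi> x = 0" if "x \<notin> K" for x by (rule grad_zero_open) (use that K in auto)
  with K that show ?thesis by blast
qed

lemma compact_norm_bound:
  assumes "compact K" obtains R where "\<And>x. R < norm x \<Longrightarrow> x \<notin> (K :: 'a::euclidean_space set)"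
  using compact_imp_bounded[OF assms] unfolding bounded_iff by (meson not_le)

lemma test_sq_integrable:
  fixes \<psi> :: "'a::euclidean_space \<Rightarrow> real"
  assumes "test_function U \<psi>" "S \<in> sets lebesgue"
  shows "sq_integrable (lebesgue_on S) \<psi>" "sq_integrable (lebesgue_on S) (grad \<psi>)"
proof -
  obtain K where K: "smooth \<psi>" "compact K" "\<And>x. x \<notin> K \<Longrightarrow> \<psi> x = 0" "\<And>x. x \<notin> K \<Longrightarrow> grad \<psi> x = 0"
    using test_functionE[OF assms(1)] by metis
  obtain R where R: "\<And>x. R < norm x \<Longrightarrow> x \<notin> K" using compact_norm_bound[OF K(2)] by metis
  show "sq_integrable (lebesgue_on S) \<psi>"
    by (rule cc_sq_integrable_on[OF smooth_continuous[OF K(1)] _ assms(2), of R]) (use R K in auto)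
  show "sq_integrable (lebesgue_on S) (grad \<psi>)"
    by (rule cc_sq_integrable_on[OF smooth_grad_continuous[OF K(1)] _ assms(2), of R]) (use R K in auto)
qed

lemma locally_integrable_sq_integrable:
  assumes "U \<in> sets lebesgue" "sq_integrable (lebesgue_on U) f" shows "locally_integrable_on U f"
  unfolding locally_integrable_on_def
proof (intro allI impI)
  fix K assume K: "compact K \<and> K \<subseteq> U"
  then have "sq_integrable (lebesgue_on K) f" using assms compact_in_lebesgue by (intro sq_integrable_on_subset[of K U]) auto
  then show "integrable (lebesgue_on K) f" using K by (intro sq_integrable_finite_integrable finite_measure_on_compact) auto
qed

lemma continuous_compact_integrable:
  fixes f :: "'a::euclidean_space \<Rightarrow> 'b::euclidean_space"
  assumes "compact K" "continuous_on K f" shows "integrable (lebesgue_on K) f"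
proof -
  have i: "integrable lborel (\<lambda>x. indicator K x *\<^sub>R f x)" by (rule borel_integrable_compact[OF assms])
  then have "integrable lebesgue (\<lambda>x. indicator K x *\<^sub>R f x)"
    by (subst integrable_completion) (auto dest: borel_measurable_integrable)
  then show ?thesis using assms(1) compact_in_lebesgue by (subst integrable_restrict_space) auto
qed

lemma borel_measurable_bilinear:
  fixes prod :: "'b::euclidean_space \<Rightarrow> 'c::euclidean_space \<Rightarrow> 'd::euclidean_space"
  assumes "bounded_bilinear prod" "f \<in> borel_measurable M" "g \<in> borel_measurable M"
  shows "(\<lambda>x. prod (f x) (g x)) \<in> borel_measurable M"
proof -
  interpret bounded_bilinear prod by fact
  have "continuous_on UNIV (\<lambda>p. prod (fst p) (snd p))" by (intro continuous_on continuous_intros)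
  then have "(\<lambda>p. prod (fst p) (snd p)) \<in> borel_measurable borel" by (rule borel_measurable_continuous_onI)
  then have "(\<lambda>p. prod (fst p) (snd p)) \<circ> (\<lambda>x. (f x, g x)) \<in> borel_measurable M"
    using assms by (intro measurable_comp[where N=borel]) auto
  then show ?thesis by (simp add: o_def)
qed

lemma locally_integrable_bilinear:
  fixes q :: "'a::euclidean_space \<Rightarrow> 'b::euclidean_space" and f :: "'a \<Rightarrow> 'c::euclidean_space"
    and prod :: "'b \<Rightarrow> 'c \<Rightarrow> 'd::euclidean_space"
  assumes "bounded_bilinear prod" "U \<in> sets lebesgue"
    and q: "continuous_on UNIV q" "\<And>x. x \<notin> K \<Longrightarrow> q x = 0" and K: "compact K" "K \<subseteq> U" and f: "locally_integrable_on U f"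
  shows "integrable (lebesgue_on U) (\<lambda>x. prod (q x) (f x))"
proof -
  interpret bounded_bilinear prod by fact
  obtain R where R: "\<And>x. R < norm x \<Longrightarrow> x \<notin> K" using compact_norm_bound[OF K(1)] by metis
  obtain B where B: "B > 0" "\<And>x. norm (q x) \<le> B" using cc_bounded[OF q(1), of R] R q(2) by metis
  obtain C where C: "C > 0" "\<And>a b. norm (prod a b) \<le> norm a * norm b * C" using pos_bounded by blast
  have fK: "integrable (lebesgue_on K) f" using f K unfolding locally_integrable_on_def by blast
  have "integrable (lebesgue_on K) (\<lambda>x. prod (q x) (f x))"
  proof (rule Bochner_Integration.integrable_bound[where f="\<lambda>x. B * norm (f x) * C"])
    show "(\<lambda>x. prod (q x) (f x)) \<in> borel_measurable (lebesgue_on K)"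
      by (intro borel_measurable_bilinear[OF assms(1)] continuous_measurable_on q(1) borel_measurable_integrable fK)
    have "norm (prod (q x) (f x)) \<le> norm (B * norm (f x) * C)" for x
    proof -
      have "norm (prod (q x) (f x)) \<le> norm (q x) * norm (f x) * C" by (rule C)
      also have "\<dots> \<le> B * norm (f x) * C" using B C(1) by (intro mult_right_mono) auto
      finally show ?thesis by simp
    qed
    then show "AE x in lebesgue_on K. norm (prod (q x) (f x)) \<le> norm (B * norm (f x) * C)" by (intro AE_I2)
  qed (use fK in auto)
  then show ?thesis
    by (subst integrable_on_eq[OF assms(2) compact_in_lebesgue[OF K(1)]]) (use q(2) K(2) in \<open>auto simp: zero_left\<close>)
qed

lemma weak_gradient_integrable:
  assumes "U \<in> sets lebesgue" "weak_gradient U f G" "test_function U \<psi>"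
  shows "integrable (lebesgue_on U) (\<lambda>x. f x *\<^sub>R grad \<psi> x)" "integrable (lebesgue_on U) (\<lambda>x. \<psi> x *\<^sub>R G x)"
proof -
  obtain K where K: "smooth \<psi>" "compact K" "K \<subseteq> U" "\<And>x. x \<notin> K \<Longrightarrow> \<psi> x = 0" "\<And>x. x \<notin> K \<Longrightarrow> grad \<psi> x = 0"
    using test_functionE[OF assms(3)] by metis
  show "integrable (lebesgue_on U) (\<lambda>x. f x *\<^sub>R grad \<psi> x)"
    by (rule locally_integrable_bilinear[OF bounded_bilinear.flip[OF bounded_bilinear_scaleR] assms(1) smooth_grad_continuous[OF K(1)] K(5,2,3)])
       (use assms(2) in \<open>auto simp: weak_gradient_def\<close>)
  show "integrable (lebesgue_on U) (\<lambda>x. \<psi> x *\<^sub>R G x)"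
    by (rule locally_integrable_bilinear[OF bounded_bilinear_scaleR assms(1) smooth_continuous[OF K(1)] K(4,2,3)])
       (use assms(2) in \<open>auto simp: weak_gradient_def\<close>)
qed

text \<open>The gradient of \<open>f * \<psi>\<close> has integral 0.\<close>

lemma weak_gradient_C1:
  fixes f :: "'a::euclidean_space \<Rightarrow> real"
  assumes U: "open U" and D: "\<And>x. x \<in> U \<Longrightarrow> GDERIV f x :> g x" and g: "continuous_on U g"
  shows "weak_gradient U f g"
proof -
  have f: "continuous_on U f"
    using D by (meson GDERIV_continuous_at continuous_at_imp_continuous_on)
  have li: "locally_integrable_on U f" "locally_integrable_on U g"
    unfolding locally_integrable_on_def
    using continuous_on_subset[OF f] continuous_on_subset[OF g] by (auto intro!: continuous_compact_integrable)
  have "(LINT x|lebesgue_on U. f x *\<^sub>R grad \<psi> x) = - (LINT x|lebesgue_on U. \<psi> x *\<^sub>R g x)"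
    if \<psi>: "test_function U \<psi>" for \<psi>
  proof -
    obtain K where K: "smooth \<psi>" "compact K" "K \<subseteq> U" "\<And>x. x \<notin> K \<Longrightarrow> \<psi> x = 0" "\<And>x. x \<notin> K \<Longrightarrow> grad \<psi> x = 0"
      using test_functionE[OF \<psi>] by metis
    have i1: "integrable (lebesgue_on U) (\<lambda>x. f x *\<^sub>R grad \<psi> x)"
      by (rule locally_integrable_bilinear[OF bounded_bilinear.flip[OF bounded_bilinear_scaleR] open_in_lebesgue[OF U] smooth_grad_continuous[OF K(1)] K(5,2,3) li(1)])
    have i2: "integrable (lebesgue_on U) (\<lambda>x. \<psi> x *\<^sub>R g x)"
      by (rule locally_integrable_bilinear[OF bounded_bilinear_scaleR open_in_lebesgue[OF U] smooth_continuous[OF K(1)] K(4,2,3) li(2)])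
    have "(LINT x|lebesgue_on U. f x *\<^sub>R grad \<psi> x + \<psi> x *\<^sub>R g x) = 0"
    proof (rule LINT_gradient_eq_0_on(1)[OF U K(2,3)])
      show "GDERIV (\<lambda>x. f x * \<psi> x) x :> f x *\<^sub>R grad \<psi> x + \<psi> x *\<^sub>R g x" if "x \<in> U" for x
        by (rule GDERIV_mult[OF D[OF that] smooth_GDERIV[OF K(1)]])
      show "continuous_on U (\<lambda>x. f x *\<^sub>R grad \<psi> x + \<psi> x *\<^sub>R g x)"
        by (intro continuous_intros f g continuous_on_subset[OF smooth_continuous[OF K(1)]]
            continuous_on_subset[OF smooth_grad_continuous[OF K(1)]]) auto
    qed (use K in auto)
    with i1 i2 show ?thesis by (simp add: add_eq_0_iff)
  qed
  with li show ?thesis by (simp add: weak_gradient_def)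
qed

lemma weak_gradient_diff:
  assumes "U \<in> sets lebesgue" "weak_gradient U f F" "weak_gradient U g G"
  shows "weak_gradient U (\<lambda>x. f x - g x) (\<lambda>x. F x - G x)"
  unfolding weak_gradient_def
proof (intro conjI allI impI)
  show "locally_integrable_on U (\<lambda>x. f x - g x)" "locally_integrable_on U (\<lambda>x. F x - G x)"
    using assms(2,3) unfolding weak_gradient_def locally_integrable_on_def by auto
  fix \<psi> assume \<psi>: "test_function U \<psi>"
  note i = weak_gradient_integrable[OF assms(1,2) \<psi>] weak_gradient_integrable[OF assms(1,3) \<psi>]
  show "(LINT x|lebesgue_on U. (f x - g x) *\<^sub>R grad \<psi> x) = - (LINT x|lebesgue_on U. \<psi> x *\<^sub>R (F x - G x))"
    unfolding scaleR_diff_left scaleR_diff_right using i \<psi> assms(2,3) by (simp add: weak_gradient_def)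
qed

lemma weak_gradient_subset:
  assumes "U \<in> sets lebesgue" "V \<in> sets lebesgue" "V \<subseteq> U" "weak_gradient U f G"
  shows "weak_gradient V f G"
  unfolding weak_gradient_def
proof (intro conjI allI impI)
  show "locally_integrable_on V f" "locally_integrable_on V G"
    using assms(3,4) unfolding weak_gradient_def locally_integrable_on_def by auto
  fix \<psi> assume "test_function V \<psi>"
  then obtain K where K: "smooth \<psi>" "compact K" "K \<subseteq> V" "\<And>x. x \<notin> K \<Longrightarrow> \<psi> x = 0" "\<And>x. x \<notin> K \<Longrightarrow> grad \<psi> x = 0"
    using test_functionE by metis
  then have "test_function U \<psi>" using assms(3) unfolding test_function_def by blast
  then have "(LINT x|lebesgue_on U. f x *\<^sub>R grad \<psi> x) = - (LINT x|lebesgue_on U. \<psi> x *\<^sub>R G x)"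
    using assms(4) by (simp add: weak_gradient_def)
  moreover have "(LINT x|lebesgue_on U. f x *\<^sub>R grad \<psi> x) = (LINT x|lebesgue_on V. f x *\<^sub>R grad \<psi> x)"
    by (rule LINT_on_eq) (use assms K in auto)
  moreover have "(LINT x|lebesgue_on U. \<psi> x *\<^sub>R G x) = (LINT x|lebesgue_on V. \<psi> x *\<^sub>R G x)"
    by (rule LINT_on_eq) (use assms K in auto)
  ultimately show "(LINT x|lebesgue_on V. f x *\<^sub>R grad \<psi> x) = - (LINT x|lebesgue_on V. \<psi> x *\<^sub>R G x)" by simp
qed

text \<open>The weak gradient is a closed operator: in its defining identity a test function and its
  gradient are fixed members of \<open>L2\<close>, so both sides pass to the limit.\<close>

lemma L2_conv_weak_gradient:
  assumes U: "U \<in> sets lebesgue" and c: "L2_conv (lebesgue_on U) F f" "L2_conv (lebesgue_on U) G g"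
    and w: "\<And>n. weak_gradient U (F n) (G n)"
  shows "weak_gradient U f g"
  unfolding weak_gradient_def
proof (intro conjI allI impI)
  show "locally_integrable_on U f" "locally_integrable_on U g"
    using c by (auto intro!: locally_integrable_sq_integrable[OF U] simp: L2_conv_def)
  fix \<psi> assume \<psi>: "test_function U \<psi>"
  note s = test_sq_integrable[OF \<psi> U]
  have "(\<lambda>n. LINT x|lebesgue_on U. F n x *\<^sub>R grad \<psi> x) \<longlonglongrightarrow> (LINT x|lebesgue_on U. f x *\<^sub>R grad \<psi> x)"
    by (rule L2_conv_integral_scaleR[OF c(1) L2_conv_const[OF s(2)]])
  moreover have "(\<lambda>n. LINT x|lebesgue_on U. F n x *\<^sub>R grad \<psi> x) = (\<lambda>n. - (LINT x|lebesgue_on U. \<psi> x *\<^sub>R G n x))"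
    using w \<psi> by (auto simp: weak_gradient_def)
  moreover have "(\<lambda>n. - (LINT x|lebesgue_on U. \<psi> x *\<^sub>R G n x)) \<longlonglongrightarrow> - (LINT x|lebesgue_on U. \<psi> x *\<^sub>R g x)"
    by (intro tendsto_minus L2_conv_integral_scaleR[OF L2_conv_const[OF s(1)] c(2)])
  ultimately show "(LINT x|lebesgue_on U. f x *\<^sub>R grad \<psi> x) = - (LINT x|lebesgue_on U. \<psi> x *\<^sub>R g x)"
    using LIMSEQ_unique by metis
qed

section \<open>The fundamental lemma of the calculus of variations\<close>

lemma compact_thicken:
  fixes K :: "'a::euclidean_space set"
  assumes "compact K" "open U" "K \<subseteq> U"
  obtains e C where "e > 0" "compact C" "K \<subseteq> C" "C \<subseteq> U" "\<And>x. x \<in> K \<Longrightarrow> cball x e \<subseteq> C" "\<And>x y. x \<notin> C \<Longrightarrow> y \<in> K \<Longrightarrow> e < dist x y"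
proof -
  obtain e where e: "e > 0" "(\<Union>x\<in>K. cball x e) \<subseteq> U"
    using compact_subset_open_imp_cball_epsilon_subset[OF assms] by metis
  define C where "C = {x + y |x y. x \<in> K \<and> y \<in> cball 0 e}"
  have mem: "z \<in> C" if "x \<in> K" "dist z x \<le> e" for x z
  proof -
    have "z = x + (z - x)" "z - x \<in> cball 0 e" using that by (auto simp: dist_norm norm_minus_commute)
    then show ?thesis unfolding C_def using that(1) by blast
  qed
  have "C \<subseteq> U"
  proof
    fix z assume "z \<in> C"
    then obtain x y where "z = x + y" "x \<in> K" "norm y \<le> e" by (auto simp: C_def)
    then have "z \<in> cball x e" by (simp add: dist_norm)
    then show "z \<in> U" using e \<open>x \<in> K\<close> by blast
  qed
  moreover have "compact C" unfolding C_def by (intro compact_sums assms) auto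
  moreover have "K \<subseteq> C" using mem e by auto
  moreover have "cball x e \<subseteq> C" if "x \<in> K" for x using mem[OF that] by (auto simp: dist_commute)
  moreover have "e < dist x y" if "x \<notin> C" "y \<in> K" for x y using mem[OF that(2), of x] that(1) by linarith
  ultimately show ?thesis using that[OF e(1)] by blast
qed

lemma inverse_Suc_le:
  assumes "e > 0" obtains N where "\<And>n. n \<ge> N \<Longrightarrow> inverse (real (Suc n)) \<le> e"
proof -
  obtain N where N: "inverse (real (Suc N)) < e" using reals_Archimedean[OF assms] by auto
  have "inverse (real (Suc n)) \<le> e" if "n \<ge> N" for n
  proof -
    have "inverse (real (Suc n)) \<le> inverse (real (Suc N))" using that by (intro le_imp_inverse_le) auto
    with N show ?thesis by linarith
  qed
  with that show ?thesis by blast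
qed

text \<open>The sign of \<open>h\<close> on a compact set is approximated by bounded continuous
  functions, and these by mollification with test functions. Two passages to the limit under the
  integral give the integral of \<open>\<bar>h\<bar>\<close> the value 0.\<close>

theorem locally_integrable_null:
  fixes h :: "'a::euclidean_space \<Rightarrow> real"
  assumes U: "open U" and h: "locally_integrable_on U h"
    and test: "\<And>\<psi>. test_function U \<psi> \<Longrightarrow> (LINT x|lebesgue_on U. \<psi> x * h x) = 0"
  shows "AE x in lebesgue_on U. h x = 0"
proof -
  have K: "AE x in lebesgue_on K. h x = 0" if K: "compact K" "K \<subseteq> U" for K
  proof -
    have hK: "integrable (lebesgue_on K) h" using h K unfolding locally_integrable_on_def by blast
    \<comment> \<open>Cutting the sign function off outside \<open>K\<close> makes the final
      integral extend over \<open>K\<close> alone, although the approximants live on a larger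
      set.\<close>
    define s where "s x = (if x \<in> K then sgn (h x) else 0)" for x
    have sm: "s \<in> borel_measurable lebesgue"
      unfolding s_def[abs_def] using borel_measurable_integrable[OF hK] compact_in_lebesgue[OF K(1)]
      by (subst borel_measurable_if) auto
    obtain g C where C: "compact C" "C \<subseteq> U"
      and g: "\<And>n. continuous_on UNIV (g n)" "\<And>n x. \<bar>g n x\<bar> \<le> 1" "\<And>n x. x \<notin> C \<Longrightarrow> g n x = 0"
        "AE x in lebesgue. (\<lambda>n. g n x) \<longlonglongrightarrow> s x"
      by (rule bounded_approx_continuous[OF sm, of 1 K U]) (use K U in \<open>auto simp: s_def sgn_if\<close>)
    obtain e D where D: "e > 0" "compact D" "C \<subseteq> D" "D \<subseteq> U" "\<And>x y. x \<notin> D \<Longrightarrow> y \<in> C \<Longrightarrow> e < dist x y"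
      using compact_thicken[OF C(1) U C(2)] by metis
    obtain N where N: "\<And>n. n \<ge> N \<Longrightarrow> inverse (real (Suc n)) \<le> e" using inverse_Suc_le[OF D(1)] by metis
    \<comment> \<open>One compact set containing \<open>K\<close> and the supports of all
      approximants, on which \<open>h\<close> is integrable and serves as majorant.\<close>
    define E where "E = D \<union> K"
    have E: "compact E" "E \<subseteq> U" using D K by (auto simp: E_def)
    have hE: "integrable (lebesgue_on E) h" using h E unfolding locally_integrable_on_def by blast
    have hEm: "h \<in> borel_measurable (lebesgue_on E)" using hE by auto
    obtain R where R: "\<And>x. R < norm x \<Longrightarrow> x \<notin> C" using compact_norm_bound[OF C(1)] by metis
    have g0: "g n x = 0" if "R < norm x" for n x using R[OF that] g(3) by blast
    have gi: "integrable lebesgue (g n)" for n by (rule cc_integrable[OF g(1) g0])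
    have zero: "(LINT x|lebesgue_on E. g n x * h x) = 0" for n
    proof -
      have mz: "moll (m + N) (g n) x = 0" if "x \<notin> D" for m x
      proof (rule moll_const_ball)
        fix y assume "norm (x - y) < inverse (real (Suc (m + N)))"
        then have "dist x y \<le> e" using N[of "m + N"] by (simp add: dist_norm)
        then have "y \<notin> C" using D(5)[OF that, of y] by auto
        then show "g n y = 0" by (rule g(3))
      qed (rule cc_measurable[OF g(1)])
      have t: "test_function U (moll (m + N) (g n))" for m
        unfolding test_function_def using moll_smooth[OF gi] mz D(2,4) by blast
      have "(LINT x|lebesgue_on E. moll (m + N) (g n) x * h x) = (LINT x|lebesgue_on U. moll (m + N) (g n) x * h x)" for m
        by (rule LINT_on_eq) (use E U mz in \<open>auto simp: E_def intro: open_in_lebesgue compact_in_lebesgue\<close>)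
      then have z: "(LINT x|lebesgue_on E. moll (m + N) (g n) x * h x) = 0" for m using test[OF t] by simp
      have "(\<lambda>m. LINT x|lebesgue_on E. moll (m + N) (g n) x * h x) \<longlonglongrightarrow> (LINT x|lebesgue_on E. g n x * h x)"
      proof (rule integral_dominated_convergence[where w="\<lambda>x. \<bar>h x\<bar>"])
        show "(\<lambda>x. g n x * h x) \<in> borel_measurable (lebesgue_on E)"
          by (intro borel_measurable_times continuous_measurable_on g hEm)
        show "(\<lambda>x. moll (m + N) (g n) x * h x) \<in> borel_measurable (lebesgue_on E)" for m
          by (intro borel_measurable_times continuous_measurable_on smooth_continuous moll_smooth gi hEm)
        show "integrable (lebesgue_on E) (\<lambda>x. \<bar>h x\<bar>)" using hE by auto
        have "(\<lambda>m. moll m (g n) x) \<longlonglongrightarrow> g n x" for x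
        proof (rule LIMSEQ_I)
          fix r :: real assume "r > 0"
          then obtain M where M: "\<And>m x. m \<ge> M \<Longrightarrow> \<bar>moll m (g n) x - g n x\<bar> \<le> r / 2"
            using moll_uniform[OF g(1) g0 half_gt_zero] by metis
          have "norm (moll m (g n) x - g n x) < r" if "m \<ge> M" for m
            using M[OF that, of x] \<open>r > 0\<close> by simp
          then show "\<exists>no. \<forall>m\<ge>no. norm (moll m (g n) x - g n x) < r" by blast
        qed
        then have "(\<lambda>m. moll (m + N) (g n) x) \<longlonglongrightarrow> g n x" for x by (rule LIMSEQ_ignore_initial_segment)
        then show "AE x in lebesgue_on E. (\<lambda>m. moll (m + N) (g n) x * h x) \<longlonglongrightarrow> g n x * h x"
          by (intro AE_I2 tendsto_intros)
        show "AE x in lebesgue_on E. norm (moll (m + N) (g n) x * h x) \<le> \<bar>h x\<bar>" for m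
        proof (rule AE_I2)
          fix x
          have "\<bar>moll (m + N) (g n) x - 0\<bar> \<le> 1" by (rule moll_close[OF gi]) (use g(2) in auto)
          then show "norm (moll (m + N) (g n) x * h x) \<le> \<bar>h x\<bar>" by (simp add: abs_mult mult_left_le_one_le)
        qed
      qed
      then show ?thesis unfolding z by (simp add: LIMSEQ_const_iff)
    qed
    have "(\<lambda>n. LINT x|lebesgue_on E. g n x * h x) \<longlonglongrightarrow> (LINT x|lebesgue_on E. s x * h x)"
    proof (rule integral_dominated_convergence[where w="\<lambda>x. \<bar>h x\<bar>"])
      show "(\<lambda>x. s x * h x) \<in> borel_measurable (lebesgue_on E)"
        by (intro borel_measurable_times measurable_restrict_space1 sm hEm)
      show "(\<lambda>x. g n x * h x) \<in> borel_measurable (lebesgue_on E)" for n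
        by (intro borel_measurable_times continuous_measurable_on g hEm)
      show "integrable (lebesgue_on E) (\<lambda>x. \<bar>h x\<bar>)" using hE by auto
      show "AE x in lebesgue_on E. (\<lambda>n. g n x * h x) \<longlonglongrightarrow> s x * h x"
        unfolding AE_on_iff[OF compact_in_lebesgue[OF E(1)]] using g(4)
        by eventually_elim (intro impI tendsto_intros)
      show "AE x in lebesgue_on E. norm (g n x * h x) \<le> \<bar>h x\<bar>" for n
        using g(2) by (intro AE_I2) (simp add: abs_mult mult_left_le_one_le)
    qed
    then have "(LINT x|lebesgue_on E. s x * h x) = 0" using zero by (simp add: LIMSEQ_const_iff)
    moreover have "(LINT x|lebesgue_on E. s x * h x) = (LINT x|lebesgue_on K. s x * h x)"
      by (rule LINT_on_eq) (use E K in \<open>auto simp: E_def s_def intro: compact_in_lebesgue\<close>)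
    moreover have "(LINT x|lebesgue_on K. s x * h x) = (LINT x|lebesgue_on K. \<bar>h x\<bar>)"
      by (rule Bochner_Integration.integral_cong) (auto simp: s_def abs_sgn mult.commute)
    ultimately have "(LINT x|lebesgue_on K. \<bar>h x\<bar>) = 0" by simp
    then have "AE x in lebesgue_on K. \<bar>h x\<bar> = 0"
      using hK by (subst (asm) integral_nonneg_eq_0_iff_AE) auto
    then show ?thesis by simp
  qed
  obtain C where C: "\<And>n::nat. compact (C n)" "\<And>n. C n \<subseteq> U" "\<Union>(range C) = U"
    using open_Union_compact_subsets[OF U] by metis
  show ?thesis
    by (rule AE_on_UN[of U C]) (use U C K in \<open>auto intro: open_in_lebesgue compact_in_lebesgue\<close>)
qed

theorem weak_gradient_unique:
  fixes f :: "'a::euclidean_space \<Rightarrow> real"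
  assumes U: "open U" and w: "weak_gradient U f G" "weak_gradient U f H"
  shows "AE x in lebesgue_on U. G x = H x"
proof -
  note Ul = open_in_lebesgue[OF U]
  have "AE x in lebesgue_on U. (G x - H x) \<bullet> b = 0" if b: "b \<in> Basis" for b
  proof (rule locally_integrable_null[OF U])
    show "locally_integrable_on U (\<lambda>x. (G x - H x) \<bullet> b)"
      using w unfolding weak_gradient_def locally_integrable_on_def by auto
    fix \<psi> assume \<psi>: "test_function U \<psi>"
    note i = weak_gradient_integrable(2)[OF Ul w(1) \<psi>] weak_gradient_integrable(2)[OF Ul w(2) \<psi>]
    have eq: "(LINT x|lebesgue_on U. \<psi> x *\<^sub>R G x) = (LINT x|lebesgue_on U. \<psi> x *\<^sub>R H x)"
      using w \<psi> by (simp add: weak_gradient_def)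
    have "(LINT x|lebesgue_on U. \<psi> x * ((G x - H x) \<bullet> b)) = (LINT x|lebesgue_on U. (\<psi> x *\<^sub>R G x - \<psi> x *\<^sub>R H x) \<bullet> b)"
      by (simp add: inner_diff_left right_diff_distrib)
    also have "\<dots> = (LINT x|lebesgue_on U. \<psi> x *\<^sub>R G x - \<psi> x *\<^sub>R H x) \<bullet> b"
      by (rule integral_inner_left) (use i in auto)
    also have "\<dots> = 0" using i eq by simp
    finally show "(LINT x|lebesgue_on U. \<psi> x * ((G x - H x) \<bullet> b)) = 0" .
  qed
  then have "AE x in lebesgue_on U. \<forall>b\<in>Basis. (G x - H x) \<bullet> b = 0" by (intro AE_finite_allI) auto
  then show ?thesis
  proof eventually_elim
    case (elim x)
    show ?case by (rule euclidean_eqI) (use elim in \<open>simp add: inner_diff_left\<close>)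
  qed
qed

section \<open>Approximation by smooth functions\<close>


text \<open>For fixed \<open>x\<close> the reflected kernel is itself a test function, supported in
  the small ball around \<open>x\<close>. Inserting it into the definition of the weak gradient
  moves the derivative from the kernel to \<open>f\<close>. Cutting \<open>f\<close> off outside
  \<open>K\<close> does no harm because the ball lies in \<open>K\<close>.\<close>

lemma grad_moll:
  fixes f :: "'a::euclidean_space \<Rightarrow> real"
  assumes U: "open U" and w: "weak_gradient U f G" and K: "compact K" "K \<subseteq> U" and x: "cball x (inverse (real (Suc n))) \<subseteq> K"
  shows "grad (moll n (\<lambda>y. if y \<in> K then f y else 0)) x = vmoll n (\<lambda>y. if y \<in> K then G y else 0) x"
proof -
  note Ul = open_in_lebesgue[OF U] and Kl = compact_in_lebesgue[OF K(1)]
  let ?m = "mollifier n :: 'a \<Rightarrow> real" and ?f = "\<lambda>y. if y \<in> K then f y else 0" and ?G = "\<lambda>y. if y \<in> K then G y else 0"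
  define \<psi> where "\<psi> y = ?m (x - y)" for y
  have \<psi>0: "\<psi> y = 0" if "y \<notin> cball x (inverse (real (Suc n)))" for y
    unfolding \<psi>_def using that by (intro mollifier_eq_0) (auto simp: dist_norm)
  have sm: "smooth \<psi>" unfolding \<psi>_def[abs_def] by (rule smooth_reflect[OF smooth_mollifier])
  have \<psi>: "test_function U \<psi>"
    unfolding test_function_def using sm \<psi>0 x K(2) by (intro conjI exI[of _ "cball x (inverse (real (Suc n)))"]) auto
  have g: "grad \<psi> y = - grad ?m (x - y)" for y
    unfolding \<psi>_def[abs_def] by (rule grad_reflect[OF smooth_mollifier])
  have g0: "grad \<psi> y = 0" if "y \<notin> cball x (inverse (real (Suc n)))" for y
    by (rule grad_zero_open[of "- cball x (inverse (real (Suc n)))"]) (use that \<psi>0 in auto)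
  have \<psi>0': "\<psi> y = 0" and g0': "grad \<psi> y = 0" if "y \<notin> K" for y
    using \<psi>0[of y] g0[of y] x that by blast+
  have fi: "integrable lebesgue ?f"
    using w K unfolding weak_gradient_def locally_integrable_on_def
    by (subst Lebesgue_Measure.integrable_restrict_UNIV[OF Kl]) auto
  have "GDERIV (moll n ?f) x :> (\<Sum>b\<in>Basis. conv (\<lambda>z. grad ?m z \<bullet> b) ?f x *\<^sub>R b)"
    by (rule conv_GDERIV[OF smooth_mollifier _ fi, of "inverse (real (Suc n))"]) (auto intro: mollifier_eq_0)
  moreover have "conv (\<lambda>z. grad ?m z \<bullet> b) ?f x = moll n (\<lambda>y. ?G y \<bullet> b) x" if b: "b \<in> Basis" for b
  proof -
    note i = weak_gradient_integrable[OF Ul w \<psi>]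
    have "conv (\<lambda>z. grad ?m z \<bullet> b) ?f x = (LINT y|lebesgue. (if y \<in> K then - ((f y *\<^sub>R grad \<psi> y) \<bullet> b) else 0))"
      unfolding conv_def by (rule Bochner_Integration.integral_cong) (auto simp: g mult.commute)
    also have "\<dots> = (LINT y|lebesgue_on K. - ((f y *\<^sub>R grad \<psi> y) \<bullet> b))"
      by (rule Lebesgue_Measure.integral_restrict_UNIV[OF Kl])
    also have "\<dots> = (LINT y|lebesgue_on U. - ((f y *\<^sub>R grad \<psi> y) \<bullet> b))"
      by (rule LINT_on_eq[OF Kl Ul]) (use K g0' in auto)
    also have "\<dots> = - ((LINT y|lebesgue_on U. f y *\<^sub>R grad \<psi> y) \<bullet> b)"
      using integral_inner_left[OF i(1), of b] by simp
    also have "\<dots> = (LINT y|lebesgue_on U. \<psi> y *\<^sub>R G y) \<bullet> b" using w \<psi> by (simp add: weak_gradient_def)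
    also have "\<dots> = (LINT y|lebesgue_on U. (\<psi> y *\<^sub>R G y) \<bullet> b)"
      using integral_inner_left[OF i(2), of b] by simp
    also have "\<dots> = (LINT y|lebesgue_on K. (\<psi> y *\<^sub>R G y) \<bullet> b)"
      by (rule LINT_on_eq[OF Ul Kl]) (use K \<psi>0' in auto)
    also have "\<dots> = (LINT y|lebesgue. (if y \<in> K then (\<psi> y *\<^sub>R G y) \<bullet> b else 0))"
      by (rule Lebesgue_Measure.integral_restrict_UNIV[OF Kl, symmetric])
    also have "\<dots> = moll n (\<lambda>y. ?G y \<bullet> b) x"
      unfolding conv_def by (rule Bochner_Integration.integral_cong) (auto simp: \<psi>_def)
    finally show ?thesis .
  qed
  ultimately show ?thesis by (simp add: grad_eqI vmoll_def)
qed

lemma sq_integrable_restrict: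
  fixes f :: "'a::euclidean_space \<Rightarrow> 'b::euclidean_space"
  assumes "U \<in> sets lebesgue" "K \<in> sets lebesgue" "K \<subseteq> U" "sq_integrable (lebesgue_on U) f"
  shows "sq_integrable lebesgue (\<lambda>y. if y \<in> K then f y else 0)"
proof -
  have "sq_integrable (lebesgue_on K) f" by (rule sq_integrable_on_subset[OF assms(2,1,3,4)])
  then have "sq_integrable (lebesgue_on K) (\<lambda>y. if y \<in> K then f y else 0)"
    unfolding sq_integrable_def
    by (subst measurable_lebesgue_cong[where g=f], simp, subst Bochner_Integration.integrable_cong[OF refl, where g="\<lambda>x. (norm (f x))\<^sup>2"]) auto
  then have "sq_integrable (lebesgue_on UNIV) (\<lambda>y. if y \<in> K then f y else 0)"
    by (subst sq_integrable_on_eq[of UNIV K]) (use assms in auto)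
  then show ?thesis by (simp add: lebesgue_on_UNIV_eq)
qed

lemma L2_conv_lebesgue_on:
  fixes F :: "nat \<Rightarrow> 'a::euclidean_space \<Rightarrow> 'b::euclidean_space"
  assumes "L2_conv lebesgue F f" "K \<in> sets lebesgue" shows "L2_conv (lebesgue_on K) F f"
  by (rule L2_conv_on_subset[of K UNIV]) (use assms in \<open>auto simp: lebesgue_on_UNIV_eq\<close>)

lemma L2_conv_cong:
  fixes F :: "nat \<Rightarrow> 'a::euclidean_space \<Rightarrow> 'b::euclidean_space"
  assumes "L2_conv (lebesgue_on K) F f" "\<And>n x. x \<in> K \<Longrightarrow> F n x = G n x" "\<And>x. x \<in> K \<Longrightarrow> f x = g x" "K \<in> sets lebesgue"
  shows "L2_conv (lebesgue_on K) G g"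
proof (rule L2_conv_cong_AE[OF assms(1)])
  show "AE x in lebesgue_on K. F n x = G n x" for n using assms(2) by (intro AE_I2) simp
  show "AE x in lebesgue_on K. f x = g x" using assms(3) by (intro AE_I2) simp
  show "G n \<in> borel_measurable (lebesgue_on K)" for n
    using sq_integrable_measurable[OF L2_conv_sq_integrable(1)[OF assms(1), of n]] assms(2) by (subst measurable_lebesgue_cong[where g="F n"]) auto
  show "g \<in> borel_measurable (lebesgue_on K)"
    using sq_integrable_measurable[OF L2_conv_sq_integrable(2)[OF assms(1)]] assms(3) by (subst measurable_lebesgue_cong[where g=f]) auto
qed

text \<open>On \<open>K\<close> sufficiently fine mollifications see only the thickened set
  \<open>C\<close>, where \<open>f\<close> is kept unchanged, so their gradients are the mollified
  weak gradient.\<close>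

lemma local_density:
  fixes f :: "'a::euclidean_space \<Rightarrow> real"
  assumes U: "open U" and f: "sq_integrable (lebesgue_on U) f" "sq_integrable (lebesgue_on U) G" and w: "weak_gradient U f G"
    and K: "compact K" "K \<subseteq> U"
  obtains \<phi> where "\<And>n. smooth (\<phi> n)" "L2_conv (lebesgue_on K) \<phi> f" "L2_conv (lebesgue_on K) (\<lambda>n. grad (\<phi> n)) G"
proof -
  obtain e C where C: "e > 0" "compact C" "K \<subseteq> C" "C \<subseteq> U" "\<And>x. x \<in> K \<Longrightarrow> cball x e \<subseteq> C"
    using compact_thicken[OF K(1) U K(2)] by metis
  obtain N where N: "\<And>n. n \<ge> N \<Longrightarrow> inverse (real (Suc n)) \<le> e" using inverse_Suc_le[OF C(1)] by metis
  obtain R where R: "\<And>x. R < norm x \<Longrightarrow> x \<notin> C" using compact_norm_bound[OF C(2)] by metis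
  let ?f = "\<lambda>y. if y \<in> C then f y else 0" and ?G = "\<lambda>y. if y \<in> C then G y else 0"
  note L = open_in_lebesgue[OF U] compact_in_lebesgue[OF C(2)] compact_in_lebesgue[OF K(1)]
  have s: "sq_integrable lebesgue ?f" "sq_integrable lebesgue ?G" by (rule sq_integrable_restrict[OF L(1,2) C(4) f(1)], rule sq_integrable_restrict[OF L(1,2) C(4) f(2)])
  have z: "?f x = 0" "?G x = 0" if "R < norm x" for x using R[OF that] by auto
  have fi: "integrable lebesgue ?f" by (rule sq_integrable_bounded_support_integrable[OF s(1) z(1)])
  have sh: "strict_mono (\<lambda>n. n + N)" by (auto intro: strict_monoI)
  have c: "L2_conv lebesgue (\<lambda>n. moll (n + N) ?f) ?f" "L2_conv lebesgue (\<lambda>n. vmoll (n + N) ?G) ?G"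
    using L2_conv_subseq[OF moll_L2_conv[OF s(1) z(1)] sh] L2_conv_subseq[OF vmoll_L2_conv[OF s(2) z(2)] sh] by simp_all
  show ?thesis
  proof (rule that[of "\<lambda>n. moll (n + N) ?f"])
    show "smooth (moll (n + N) ?f)" for n by (rule moll_smooth[OF fi])
    show "L2_conv (lebesgue_on K) (\<lambda>n. moll (n + N) ?f) f"
      by (rule L2_conv_cong[OF L2_conv_lebesgue_on[OF c(1) L(3)] _ _ L(3)]) (use C in auto)
    show "L2_conv (lebesgue_on K) (\<lambda>n. grad (moll (n + N) ?f)) G"
    proof (rule L2_conv_cong[OF L2_conv_lebesgue_on[OF c(2) L(3)] _ _ L(3)])
      fix n x assume x: "x \<in> K"
      have "cball x (inverse (real (Suc (n + N)))) \<subseteq> cball x e" using N[of "n + N"] by (intro subset_cball) simp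
      then show "vmoll (n + N) ?G x = grad (moll (n + N) ?f) x"
        using C(5)[OF x] by (intro grad_moll[OF U w C(2,4), symmetric]) auto
    qed (use C in auto)
  qed
qed

lemma sq_integrable_cong_AE:
  fixes f g :: "'a::euclidean_space \<Rightarrow> 'b::euclidean_space"
  assumes "S \<in> sets lebesgue" "sq_integrable (lebesgue_on S) f" "AE x in lebesgue_on S. f x = g x"
  shows "sq_integrable (lebesgue_on S) g"
proof (rule sq_integrable_dominated[where w="\<lambda>x. (norm (f x))\<^sup>2"])
  show "g \<in> borel_measurable (lebesgue_on S)"
    by (rule borel_measurable_on_cong_AE[OF assms(1) sq_integrable_measurable[OF assms(2)] assms(3)])
  show "AE x in lebesgue_on S. (norm (g x))\<^sup>2 \<le> (norm (f x))\<^sup>2" using assms(3) by eventually_elim simp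
qed (rule sq_integrable_integrable[OF assms(2)])

lemma L2_conv_limit_AE:
  fixes f :: "'a::euclidean_space \<Rightarrow> 'b::euclidean_space"
  assumes "S \<in> sets lebesgue" "L2_conv (lebesgue_on S) F f" "AE x in lebesgue_on S. f x = g x"
  shows "L2_conv (lebesgue_on S) F g"
  using sq_integrable_cong_AE[OF assms(1) L2_conv_sq_integrable(2)[OF assms(2)] assms(3)] assms(2)
  by (intro L2_conv_cong_AE[OF assms(2) _ assms(3)]) (auto simp: L2_conv_def sq_integrable_def)

text \<open>\<open>v\<close> lies in \<open>H10 U\<close> with weak gradient \<open>g\<close>; carrying \<open>g\<close> along avoids the choice in \<open>wgrad\<close>.\<close>

definition H10_pair :: "'a::euclidean_space set \<Rightarrow> ('a \<Rightarrow> real) \<Rightarrow> ('a \<Rightarrow> 'a) \<Rightarrow> bool" where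
  "H10_pair U v g \<longleftrightarrow> (\<exists>\<psi>. (\<forall>n. test_function U (\<psi> n)) \<and> L2_conv (lebesgue_on U) \<psi> v \<and>
     L2_conv (lebesgue_on U) (\<lambda>n. grad (\<psi> n)) g)"

text \<open>Fine mollifications of a function with compact support in \<open>U\<close> are test
  functions on \<open>U\<close>, which supplies the approximating sequence directly.\<close>

theorem compact_support_imp_H10_pair:
  fixes f :: "'a::euclidean_space \<Rightarrow> real"
  assumes U: "open U" and f: "sq_integrable (lebesgue_on U) f" "sq_integrable (lebesgue_on U) G" and w: "weak_gradient U f G"
    and K: "compact K" "K \<subseteq> U" and supp: "AE x in lebesgue_on U. x \<notin> K \<longrightarrow> f x = 0 \<and> G x = 0"
  shows "H10_pair U f G"
proof -
  \<comment> \<open>Two thickenings: \<open>C1\<close> contains the supports of the mollifications,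
    and on the larger \<open>C\<close> the function is left uncut, so that \<open>grad_moll\<close>
    applies at every point of \<open>C1\<close>.\<close>
  obtain e1 C1 where C1: "e1 > 0" "compact C1" "K \<subseteq> C1" "C1 \<subseteq> U" "\<And>x y. x \<notin> C1 \<Longrightarrow> y \<in> K \<Longrightarrow> e1 < dist x y"
    using compact_thicken[OF K(1) U K(2)] by metis
  obtain e2 C where C: "e2 > 0" "compact C" "C1 \<subseteq> C" "C \<subseteq> U" "\<And>x. x \<in> C1 \<Longrightarrow> cball x e2 \<subseteq> C"
    using compact_thicken[OF C1(2) U C1(4)] by metis
  obtain N where N: "\<And>n. n \<ge> N \<Longrightarrow> inverse (real (Suc n)) \<le> min e1 e2" using inverse_Suc_le[of "min e1 e2"] C1 C by auto
  obtain R where R: "\<And>x. R < norm x \<Longrightarrow> x \<notin> C" using compact_norm_bound[OF C(2)] by metis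
  let ?f = "\<lambda>y. if y \<in> C then f y else 0" and ?G = "\<lambda>y. if y \<in> C then G y else 0"
  note L = open_in_lebesgue[OF U] compact_in_lebesgue[OF C(2)]
  have s: "sq_integrable lebesgue ?f" "sq_integrable lebesgue ?G" by (rule sq_integrable_restrict[OF L(1,2) C(4) f(1)], rule sq_integrable_restrict[OF L(1,2) C(4) f(2)])
  have z: "?f x = 0" "?G x = 0" if "R < norm x" for x using R[OF that] by auto
  have fi: "integrable lebesgue ?f" by (rule sq_integrable_bounded_support_integrable[OF s(1) z(1)])
  have sh: "strict_mono (\<lambda>n. n + N)" by (auto intro: strict_monoI)
  have c: "L2_conv lebesgue (\<lambda>n. moll (n + N) ?f) ?f" "L2_conv lebesgue (\<lambda>n. vmoll (n + N) ?G) ?G"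
    using L2_conv_subseq[OF moll_L2_conv[OF s(1) z(1)] sh] L2_conv_subseq[OF vmoll_L2_conv[OF s(2) z(2)] sh] by simp_all
  have supp': "AE x in lebesgue. x \<in> U \<longrightarrow> x \<notin> K \<longrightarrow> f x = 0 \<and> G x = 0" using supp by (simp add: AE_on_iff[OF L(1)])
  have far: "AE y in lebesgue. norm (x - y) < inverse (real (Suc (n + N))) \<longrightarrow> ?f y = 0 \<and> ?G y = 0" if "x \<notin> C1" for x n
    using supp'
  proof eventually_elim
    case (elim y)
    show ?case
    proof
      assume "norm (x - y) < inverse (real (Suc (n + N)))"
      then have "y \<notin> K" using C1(5)[OF that, of y] N[of "n + N"] by (auto simp: dist_norm)
      with elim C(4) show "?f y = 0 \<and> ?G y = 0" by auto
    qed
  qed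
  have mz: "moll (n + N) ?f x = 0" if "x \<notin> C1" for x n
  proof -
    have "moll (n + N) ?f x = moll (n + N) (\<lambda>_. 0) x"
      by (rule moll_cong_ball) (use far[OF that, of n] s(1) in \<open>auto simp: sq_integrable_def elim: AE_mp\<close>)
    then show ?thesis by (simp add: conv_def)
  qed
  have vz: "vmoll (n + N) ?G x = 0" if "x \<notin> C1" for x n
  proof -
    have "moll (n + N) (\<lambda>y. ?G y \<bullet> b) x = 0" for b
    proof -
      have m: "?G \<in> borel_measurable lebesgue" using s(2) by (simp add: sq_integrable_def)
      have "moll (n + N) (\<lambda>y. ?G y \<bullet> b) x = moll (n + N) (\<lambda>_. 0) x"
      proof (rule moll_cong_ball)
        show "AE y in lebesgue. norm (x - y) < inverse (real (Suc (n + N))) \<longrightarrow> ?G y \<bullet> b = 0"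
          using far[OF that, of n] by eventually_elim auto
        show "(\<lambda>y. ?G y \<bullet> b) \<in> borel_measurable lebesgue" using m by (intro borel_measurable_inner) auto
      qed simp
      then show ?thesis by (simp add: conv_def)
    qed
    then show ?thesis by (simp add: vmoll_def)
  qed
  have gm: "grad (moll (n + N) ?f) x = vmoll (n + N) ?G x" for n x
  proof (cases "x \<in> C1")
    case True
    have "cball x (inverse (real (Suc (n + N)))) \<subseteq> cball x e2" using N[of "n + N"] by (intro subset_cball) simp
    then show ?thesis using C(5)[OF True] by (intro grad_moll[OF U w C(2,4)]) auto
  next
    case False
    have "open (- C1)" using C1 by (simp add: compact_imp_closed open_Compl)
    then have "grad (moll (n + N) ?f) x = 0" by (rule grad_zero_open) (use False mz in auto)
    with vz[OF False] show ?thesis by simp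
  qed
  have fin: "AE x in lebesgue_on U. ?f x = f x" "AE x in lebesgue_on U. ?G x = G x"
    using supp by (eventually_elim, use C1(3) C(3) in auto)+
  have "L2_conv (lebesgue_on U) (\<lambda>n. moll (n + N) ?f) f"
    by (rule L2_conv_limit_AE[OF L(1) L2_conv_lebesgue_on[OF c(1) L(1)] fin(1)])
  moreover have "(\<lambda>n. grad (moll (n + N) ?f)) = (\<lambda>n. vmoll (n + N) ?G)" by (intro ext gm)
  then have "L2_conv (lebesgue_on U) (\<lambda>n. grad (moll (n + N) ?f)) G"
    using L2_conv_limit_AE[OF L(1) L2_conv_lebesgue_on[OF c(2) L(1)] fin(2)] by simp
  moreover have "test_function U (moll (n + N) ?f)" for n
    unfolding test_function_def using moll_smooth[OF fi] mz C1(2,4) by blast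
  ultimately show ?thesis unfolding H10_pair_def by (intro exI[of _ "\<lambda>n. moll (n + N) ?f"]) simp
qed

text \<open>The classical chain rule for smooth approximants on the support of the test function
  passes to the limit: \<open>flat 0\<close> and \<open>flat 2\<close> are bounded and continuous,
  and an almost everywhere convergent subsequence makes the outer factors converge.\<close>

theorem weak_gradient_flat:
  fixes f :: "'a::euclidean_space \<Rightarrow> real"
  assumes U: "open U" and f: "sq_integrable (lebesgue_on U) f" "sq_integrable (lebesgue_on U) G" and w: "weak_gradient U f G"
  shows "weak_gradient U (\<lambda>x. flat 0 (f x)) (\<lambda>x. flat 2 (f x) *\<^sub>R G x)"
proof -
  note L = open_in_lebesgue[OF U]
  have fm: "(\<lambda>x. flat m (f x)) \<in> borel_measurable (lebesgue_on U)" for m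
    using measurable_compose[OF sq_integrable_measurable[OF f(1)] flat_borel] .
  have g: "sq_integrable (lebesgue_on U) (\<lambda>x. flat 2 (f x) *\<^sub>R G x)"
    by (rule sq_integrable_scaleR_bounded[where B="fact 2"]) (use fm f flat_bound[of 2] flat_nonneg in \<open>auto simp del: fact_2\<close>)
  have li: "locally_integrable_on U (\<lambda>x. flat 0 (f x))"
    unfolding locally_integrable_on_def
  proof (intro allI impI)
    fix K assume K: "compact K \<and> K \<subseteq> U"
    have "sq_integrable (lebesgue_on K) (\<lambda>x. flat 0 (f x))"
    proof (rule sq_integrable_bounded[where B="fact 0"])
      show "(\<lambda>x. flat 0 (f x)) \<in> borel_measurable (lebesgue_on K)" using fm K by (blast intro: measurable_restrict_mono)
    qed (use K flat_bound[of 0] flat_nonneg in \<open>auto intro: finite_measure_on_compact\<close>)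
    then show "integrable (lebesgue_on K) (\<lambda>x. flat 0 (f x))" using K by (intro sq_integrable_finite_integrable finite_measure_on_compact) auto
  qed
  show ?thesis
    unfolding weak_gradient_def
  proof (intro conjI allI impI li locally_integrable_sq_integrable[OF L g])
    fix \<psi> assume "test_function U \<psi>"
    then obtain K where K: "smooth \<psi>" "compact K" "K \<subseteq> U" "\<And>x. x \<notin> K \<Longrightarrow> \<psi> x = 0" "\<And>x. x \<notin> K \<Longrightarrow> grad \<psi> x = 0"
      using test_functionE by metis
    note Kl = compact_in_lebesgue[OF K(2)] and s = test_sq_integrable[OF \<open>test_function U \<psi>\<close> compact_in_lebesgue[OF K(2)]]
    obtain \<phi>' where \<phi>': "\<And>n. smooth (\<phi>' n)" "L2_conv (lebesgue_on K) \<phi>' f" "L2_conv (lebesgue_on K) (\<lambda>n. grad (\<phi>' n)) G"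
      using local_density[OF U f w K(2,3)] by metis
    obtain r where r: "strict_mono (r :: nat \<Rightarrow> nat)" "AE x in lebesgue_on K. (\<lambda>n. \<phi>' (r n) x) \<longlonglongrightarrow> f x"
      using L2_conv_AE_subseq[OF \<phi>'(2)] by metis
    define \<phi> where "\<phi> n = \<phi>' (r n)" for n
    have \<phi>: "\<And>n. smooth (\<phi> n)" "L2_conv (lebesgue_on K) (\<lambda>n. grad (\<phi> n)) G" "AE x in lebesgue_on K. (\<lambda>n. \<phi> n x) \<longlonglongrightarrow> f x"
      using \<phi>'(1) L2_conv_subseq[OF \<phi>'(3) r(1)] r(2) by (auto simp: \<phi>_def)
    have lim: "AE x in lebesgue_on K. (\<lambda>n. flat m (\<phi> n x)) \<longlonglongrightarrow> flat m (f x)" for m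
      using \<phi>(3)
    proof eventually_elim
      case (elim x)
      show ?case
        using continuous_on_tendsto_compose[OF flat_continuous[of UNIV m] elim] by simp
    qed
    have fmK: "(\<lambda>x. flat m (f x)) \<in> borel_measurable (lebesgue_on K)" for m
      using fm K(3) by (blast intro: measurable_restrict_mono)
    have \<phi>m: "(\<lambda>x. flat m (\<phi> n x)) \<in> borel_measurable (lebesgue_on K)" for m n
      by (intro continuous_measurable_on continuous_on_compose2[OF flat_continuous[of UNIV] smooth_continuous[OF \<phi>(1)]]) auto
    have bd: "AE x in lebesgue_on K. \<bar>flat m (g x)\<bar> \<le> fact m" for m and g :: "'a \<Rightarrow> real"
      using flat_bound[of m] flat_nonneg[of m] by (intro AE_I2) simp
    have c0: "L2_conv (lebesgue_on K) (\<lambda>n x. flat 0 (\<phi> n x)) (\<lambda>x. flat 0 (f x))"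
    proof (rule L2_conv_dominated[OF \<phi>m fmK lim])
      show "AE x in lebesgue_on K. (norm (flat 0 (\<phi> n x)))\<^sup>2 \<le> 1" for n
        using flat_bound[of 0] flat_nonneg[of 0] by (intro AE_I2) (simp add: power_le_one)
      show "integrable (lebesgue_on K) (\<lambda>x. 1)" using finite_measure.integrable_const[OF finite_measure_on_compact[OF K(2)]] .
    qed
    have c2: "L2_conv (lebesgue_on K) (\<lambda>n x. flat 2 (\<phi> n x) *\<^sub>R grad (\<phi> n) x) (\<lambda>x. flat 2 (f x) *\<^sub>R G x)"
      by (rule L2_conv_scaleR_AE[OF \<phi>m fmK bd lim \<phi>(2)])
    have eq: "(LINT x|lebesgue_on K. flat 0 (\<phi> n x) *\<^sub>R grad \<psi> x) = - (LINT x|lebesgue_on K. \<psi> x *\<^sub>R (flat 2 (\<phi> n x) *\<^sub>R grad (\<phi> n) x))" for n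
    proof -
      have "weak_gradient U (\<lambda>x. flat 0 (\<phi> n x)) (\<lambda>x. flat 2 (\<phi> n x) *\<^sub>R grad (\<phi> n) x)"
      proof (rule weak_gradient_C1[OF U])
        show "GDERIV (\<lambda>x. flat 0 (\<phi> n x)) x :> flat 2 (\<phi> n x) *\<^sub>R grad (\<phi> n) x" for x
          by (rule GDERIV_DERIV_compose[OF smooth_GDERIV[OF \<phi>(1)] flat0_DERIV])
        have "continuous_on UNIV (\<lambda>x. flat 2 (\<phi> n x) *\<^sub>R grad (\<phi> n) x)"
          by (intro continuous_on_scaleR smooth_grad_continuous \<phi>(1) continuous_on_compose2[OF flat_continuous[of UNIV] smooth_continuous[OF \<phi>(1)]]) auto
        then show "continuous_on U (\<lambda>x. flat 2 (\<phi> n x) *\<^sub>R grad (\<phi> n) x)" by (rule continuous_on_subset) auto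
      qed
      then have "weak_gradient U (\<lambda>x. flat 0 (\<phi> n x)) (\<lambda>x. flat 2 (\<phi> n x) *\<^sub>R grad (\<phi> n) x)" .
      then have "(LINT x|lebesgue_on U. flat 0 (\<phi> n x) *\<^sub>R grad \<psi> x) = - (LINT x|lebesgue_on U. \<psi> x *\<^sub>R (flat 2 (\<phi> n x) *\<^sub>R grad (\<phi> n) x))"
        using \<open>test_function U \<psi>\<close> by (simp add: weak_gradient_def)
      moreover have "(LINT x|lebesgue_on U. flat 0 (\<phi> n x) *\<^sub>R grad \<psi> x) = (LINT x|lebesgue_on K. flat 0 (\<phi> n x) *\<^sub>R grad \<psi> x)"
        by (rule LINT_on_eq[OF L Kl]) (use K in auto)
      moreover have "(LINT x|lebesgue_on U. \<psi> x *\<^sub>R (flat 2 (\<phi> n x) *\<^sub>R grad (\<phi> n) x)) = (LINT x|lebesgue_on K. \<psi> x *\<^sub>R (flat 2 (\<phi> n x) *\<^sub>R grad (\<phi> n) x))"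
        by (rule LINT_on_eq[OF L Kl]) (use K in auto)
      ultimately show ?thesis by simp
    qed
    have "(\<lambda>n. LINT x|lebesgue_on K. flat 0 (\<phi> n x) *\<^sub>R grad \<psi> x) \<longlonglongrightarrow> (LINT x|lebesgue_on K. flat 0 (f x) *\<^sub>R grad \<psi> x)"
      by (rule L2_conv_integral_scaleR[OF c0 L2_conv_const[OF s(2)]])
    moreover have "(\<lambda>n. - (LINT x|lebesgue_on K. \<psi> x *\<^sub>R (flat 2 (\<phi> n x) *\<^sub>R grad (\<phi> n) x)))
        \<longlonglongrightarrow> - (LINT x|lebesgue_on K. \<psi> x *\<^sub>R (flat 2 (f x) *\<^sub>R G x))"
      by (intro tendsto_minus L2_conv_integral_scaleR[OF L2_conv_const[OF s(1)] c2])
    ultimately have "(LINT x|lebesgue_on K. flat 0 (f x) *\<^sub>R grad \<psi> x) = - (LINT x|lebesgue_on K. \<psi> x *\<^sub>R (flat 2 (f x) *\<^sub>R G x))"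
      unfolding eq by (rule LIMSEQ_unique)
    moreover have "(LINT x|lebesgue_on U. flat 0 (f x) *\<^sub>R grad \<psi> x) = (LINT x|lebesgue_on K. flat 0 (f x) *\<^sub>R grad \<psi> x)"
      by (rule LINT_on_eq[OF L Kl]) (use K in auto)
    moreover have "(LINT x|lebesgue_on U. \<psi> x *\<^sub>R (flat 2 (f x) *\<^sub>R G x)) = (LINT x|lebesgue_on K. \<psi> x *\<^sub>R (flat 2 (f x) *\<^sub>R G x))"
      by (rule LINT_on_eq[OF L Kl]) (use K in auto)
    ultimately show "(LINT x|lebesgue_on U. flat 0 (f x) *\<^sub>R grad \<psi> x) = - (LINT x|lebesgue_on U. \<psi> x *\<^sub>R (flat 2 (f x) *\<^sub>R G x))"
      by simp
  qed
qed

section \<open>The space \<open>H10\<close>\<close>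

lemma test_weak_gradient: "open U \<Longrightarrow> test_function U \<psi> \<Longrightarrow> weak_gradient U \<psi> (grad \<psi>)"
  by (rule weak_gradient_C1)
     (auto simp: test_function_def intro: smooth_GDERIV continuous_on_subset[OF smooth_grad_continuous])

lemma test_H10_pair: "open U \<Longrightarrow> test_function U \<psi> \<Longrightarrow> H10_pair U \<psi> (grad \<psi>)"
  unfolding H10_pair_def by (rule exI[of _ "\<lambda>_. \<psi>"]) (auto intro: L2_conv_const test_sq_integrable open_in_lebesgue)

lemma H10_pair_sq_integrable:
  assumes "H10_pair U v g" shows "sq_integrable (lebesgue_on U) v" "sq_integrable (lebesgue_on U) g"
  using assms L2_conv_sq_integrable(2) unfolding H10_pair_def by blast+

lemma H10_pair_weak_gradient:
  assumes "open U" "H10_pair U v g" shows "weak_gradient U v g"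
proof -
  obtain \<psi> where \<psi>: "\<And>n. test_function U (\<psi> n)" "L2_conv (lebesgue_on U) \<psi> v" "L2_conv (lebesgue_on U) (\<lambda>n. grad (\<psi> n)) g"
    using assms(2) unfolding H10_pair_def by blast
  show ?thesis
    by (rule L2_conv_weak_gradient[OF open_in_lebesgue[OF assms(1)] \<psi>(2,3)]) (rule test_weak_gradient[OF assms(1) \<psi>(1)])
qed

lemma wgrad_AE_eq:
  assumes "open U" "weak_gradient U f G" shows "AE x in lebesgue_on U. wgrad U f x = G x"
proof -
  have "weak_gradient U f (wgrad U f)" unfolding wgrad_def by (rule someI[of _ G]) (rule assms(2))
  then show ?thesis using weak_gradient_unique[OF assms(1)] assms(2) by blast
qed

lemma wgrad_weak_gradient: "weak_gradient U f G \<Longrightarrow> weak_gradient U f (wgrad U f)"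
  unfolding wgrad_def by (rule someI[of _ G])

lemma H1_iff:
  assumes "open U"
  shows "f \<in> H1 U \<longleftrightarrow> sq_integrable (lebesgue_on U) f \<and> sq_integrable (lebesgue_on U) (wgrad U f) \<and> weak_gradient U f (wgrad U f)"
proof
  assume "f \<in> H1 U"
  then obtain G where G: "sq_integrable (lebesgue_on U) f" "weak_gradient U f G" "sq_integrable (lebesgue_on U) G" by (auto simp: H1_def L2_on_iff_sq_integrable)
  have "AE x in lebesgue_on U. G x = wgrad U f x" using wgrad_AE_eq[OF assms G(2)] by eventually_elim simp
  with G sq_integrable_cong_AE[OF open_in_lebesgue[OF assms] G(3)] wgrad_weak_gradient[OF G(2)]
  show "sq_integrable (lebesgue_on U) f \<and> sq_integrable (lebesgue_on U) (wgrad U f) \<and> weak_gradient U f (wgrad U f)" by blast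
qed (auto simp: H1_def L2_on_iff_sq_integrable)

lemma H1I: "sq_integrable (lebesgue_on U) f \<Longrightarrow> sq_integrable (lebesgue_on U) G \<Longrightarrow> weak_gradient U f G \<Longrightarrow> f \<in> H1 U"
  by (auto simp: H1_def L2_on_iff_sq_integrable)

lemma H1_converges_iff:
  assumes "open U" "f \<in> H1 U" "\<And>n. sq_integrable (lebesgue_on U) (\<psi> n)" "\<And>n. sq_integrable (lebesgue_on U) (grad (\<psi> n))"
  shows "H1_converges U \<psi> f \<longleftrightarrow> L2_conv (lebesgue_on U) \<psi> f \<and> L2_conv (lebesgue_on U) (\<lambda>n. grad (\<psi> n)) (wgrad U f)"
  using assms(2-4) unfolding H1_iff[OF assms(1)] H1_converges_def L2_conv_def by auto

lemma H10_pair_AE: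
  assumes "U \<in> sets lebesgue" "H10_pair U v g" "AE x in lebesgue_on U. v x = v' x" "AE x in lebesgue_on U. g x = g' x"
  shows "H10_pair U v' g'"
  using assms(2) L2_conv_limit_AE[OF assms(1) _ assms(3)] L2_conv_limit_AE[OF assms(1) _ assms(4)] unfolding H10_pair_def by blast

text \<open>Bridge from \<open>H10\<close>, where the gradient is a choice, to pairs with explicit
  gradient. Square integrability of test functions turns the bare limits in
  \<open>H1_converges\<close> into convergence in \<open>L2\<close>.\<close>

theorem H10_iff:
  assumes U: "open U" shows "v \<in> H10 U \<longleftrightarrow> H10_pair U v (wgrad U v)"
proof
  assume "v \<in> H10 U"
  then obtain \<psi> where v: "v \<in> H1 U" and \<psi>: "\<And>n. test_function U (\<psi> n)" "H1_converges U \<psi> v" by (auto simp: H10_def)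
  have "L2_conv (lebesgue_on U) \<psi> v \<and> L2_conv (lebesgue_on U) (\<lambda>n. grad (\<psi> n)) (wgrad U v)"
    using \<psi>(2) by (subst (asm) H1_converges_iff[OF U v]) (auto intro: test_sq_integrable[OF \<psi>(1) open_in_lebesgue[OF U]])
  with \<psi>(1) show "H10_pair U v (wgrad U v)" unfolding H10_pair_def by blast
next
  assume p: "H10_pair U v (wgrad U v)"
  have v: "v \<in> H1 U" using H1I[OF H10_pair_sq_integrable[OF p] H10_pair_weak_gradient[OF U p]] .
  obtain \<psi> where \<psi>: "\<And>n. test_function U (\<psi> n)" "L2_conv (lebesgue_on U) \<psi> v" "L2_conv (lebesgue_on U) (\<lambda>n. grad (\<psi> n)) (wgrad U v)"
    using p unfolding H10_pair_def by blast
  have "H1_converges U \<psi> v"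
    using \<psi>(2,3) by (subst H1_converges_iff[OF U v]) (auto intro: test_sq_integrable[OF \<psi>(1) open_in_lebesgue[OF U]])
  with v \<psi>(1) show "v \<in> H10 U" by (auto simp: H10_def)
qed

lemma H10_pair_wgrad:
  assumes U: "open U" and p: "H10_pair U v g"
  shows "v \<in> H10 U" "AE x in lebesgue_on U. wgrad U v x = g x"
proof -
  show ae: "AE x in lebesgue_on U. wgrad U v x = g x"
    by (rule wgrad_AE_eq[OF U H10_pair_weak_gradient[OF U p]])
  have "AE x in lebesgue_on U. g x = wgrad U v x" using ae by eventually_elim simp
  then have "H10_pair U v (wgrad U v)" by (intro H10_pair_AE[OF open_in_lebesgue[OF U] p]) auto
  then show "v \<in> H10 U" by (simp add: H10_iff[OF U])
qed

lemma test_function_mono: "U \<subseteq> V \<Longrightarrow> test_function U \<psi> \<Longrightarrow> test_function V \<psi>"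
  unfolding test_function_def by blast

text \<open>Test functions on \<open>U\<close> vanish outside \<open>U\<close> and are test
  functions on \<open>V\<close>, so the same approximating sequence serves the extension by
  zero.\<close>

lemma H10_pair_extend:
  assumes UV: "open U" "open V" "U \<subseteq> V" and p: "H10_pair U v g"
  shows "H10_pair V (\<lambda>x. if x \<in> U then v x else 0) (\<lambda>x. if x \<in> U then g x else 0)"
proof -
  obtain \<psi> where \<psi>: "\<And>n. test_function U (\<psi> n)" "L2_conv (lebesgue_on U) \<psi> v" "L2_conv (lebesgue_on U) (\<lambda>n. grad (\<psi> n)) g"
    using p unfolding H10_pair_def by blast
  note L = open_in_lebesgue[OF UV(1)] open_in_lebesgue[OF UV(2)]
  have z: "\<psi> n x = 0" "grad (\<psi> n) x = 0" if "x \<notin> U" for n x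
  proof -
    obtain K where "K \<subseteq> U" "\<And>x. x \<notin> K \<Longrightarrow> \<psi> n x = 0" "\<And>x. x \<notin> K \<Longrightarrow> grad (\<psi> n) x = 0"
      using test_functionE[OF \<psi>(1)[of n]] by metis
    then show "\<psi> n x = 0" "grad (\<psi> n) x = 0" using that by blast+
  qed
  have "L2_conv (lebesgue_on U) \<psi> (\<lambda>x. if x \<in> U then v x else 0)"
    by (rule L2_conv_cong[OF \<psi>(2) _ _ L(1)]) auto
  then have 1: "L2_conv (lebesgue_on V) \<psi> (\<lambda>x. if x \<in> U then v x else 0)"
    by (subst (asm) L2_conv_on_eq[OF L]) (use UV z in auto)
  have "L2_conv (lebesgue_on U) (\<lambda>n. grad (\<psi> n)) (\<lambda>x. if x \<in> U then g x else 0)"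
    by (rule L2_conv_cong[OF \<psi>(3) _ _ L(1)]) auto
  then have 2: "L2_conv (lebesgue_on V) (\<lambda>n. grad (\<psi> n)) (\<lambda>x. if x \<in> U then g x else 0)"
    by (subst (asm) L2_conv_on_eq[OF L]) (use UV z in auto)
  show ?thesis unfolding H10_pair_def using 1 2 test_function_mono[OF UV(3) \<psi>(1)] by blast
qed

text \<open>A test function on \<open>V\<close> times \<eta> is supported in the intersection of its
  support with \<open>C\<close>, which is compact and lies in \<open>U\<close> by
  \<open>sub\<close>. A bounded part of an unbounded domain is reached in this way while the
  boundary condition on the rays is kept.\<close>

lemma H10_pair_cutoff:
  assumes UV: "open U" "open V" "U \<subseteq> V" and sub: "V \<inter> C \<subseteq> U" and C: "compact C"
    and \<eta>: "smooth \<eta>" "\<And>x. x \<notin> C \<Longrightarrow> \<eta> x = 0" and p: "H10_pair V v g"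
  shows "H10_pair U (\<lambda>x. \<eta> x * v x) (\<lambda>x. \<eta> x *\<^sub>R g x + v x *\<^sub>R grad \<eta> x)"
proof -
  obtain \<psi> where \<psi>: "\<And>n. test_function V (\<psi> n)" "L2_conv (lebesgue_on V) \<psi> v" "L2_conv (lebesgue_on V) (\<lambda>n. grad (\<psi> n)) g"
    using p unfolding H10_pair_def by blast
  note L = open_in_lebesgue[OF UV(1)] open_in_lebesgue[OF UV(2)]
  have cU: "L2_conv (lebesgue_on U) \<psi> v" "L2_conv (lebesgue_on U) (\<lambda>n. grad (\<psi> n)) g"
    by (rule L2_conv_on_subset[OF L UV(3) \<psi>(2)], rule L2_conv_on_subset[OF L UV(3) \<psi>(3)])
  obtain R where R: "\<And>x. R < norm x \<Longrightarrow> x \<notin> C" using compact_norm_bound[OF C] by metis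
  have "open (- C)" using C by (simp add: compact_imp_closed open_Compl)
  then have g0: "grad \<eta> x = 0" if "x \<notin> C" for x by (rule grad_zero_open) (use that \<eta>(2) in auto)
  obtain B where B: "\<And>x. norm (\<eta> x) \<le> B" using cc_bounded[OF smooth_continuous[OF \<eta>(1)], of R] R \<eta>(2) by metis
  obtain B' where B': "\<And>x. norm (grad \<eta> x) \<le> B'" using cc_bounded[OF smooth_grad_continuous[OF \<eta>(1)], of R] R g0 by metis
  have sm: "smooth (\<psi> n)" for n using \<psi>(1) by (simp add: test_function_def)
  have 1: "L2_conv (lebesgue_on U) (\<lambda>n x. \<eta> x *\<^sub>R \<psi> n x) (\<lambda>x. \<eta> x *\<^sub>R v x)"
    by (rule L2_conv_scaleR[OF _ _ cU(1), of _ B]) (use B \<eta>(1) in \<open>auto intro: continuous_measurable_on smooth_continuous\<close>)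
  have 2: "L2_conv (lebesgue_on U) (\<lambda>n x. \<eta> x *\<^sub>R grad (\<psi> n) x) (\<lambda>x. \<eta> x *\<^sub>R g x)"
    by (rule L2_conv_scaleR[OF _ _ cU(2), of _ B]) (use B \<eta>(1) in \<open>auto intro: continuous_measurable_on smooth_continuous\<close>)
  have comp: "L2_conv (lebesgue_on U) (\<lambda>n x. (grad \<eta> x \<bullet> b) *\<^sub>R \<psi> n x) (\<lambda>x. (grad \<eta> x \<bullet> b) *\<^sub>R v x)" if b: "b \<in> Basis" for b
  proof (rule L2_conv_scaleR[OF _ _ cU(1)])
    show "(\<lambda>x. grad \<eta> x \<bullet> b) \<in> borel_measurable (lebesgue_on U)"
      by (intro continuous_measurable_on smooth_continuous smooth_grad_component \<eta>(1) b)
    show "AE x in lebesgue_on U. \<bar>grad \<eta> x \<bullet> b\<bar> \<le> B'"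
      using Basis_le_norm[OF b] B' by (intro AE_I2) (meson order_trans)
  qed
  have "L2_conv (lebesgue_on U) (\<lambda>n x. \<Sum>b\<in>Basis. ((grad \<eta> x \<bullet> b) *\<^sub>R \<psi> n x) *\<^sub>R b) (\<lambda>x. \<Sum>b\<in>Basis. ((grad \<eta> x \<bullet> b) *\<^sub>R v x) *\<^sub>R b)"
    by (intro L2_conv_sum L2_conv_scaleR_vector comp) auto
  moreover have "(\<Sum>b\<in>Basis. ((grad \<eta> x \<bullet> b) *\<^sub>R t) *\<^sub>R b) = t *\<^sub>R grad \<eta> x" for x t
  proof -
    have "(\<Sum>b\<in>Basis. ((grad \<eta> x \<bullet> b) *\<^sub>R t) *\<^sub>R b) = t *\<^sub>R (\<Sum>b\<in>Basis. (grad \<eta> x \<bullet> b) *\<^sub>R b)"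
      by (simp add: scaleR_sum_right mult.commute)
    then show ?thesis by (simp add: euclidean_representation)
  qed
  ultimately have 3: "L2_conv (lebesgue_on U) (\<lambda>n x. \<psi> n x *\<^sub>R grad \<eta> x) (\<lambda>x. v x *\<^sub>R grad \<eta> x)" by simp
  have t: "test_function U (\<lambda>x. \<eta> x * \<psi> n x)" for n
  proof -
    obtain K where K: "compact K" "K \<subseteq> V" "\<And>x. x \<notin> K \<Longrightarrow> \<psi> n x = 0" using \<psi>(1)[of n] unfolding test_function_def by blast
    have "compact (K \<inter> C)" using K C by (intro compact_Int) auto
    moreover have "K \<inter> C \<subseteq> U" using K sub by blast
    ultimately show ?thesis
      unfolding test_function_def using smooth_mult[OF \<eta>(1) sm] K(3) \<eta>(2) by (intro conjI exI[of _ "K \<inter> C"]) auto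
  qed
  have "grad (\<lambda>x. \<eta> x * \<psi> n x) = (\<lambda>x. \<eta> x *\<^sub>R grad (\<psi> n) x + \<psi> n x *\<^sub>R grad \<eta> x)" for n
    by (rule ext) (rule grad_mult[OF \<eta>(1) sm])
  then have "L2_conv (lebesgue_on U) (\<lambda>n. grad (\<lambda>x. \<eta> x * \<psi> n x)) (\<lambda>x. \<eta> x *\<^sub>R g x + v x *\<^sub>R grad \<eta> x)"
    using L2_conv_add[OF 2 3] by simp
  with t 1 show ?thesis unfolding H10_pair_def by (intro exI[of _ "\<lambda>n x. \<eta> x * \<psi> n x"]) simp
qed

lemma H10_pair_diff:
  assumes "H10_pair U v g" "H10_pair U w h"
  shows "H10_pair U (\<lambda>x. v x - w x) (\<lambda>x. g x - h x)"
proof -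
  obtain \<psi> where \<psi>: "\<And>n. test_function U (\<psi> n)" "L2_conv (lebesgue_on U) \<psi> v" "L2_conv (lebesgue_on U) (\<lambda>n. grad (\<psi> n)) g"
    using assms(1) unfolding H10_pair_def by blast
  obtain \<phi> where \<phi>: "\<And>n. test_function U (\<phi> n)" "L2_conv (lebesgue_on U) \<phi> w" "L2_conv (lebesgue_on U) (\<lambda>n. grad (\<phi> n)) h"
    using assms(2) unfolding H10_pair_def by blast
  have "test_function U (\<lambda>x. \<psi> n x - \<phi> n x)" for n
  proof -
    obtain K K' where "compact K" "K \<subseteq> U" "\<And>x. x \<notin> K \<Longrightarrow> \<psi> n x = 0" "compact K'" "K' \<subseteq> U" "\<And>x. x \<notin> K' \<Longrightarrow> \<phi> n x = 0"
      using \<psi>(1)[of n] \<phi>(1)[of n] unfolding test_function_def by metis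
    then show ?thesis
      unfolding test_function_def using smooth_diff \<psi>(1)[of n] \<phi>(1)[of n]
      by (intro conjI exI[of _ "K \<union> K'"]) (auto simp: test_function_def)
  qed
  moreover have "grad (\<lambda>x. \<psi> n x - \<phi> n x) = (\<lambda>x. grad (\<psi> n) x - grad (\<phi> n) x)" for n
    using \<psi>(1)[of n] \<phi>(1)[of n] by (intro ext grad_diff) (auto simp: test_function_def)
  ultimately show ?thesis
    unfolding H10_pair_def using L2_conv_diff[OF \<psi>(2) \<phi>(2)] L2_conv_diff[OF \<psi>(3) \<phi>(3)]
    by (intro exI[of _ "\<lambda>n x. \<psi> n x - \<phi> n x"]) simp
qed

text \<open>The indicator of the ball of radius \<open>R + 1\<close>, mollified at scale 1, which is
  the scale of index 0.\<close>

lemma smooth_cutoff: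
  obtains \<eta> :: "'a::euclidean_space \<Rightarrow> real"
  where "smooth \<eta>" "\<And>x. norm x \<le> R \<Longrightarrow> \<eta> x = 1" "\<And>x. x \<notin> cball 0 (R + 2) \<Longrightarrow> \<eta> x = 0"
proof -
  let ?f = "indicator (cball 0 (R + 1)) :: 'a \<Rightarrow> real"
  have i: "integrable lebesgue ?f" using lmeasurable_cball[of 0 "R + 1"] by (auto simp: fmeasurable_def)
  have m: "?f \<in> borel_measurable lebesgue" using i by (rule borel_measurable_integrable)
  show ?thesis
  proof (rule that[of "moll 0 ?f"])
    show "smooth (moll 0 ?f)" by (rule moll_smooth[OF i])
    show "moll 0 ?f x = 1" if "norm x \<le> R" for x
    proof (rule moll_const_ball[OF _ m])
      fix y assume "norm (x - y) < inverse (real (Suc 0))"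
      moreover have "norm y \<le> norm (x - y) + norm x" using norm_triangle_ineq3[of x "x - y"] norm_triangle_sub[of y x] by (simp add: norm_minus_commute)
      ultimately show "?f y = 1" using that by simp
    qed
    show "moll 0 ?f x = 0" if "x \<notin> cball 0 (R + 2)" for x
      by (rule moll_support[of "R + 1"]) (use that m in auto)
  qed
qed

section \<open>Comparison\<close>

text \<open>The equation of \<open>variational_solution\<close> with the gradients as data: any pair
  may serve for testing, whichever representative of its gradient is given.\<close>

definition weak_solution :: "'a::euclidean_space set \<Rightarrow> ('a \<Rightarrow> real) \<Rightarrow> ('a \<Rightarrow> 'a) \<Rightarrow> bool" where
  "weak_solution U w g \<longleftrightarrow> H10_pair U w g \<and> (\<forall>v \<gamma>. H10_pair U v \<gamma> \<longrightarrow>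
     integrable (lebesgue_on U) (\<lambda>x. exp (- w x) * v x) \<and>
     (LINT x|lebesgue_on U. g x \<bullet> \<gamma> x) = (LINT x|lebesgue_on U. exp (- w x) * v x))"

text \<open>Also covers non-integrable functions, whose integral is 0 by convention.\<close>

lemma LINT_nonpos:
  fixes f :: "'a \<Rightarrow> real"
  assumes "\<And>x. f x \<le> 0" shows "(LINT x|M. f x) \<le> 0"
proof -
  have "0 \<le> (LINT x|M. - f x)" using assms by (intro integral_nonneg_AE AE_I2) simp
  then show ?thesis by simp
qed

lemma LINT_inner_cong_AE:
  assumes "sq_integrable M g" "sq_integrable M \<gamma>" "sq_integrable M \<delta>" "AE x in M. \<gamma> x = \<delta> x"
  shows "(LINT x|M. g x \<bullet> \<gamma> x) = (LINT x|M. g x \<bullet> \<delta> x)"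
proof (rule integral_cong_AE)
  show "AE x in M. g x \<bullet> \<gamma> x = g x \<bullet> \<delta> x" using assms(4) by eventually_elim simp
qed (use sq_integrable_inner_integrable[OF assms(1,2)] sq_integrable_inner_integrable[OF assms(1,3)] in auto)

lemma variational_solution_weak:
  assumes U: "open U" and w: "variational_solution U w" shows "weak_solution U w (wgrad U w)"
  unfolding weak_solution_def
proof (intro conjI allI impI)
  show p: "H10_pair U w (wgrad U w)" using w by (simp add: variational_solution_def H10_iff[OF U])
  fix v \<gamma> assume v: "H10_pair U v \<gamma>"
  note V = H10_pair_wgrad[OF U v]
  show "integrable (lebesgue_on U) (\<lambda>x. exp (- w x) * v x)" using w V by (simp add: variational_solution_def)
  have "(LINT x|lebesgue_on U. wgrad U w x \<bullet> \<gamma> x) = (LINT x|lebesgue_on U. wgrad U w x \<bullet> wgrad U v x)"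
  proof (rule LINT_inner_cong_AE)
    show "AE x in lebesgue_on U. \<gamma> x = wgrad U v x" using V(2) by eventually_elim simp
    show "sq_integrable (lebesgue_on U) (wgrad U v)" using V(1) H10_pair_sq_integrable(2) by (auto simp: H10_iff[OF U])
  qed (rule H10_pair_sq_integrable(2)[OF p], rule H10_pair_sq_integrable(2)[OF v])
  then show "(LINT x|lebesgue_on U. wgrad U w x \<bullet> \<gamma> x) = (LINT x|lebesgue_on U. exp (- w x) * v x)"
    using w V by (simp add: variational_solution_def)
qed

lemma H10_pair_AE_approx:
  assumes "H10_pair U w g"
  shows "\<exists>\<psi>. (\<forall>n. test_function U (\<psi> n)) \<and> L2_conv (lebesgue_on U) \<psi> w \<and>
    L2_conv (lebesgue_on U) (\<lambda>n. grad (\<psi> n)) g \<and> (AE x in lebesgue_on U. (\<lambda>n. \<psi> n x) \<longlonglongrightarrow> w x)"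
proof -
  obtain \<psi> where \<psi>: "\<And>n. test_function U (\<psi> n)" "L2_conv (lebesgue_on U) \<psi> w" "L2_conv (lebesgue_on U) (\<lambda>n. grad (\<psi> n)) g"
    using assms unfolding H10_pair_def by blast
  obtain r where r: "strict_mono (r :: nat \<Rightarrow> nat)" "AE x in lebesgue_on U. (\<lambda>n. \<psi> (r n) x) \<longlonglongrightarrow> w x"
    using L2_conv_AE_subseq[OF \<psi>(2)] by metis
  show ?thesis
    using \<psi>(1) L2_conv_subseq[OF \<psi>(2) r(1)] L2_conv_subseq[OF \<psi>(3) r(1)] r(2)
    by (intro exI[of _ "\<lambda>n. \<psi> (r n)"]) simp
qed

lemma flat_tendsto: "a \<longlonglongrightarrow> l \<Longrightarrow> (\<lambda>n. flat m (a n)) \<longlonglongrightarrow> flat m l"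
  using continuous_on_tendsto_compose[OF flat_continuous[of UNIV m]] by simp

lemma flat_abs_bound: "\<bar>flat m t\<bar> \<le> fact m"
  using flat_bound[of m t] flat_nonneg[of m t] by simp

text \<open>Testing with \<open>flat 0 (- \<psi> n)\<close> gives a gradient side whose limit is
  minus a non-negative integral and a right-hand side that is non-negative. Both limits are
  therefore 0, which forces \<open>flat 0 (- w x) = 0\<close> almost everywhere.\<close>

theorem weak_solution_nonneg:
  assumes U: "open U" and w: "weak_solution U w g"
  shows "AE x in lebesgue_on U. 0 \<le> w x"
proof -
  have p: "H10_pair U w g" using w by (simp add: weak_solution_def)
  obtain \<psi> where \<psi>: "\<And>n. test_function U (\<psi> n)" "L2_conv (lebesgue_on U) \<psi> w"
    "L2_conv (lebesgue_on U) (\<lambda>n. grad (\<psi> n)) g" "AE x in lebesgue_on U. (\<lambda>n. \<psi> n x) \<longlonglongrightarrow> w x"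
    using H10_pair_AE_approx[OF p] by blast
  have sm: "smooth (\<psi> n)" for n using \<psi>(1) by (simp add: test_function_def)
  define v where "v n x = flat 0 (- \<psi> n x)" for n x
  define \<gamma> where "\<gamma> n x = (- flat 2 (- \<psi> n x)) *\<^sub>R grad (\<psi> n) x" for n x
  have t: "test_function U (v n)" for n
  proof -
    obtain K where K: "compact K" "K \<subseteq> U" "\<forall>x. x \<notin> K \<longrightarrow> \<psi> n x = 0"
      using \<psi>(1)[of n] unfolding test_function_def by blast
    have "smooth (v n)" unfolding v_def[abs_def] by (rule smooth_compose[OF smooth_flat smooth_uminus[OF sm]])
    moreover have "\<forall>x. x \<notin> K \<longrightarrow> v n x = 0" using K(3) by (simp add: v_def)
    ultimately show ?thesis unfolding test_function_def using K by blast
  qed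
  have gr: "grad (v n) = \<gamma> n" for n
  proof
    fix x
    have "GDERIV (\<lambda>x. - \<psi> n x) x :> - grad (\<psi> n) x" by (rule GDERIV_minus[OF smooth_GDERIV[OF sm]])
    from GDERIV_DERIV_compose[OF this flat0_DERIV] show "grad (v n) x = \<gamma> n x"
      unfolding v_def[abs_def] \<gamma>_def by (intro grad_eqI) simp
  qed
  have hp: "H10_pair U (v n) (\<gamma> n)" for n using test_H10_pair[OF U t[of n]] by (simp add: gr)
  have iv: "integrable (lebesgue_on U) (\<lambda>x. exp (- w x) * v n x)"
    and eq: "(LINT x|lebesgue_on U. g x \<bullet> \<gamma> n x) = (LINT x|lebesgue_on U. exp (- w x) * v n x)" for n
    using w hp[of n] by (auto simp: weak_solution_def)
  have wm: "w \<in> borel_measurable (lebesgue_on U)" using sq_integrable_measurable[OF H10_pair_sq_integrable(1)[OF p]] .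
  have "L2_conv (lebesgue_on U) \<gamma> (\<lambda>x. (- flat 2 (- w x)) *\<^sub>R g x)"
    unfolding \<gamma>_def[abs_def]
  proof (rule L2_conv_scaleR_AE[OF _ _ _ _ \<psi>(3)])
    show "(\<lambda>x. - flat 2 (- \<psi> n x)) \<in> borel_measurable (lebesgue_on U)" for n
      using continuous_measurable_on[OF smooth_continuous[OF sm[of n]], of U] by measurable
    show "(\<lambda>x. - flat 2 (- w x)) \<in> borel_measurable (lebesgue_on U)" using wm by measurable
    show "AE x in lebesgue_on U. \<bar>- flat 2 (- \<psi> n x)\<bar> \<le> fact 2" for n
      by (intro AE_I2) (simp only: abs_minus_cancel flat_abs_bound)
    show "AE x in lebesgue_on U. (\<lambda>n. - flat 2 (- \<psi> n x)) \<longlonglongrightarrow> - flat 2 (- w x)"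
      using \<psi>(4) by eventually_elim (intro tendsto_intros flat_tendsto)
  qed
  from L2_conv_inner[OF L2_conv_const[OF H10_pair_sq_integrable(2)[OF p]] this]
  have lim: "(\<lambda>n. LINT x|lebesgue_on U. exp (- w x) * v n x) \<longlonglongrightarrow> (LINT x|lebesgue_on U. g x \<bullet> ((- flat 2 (- w x)) *\<^sub>R g x))"
    unfolding eq .
  have nn: "0 \<le> exp (- w x) * v n x" for n x by (simp add: v_def flat_nonneg)
  have "(LINT x|lebesgue_on U. g x \<bullet> ((- flat 2 (- w x)) *\<^sub>R g x)) \<le> 0"
    using flat_nonneg[of 2] by (intro LINT_nonpos) (simp add: mult_nonneg_nonneg)
  moreover have "0 \<le> (LINT x|lebesgue_on U. g x \<bullet> ((- flat 2 (- w x)) *\<^sub>R g x))"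
    by (rule LIMSEQ_le_const[OF lim]) (use nn in \<open>auto intro!: integral_nonneg_AE\<close>)
  ultimately have "(LINT x|lebesgue_on U. g x \<bullet> ((- flat 2 (- w x)) *\<^sub>R g x)) = 0" by (rule antisym)
  \<comment> \<open>The factor \<open>exp (- w x)\<close> has no bound before \<open>w\<close> is
    known to be non-negative, so the limit is identified through convergence in \<open>L1\<close>
    and an almost everywhere convergent subsequence instead of a majorant.\<close>
  then have "(\<lambda>n. LINT x|lebesgue_on U. norm (exp (- w x) * v n x)) \<longlonglongrightarrow> 0"
    using lim by (simp add: v_def flat_nonneg)
  from tendsto_L1_AE_subseq[OF iv this] obtain r where
    r: "strict_mono (r :: nat \<Rightarrow> nat)" "AE x in lebesgue_on U. (\<lambda>n. exp (- w x) * v (r n) x) \<longlonglongrightarrow> 0" by blast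
  from r(2) \<psi>(4) show ?thesis
  proof eventually_elim
    case (elim x)
    have "(\<lambda>n. \<psi> (r n) x) \<longlonglongrightarrow> w x" using LIMSEQ_subseq_LIMSEQ[OF elim(2) r(1)] by (simp add: o_def)
    then have "(\<lambda>n. exp (- w x) * v (r n) x) \<longlonglongrightarrow> exp (- w x) * flat 0 (- w x)"
      unfolding v_def by (intro tendsto_intros flat_tendsto)
    with elim(1) have "exp (- w x) * flat 0 (- w x) = 0" using LIMSEQ_unique by blast
    then show ?case by (simp add: flat_eq_0_iff)
  qed
qed

text \<open>Testing with \<open>flat 0 (\<psi> - \<phi>)\<close>, where \<open>\<psi>\<close> is a test function, needs no boundary condition
  on \<open>\<phi>\<close> because \<open>\<phi>\<close> is non-negative. The monotone zeroth order term alone forces the order.\<close>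

theorem comparison:
  assumes U: "open U" "bounded U" and w: "weak_solution U w g"
    and \<phi>: "\<phi> \<in> borel_measurable (lebesgue_on U)" "AE x in lebesgue_on U. 0 \<le> \<phi> x"
    and hp: "\<And>\<psi>. test_function U \<psi> \<Longrightarrow>
       H10_pair U (\<lambda>x. flat 0 (\<psi> x - \<phi> x)) (\<lambda>x. flat 2 (\<psi> x - \<phi> x) *\<^sub>R (grad \<psi> x - P x))"
    and ip: "\<And>\<psi>. test_function U \<psi> \<Longrightarrow>
       integrable (lebesgue_on U) (\<lambda>x. P x \<bullet> (flat 2 (\<psi> x - \<phi> x) *\<^sub>R (grad \<psi> x - P x)))"
    and super: "\<And>\<psi>. test_function U \<psi> \<Longrightarrow>
       (LINT x|lebesgue_on U. exp (- \<phi> x) * flat 0 (\<psi> x - \<phi> x))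
        \<le> (LINT x|lebesgue_on U. P x \<bullet> (flat 2 (\<psi> x - \<phi> x) *\<^sub>R (grad \<psi> x - P x)))"
  shows "AE x in lebesgue_on U. w x \<le> \<phi> x"
proof -
  let ?M = "lebesgue_on U"
  interpret finite_measure ?M by (rule finite_measure_on_bounded_open[OF U])
  have p: "H10_pair U w g" using w by (simp add: weak_solution_def)
  note sg = H10_pair_sq_integrable(2)[OF p]
  have wm [measurable]: "w \<in> borel_measurable ?M" using sq_integrable_measurable[OF H10_pair_sq_integrable(1)[OF p]] .
  have [measurable]: "\<phi> \<in> borel_measurable ?M" by fact
  have w0: "AE x in ?M. 0 \<le> w x" by (rule weak_solution_nonneg[OF U(1) w])
  obtain \<psi> where \<psi>: "\<And>n. test_function U (\<psi> n)" "L2_conv ?M \<psi> w"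
    "L2_conv ?M (\<lambda>n. grad (\<psi> n)) g" "AE x in ?M. (\<lambda>n. \<psi> n x) \<longlonglongrightarrow> w x"
    using H10_pair_AE_approx[OF p] by blast
  have sm: "smooth (\<psi> n)" for n using \<psi>(1) by (simp add: test_function_def)
  have [measurable]: "\<psi> n \<in> borel_measurable ?M" for n using continuous_measurable_on[OF smooth_continuous[OF sm]] .
  define v where "v n x = flat 0 (\<psi> n x - \<phi> x)" for n x
  define \<gamma> where "\<gamma> n x = flat 2 (\<psi> n x - \<phi> x) *\<^sub>R (grad (\<psi> n) x - P x)" for n x
  have hpn: "H10_pair U (v n) (\<gamma> n)" for n using hp[OF \<psi>(1)] by (simp add: v_def[abs_def] \<gamma>_def[abs_def])
  have [measurable]: "v n \<in> borel_measurable ?M" for n unfolding v_def[abs_def] by measurable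
  have v01: "0 \<le> v n x" "v n x \<le> 1" for n x using flat_nonneg[of 0] flat_bound[of 0] by (auto simp: v_def)
  \<comment> \<open>Non-negativity of both functions places the exponentials in
    \<open>(0, 1]\<close>, so constants are majorants on the bounded set \<open>U\<close>.\<close>
  have eb: "AE x in ?M. \<bar>exp (- w x) - exp (- \<phi> x)\<bar> \<le> 1"
    using w0 \<phi>(2)
  proof eventually_elim
    case (elim x)
    have "0 < exp (- w x)" "exp (- w x) \<le> 1" "0 < exp (- \<phi> x)" "exp (- \<phi> x) \<le> 1" using elim by auto
    then show ?case by linarith
  qed
  have iw: "integrable ?M (\<lambda>x. exp (- w x) * v n x)"
    and eqw: "(LINT x|?M. g x \<bullet> \<gamma> n x) = (LINT x|?M. exp (- w x) * v n x)" for n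
    using w hpn[of n] by (auto simp: weak_solution_def)
  have i\<phi>: "integrable ?M (\<lambda>x. exp (- \<phi> x) * v n x)" for n
  proof (rule integrable_const_bound[where B=1])
    show "AE x in ?M. norm (exp (- \<phi> x) * v n x) \<le> 1"
      using \<phi>(2)
    proof eventually_elim
      case (elim x)
      have "exp (- \<phi> x) * v n x \<le> 1 * 1" using elim v01[of n x] by (intro mult_mono) auto
      then show ?case using v01[of n x] by simp
    qed
  qed measurable
  have ig: "integrable ?M (\<lambda>x. g x \<bullet> \<gamma> n x)" for n by (rule sq_integrable_inner_integrable[OF sg H10_pair_sq_integrable(2)[OF hpn]])
  have iP: "integrable ?M (\<lambda>x. P x \<bullet> \<gamma> n x)" for n using ip[OF \<psi>(1)] by (simp add: \<gamma>_def)
  have ie: "integrable ?M (\<lambda>x. (norm (grad (\<psi> n) x - g x))\<^sup>2)" for n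
    by (rule sq_integrable_integrable[OF sq_integrable_diff[OF L2_conv_sq_integrable[OF \<psi>(3)]]])
  \<comment> \<open>The cost of using \<open>\<psi> n\<close> in place of \<open>w\<close>. With
    \<open>a = grad \<psi> - P\<close> and \<open>e = grad \<psi> - g\<close>, the difference
    \<open>g - P\<close> equals \<open>a - e\<close>, and \<open>(a - e) \<bullet> a\<close> is at
    least minus half the squared norm of \<open>e\<close>. The bound 2 for \<open>flat 2\<close>
    cancels the factor one half.\<close>
  have low: "- (LINT x|?M. (norm (grad (\<psi> n) x - g x))\<^sup>2) \<le> (LINT x|?M. (exp (- w x) - exp (- \<phi> x)) * v n x)" for n
  proof -
    have "- (LINT x|?M. (norm (grad (\<psi> n) x - g x))\<^sup>2) = (LINT x|?M. - (norm (grad (\<psi> n) x - g x))\<^sup>2)" by simp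
    also have "\<dots> \<le> (LINT x|?M. g x \<bullet> \<gamma> n x - P x \<bullet> \<gamma> n x)"
    proof (rule integral_mono)
      fix x
      define a where "a = grad (\<psi> n) x - P x"
      define e where "e = grad (\<psi> n) x - g x"
      define k where "k = flat 2 (\<psi> n x - \<phi> x)"
      have k: "0 \<le> k" "k \<le> 2" using flat_nonneg[of 2] flat_bound[of 2] by (auto simp: k_def)
      have "g x \<bullet> \<gamma> n x - P x \<bullet> \<gamma> n x = k * ((a - e) \<bullet> a)"
        by (simp add: \<gamma>_def a_def e_def k_def inner_diff_left right_diff_distrib)
      moreover have "(a - e) \<bullet> a \<ge> - (norm e)\<^sup>2 / 2"
      proof -
        have "0 \<le> (a - e) \<bullet> (a - e) + a \<bullet> a" by simp
        also have "\<dots> = 2 * ((a - e) \<bullet> a) + e \<bullet> e" by (simp add: inner_diff_left inner_diff_right inner_commute)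
        finally show ?thesis by (simp add: power2_norm_eq_inner)
      qed
      then have "k * ((a - e) \<bullet> a) \<ge> k * (- (norm e)\<^sup>2 / 2)" using k(1) by (rule mult_left_mono)
      moreover have "k * (norm e)\<^sup>2 \<le> 2 * (norm e)\<^sup>2" using k(2) by (intro mult_right_mono) auto
      ultimately show "- (norm (grad (\<psi> n) x - g x))\<^sup>2 \<le> g x \<bullet> \<gamma> n x - P x \<bullet> \<gamma> n x" by (simp add: e_def)
    qed (use ie ig iP in auto)
    also have "\<dots> = (LINT x|?M. g x \<bullet> \<gamma> n x) - (LINT x|?M. P x \<bullet> \<gamma> n x)" using ig iP by simp
    also have "\<dots> \<le> (LINT x|?M. exp (- w x) * v n x) - (LINT x|?M. exp (- \<phi> x) * v n x)"
      using eqw[of n] super[OF \<psi>(1), of n] by (simp add: v_def \<gamma>_def)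
    also have "\<dots> = (LINT x|?M. (exp (- w x) - exp (- \<phi> x)) * v n x)" using iw i\<phi> by (simp add: left_diff_distrib)
    finally show ?thesis .
  qed
  let ?F = "\<lambda>x. (exp (- w x) - exp (- \<phi> x)) * flat 0 (w x - \<phi> x)"
  have bd: "AE x in ?M. norm ((exp (- w x) - exp (- \<phi> x)) * t x) \<le> 1" if "\<And>x. 0 \<le> t x" "\<And>x. t x \<le> 1" for t
    using eb
  proof eventually_elim
    case (elim x)
    have "\<bar>exp (- w x) - exp (- \<phi> x)\<bar> * t x \<le> 1 * 1" using elim that[of x] by (intro mult_mono) auto
    then show ?case using that(1)[of x] by (simp add: abs_mult)
  qed
  have DC: "(\<lambda>n. LINT x|?M. (exp (- w x) - exp (- \<phi> x)) * v n x) \<longlonglongrightarrow> (LINT x|?M. ?F x)"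
  proof (rule integral_dominated_convergence[where w="\<lambda>_. 1"])
    show "AE x in ?M. (\<lambda>n. (exp (- w x) - exp (- \<phi> x)) * v n x) \<longlonglongrightarrow> ?F x"
      using \<psi>(4) unfolding v_def by eventually_elim (intro tendsto_intros flat_tendsto)
    show "AE x in ?M. norm ((exp (- w x) - exp (- \<phi> x)) * v n x) \<le> 1" for n by (rule bd[OF v01])
  qed (simp_all, measurable)
  have "0 \<le> (LINT x|?M. ?F x)"
  proof (rule LIMSEQ_le[OF _ DC])
    show "(\<lambda>n. - (LINT x|?M. (norm (grad (\<psi> n) x - g x))\<^sup>2)) \<longlonglongrightarrow> 0"
      using tendsto_minus[OF L2_conv_tendsto[OF \<psi>(3)]] by simp
  qed (use low in auto)
  moreover have F0: "?F x \<le> 0" for x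
  proof (cases "w x \<le> \<phi> x")
    case False
    then show ?thesis by (intro mult_nonpos_nonneg) (auto simp: flat_nonneg)
  qed simp
  moreover have iF: "integrable ?M ?F"
  proof (rule integrable_const_bound[where B=1])
    show "AE x in ?M. norm (?F x) \<le> 1" by (rule bd) (use flat_nonneg[of 0] flat_bound[of 0] in auto)
  qed measurable
  ultimately have "(LINT x|?M. - ?F x) = 0"
  proof -
    have "(LINT x|?M. ?F x) \<le> 0" by (rule LINT_nonpos[OF F0])
    with \<open>0 \<le> (LINT x|?M. ?F x)\<close> show ?thesis by simp
  qed
  moreover have "integrable ?M (\<lambda>x. - ?F x)" using iF by (rule Bochner_Integration.integrable_minus)
  ultimately have "AE x in ?M. - ?F x = 0"
    using F0 by (subst (asm) integral_nonneg_eq_0_iff_AE) (auto intro!: AE_I2 simp only: neg_0_le_iff_le)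
  then show ?thesis
  proof eventually_elim
    case (elim x)
    then show ?case by (auto simp: flat_eq_0_iff)
  qed
qed

section \<open>Comparison with supersolutions in \<open>H1\<close> and with classical
  supersolutions\<close>

lemma sq_integrable_flat:
  assumes "finite_measure M" "f \<in> borel_measurable M" shows "sq_integrable M (\<lambda>x. flat m (f x))"
proof (rule sq_integrable_bounded[where B="fact m"])
  show "(\<lambda>x. flat m (f x)) \<in> borel_measurable M" using assms(2) by measurable
qed (use assms flat_abs_bound in auto)

text \<open>Applied three times: to solutions on larger truncations, to supersolutions on the whole
  sector, and to the reflection of a solution. The chain rule for \<open>flat\<close> supplies the
  gradient of the test function.\<close>

theorem comparison_H1:
  assumes U: "open U" "bounded U" and w: "weak_solution U w g"
    and \<phi>: "sq_integrable (lebesgue_on U) \<phi>" "sq_integrable (lebesgue_on U) P" "weak_gradient U \<phi> P" "AE x in lebesgue_on U. 0 \<le> \<phi> x"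
    and super: "\<And>v \<gamma>. H10_pair U v \<gamma> \<Longrightarrow> (\<And>x. 0 \<le> v x) \<Longrightarrow> (\<And>x. v x \<le> 1) \<Longrightarrow>
       (LINT x|lebesgue_on U. exp (- \<phi> x) * v x) \<le> (LINT x|lebesgue_on U. P x \<bullet> \<gamma> x)"
  shows "AE x in lebesgue_on U. w x \<le> \<phi> x"
proof -
  note L = open_in_lebesgue[OF U(1)] and fin = finite_measure_on_bounded_open[OF U]
  have hp: "H10_pair U (\<lambda>x. flat 0 (\<psi> x - \<phi> x)) (\<lambda>x. flat 2 (\<psi> x - \<phi> x) *\<^sub>R (grad \<psi> x - P x))"
    if \<psi>: "test_function U \<psi>" for \<psi>
  proof -
    obtain K where K: "smooth \<psi>" "compact K" "K \<subseteq> U" "\<And>x. x \<notin> K \<Longrightarrow> \<psi> x = 0"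
      using test_functionE[OF \<psi>] by metis
    note s = sq_integrable_diff[OF test_sq_integrable(1)[OF \<psi> L] \<phi>(1)] sq_integrable_diff[OF test_sq_integrable(2)[OF \<psi> L] \<phi>(2)]
    have wd: "weak_gradient U (\<lambda>x. \<psi> x - \<phi> x) (\<lambda>x. grad \<psi> x - P x)"
      by (rule weak_gradient_diff[OF L test_weak_gradient[OF U(1) \<psi>] \<phi>(3)])
    show ?thesis
    proof (rule compact_support_imp_H10_pair[OF U(1) _ _ weak_gradient_flat[OF U(1) s wd] K(2,3)])
      show "sq_integrable (lebesgue_on U) (\<lambda>x. flat 0 (\<psi> x - \<phi> x))" by (rule sq_integrable_flat[OF fin sq_integrable_measurable[OF s(1)]])
      show "sq_integrable (lebesgue_on U) (\<lambda>x. flat 2 (\<psi> x - \<phi> x) *\<^sub>R (grad \<psi> x - P x))"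
        by (rule sq_integrable_scaleR_bounded[OF sq_integrable_measurable[OF sq_integrable_flat[OF fin sq_integrable_measurable[OF s(1)]]] _ s(2), of _ "fact 2"])
           (intro AE_I2 flat_abs_bound)
      show "AE x in lebesgue_on U. x \<notin> K \<longrightarrow> flat 0 (\<psi> x - \<phi> x) = 0 \<and> flat 2 (\<psi> x - \<phi> x) *\<^sub>R (grad \<psi> x - P x) = 0"
        using \<phi>(4) by eventually_elim (auto simp: K(4))
    qed
  qed
  show ?thesis
  proof (rule comparison[OF U w sq_integrable_measurable[OF \<phi>(1)] \<phi>(4) hp])
    fix \<psi> assume "test_function U \<psi>"
    note h = hp[OF this]
    show "integrable (lebesgue_on U) (\<lambda>x. P x \<bullet> (flat 2 (\<psi> x - \<phi> x) *\<^sub>R (grad \<psi> x - P x)))"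
      by (rule sq_integrable_inner_integrable[OF \<phi>(2) H10_pair_sq_integrable(2)[OF h]])
    show "(LINT x|lebesgue_on U. exp (- \<phi> x) * flat 0 (\<psi> x - \<phi> x))
        \<le> (LINT x|lebesgue_on U. P x \<bullet> (flat 2 (\<psi> x - \<phi> x) *\<^sub>R (grad \<psi> x - P x)))"
      by (rule super[OF h]) (use flat_nonneg[of 0] flat_bound[of 0] in auto)
  qed
qed

lemma continuous_compact_integrable_on:
  fixes f :: "'a::euclidean_space \<Rightarrow> 'b::euclidean_space"
  assumes "open U" "compact K" "K \<subseteq> U" "continuous_on U f" "\<And>x. x \<in> U - K \<Longrightarrow> f x = 0"
  shows "integrable (lebesgue_on U) f"
  using continuous_compact_integrable[OF assms(2) continuous_on_subset[OF assms(4,3)]] assms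
  by (subst integrable_on_eq[of U K]) (auto intro: open_in_lebesgue compact_in_lebesgue)

lemma continuous_compact_sq_integrable_on:
  fixes f :: "'a::euclidean_space \<Rightarrow> 'b::euclidean_space"
  assumes "open U" "compact K" "K \<subseteq> U" "continuous_on U f" "\<And>x. x \<in> U - K \<Longrightarrow> f x = 0"
  shows "sq_integrable (lebesgue_on U) f"
  unfolding sq_integrable_def
proof
  show "f \<in> borel_measurable (lebesgue_on U)"
    using continuous_compact_integrable_on[OF assms] by (rule borel_measurable_integrable)
  show "integrable (lebesgue_on U) (\<lambda>x. (norm (f x))\<^sup>2)"
    by (rule continuous_compact_integrable_on[OF assms(1-3)]) (use assms in \<open>auto intro: continuous_intros\<close>)
qed

text \<open>Here \<open>P\<close> is the gradient of \<phi> and the sum over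
  \<open>Q b x \<bullet> b\<close> its Laplacian. The integrands are continuous with compact support
  in \<open>U\<close>, so pointwise information on the open set settles every integrability
  question.\<close>

theorem comparison_smooth:
  fixes \<phi> :: "'a::euclidean_space \<Rightarrow> real"
  assumes U: "open U" "bounded U" and w: "weak_solution U w g"
    and \<phi>: "\<And>x. x \<in> U \<Longrightarrow> GDERIV \<phi> x :> P x" "\<And>x. x \<in> U \<Longrightarrow> 0 \<le> \<phi> x"
    and P: "\<And>x b. x \<in> U \<Longrightarrow> b \<in> Basis \<Longrightarrow> GDERIV (\<lambda>x. P x \<bullet> b) x :> Q b x" "\<And>b. b \<in> Basis \<Longrightarrow> continuous_on U (Q b)"
    and super: "\<And>x. x \<in> U \<Longrightarrow> exp (- \<phi> x) \<le> - (\<Sum>b\<in>Basis. Q b x \<bullet> b)"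
  shows "AE x in lebesgue_on U. w x \<le> \<phi> x"
proof -
  note L = open_in_lebesgue[OF U(1)] and fin = finite_measure_on_bounded_open[OF U]
  have c\<phi>: "continuous_on U \<phi>" using \<phi>(1) by (meson GDERIV_continuous_at continuous_at_imp_continuous_on)
  have cPb: "continuous_on U (\<lambda>x. P x \<bullet> b)" if "b \<in> Basis" for b
    using P(1)[OF _ that] by (meson GDERIV_continuous_at continuous_at_imp_continuous_on)
  have cP: "continuous_on U P" by (subst continuous_on_componentwise) (use cPb in auto)
  have m\<phi>: "\<phi> \<in> borel_measurable (lebesgue_on U)"
    by (rule continuous_imp_measurable_on_sets_lebesgue[OF c\<phi> L])
  have ae: "AE x in lebesgue_on U. 0 \<le> \<phi> x" using \<phi>(2) by (intro AE_I2) simp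
  have main: "H10_pair U (\<lambda>x. flat 0 (\<psi> x - \<phi> x)) (\<lambda>x. flat 2 (\<psi> x - \<phi> x) *\<^sub>R (grad \<psi> x - P x)) \<and>
     integrable (lebesgue_on U) (\<lambda>x. P x \<bullet> (flat 2 (\<psi> x - \<phi> x) *\<^sub>R (grad \<psi> x - P x))) \<and>
       (LINT x|lebesgue_on U. exp (- \<phi> x) * flat 0 (\<psi> x - \<phi> x))
        \<le> (LINT x|lebesgue_on U. P x \<bullet> (flat 2 (\<psi> x - \<phi> x) *\<^sub>R (grad \<psi> x - P x)))"
    if \<psi>: "test_function U \<psi>" for \<psi>
  proof -
    obtain K where K: "smooth \<psi>" "compact K" "K \<subseteq> U" "\<And>x. x \<notin> K \<Longrightarrow> \<psi> x = 0"
      using test_functionE[OF \<psi>] by metis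
    define v where "v x = flat 0 (\<psi> x - \<phi> x)" for x
    define \<gamma> where "\<gamma> x = flat 2 (\<psi> x - \<phi> x) *\<^sub>R (grad \<psi> x - P x)" for x
    have v0: "v x = 0" "\<gamma> x = 0" if "x \<in> U - K" for x using that \<phi>(2)[of x] K(4)[of x] by (auto simp: v_def \<gamma>_def)
    have D: "GDERIV v x :> \<gamma> x" if "x \<in> U" for x
      unfolding v_def[abs_def] \<gamma>_def
      by (rule GDERIV_DERIV_compose[OF GDERIV_diff[OF smooth_GDERIV[OF K(1)] \<phi>(1)[OF that]] flat0_DERIV])
    have c\<psi>: "continuous_on U \<psi>" "continuous_on U (grad \<psi>)"
      using K(1) by (auto intro: continuous_on_subset[OF smooth_continuous] continuous_on_subset[OF smooth_grad_continuous])
    have cf: "continuous_on U (\<lambda>x. flat m (\<psi> x - \<phi> x))" for m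
      by (rule continuous_on_compose2[OF flat_continuous[of UNIV m]]) (auto intro!: continuous_intros c\<psi> c\<phi>)
    have cv: "continuous_on U v" unfolding v_def[abs_def] by (rule cf)
    have c\<gamma>: "continuous_on U \<gamma>" unfolding \<gamma>_def[abs_def] by (intro continuous_intros cf c\<psi> cP)
    have sv: "sq_integrable (lebesgue_on U) v" by (rule continuous_compact_sq_integrable_on[OF U(1) K(2,3) cv v0(1)])
    have s\<gamma>: "sq_integrable (lebesgue_on U) \<gamma>" by (rule continuous_compact_sq_integrable_on[OF U(1) K(2,3) c\<gamma> v0(2)])
    have h: "H10_pair U v \<gamma>"
      by (rule compact_support_imp_H10_pair[OF U(1) sv s\<gamma> weak_gradient_C1[OF U(1) D c\<gamma>] K(2,3)])
         (use v0 in \<open>auto intro!: AE_I2\<close>)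
    have iP: "integrable (lebesgue_on U) (\<lambda>x. P x \<bullet> \<gamma> x)"
      by (rule continuous_compact_integrable_on[OF U(1) K(2,3)]) (use v0 in \<open>auto intro!: continuous_intros cP c\<gamma>\<close>)
    define d where "d x = (\<Sum>b\<in>Basis. Q b x \<bullet> b)" for x
    have cd: "continuous_on U d" unfolding d_def[abs_def] by (intro continuous_intros P(2))
    have id: "integrable (lebesgue_on U) (\<lambda>x. v x * d x)"
      by (rule continuous_compact_integrable_on[OF U(1) K(2,3)]) (use v0 in \<open>auto intro!: continuous_intros cd cv\<close>)
    \<comment> \<open>Divergence theorem for the field \<open>v x *\<^sub>R P x\<close>, one
      component at a time: component \<open>b\<close> of the gradient of
      \<open>(P x \<bullet> b) * v x\<close> has integral 0. Summation over the basis gives Green's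
      formula.\<close>
    have ib: "(LINT x|lebesgue_on U. ((P x \<bullet> b) *\<^sub>R \<gamma> x + v x *\<^sub>R Q b x) \<bullet> b) = 0"
      "integrable (lebesgue_on U) (\<lambda>x. ((P x \<bullet> b) *\<^sub>R \<gamma> x + v x *\<^sub>R Q b x) \<bullet> b)" if b: "b \<in> Basis" for b
    proof -
      have Db: "GDERIV (\<lambda>x. (P x \<bullet> b) * v x) x :> (P x \<bullet> b) *\<^sub>R \<gamma> x + v x *\<^sub>R Q b x" if "x \<in> U" for x
        by (rule GDERIV_mult[OF P(1)[OF that b] D[OF that]])
      have cb: "continuous_on U (\<lambda>x. (P x \<bullet> b) *\<^sub>R \<gamma> x + v x *\<^sub>R Q b x)"
        by (intro continuous_intros cPb b c\<gamma> cv P(2))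
      have z: "(P x \<bullet> b) * v x = 0" if "x \<in> U - K" for x using v0[OF that] by simp
      note X = LINT_gradient_eq_0_on[OF U(1) K(2,3) z Db cb]
      show "(LINT x|lebesgue_on U. ((P x \<bullet> b) *\<^sub>R \<gamma> x + v x *\<^sub>R Q b x) \<bullet> b) = 0"
        using integral_inner_left[OF X(2), of b] X(1) by simp
      show "integrable (lebesgue_on U) (\<lambda>x. ((P x \<bullet> b) *\<^sub>R \<gamma> x + v x *\<^sub>R Q b x) \<bullet> b)"
        by (rule integrable_inner_left[OF X(2)])
    qed
    have "(LINT x|lebesgue_on U. P x \<bullet> \<gamma> x + v x * d x) = (LINT x|lebesgue_on U. (\<Sum>b\<in>Basis. ((P x \<bullet> b) *\<^sub>R \<gamma> x + v x *\<^sub>R Q b x) \<bullet> b))"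
      by (rule Bochner_Integration.integral_cong[OF refl])
         (simp add: d_def euclidean_inner[of "P x" "\<gamma> x" for x] inner_add_left sum.distrib sum_distrib_left)
    also have "\<dots> = 0" using ib by (subst Bochner_Integration.integral_sum) auto
    finally have eq: "(LINT x|lebesgue_on U. P x \<bullet> \<gamma> x) = (LINT x|lebesgue_on U. - (v x * d x))"
      using iP id by simp
    have "(LINT x|lebesgue_on U. exp (- \<phi> x) * v x) \<le> (LINT x|lebesgue_on U. - (v x * d x))"
    proof (rule integral_mono)
      show "integrable (lebesgue_on U) (\<lambda>x. exp (- \<phi> x) * v x)"
        by (rule continuous_compact_integrable_on[OF U(1) K(2,3)]) (use v0 in \<open>auto intro!: continuous_intros c\<phi> cv\<close>)
      fix x assume "x \<in> space (lebesgue_on U)"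
      then have "exp (- \<phi> x) * v x \<le> - d x * v x"
        unfolding d_def by (intro mult_right_mono super) (auto simp: v_def flat_nonneg)
      then show "exp (- \<phi> x) * v x \<le> - (v x * d x)" by (simp add: mult.commute)
    qed (use id in auto)
    then show ?thesis using h iP eq by (simp add: v_def[abs_def] \<gamma>_def[abs_def])
  qed
  show ?thesis by (rule comparison[OF U w m\<phi> ae, of P]) (use main in blast)+
qed

section \<open>Reflections\<close>

text \<open>The condition on \<open>s\<close> says that every sign is 1 or -1. The diagonal form is
  the one for which an affine change of variables for Lebesgue measure is available.\<close>

locale coordinate_reflection =
  fixes s :: "'a::euclidean_space \<Rightarrow> real" and S :: "'a \<Rightarrow> 'a"
  assumes sign: "\<And>j. j \<in> Basis \<Longrightarrow> s j * s j = 1"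
    and S_eq: "S = (\<lambda>x. \<Sum>j\<in>Basis. (s j * (x \<bullet> j)) *\<^sub>R j)"
begin

lemma S_inner_Basis: "j \<in> Basis \<Longrightarrow> S x \<bullet> j = s j * (x \<bullet> j)"
  by (simp add: S_eq)

lemma S_S [simp]: "S (S x) = x"
proof (rule euclidean_eqI)
  fix j :: 'a assume j: "j \<in> Basis"
  have "S (S x) \<bullet> j = (s j * s j) * (x \<bullet> j)" using j by (simp add: S_inner_Basis)
  then show "S (S x) \<bullet> j = x \<bullet> j" using sign[OF j] by simp
qed

lemma S_inner: "S x \<bullet> y = x \<bullet> S y"
proof -
  have "S x \<bullet> y = (\<Sum>b\<in>Basis. s b * (x \<bullet> b) * (y \<bullet> b))"
    by (subst euclidean_inner) (rule sum.cong, simp_all add: S_inner_Basis)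
  moreover have "x \<bullet> S y = (\<Sum>b\<in>Basis. s b * (x \<bullet> b) * (y \<bullet> b))"
    by (subst euclidean_inner) (rule sum.cong, simp_all add: S_inner_Basis)
  ultimately show ?thesis by simp
qed

lemma S_norm: "norm (S x) = norm x"
  by (simp add: norm_eq_sqrt_inner S_inner)

lemma S_diff: "S x - S y = S (x - y)"
  by (simp add: S_eq inner_diff_left right_diff_distrib scaleR_diff_left sum_subtractf)

lemma S_continuous: "continuous_on A S"
  unfolding S_eq by (intro continuous_intros)

text \<open>The Jacobian factor is the product of the \<open>\<bar>s j\<bar>\<close>, which equals
  1.\<close>

lemma S_measurable: "S \<in> lebesgue \<rightarrow>\<^sub>M lebesgue"
  and lebesgue_S: "lebesgue = distr lebesgue lebesgue S"
proof -
  have s: "s j \<noteq> 0" "\<bar>s j\<bar> = 1" if "j \<in> Basis" for j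
    using sign[OF that] by (auto simp: abs_square_eq_1 simp flip: power2_eq_square)
  have T: "(\<lambda>x. 0 + (\<Sum>j\<in>Basis. (s j * (x \<bullet> j)) *\<^sub>R j)) = S" by (simp add: S_eq)
  show "S \<in> lebesgue \<rightarrow>\<^sub>M lebesgue" using lebesgue_affine_measurable[of s 0, unfolded T] s by blast
  have "lebesgue = density (distr lebesgue lebesgue S) (\<lambda>_. (\<Prod>j\<in>Basis. \<bar>s j\<bar>))"
    using lebesgue_affine_euclidean[of s 0, unfolded T] s by blast
  then show "lebesgue = distr lebesgue lebesgue S" using s by (simp add: density_1)
qed

lemma LINT_S:
  fixes f :: "'a \<Rightarrow> 'b::euclidean_space"
  assumes U: "U \<in> sets lebesgue" "\<And>x. S x \<in> U \<longleftrightarrow> x \<in> U" and f: "f \<in> borel_measurable (lebesgue_on U)"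
  shows "(LINT x|lebesgue_on U. f (S x)) = (LINT x|lebesgue_on U. f x)"
    and "(\<lambda>x. f (S x)) \<in> borel_measurable (lebesgue_on U)"
    and "integrable (lebesgue_on U) f \<Longrightarrow> integrable (lebesgue_on U) (\<lambda>x. f (S x))"
proof -
  let ?F = "\<lambda>x. if x \<in> U then f x else 0"
  have F: "?F \<in> borel_measurable lebesgue" using f U(1) by (simp add: borel_measurable_if)
  have FS: "(\<lambda>x. ?F (S x)) = (\<lambda>x. if x \<in> U then f (S x) else 0)" by (simp add: U(2))
  have "(LINT x|lebesgue. ?F x) = (LINT x|distr lebesgue lebesgue S. ?F x)" using lebesgue_S by simp
  also have "\<dots> = (LINT x|lebesgue. ?F (S x))" by (rule integral_distr[OF S_measurable F])
  finally show "(LINT x|lebesgue_on U. f (S x)) = (LINT x|lebesgue_on U. f x)"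
    unfolding FS using U(1) by (simp add: Lebesgue_Measure.integral_restrict_UNIV)
  have "(\<lambda>x. ?F (S x)) \<in> borel_measurable lebesgue" using measurable_compose[OF S_measurable F] .
  then show "(\<lambda>x. f (S x)) \<in> borel_measurable (lebesgue_on U)" unfolding FS using U(1) by (simp add: borel_measurable_if)
  assume "integrable (lebesgue_on U) f"
  then have "integrable lebesgue ?F" using U(1) by (simp add: Lebesgue_Measure.integrable_restrict_UNIV)
  then have "integrable (distr lebesgue lebesgue S) ?F" using lebesgue_S by simp
  then have "integrable lebesgue (\<lambda>x. ?F (S x))" by (subst (asm) integrable_distr_eq[OF S_measurable F])
  then show "integrable (lebesgue_on U) (\<lambda>x. f (S x))" unfolding FS using U(1) by (simp add: Lebesgue_Measure.integrable_restrict_UNIV)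
qed

lemma sq_integrable_S:
  fixes f :: "'a \<Rightarrow> 'b::euclidean_space"
  assumes U: "U \<in> sets lebesgue" "\<And>x. S x \<in> U \<longleftrightarrow> x \<in> U" and f: "sq_integrable (lebesgue_on U) f"
  shows "sq_integrable (lebesgue_on U) (\<lambda>x. f (S x))"
  unfolding sq_integrable_def
proof
  show "(\<lambda>x. f (S x)) \<in> borel_measurable (lebesgue_on U)" by (rule LINT_S(2)[OF U sq_integrable_measurable[OF f]])
  have i: "integrable (lebesgue_on U) (\<lambda>x. (norm (f x))\<^sup>2)" by (rule sq_integrable_integrable[OF f])
  show "integrable (lebesgue_on U) (\<lambda>x. (norm (f (S x)))\<^sup>2)"
    by (rule LINT_S(3)[OF U borel_measurable_integrable[OF i] i])
qed

lemma L2_conv_S: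
  fixes f :: "'a \<Rightarrow> 'b::euclidean_space"
  assumes U: "U \<in> sets lebesgue" "\<And>x. S x \<in> U \<longleftrightarrow> x \<in> U" and c: "L2_conv (lebesgue_on U) F f"
  shows "L2_conv (lebesgue_on U) (\<lambda>n x. F n (S x)) (\<lambda>x. f (S x))"
proof -
  have "(LINT x|lebesgue_on U. (norm (F n (S x) - f (S x)))\<^sup>2) = (LINT x|lebesgue_on U. (norm (F n x - f x))\<^sup>2)" for n
    by (rule LINT_S(1)[OF U, where f="\<lambda>x. (norm (F n x - f x))\<^sup>2"])
       (rule borel_measurable_integrable[OF sq_integrable_integrable[OF sq_integrable_diff[OF L2_conv_sq_integrable[OF c]]]])
  then show ?thesis
    using L2_conv_tendsto[OF c] sq_integrable_S[OF U L2_conv_sq_integrable(1)[OF c]] sq_integrable_S[OF U L2_conv_sq_integrable(2)[OF c]] unfolding L2_conv_def by simp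
qed

lemma L2_conv_S_image:
  assumes "L2_conv M F f" shows "L2_conv M (\<lambda>n x. S (F n x)) (\<lambda>x. S (f x))"
proof -
  have m: "S \<in> borel_measurable borel" by (rule borel_measurable_continuous_onI[OF S_continuous])
  have s: "sq_integrable M (\<lambda>x. S (g x))" if "sq_integrable M g" for g
    using that measurable_compose[of g M borel S borel] m by (simp add: sq_integrable_def S_norm)
  show ?thesis
    using L2_conv_tendsto[OF assms] s[OF L2_conv_sq_integrable(1)[OF assms]] s[OF L2_conv_sq_integrable(2)[OF assms]]
    by (simp add: L2_conv_def S_diff S_norm)
qed

lemma smooth_S: "smooth \<psi> \<Longrightarrow> smooth (\<lambda>x. \<psi> (S x))"
  using smooth_affine[of \<psi> 0 s] by (simp add: S_eq)

lemma grad_S: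
  assumes "smooth \<psi>" shows "grad (\<lambda>x. \<psi> (S x)) x = S (grad \<psi> (S x))"
proof (rule grad_eqI)
  have S: "(S has_derivative S) (at x)" unfolding S_eq by (auto intro!: derivative_eq_intros)
  have "((\<lambda>x. \<psi> (S x)) has_derivative (\<lambda>h. S h \<bullet> grad \<psi> (S x))) (at x)"
    using smooth_GDERIV[OF assms] unfolding gderiv_def by (rule has_derivative_compose[OF S])
  then show "GDERIV (\<lambda>x. \<psi> (S x)) x :> S (grad \<psi> (S x))" by (simp add: gderiv_def S_inner)
qed

text \<open>The approximating test functions are reflected; the gradient acquires an outer
  \<open>S\<close> because \<open>S\<close> is its own adjoint.\<close>

lemma H10_pair_S:
  assumes U: "open U" "\<And>x. S x \<in> U \<longleftrightarrow> x \<in> U" and p: "H10_pair U v \<gamma>"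
  shows "H10_pair U (\<lambda>x. v (S x)) (\<lambda>x. S (\<gamma> (S x)))"
proof -
  obtain \<psi> where \<psi>: "\<And>n. test_function U (\<psi> n)" "L2_conv (lebesgue_on U) \<psi> v" "L2_conv (lebesgue_on U) (\<lambda>n. grad (\<psi> n)) \<gamma>"
    using p unfolding H10_pair_def by blast
  note L = open_in_lebesgue[OF U(1)]
  have "test_function U (\<lambda>x. \<psi> n (S x))" for n
  proof -
    obtain K where K: "smooth (\<psi> n)" "compact K" "K \<subseteq> U" "\<forall>x. x \<notin> K \<longrightarrow> \<psi> n x = 0"
      using \<psi>(1)[of n] unfolding test_function_def by blast
    have "compact (S ` K)" by (rule compact_continuous_image[OF S_continuous K(2)])
    moreover have "S ` K \<subseteq> U" using K(3) U(2) by auto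
    moreover have "\<psi> n (S x) = 0" if "x \<notin> S ` K" for x
    proof -
      have "S x \<notin> K" using that S_S by (metis image_eqI)
      then show ?thesis using K(4) by blast
    qed
    ultimately show ?thesis unfolding test_function_def using smooth_S[OF K(1)] by blast
  qed
  moreover have "grad (\<lambda>x. \<psi> n (S x)) = (\<lambda>x. S (grad (\<psi> n) (S x)))" for n
    by (rule ext) (use grad_S \<psi>(1) in \<open>auto simp: test_function_def\<close>)
  ultimately show ?thesis
    unfolding H10_pair_def using L2_conv_S[OF L U(2) \<psi>(2)] L2_conv_S_image[OF L2_conv_S[OF L U(2) \<psi>(3)]]
    by (intro exI[of _ "\<lambda>n x. \<psi> n (S x)"]) simp
qed

text \<open>The reflected function solves the same equation, so it is an admissible supersolution
  and \<open>w x \<le> w (S x)\<close>. The same inequality at \<open>S x\<close> is the converse,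
  as \<open>S\<close> is an involution.\<close>

theorem weak_solution_symmetric:
  assumes U: "open U" "bounded U" "\<And>x. S x \<in> U \<longleftrightarrow> x \<in> U" and w: "weak_solution U w g" "continuous_on U w"
    and x: "x \<in> U"
  shows "w (S x) = w x"
proof -
  note L = open_in_lebesgue[OF U(1)]
  have p: "H10_pair U w g" using w by (simp add: weak_solution_def)
  note pS = H10_pair_S[OF U(1,3) p]
  have nn: "AE x in lebesgue_on U. 0 \<le> w x" by (rule weak_solution_nonneg[OF U(1) w(1)])
  have wc: "continuous_on U (\<lambda>x. w (S x))"
    by (rule continuous_on_compose2[OF w(2) S_continuous]) (use U(3) in auto)
  have w0: "0 \<le> w x" if "x \<in> U" for x
    using AE_le_imp_le_on_open[OF U(1) _ w(2) nn that] by simp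
  have "AE x in lebesgue_on U. w x \<le> w (S x)"
  proof (rule comparison_H1[OF U(1,2) w(1) H10_pair_sq_integrable[OF pS] H10_pair_weak_gradient[OF U(1) pS]])
    show "AE x in lebesgue_on U. 0 \<le> w (S x)" using w0 U(3) by (intro AE_I2) simp
    fix v \<gamma> assume v: "H10_pair U v \<gamma>"
    note vS = H10_pair_S[OF U(1,3) v]
    have uR_weak_solution: "integrable (lebesgue_on U) (\<lambda>x. exp (- w x) * v (S x))"
      "(LINT x|lebesgue_on U. g x \<bullet> S (\<gamma> (S x))) = (LINT x|lebesgue_on U. exp (- w x) * v (S x))"
      using w(1) vS unfolding weak_solution_def by blast+
    have ig: "integrable (lebesgue_on U) (\<lambda>x. g x \<bullet> S (\<gamma> (S x)))"
      by (rule sq_integrable_inner_integrable[OF H10_pair_sq_integrable(2)[OF p] H10_pair_sq_integrable(2)[OF vS]])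
    have "(LINT x|lebesgue_on U. exp (- w (S x)) * v x) = (LINT x|lebesgue_on U. exp (- w x) * v (S x))"
      using LINT_S(1)[OF L U(3) borel_measurable_integrable[OF uR_weak_solution(1)]] by simp
    also have "\<dots> = (LINT x|lebesgue_on U. g (S x) \<bullet> S (\<gamma> x))"
      using LINT_S(1)[OF L U(3) borel_measurable_integrable[OF ig]] uR_weak_solution(2) by simp
    finally show "(LINT x|lebesgue_on U. exp (- w (S x)) * v x) \<le> (LINT x|lebesgue_on U. S (g (S x)) \<bullet> \<gamma> x)"
      by (simp add: S_inner)
  qed
  then have le: "w x \<le> w (S x)" if "x \<in> U" for x
    using AE_le_imp_le_on_open[OF U(1) w(2) wc _ that] by blast
  show ?thesis using le[OF x] le[of "S x"] x U(3) by (intro antisym) auto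
qed

end

section \<open>Geometry of the sector\<close>

text \<open>The identification with complex numbers makes \<open>Arg\<close> available, whose
  continuity off the slit yields openness of the sectors.\<close>

definition to_complex :: "real^2 \<Rightarrow> complex" where "to_complex x = Complex (x $ 1) (x $ 2)"

lemma polar_nth [simp]: "polar r \<theta> $ 1 = r * cos \<theta>" "polar r \<theta> $ 2 = r * sin \<theta>"
  by (simp_all add: polar_def)

lemma to_complex_polar: "to_complex (polar r \<theta>) = rcis r \<theta>"
  by (simp add: to_complex_def complex_eq_iff)

lemma to_complex_inject: "to_complex x = to_complex y \<longleftrightarrow> x = y"
  by (auto simp: to_complex_def vec_eq_iff forall_2)

lemma norm_to_complex: "cmod (to_complex x) = norm x"
  by (simp add: to_complex_def cmod_def norm_vec_def L2_set_def sum_2)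

lemma norm_polar: "0 \<le> r \<Longrightarrow> norm (polar r \<theta>) = r"
  by (simp add: to_complex_polar flip: norm_to_complex)

lemma to_complex_continuous: "continuous_on A to_complex"
  unfolding to_complex_def[abs_def] Complex_eq by (intro continuous_intros)

lemma rcis_notin_nonpos_Reals:
  assumes "0 < r" "\<bar>\<theta>\<bar> < pi" shows "rcis r \<theta> \<notin> \<real>\<^sub>\<le>\<^sub>0"
proof
  assume "rcis r \<theta> \<in> \<real>\<^sub>\<le>\<^sub>0"
  then have "r * cos \<theta> \<le> 0" "sin \<theta> = 0" using assms by (auto simp: complex_nonpos_Reals_iff)
  moreover have "\<theta> = 0" using assms \<open>sin \<theta> = 0\<close> sin_eq_0_pi[of \<theta>] by auto
  ultimately show False using assms by simp
qed

lemma polar_cmod_Arg: "polar (cmod (to_complex x)) (Arg (to_complex x)) = x"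
  using to_complex_polar[of "cmod (to_complex x)" "Arg (to_complex x)"] rcis_cmod_Arg[of "to_complex x"] to_complex_inject by metis

lemma Arg_rcis: "0 < r \<Longrightarrow> \<bar>\<theta>\<bar> < pi \<Longrightarrow> Arg (rcis r \<theta>) = \<theta>"
  by (rule Arg_unique'[OF _ _ refl]) auto

context
  fixes \<theta>0 :: real assumes \<theta>0: "0 < \<theta>0" "\<theta>0 \<le> pi"
begin

text \<open>Removing the non-positive axis covers the case \<open>\<theta>0 = pi\<close> uniformly:
  off that axis the principal argument lies strictly between \<open>- pi\<close> and
  \<open>pi\<close> and is continuous.\<close>

lemma sector_eq: "sector \<theta>0 = to_complex -` {z \<in> - \<real>\<^sub>\<le>\<^sub>0. \<bar>Arg z\<bar> < \<theta>0}"
proof (intro equalityI subsetI)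
  fix x assume "x \<in> sector \<theta>0"
  then obtain r \<theta> where x: "x = polar r \<theta>" "0 < r" "\<bar>\<theta>\<bar> < \<theta>0" by (auto simp: sector_def)
  then have "\<bar>\<theta>\<bar> < pi" using \<theta>0 by linarith
  with x show "x \<in> to_complex -` {z \<in> - \<real>\<^sub>\<le>\<^sub>0. \<bar>Arg z\<bar> < \<theta>0}"
    using rcis_notin_nonpos_Reals[OF x(2)] Arg_rcis[OF x(2)] by (auto simp: to_complex_polar)
next
  fix x assume x: "x \<in> to_complex -` {z \<in> - \<real>\<^sub>\<le>\<^sub>0. \<bar>Arg z\<bar> < \<theta>0}"
  then have "to_complex x \<noteq> 0" by (auto simp: complex_nonpos_Reals_iff)
  then show "x \<in> sector \<theta>0" using x unfolding sector_def
    by (intro CollectI exI[of _ "cmod (to_complex x)"] exI[of _ "Arg (to_complex x)"]) (auto simp: polar_cmod_Arg)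
qed

lemma open_sector: "open (sector \<theta>0)"
proof -
  have "open (- \<real>\<^sub>\<le>\<^sub>0 \<inter> (\<lambda>z. \<bar>Arg z\<bar>) -` {..<\<theta>0})"
    by (intro continuous_open_preimage continuous_on_rabs continuous_on_Arg open_Compl closed_nonpos_Reals_complex open_lessThan)
  moreover have "{z \<in> - \<real>\<^sub>\<le>\<^sub>0. \<bar>Arg z\<bar> < \<theta>0} = - \<real>\<^sub>\<le>\<^sub>0 \<inter> (\<lambda>z. \<bar>Arg z\<bar>) -` {..<\<theta>0}" by auto
  ultimately show ?thesis
    unfolding sector_eq by (intro open_vimage to_complex_continuous) simp
qed

lemma half_sector_eq:
  assumes \<sigma>: "\<sigma> \<in> {-1, 1}"
  shows "half_sector \<theta>0 \<sigma> R = to_complex -` {z \<in> - \<real>\<^sub>\<le>\<^sub>0. 0 < \<sigma> * Arg z \<and> \<sigma> * Arg z < \<theta>0} \<inter> {x. norm x < R}"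
proof (intro equalityI subsetI)
  fix x assume "x \<in> half_sector \<theta>0 \<sigma> R"
  then obtain r \<theta> where x: "x = polar r (\<sigma> * \<theta>)" "0 < r" "r < R" "0 < \<theta>" "\<theta> < \<theta>0" by (auto simp: half_sector_def)
  then have "\<bar>\<sigma> * \<theta>\<bar> < pi" using \<theta>0 \<sigma> by auto
  with x show "x \<in> to_complex -` {z \<in> - \<real>\<^sub>\<le>\<^sub>0. 0 < \<sigma> * Arg z \<and> \<sigma> * Arg z < \<theta>0} \<inter> {x. norm x < R}"
    using rcis_notin_nonpos_Reals[OF x(2)] Arg_rcis[OF x(2)] \<sigma> by (auto simp: to_complex_polar norm_polar)
next
  fix x assume x: "x \<in> to_complex -` {z \<in> - \<real>\<^sub>\<le>\<^sub>0. 0 < \<sigma> * Arg z \<and> \<sigma> * Arg z < \<theta>0} \<inter> {x. norm x < R}"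
  then have "to_complex x \<noteq> 0" by (auto simp: complex_nonpos_Reals_iff)
  then have "0 < norm x" by (simp flip: norm_to_complex)
  define t where "t = \<sigma> * Arg (to_complex x)"
  have "\<sigma> * t = Arg (to_complex x)" using \<sigma> by (auto simp: t_def)
  then have "x = polar (norm x) (\<sigma> * t)" using polar_cmod_Arg[of x] by (simp add: norm_to_complex)
  moreover have "0 < t" "t < \<theta>0" "norm x < R" using x by (auto simp: t_def)
  ultimately show "x \<in> half_sector \<theta>0 \<sigma> R" unfolding half_sector_def using \<open>0 < norm x\<close> by blast
qed

lemma open_half_sector:
  assumes \<sigma>: "\<sigma> \<in> {-1, 1}" shows "open (half_sector \<theta>0 \<sigma> R)"
proof -
  have "open (- \<real>\<^sub>\<le>\<^sub>0 \<inter> (\<lambda>z. \<sigma> * Arg z) -` {0<..<\<theta>0})"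
    by (intro continuous_open_preimage continuous_on_mult_left continuous_on_Arg open_Compl closed_nonpos_Reals_complex open_greaterThanLessThan)
  moreover have "{z \<in> - \<real>\<^sub>\<le>\<^sub>0. 0 < \<sigma> * Arg z \<and> \<sigma> * Arg z < \<theta>0} = - \<real>\<^sub>\<le>\<^sub>0 \<inter> (\<lambda>z. \<sigma> * Arg z) -` {0<..<\<theta>0}" by auto
  ultimately have "open (to_complex -` {z \<in> - \<real>\<^sub>\<le>\<^sub>0. 0 < \<sigma> * Arg z \<and> \<sigma> * Arg z < \<theta>0})"
    by (intro open_vimage to_complex_continuous) simp
  moreover have "open {x::real^2. norm x < R}" by (intro open_Collect_less continuous_intros)
  ultimately show ?thesis unfolding half_sector_eq[OF \<sigma>] by (rule open_Int)
qed

lemma half_sector_subset: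
  assumes \<sigma>: "\<sigma> \<in> {-1, 1}" shows "half_sector \<theta>0 \<sigma> R \<subseteq> sector_trunc \<theta>0 R"
  unfolding half_sector_eq[OF \<sigma>] sector_trunc_def sector_eq using \<sigma> by auto

lemma open_sector_trunc: "open (sector_trunc \<theta>0 R)"
proof -
  have "open {x::real^2. norm x < R}" by (intro open_Collect_less continuous_intros)
  moreover have "sector_trunc \<theta>0 R = sector \<theta>0 \<inter> {x. norm x < R}" by (auto simp: sector_trunc_def)
  ultimately show ?thesis using open_sector by auto
qed

lemma bounded_sector_trunc: "bounded (sector_trunc \<theta>0 R)"
  by (rule bounded_subset[OF bounded_ball[of 0 R]]) (auto simp: sector_trunc_def)

text \<open>For \<open>\<theta>0 = pi\<close> both rays coincide with the slit, and the angle
  \<open>- pi\<close> is not a value of \<open>Arg\<close>; this case is settled by the removed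
  axis, the other one by the argument.\<close>

lemma ray_notin_sector:
  assumes "0 < r" "\<sigma> \<in> {-1, 1}" shows "polar r (\<sigma> * \<theta>0) \<notin> sector \<theta>0"
proof (cases "\<theta>0 = pi")
  case True
  have "to_complex (polar r (\<sigma> * \<theta>0)) \<in> \<real>\<^sub>\<le>\<^sub>0"
    using assms True by (auto simp: to_complex_def complex_nonpos_Reals_iff)
  then show ?thesis by (auto simp: sector_eq)
next
  case False
  then have "Arg (to_complex (polar r (\<sigma> * \<theta>0))) = \<sigma> * \<theta>0"
    unfolding to_complex_polar using assms \<theta>0 by (intro Arg_rcis) auto
  then show ?thesis using assms \<theta>0 by (auto simp: sector_eq)
qed

text \<open>In polar coordinates \<open>norm x + x $ 1\<close> is
  \<open>r * (1 + cos \<theta>)\<close>, positive because the angle stays strictly below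
  \<open>pi\<close> in absolute value. Up to a factor 2 this is the radicand in
  \<open>re_sqrt\<close>.\<close>

lemma sector_slit: assumes "x \<in> sector \<theta>0" shows "0 < norm x" "0 < norm x + x $ 1"
proof -
  obtain r \<theta> where x: "x = polar r \<theta>" "0 < r" "\<bar>\<theta>\<bar> < \<theta>0" using assms by (auto simp: sector_def)
  show "0 < norm x" using x by (simp add: norm_polar)
  have "cos \<bar>\<theta>\<bar> > cos pi" using x \<theta>0 by (intro cos_monotone_0_pi) auto
  then have "0 < r * (1 + cos \<theta>)" using x by (intro mult_pos_pos) auto
  then show "0 < norm x + x $ 1" using x by (simp add: norm_polar distrib_left)
qed

end

text \<open>The reflection that reverses the angle, written as a diagonal map to fit
  \<open>coordinate_reflection\<close>.\<close>

definition flip :: "real^2 \<Rightarrow> real^2" where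
  "flip x = (\<Sum>j\<in>Basis. ((if j = axis 2 1 then -1 else 1) * (x \<bullet> j)) *\<^sub>R j)"

interpretation flip: coordinate_reflection "\<lambda>j. if j = axis 2 1 then -1 else 1" flip
  by unfold_locales (auto simp: flip_def[abs_def])

lemma flip_nth: "flip x $ 1 = x $ 1" "flip x $ 2 = - x $ 2"
proof -
  have b: "axis 1 1 \<in> (Basis :: (real^2) set)" "axis 2 1 \<in> (Basis :: (real^2) set)" by (simp_all add: axis_in_Basis_iff)
  have ne: "axis 1 1 \<noteq> (axis 2 1 :: real^2)" by (simp add: axis_eq_axis)
  show "flip x $ 1 = x $ 1" using flip.S_inner_Basis[OF b(1), of x] ne by (simp add: cart_eq_inner_axis)
  show "flip x $ 2 = - x $ 2" using flip.S_inner_Basis[OF b(2), of x] by (simp add: cart_eq_inner_axis)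
qed

lemma flip_polar: "flip (polar r \<theta>) = polar r (- \<theta>)"
  by (simp add: vec_eq_iff forall_2 flip_nth)

lemma flip_sector_imp: "x \<in> sector \<theta>0 \<Longrightarrow> flip x \<in> sector \<theta>0"
  unfolding sector_def by (auto simp: flip_polar) (metis abs_minus_cancel)

lemma flip_sector_trunc: "flip x \<in> sector_trunc \<theta>0 R \<longleftrightarrow> x \<in> sector_trunc \<theta>0 R"
  using flip_sector_imp[of x \<theta>0] flip_sector_imp[of "flip x" \<theta>0] by (auto simp: sector_trunc_def flip.S_norm)

section \<open>An explicit supersolution\<close>

text \<open>\<open>re_sqrt\<close> is the real part of the principal square root, a positive harmonic function on the
  slit plane with squared gradient \<open>1 / (4 * norm x)\<close>. The concave function \<open>6 * ln (1 + re_sqrt x)\<close>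
  of it outweighs the subharmonic term \<open>ln (2 + norm x)\<close>, which makes \<open>exp (- barrier x)\<close> small
  enough near the slit.\<close>

definition re_sqrt :: "real^2 \<Rightarrow> real" where "re_sqrt x = sqrt ((norm x + x \<bullet> axis 1 1) / 2)"

definition barrier :: "real^2 \<Rightarrow> real" where
  "barrier x = ln 4 + (ln (2 + norm x) + 6 * ln (1 + re_sqrt x))"

text \<open>\<open>barrier_k1 x *\<^sub>R x\<close> is the gradient of
  \<open>ln (2 + norm x)\<close>. The gradient of \<open>re_sqrt\<close> is
  \<open>sgn x + axis 1 1\<close> divided by \<open>4 * re_sqrt x\<close>, so
  \<open>barrier_k2\<close> is the coefficient that \<open>6 * ln (1 + re_sqrt x)\<close>
  contributes to this direction.\<close>

definition barrier_k1 :: "real^2 \<Rightarrow> real" where "barrier_k1 x = inverse (norm x * (2 + norm x))"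
definition barrier_k2 :: "real^2 \<Rightarrow> real" where "barrier_k2 x = 3 / 2 * inverse (re_sqrt x * (1 + re_sqrt x))"

definition barrier_P :: "real^2 \<Rightarrow> real^2" where
  "barrier_P x = barrier_k1 x *\<^sub>R x + barrier_k2 x *\<^sub>R (sgn x + axis 1 1)"

definition re_sqrt_D :: "real^2 \<Rightarrow> real^2" where
  "re_sqrt_D x = inverse (4 * re_sqrt x) *\<^sub>R (sgn x + axis 1 1)"

definition barrier_Dk1 :: "real^2 \<Rightarrow> real^2" where
  "barrier_Dk1 x = (- (barrier_k1 x)\<^sup>2 * (2 * norm x + 2)) *\<^sub>R sgn x"
definition barrier_Dk2 :: "real^2 \<Rightarrow> real^2" where
  "barrier_Dk2 x = (- (3 / 2) * (inverse (re_sqrt x * (1 + re_sqrt x)))\<^sup>2 * (1 + 2 * re_sqrt x)) *\<^sub>R re_sqrt_D x"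

text \<open>The product rule applied to component \<open>b\<close> of \<open>barrier_P\<close>; the
  sum of \<open>barrier_Q b x \<bullet> b\<close> over the basis is the Laplacian of the
  barrier.\<close>

definition barrier_Q :: "real^2 \<Rightarrow> real^2 \<Rightarrow> real^2" where
  "barrier_Q b x = (barrier_k1 x *\<^sub>R b + (x \<bullet> b) *\<^sub>R barrier_Dk1 x) +
     (barrier_k2 x *\<^sub>R (inverse (norm x) *\<^sub>R b + (x \<bullet> b) *\<^sub>R (- (inverse (norm x))\<^sup>2 *\<^sub>R sgn x)) +
      (sgn x \<bullet> b + axis 1 1 \<bullet> b) *\<^sub>R barrier_Dk2 x)"

context
  fixes x :: "real^2"
  assumes x: "0 < norm x" "0 < norm x + x \<bullet> axis 1 1"
begin

lemma re_sqrt_pos: "0 < re_sqrt x" using x by (simp add: re_sqrt_def)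
lemma re_sqrt_sq: "(re_sqrt x)\<^sup>2 = (norm x + x \<bullet> axis 1 1) / 2" using x by (simp add: re_sqrt_def)
lemma x_nz: "x \<noteq> 0" using x by auto

lemma GDERIV_inner_const: "GDERIV (\<lambda>x. x \<bullet> b) y :> b"
  unfolding gderiv_def by (auto intro!: derivative_eq_intros)

lemma GDERIV_re_sqrt: "GDERIV re_sqrt x :> re_sqrt_D x"
proof -
  have 1: "GDERIV (\<lambda>x. norm x + x \<bullet> axis 1 1) x :> sgn x + axis 1 1"
    by (rule GDERIV_add[OF GDERIV_norm[OF x_nz] GDERIV_inner_const])
  have 2: "DERIV (\<lambda>t. sqrt (t / 2)) (norm x + x \<bullet> axis 1 1) :> inverse (4 * re_sqrt x)"
    using x by (auto intro!: derivative_eq_intros simp: re_sqrt_def field_simps)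
  from GDERIV_DERIV_compose[OF 1 2] show ?thesis by (simp add: re_sqrt_def[abs_def] re_sqrt_D_def)
qed

lemma GDERIV_barrier: "GDERIV barrier x :> barrier_P x"
proof -
  have l: "DERIV (\<lambda>t. ln (c + t)) t :> inverse (c + t)" if "0 < c + t" for c t :: real
    using that by (auto intro!: derivative_eq_intros simp: inverse_eq_divide)
  have 1: "GDERIV (\<lambda>x. ln (2 + norm x)) x :> inverse (2 + norm x) *\<^sub>R sgn x"
    by (rule GDERIV_DERIV_compose[OF GDERIV_norm[OF x_nz] l]) (simp add: add_pos_nonneg)
  have 2: "GDERIV (\<lambda>x. ln (1 + re_sqrt x)) x :> inverse (1 + re_sqrt x) *\<^sub>R re_sqrt_D x"
    by (rule GDERIV_DERIV_compose[OF GDERIV_re_sqrt l]) (use re_sqrt_pos in simp)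
  have 3: "GDERIV (\<lambda>x. 6 * ln (1 + re_sqrt x)) x :> 6 *\<^sub>R (inverse (1 + re_sqrt x) *\<^sub>R re_sqrt_D x) + ln (1 + re_sqrt x) *\<^sub>R 0"
    by (rule GDERIV_mult[OF GDERIV_const 2])
  have "GDERIV barrier x :> 0 + (inverse (2 + norm x) *\<^sub>R sgn x + (6 *\<^sub>R (inverse (1 + re_sqrt x) *\<^sub>R re_sqrt_D x) + ln (1 + re_sqrt x) *\<^sub>R 0))"
    unfolding barrier_def[abs_def] by (rule GDERIV_add[OF GDERIV_const GDERIV_add[OF 1 3]])
  moreover have "6 *\<^sub>R (inverse (1 + re_sqrt x) *\<^sub>R re_sqrt_D x) = barrier_k2 x *\<^sub>R (sgn x + axis 1 1)"
  proof -
    have "6 * (inverse (1 + re_sqrt x) * inverse (4 * re_sqrt x)) = barrier_k2 x" by (simp add: barrier_k2_def)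
    then show ?thesis unfolding re_sqrt_D_def scaleR_scaleR by simp
  qed
  moreover have "inverse (2 + norm x) *\<^sub>R sgn x = barrier_k1 x *\<^sub>R x"
    by (simp add: barrier_k1_def sgn_div_norm mult.commute)
  ultimately show ?thesis by (simp add: barrier_P_def)
qed

lemma GDERIV_k1: "GDERIV barrier_k1 x :> barrier_Dk1 x"
proof -
  have "DERIV (\<lambda>t. inverse (t * (2 + t))) (norm x) :> - (inverse (norm x * (2 + norm x)))\<^sup>2 * (2 * norm x + 2)"
  proof (rule DERIV_cong[OF DERIV_inverse_fun])
    show "DERIV (\<lambda>t. t * (2 + t)) (norm x) :> 2 * norm x + 2" by (auto intro!: derivative_eq_intros)
    have "0 < norm x * (2 + norm x)" using x by (intro mult_pos_pos) linarith+
    then show "norm x * (2 + norm x) \<noteq> 0" by linarith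
  qed (simp add: power2_eq_square ac_simps)
  from GDERIV_DERIV_compose[OF GDERIV_norm[OF x_nz] this] show ?thesis
    by (simp add: barrier_k1_def[abs_def] barrier_Dk1_def)
qed

lemma GDERIV_k2: "GDERIV barrier_k2 x :> barrier_Dk2 x"
proof -
  have "DERIV (\<lambda>t. 3 / 2 * inverse (t * (1 + t))) (re_sqrt x) :> - (3 / 2) * (inverse (re_sqrt x * (1 + re_sqrt x)))\<^sup>2 * (1 + 2 * re_sqrt x)"
  proof (rule DERIV_cong[OF DERIV_cmult[OF DERIV_inverse_fun]])
    show "DERIV (\<lambda>t. t * (1 + t)) (re_sqrt x) :> 1 + 2 * re_sqrt x" by (auto intro!: derivative_eq_intros)
    show "re_sqrt x * (1 + re_sqrt x) \<noteq> 0" using re_sqrt_pos by auto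
  qed (simp add: power2_eq_square ac_simps)
  from GDERIV_DERIV_compose[OF GDERIV_re_sqrt this] show ?thesis
    by (simp add: barrier_k2_def[abs_def] barrier_Dk2_def)
qed

lemma GDERIV_sgn: "GDERIV (\<lambda>x. sgn x \<bullet> b) x :> inverse (norm x) *\<^sub>R b + (x \<bullet> b) *\<^sub>R (- (inverse (norm x))\<^sup>2 *\<^sub>R sgn x)"
  using GDERIV_mult[OF GDERIV_inverse[OF GDERIV_norm[OF x_nz]] GDERIV_inner_const, of b] x_nz
  by (simp add: sgn_div_norm)

lemma GDERIV_barrier_P: "GDERIV (\<lambda>x. barrier_P x \<bullet> b) x :> barrier_Q b x"
proof -
  have 1: "GDERIV (\<lambda>x. barrier_k1 x * (x \<bullet> b)) x :> barrier_k1 x *\<^sub>R b + (x \<bullet> b) *\<^sub>R barrier_Dk1 x"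
    by (rule GDERIV_mult[OF GDERIV_k1 GDERIV_inner_const])
  have 2: "GDERIV (\<lambda>x. barrier_k2 x * (sgn x \<bullet> b + axis 1 1 \<bullet> b)) x :>
      barrier_k2 x *\<^sub>R (inverse (norm x) *\<^sub>R b + (x \<bullet> b) *\<^sub>R (- (inverse (norm x))\<^sup>2 *\<^sub>R sgn x) + 0) +
      (sgn x \<bullet> b + axis 1 1 \<bullet> b) *\<^sub>R barrier_Dk2 x"
    by (rule GDERIV_mult[OF GDERIV_k2 GDERIV_add[OF GDERIV_sgn GDERIV_const]])
  show ?thesis
    using GDERIV_add[OF 1 2] by (simp add: barrier_P_def inner_add_left barrier_Q_def)
qed

text \<open>For a radial function the Laplacian is the second derivative plus the first derivative
  over \<open>r\<close>, which gives the first term for \<open>ln (2 + r)\<close>. As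
  \<open>re_sqrt\<close> is harmonic with squared gradient \<open>1 / (4 * r)\<close>, only the
  second derivative of \<open>6 * ln (1 + a)\<close> contributes, which gives the second
  term.\<close>

lemma barrier_divergence:
  "(\<Sum>b\<in>Basis. barrier_Q b x \<bullet> b) = 2 / (norm x * (2 + norm x)\<^sup>2) - 3 / (2 * norm x * (1 + re_sqrt x)\<^sup>2)"
proof -
  let ?r = "norm x" and ?a = "re_sqrt x"
  note a = re_sqrt_pos
  have D: "(\<Sum>b\<in>(Basis :: (real^2) set). b \<bullet> b) = 2"
  proof -
    have "(\<Sum>b\<in>(Basis :: (real^2) set). b \<bullet> b) = (\<Sum>b\<in>(Basis :: (real^2) set). 1)" by (intro sum.cong) auto
    then show ?thesis by simp
  qed
  have I: "(\<Sum>b\<in>Basis. (y \<bullet> b) * (z \<bullet> b)) = y \<bullet> z" for y z :: "real^2" by (rule euclidean_inner[symmetric])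
  have "barrier_Q b x \<bullet> b = barrier_k1 x * (b \<bullet> b) + (x \<bullet> b) * (barrier_Dk1 x \<bullet> b)
      + barrier_k2 x * (inverse ?r * (b \<bullet> b) - (inverse ?r)\<^sup>2 * ((x \<bullet> b) * (sgn x \<bullet> b)))
      + ((sgn x + axis 1 1) \<bullet> b) * (barrier_Dk2 x \<bullet> b)" for b
    unfolding barrier_Q_def by (simp add: inner_add_left inner_diff_left)
  then have "(\<Sum>b\<in>Basis. barrier_Q b x \<bullet> b) = barrier_k1 x * (\<Sum>b\<in>(Basis :: (real^2) set). b \<bullet> b)
      + (\<Sum>b\<in>Basis. (x \<bullet> b) * (barrier_Dk1 x \<bullet> b))
      + barrier_k2 x * (inverse ?r * (\<Sum>b\<in>(Basis :: (real^2) set). b \<bullet> b) - (inverse ?r)\<^sup>2 * (\<Sum>b\<in>Basis. (x \<bullet> b) * (sgn x \<bullet> b)))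
      + (\<Sum>b\<in>Basis. ((sgn x + axis 1 1) \<bullet> b) * (barrier_Dk2 x \<bullet> b))"
    by (simp only: sum.distrib sum_distrib_left[symmetric] sum_subtractf)
  also have "\<dots> = barrier_k1 x * 2 + x \<bullet> barrier_Dk1 x
      + barrier_k2 x * (inverse ?r * 2 - (inverse ?r)\<^sup>2 * (x \<bullet> sgn x)) + (sgn x + axis 1 1) \<bullet> barrier_Dk2 x"
    unfolding D I ..
  finally have main: "(\<Sum>b\<in>Basis. barrier_Q b x \<bullet> b) = barrier_k1 x * 2 + x \<bullet> barrier_Dk1 x
      + barrier_k2 x * (inverse ?r * 2 - (inverse ?r)\<^sup>2 * (x \<bullet> sgn x)) + (sgn x + axis 1 1) \<bullet> barrier_Dk2 x" .
  have xs: "x \<bullet> sgn x = ?r" using x by (simp add: sgn_div_norm power2_norm_eq_inner[symmetric] power2_eq_square)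
  \<comment> \<open>This identity is the formula \<open>1 / (4 * norm x)\<close> for the squared
    gradient of \<open>re_sqrt\<close>.\<close>
  have ss: "(sgn x + axis 1 1) \<bullet> (sgn x + axis 1 1) = 4 * ?a\<^sup>2 / ?r"
  proof -
    have "sgn x \<bullet> sgn x = 1" using x_nz by (simp add: norm_sgn flip: power2_norm_eq_inner)
    moreover have "axis 1 1 \<bullet> (axis 1 1 :: real^2) = 1" by (simp add: inner_axis_axis)
    moreover have "sgn x \<bullet> axis 1 1 = (x \<bullet> axis 1 1) / ?r" by (simp add: sgn_div_norm divide_inverse mult.commute)
    ultimately show ?thesis using x re_sqrt_sq by (simp add: inner_add_left inner_add_right inner_commute field_simps)
  qed
  have k1: "x \<bullet> barrier_Dk1 x = - (barrier_k1 x)\<^sup>2 * (2 * ?r + 2) * ?r"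
    using xs by (simp add: barrier_Dk1_def)
  have k2: "(sgn x + axis 1 1) \<bullet> barrier_Dk2 x = - (3 / 2) * (inverse (?a * (1 + ?a)))\<^sup>2 * (1 + 2 * ?a) * (inverse (4 * ?a) * (4 * ?a\<^sup>2 / ?r))"
    unfolding barrier_Dk2_def re_sqrt_D_def inner_scaleR_right ss ..
  have e1: "barrier_k1 x * 2 + - (barrier_k1 x)\<^sup>2 * (2 * ?r + 2) * ?r = 2 / (?r * (2 + ?r)\<^sup>2)"
  proof -
    have 1: "?r \<noteq> 0" "2 + ?r \<noteq> 0" using x(1) by linarith+
    show ?thesis unfolding barrier_k1_def using 1 by (simp add: divide_simps) (simp add: algebra_simps power2_eq_square)
  qed
  have e2: "barrier_k2 x * (inverse ?r * 2 - (inverse ?r)\<^sup>2 * ?r) + - (3 / 2) * (inverse (?a * (1 + ?a)))\<^sup>2 * (1 + 2 * ?a) * (inverse (4 * ?a) * (4 * ?a\<^sup>2 / ?r))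
     = - 3 / (2 * ?r * (1 + ?a)\<^sup>2)"
  proof -
    have 1: "1 + ?a \<noteq> 0" "?a \<noteq> 0" "?r \<noteq> 0" using x(1) a by auto
    have i: "inverse ?r * 2 - (inverse ?r)\<^sup>2 * ?r = inverse ?r" using 1 by (simp add: power2_eq_square)
    show ?thesis unfolding barrier_k2_def i using 1 by (simp add: divide_simps) (simp add: algebra_simps power2_eq_square)
  qed
  show ?thesis unfolding main k1 k2 xs using e1 e2 by linarith
qed

text \<open>With \<open>a = re_sqrt x\<close>, one sixth of the concave gain,
  \<open>1 / (4 * r * (1 + a)\<^sup>2)\<close>, already dominates \<open>exp (- barrier x)\<close>;
  the summand \<open>ln 4\<close> supplies its factor 4. The remaining \<open>5 / 4\<close> of the
  coefficient \<open>3 / 2\<close> has to absorb the Laplacian of \<open>ln (2 + r)\<close>.\<close>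

lemma barrier_supersolution: "exp (- barrier x) \<le> - (\<Sum>b\<in>Basis. barrier_Q b x \<bullet> b)"
proof -
  define r where "r = norm x"
  define a where "a = re_sqrt x"
  have r: "0 < r" using x by (simp add: r_def)
  have a: "0 < a" using re_sqrt_pos by (simp add: a_def)
  have "x \<bullet> axis 1 1 \<le> norm x" using norm_cauchy_schwarz[of x "axis 1 1"] by (simp add: norm_axis_1)
  then have ar: "a\<^sup>2 \<le> r" using re_sqrt_sq by (simp add: a_def r_def)
  have "exp (- barrier x) = inverse (4 * (2 + r) * (1 + a) ^ 6)"
  proof -
    have "barrier x = ln (4 * (2 + r) * (1 + a) ^ 6)"
    proof -
      have "ln (4 * (2 + r) * (1 + a) ^ 6) = ln (4 * (2 + r)) + ln ((1 + a) ^ 6)"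
        by (rule ln_mult_pos) (use r a in auto)
      moreover have "ln (4 * (2 + r)) = ln 4 + ln (2 + r)" by (rule ln_mult_pos) (use r in auto)
      moreover have "ln ((1 + a) ^ 6) = 6 * ln (1 + a)" using a ln_realpow[of "1 + a" 6] by simp
      ultimately show ?thesis unfolding barrier_def r_def[symmetric] a_def[symmetric] by linarith
    qed
    moreover have "0 < 4 * (2 + r) * (1 + a) ^ 6" using r a by simp
    ultimately show ?thesis by (simp only: exp_minus exp_ln)
  qed
  also have "\<dots> \<le> 1 / (4 * r * (1 + a)\<^sup>2)"
  proof -
    have "r * (1 + a)\<^sup>2 \<le> (2 + r) * (1 + a) ^ 6"
      using r a by (intro mult_mono power_increasing) auto
    then have "4 * r * (1 + a)\<^sup>2 \<le> 4 * (2 + r) * (1 + a) ^ 6" by (simp only: mult.assoc mult_le_cancel_left) simp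
    then show ?thesis using r a by (simp add: inverse_eq_divide frac_le)
  qed
  also have "\<dots> \<le> 3 / (2 * r * (1 + a)\<^sup>2) - 2 / (r * (2 + r)\<^sup>2)"
  proof -
    \<comment> \<open>After \<open>a\<^sup>2 \<le> r\<close> the absorption becomes a polynomial
      inequality in \<open>a\<close>, proved by completing the square in
      \<open>12 * a\<^sup>2 - 16 * a\<close>.\<close>
    have "8 * (1 + a)\<^sup>2 \<le> 5 * (2 + a\<^sup>2)\<^sup>2"
    proof -
      have "5 * (2 + a\<^sup>2)\<^sup>2 - 8 * (1 + a)\<^sup>2 = 5 * a ^ 4 + 12 * (a - 2 / 3)\<^sup>2 + 20 / 3"
        by (simp add: power2_eq_square power4_eq_xxxx algebra_simps)
      moreover have "0 \<le> 5 * a ^ 4 + 12 * (a - 2 / 3)\<^sup>2" by simp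
      ultimately show ?thesis by linarith
    qed
    also have "\<dots> \<le> 5 * (2 + r)\<^sup>2" using ar by (intro mult_left_mono power_mono) auto
    finally have "2 / (2 + r)\<^sup>2 \<le> 5 / 4 / (1 + a)\<^sup>2" using r a by (simp add: divide_simps split: if_splits)
    then have "2 / (2 + r)\<^sup>2 / r \<le> 5 / 4 / (1 + a)\<^sup>2 / r" using r by (intro divide_right_mono) auto
    moreover have "3 / (2 * r * (1 + a)\<^sup>2) - 5 / 4 / (1 + a)\<^sup>2 / r = 1 / (4 * r * (1 + a)\<^sup>2)"
      using r a by (simp add: divide_simps)
    moreover have "2 / (2 + r)\<^sup>2 / r = 2 / (r * (2 + r)\<^sup>2)" by simp
    ultimately show ?thesis by linarith
  qed
  finally show ?thesis unfolding barrier_divergence by (simp add: r_def a_def)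
qed

lemma barrier_nonneg: "0 \<le> barrier x"
  using re_sqrt_pos by (simp add: barrier_def)

text \<open>From \<open>(1 + a)\<^sup>2 \<le> 2 * (1 + r)\<close> the term
  \<open>6 * ln (1 + a)\<close> is at most three times \<open>ln 2 + ln (1 + r)\<close>; the term
  \<open>ln (2 + r)\<close> accounts for the fourth.\<close>

lemma barrier_bound: "barrier x \<le> ln 4 + 4 * ln 2 + 4 * ln (1 + norm x)"
proof -
  define r where "r = norm x"
  define a where "a = re_sqrt x"
  have r: "0 < r" using x by (simp add: r_def)
  have a: "0 < a" using re_sqrt_pos by (simp add: a_def)
  have "x \<bullet> axis 1 1 \<le> norm x" using norm_cauchy_schwarz[of x "axis 1 1"] by (simp add: norm_axis_1)
  then have ar: "a\<^sup>2 \<le> r" using re_sqrt_sq by (simp add: a_def r_def)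
  have "(1 + a)\<^sup>2 \<le> 2 * (1 + r)"
  proof -
    have "(1 + a)\<^sup>2 \<le> 2 * (1 + a\<^sup>2)"
      using zero_le_power2[of "1 - a"] by (simp add: power2_eq_square algebra_simps)
    also have "\<dots> \<le> 2 * (1 + r)" using ar by simp
    finally show ?thesis .
  qed
  then have "ln ((1 + a)\<^sup>2) \<le> ln (2 * (1 + r))" using r a by (subst ln_le_cancel_iff) auto
  moreover have l2: "ln (2 * (1 + r)) = ln 2 + ln (1 + r)" by (rule ln_mult_pos) (use r in auto)
  moreover have "ln ((1 + a)\<^sup>2) = 2 * ln (1 + a)" using a ln_realpow[of "1 + a" 2] by simp
  ultimately have 1: "2 * ln (1 + a) \<le> ln 2 + ln (1 + r)" by linarith
  have "ln (2 + r) \<le> ln (2 * (1 + r))" using r by (subst ln_le_cancel_iff) auto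
  with 1 l2 show ?thesis unfolding barrier_def r_def[symmetric] a_def[symmetric] by linarith
qed

end

lemma barrier_Q_continuous:
  assumes "\<And>x. x \<in> U \<Longrightarrow> 0 < norm x" "\<And>x. x \<in> U \<Longrightarrow> 0 < norm x + x \<bullet> axis 1 1"
  shows "continuous_on U (barrier_Q b)"
proof -
  have r: "continuous_on U re_sqrt" unfolding re_sqrt_def[abs_def] by (intro continuous_intros) simp
  have nz: "norm x \<noteq> 0" "re_sqrt x \<noteq> 0" "1 + re_sqrt x \<noteq> 0" "2 + norm x \<noteq> 0" "x \<noteq> 0" if "x \<in> U" for x
    using re_sqrt_pos[of x] assms[OF that] add_pos_pos[of 2 "norm x"] by auto
  have s: "continuous_on U (sgn :: real^2 \<Rightarrow> real^2)"
    unfolding sgn_div_norm[abs_def] using nz by (intro continuous_intros) auto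
  have k1: "continuous_on U barrier_k1" unfolding barrier_k1_def[abs_def] using nz by (intro continuous_intros) auto
  have k2: "continuous_on U barrier_k2" unfolding barrier_k2_def[abs_def] using nz by (intro continuous_intros r) auto
  have d: "continuous_on U re_sqrt_D" unfolding re_sqrt_D_def[abs_def] using nz by (intro continuous_intros r s) auto
  have d1: "continuous_on U barrier_Dk1" unfolding barrier_Dk1_def[abs_def] by (intro continuous_intros k1 s)
  have d2: "continuous_on U barrier_Dk2" unfolding barrier_Dk2_def[abs_def] using nz by (intro continuous_intros r d) auto
  show ?thesis unfolding barrier_Q_def[abs_def] using nz by (intro continuous_intros k1 k2 d1 d2 s) auto
qed

text \<open>The truncated sector avoids the slit, so the barrier is smooth on it. The bound contains
  no \<open>R\<close>, which makes the supremum over all radii finite.\<close>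

theorem weak_solution_le_barrier:
  assumes \<theta>0: "0 < \<theta>0" "\<theta>0 \<le> pi" and w: "weak_solution (sector_trunc \<theta>0 R) w g" "continuous_on (sector_trunc \<theta>0 R) w"
    and x: "x \<in> sector_trunc \<theta>0 R"
  shows "w x \<le> ln 4 + 4 * ln 2 + 4 * ln (1 + norm x)"
proof -
  let ?U = "sector_trunc \<theta>0 R"
  note U = open_sector_trunc[OF \<theta>0] bounded_sector_trunc[OF \<theta>0]
  have pos: "0 < norm y" "0 < norm y + y \<bullet> axis 1 1" if "y \<in> ?U" for y
    using sector_slit[OF \<theta>0, of y] that by (auto simp: sector_trunc_def cart_eq_inner_axis)
  have "AE x in lebesgue_on ?U. w x \<le> barrier x"
  proof (rule comparison_smooth[OF U w(1)])
    show "GDERIV barrier y :> barrier_P y" if "y \<in> ?U" for y by (rule GDERIV_barrier[OF pos[OF that]])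
    show "0 \<le> barrier y" if "y \<in> ?U" for y by (rule barrier_nonneg[OF pos[OF that]])
    show "GDERIV (\<lambda>y. barrier_P y \<bullet> b) y :> barrier_Q b y" if "y \<in> ?U" for y b by (rule GDERIV_barrier_P[OF pos[OF that]])
    show "continuous_on ?U (barrier_Q b)" for b by (rule barrier_Q_continuous[OF pos])
    show "exp (- barrier y) \<le> - (\<Sum>b\<in>Basis. barrier_Q b y \<bullet> b)" if "y \<in> ?U" for y
      by (rule barrier_supersolution[OF pos[OF that]])
  qed
  moreover have "continuous_on ?U barrier"
    using GDERIV_barrier[OF pos] by (meson GDERIV_continuous_at continuous_at_imp_continuous_on)
  ultimately have "w x \<le> barrier x" using AE_le_imp_le_on_open[OF U(1) w(2) _ _ x] by blast
  with barrier_bound[OF pos[OF x]] show ?thesis by linarith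
qed

section \<open>The minimal solution\<close>

text \<open>Test pairs on \<open>U\<close> are extended by zero to \<open>V\<close>. A solution on a
  large truncation can therefore be tested on any smaller one, whatever its values on the separating
  arc.\<close>

lemma weak_solution_restrict:
  assumes UV: "open U" "open V" "U \<subseteq> V" and w: "weak_solution V w g" and v: "H10_pair U v \<gamma>"
  shows "integrable (lebesgue_on U) (\<lambda>x. exp (- w x) * v x)"
    and "(LINT x|lebesgue_on U. g x \<bullet> \<gamma> x) = (LINT x|lebesgue_on U. exp (- w x) * v x)"
proof -
  note L = open_in_lebesgue[OF UV(1)] open_in_lebesgue[OF UV(2)]
  let ?v = "\<lambda>x. if x \<in> U then v x else 0" and ?\<gamma> = "\<lambda>x. if x \<in> U then \<gamma> x else 0"
  have W: "integrable (lebesgue_on V) (\<lambda>x. exp (- w x) * ?v x)"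
    "(LINT x|lebesgue_on V. g x \<bullet> ?\<gamma> x) = (LINT x|lebesgue_on V. exp (- w x) * ?v x)"
    using w H10_pair_extend[OF UV v] unfolding weak_solution_def by blast+
  have "integrable (lebesgue_on U) (\<lambda>x. exp (- w x) * ?v x)"
    using W(1) by (subst (asm) integrable_on_eq[OF L(2,1)]) (use UV(3) in auto)
  then show "integrable (lebesgue_on U) (\<lambda>x. exp (- w x) * v x)"
    by (rule Bochner_Integration.integrable_cong[THEN iffD1, rotated 2]) auto
  have 1: "(LINT x|lebesgue_on V. g x \<bullet> ?\<gamma> x) = (LINT x|lebesgue_on U. g x \<bullet> ?\<gamma> x)"
    by (rule LINT_on_eq[OF L(2,1)]) (use UV(3) in auto)
  have 2: "(LINT x|lebesgue_on V. exp (- w x) * ?v x) = (LINT x|lebesgue_on U. exp (- w x) * ?v x)"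
    by (rule LINT_on_eq[OF L(2,1)]) (use UV(3) in auto)
  have 3: "(LINT x|lebesgue_on U. g x \<bullet> ?\<gamma> x) = (LINT x|lebesgue_on U. g x \<bullet> \<gamma> x)"
    by (rule Bochner_Integration.integral_cong) auto
  have 4: "(LINT x|lebesgue_on U. exp (- w x) * ?v x) = (LINT x|lebesgue_on U. exp (- w x) * v x)"
    by (rule Bochner_Integration.integral_cong) auto
  show "(LINT x|lebesgue_on U. g x \<bullet> \<gamma> x) = (LINT x|lebesgue_on U. exp (- w x) * v x)"
    using W(2) unfolding 1 2 3 4 .
qed

locale sector_angle =
  fixes \<theta>0 :: real
  assumes \<theta>0: "0 < \<theta>0" "\<theta>0 \<le> pi"
begin

abbreviation \<Omega> :: "(real^2) set" where "\<Omega> \<equiv> sector \<theta>0"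
abbreviation T :: "real \<Rightarrow> (real^2) set" where "T R \<equiv> sector_trunc \<theta>0 R"

lemmas open_T = open_sector_trunc[OF \<theta>0] and open_\<Omega> = open_sector[OF \<theta>0] and bounded_T = bounded_sector_trunc[OF \<theta>0]
lemmas L_T = open_in_lebesgue[OF open_T] and L_\<Omega> = open_in_lebesgue[OF open_\<Omega>]
lemmas fin_T = finite_measure_on_bounded_open[OF open_T bounded_T]

lemma mem_T: "x \<in> T R \<longleftrightarrow> x \<in> \<Omega> \<and> norm x < R" by (simp add: sector_trunc_def)
lemma T_subset: "T R \<subseteq> \<Omega>" by (auto simp: mem_T)
lemma T_mono: "R \<le> R' \<Longrightarrow> T R \<subseteq> T R'" by (auto simp: mem_T)

lemma bounded_subset_T: assumes "bounded V" "V \<subseteq> \<Omega>" obtains k :: nat where "V \<subseteq> T (real k)"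
proof -
  obtain B where B: "\<forall>x\<in>V. norm x \<le> B" using assms(1) bounded_iff by blast
  obtain k :: nat where "B < real k" using reals_Archimedean2 by blast
  then have "V \<subseteq> T (real k)" using B assms(2) by (force simp: mem_T)
  with that show ?thesis by blast
qed

lemma measurable_\<Omega>:
  fixes f :: "real^2 \<Rightarrow> 'b::euclidean_space"
  assumes "\<And>k::nat. f \<in> borel_measurable (lebesgue_on (T (real k)))"
  shows "f \<in> borel_measurable (lebesgue_on \<Omega>)"
proof -
  have "(\<lambda>x. if x \<in> \<Omega> then f x else 0) \<in> borel_measurable lebesgue"
  proof (rule borel_measurable_LIMSEQ_metric)
    show "(\<lambda>x. if x \<in> T (real k) then f x else 0) \<in> borel_measurable lebesgue" for k
      using assms[of k] by (simp add: borel_measurable_if[OF L_T])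
    fix x :: "real^2"
    obtain N :: nat where N: "norm x < real N" using reals_Archimedean2 by blast
    have "(if x \<in> T (real k) then f x else 0) = (if x \<in> \<Omega> then f x else 0)" if "k \<ge> N" for k
      using N that by (auto simp: mem_T)
    then show "(\<lambda>k. if x \<in> T (real k) then f x else 0) \<longlonglongrightarrow> (if x \<in> \<Omega> then f x else 0)"
      by (intro tendsto_eventually eventually_sequentiallyI[of N])
  qed
  then show ?thesis by (simp add: borel_measurable_if[OF L_\<Omega>])
qed

section \<open>Functions in \<open>H1\<close> on bounded subsets of the sector, and their comparison
  with solutions\<close>

lemma local_H1D: "f \<in> local_H1 U \<Longrightarrow> open V \<Longrightarrow> bounded V \<Longrightarrow> V \<subseteq> U \<Longrightarrow> f \<in> H1 V"
  by (simp add: local_H1_def)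

text \<open>Membership in \<open>local_H1\<close> gives weak gradients on bounded sets only, whereas
  \<open>wgrad \<Omega> \<phi>\<close> means something only if a weak gradient on all of
  \<open>\<Omega>\<close> exists. The local gradients are glued, and uniqueness up to null sets
  makes them agree on overlaps.\<close>

lemma local_H1_wgrad:
  assumes \<phi>: "\<phi> \<in> local_H1 \<Omega>"
  shows "weak_gradient \<Omega> \<phi> (wgrad \<Omega> \<phi>)" "sq_integrable (lebesgue_on (T R)) \<phi>" "sq_integrable (lebesgue_on (T R)) (wgrad \<Omega> \<phi>)"
    "wgrad \<Omega> \<phi> \<in> borel_measurable (lebesgue_on \<Omega>)" "\<phi> \<in> borel_measurable (lebesgue_on \<Omega>)"
proof -
  have H: "\<phi> \<in> H1 (T R)" for R by (rule local_H1D[OF \<phi> open_T bounded_T T_subset])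
  define W where "W R = wgrad (T R) \<phi>" for R
  have W: "sq_integrable (lebesgue_on (T R)) \<phi>" "sq_integrable (lebesgue_on (T R)) (W R)" "weak_gradient (T R) \<phi> (W R)" for R
    using H[of R] unfolding W_def H1_iff[OF open_T] by simp_all
  \<comment> \<open>The least integer radius whose truncation can contain \<open>x\<close>. Being
    integer-valued, it involves countably many local gradients, so the exceptional sets still form a
    null set.\<close>
  define \<kappa> where "\<kappa> x = Suc (nat \<lfloor>norm x\<rfloor>)" for x :: "real^2"
  have \<kappa>1: "norm x < real (\<kappa> x)" for x unfolding \<kappa>_def by linarith
  have \<kappa>2: "\<kappa> x \<le> k" if "norm x < real k" for x k
  proof -
    have "\<lfloor>norm x\<rfloor> < int k" using that by (simp add: floor_less_iff)
    then show ?thesis by (simp add: \<kappa>_def Suc_le_eq nat_less_iff)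
  qed
  define G where "G x = W (real (\<kappa> x)) x" for x
  have eq: "AE x in lebesgue_on (T (real k)). W (real k) x = G x" for k :: nat
  proof -
    have "AE x in lebesgue. x \<in> T (real j) \<longrightarrow> j \<le> k \<longrightarrow> W (real k) x = W (real j) x" for j :: nat
    proof (cases "j \<le> k")
      case True
      have "weak_gradient (T (real j)) \<phi> (W (real k))"
        by (rule weak_gradient_subset[OF L_T L_T T_mono W(3)]) (use True in simp)
      from weak_gradient_unique[OF open_T this W(3)] show ?thesis
        unfolding AE_on_iff[OF L_T] by eventually_elim simp
    qed simp
    then have "AE x in lebesgue. \<forall>j::nat. x \<in> T (real j) \<longrightarrow> j \<le> k \<longrightarrow> W (real k) x = W (real j) x"
      by (subst AE_all_countable) blast
    then show ?thesis unfolding AE_on_iff[OF L_T] G_def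
    proof eventually_elim
      case (elim x)
      show ?case
      proof
        assume x: "x \<in> T (real k)"
        then have "x \<in> T (real (\<kappa> x))" "\<kappa> x \<le> k" using \<kappa>1 \<kappa>2 by (auto simp: mem_T)
        with elim show "W (real k) x = W (real (\<kappa> x)) x" by blast
      qed
    qed
  qed
  have sG: "sq_integrable (lebesgue_on (T (real k))) G" for k :: nat by (rule sq_integrable_cong_AE[OF L_T W(2) eq])
  have wG: "weak_gradient \<Omega> \<phi> G"
    unfolding weak_gradient_def
  proof (intro conjI allI impI)
    show "locally_integrable_on \<Omega> \<phi>" "locally_integrable_on \<Omega> G"
      unfolding locally_integrable_on_def
    proof (safe)
      fix K :: "(real^2) set" assume K: "compact K" "K \<subseteq> \<Omega>"
      obtain k :: nat where k: "K \<subseteq> T (real k)" using bounded_subset_T[OF compact_imp_bounded[OF K(1)] K(2)] by blast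
      note i = sq_integrable_finite_integrable[OF fin_T]
      show "integrable (lebesgue_on K) \<phi>" by (rule integrable_on_subset[OF compact_in_lebesgue[OF K(1)] L_T k i[OF W(1)]])
      show "integrable (lebesgue_on K) G" by (rule integrable_on_subset[OF compact_in_lebesgue[OF K(1)] L_T k i[OF sG]])
    qed
    fix \<psi> assume "test_function \<Omega> \<psi>"
    then obtain K where K: "smooth \<psi>" "compact K" "K \<subseteq> \<Omega>" "\<And>x. x \<notin> K \<Longrightarrow> \<psi> x = 0" "\<And>x. x \<notin> K \<Longrightarrow> grad \<psi> x = 0"
      using test_functionE by metis
    obtain k :: nat where k: "K \<subseteq> T (real k)" using bounded_subset_T[OF compact_imp_bounded[OF K(2)] K(3)] by blast
    have t: "test_function (T (real k)) \<psi>" unfolding test_function_def using K k by blast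
    have "(LINT x|lebesgue_on \<Omega>. \<phi> x *\<^sub>R grad \<psi> x) = (LINT x|lebesgue_on (T (real k)). \<phi> x *\<^sub>R grad \<psi> x)"
      by (rule LINT_on_eq[OF L_\<Omega> L_T]) (use K k T_subset in auto)
    also have "\<dots> = - (LINT x|lebesgue_on (T (real k)). \<psi> x *\<^sub>R W (real k) x)"
      using W(3)[of "real k"] t unfolding weak_gradient_def by blast
    also have "(LINT x|lebesgue_on (T (real k)). \<psi> x *\<^sub>R W (real k) x) = (LINT x|lebesgue_on (T (real k)). \<psi> x *\<^sub>R G x)"
    proof (rule integral_cong_AE)
      show "AE x in lebesgue_on (T (real k)). \<psi> x *\<^sub>R W (real k) x = \<psi> x *\<^sub>R G x" using eq[of k] by eventually_elim simp
    qed (intro borel_measurable_scaleR continuous_measurable_on smooth_continuous K(1) sq_integrable_measurable[OF W(2)] sq_integrable_measurable[OF sG])+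
    also have "\<dots> = (LINT x|lebesgue_on \<Omega>. \<psi> x *\<^sub>R G x)"
      by (rule LINT_on_eq[OF L_T L_\<Omega>]) (use K k T_subset in auto)
    finally show "(LINT x|lebesgue_on \<Omega>. \<phi> x *\<^sub>R grad \<psi> x) = - (LINT x|lebesgue_on \<Omega>. \<psi> x *\<^sub>R G x)" .
  qed
  show w: "weak_gradient \<Omega> \<phi> (wgrad \<Omega> \<phi>)" by (rule wgrad_weak_gradient[OF wG])
  show "sq_integrable (lebesgue_on (T R)) \<phi>" by (rule W(1))
  have s: "sq_integrable (lebesgue_on (T R)) (wgrad \<Omega> \<phi>)" for R
  proof (rule sq_integrable_cong_AE[OF L_T W(2)])
    show "AE x in lebesgue_on (T R). W R x = wgrad \<Omega> \<phi> x"
      by (rule weak_gradient_unique[OF open_T W(3) weak_gradient_subset[OF L_\<Omega> L_T T_subset w]])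
  qed
  then show "sq_integrable (lebesgue_on (T R)) (wgrad \<Omega> \<phi>)" .
  show "wgrad \<Omega> \<phi> \<in> borel_measurable (lebesgue_on \<Omega>)" by (intro measurable_\<Omega> sq_integrable_measurable[OF s])
  show "\<phi> \<in> borel_measurable (lebesgue_on \<Omega>)" by (intro measurable_\<Omega> sq_integrable_measurable[OF W(1)])
qed

text \<open>No trace condition: solutions and supersolutions both qualify, and the comparison only uses
  the sign of \<open>\<phi>\<close>.\<close>

definition supersol :: "(real^2 \<Rightarrow> real) \<Rightarrow> bool" where
  "supersol \<phi> \<longleftrightarrow> \<phi> \<in> local_H1 \<Omega> \<and> (AE x in lebesgue_on \<Omega>. 0 \<le> \<phi> x) \<and>
     (\<forall>v\<in>H10 \<Omega>. bounded_support_on \<Omega> v \<and> (AE x in lebesgue_on \<Omega>. 0 \<le> v x) \<longrightarrow>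
        (LINT x|lebesgue_on \<Omega>. exp (- \<phi> x) * v x) \<le> (LINT x|lebesgue_on \<Omega>. wgrad \<Omega> \<phi> x \<bullet> wgrad \<Omega> v x))"

lemma nonneg_solution_supersol: "nonneg_solution \<theta>0 \<phi> \<Longrightarrow> supersol \<phi>"
  unfolding supersol_def nonneg_solution_def local_variational_solution_def Let_def by simp

lemma nonneg_supersolution_supersol: "nonneg_supersolution \<theta>0 \<phi> \<Longrightarrow> supersol \<phi>"
  unfolding supersol_def nonneg_supersolution_def local_variational_supersolution_def Let_def by simp

text \<open>Test pairs on the truncation are extended by zero to the whole sector; the extension has
  bounded support and is admissible for \<open>supersol\<close>. The rest translates between
  \<open>wgrad\<close> on the sector and the extended gradient.\<close>

lemma weak_solution_le_supersol:
  assumes w: "weak_solution (T R) w g" and \<phi>: "supersol \<phi>"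
  shows "AE x in lebesgue_on (T R). w x \<le> \<phi> x"
proof -
  have lh: "\<phi> \<in> local_H1 \<Omega>" and nn: "AE x in lebesgue_on \<Omega>. 0 \<le> \<phi> x" using \<phi> by (auto simp: supersol_def)
  note W = local_H1_wgrad[OF lh]
  show ?thesis
  proof (rule comparison_H1[OF open_T bounded_T w W(2,3) weak_gradient_subset[OF L_\<Omega> L_T T_subset W(1)]])
    show "AE x in lebesgue_on (T R). 0 \<le> \<phi> x" by (rule AE_on_subset[OF L_T L_\<Omega> T_subset nn])
    fix v \<gamma> assume v: "H10_pair (T R) v \<gamma>" and v0: "\<And>x. 0 \<le> v x"
    let ?v = "\<lambda>x. if x \<in> T R then v x else 0" and ?\<gamma> = "\<lambda>x. if x \<in> T R then \<gamma> x else 0"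
    have p: "H10_pair \<Omega> ?v ?\<gamma>" by (rule H10_pair_extend[OF open_T open_\<Omega> T_subset v])
    note h = H10_pair_wgrad[OF open_\<Omega> p]
    have "bounded_support_on \<Omega> ?v"
      unfolding bounded_support_on_def by (rule exI[of _ R]) (auto simp: mem_T intro!: AE_I2)
    moreover have "AE x in lebesgue_on \<Omega>. 0 \<le> ?v x" using v0 by (intro AE_I2) simp
    ultimately have le: "(LINT x|lebesgue_on \<Omega>. exp (- \<phi> x) * ?v x) \<le> (LINT x|lebesgue_on \<Omega>. wgrad \<Omega> \<phi> x \<bullet> wgrad \<Omega> ?v x)"
      using \<phi> h(1) unfolding supersol_def by blast
    have m: "wgrad \<Omega> ?v \<in> borel_measurable (lebesgue_on \<Omega>)"
      using h(1) H10_pair_sq_integrable(2) sq_integrable_measurable unfolding H10_iff[OF open_\<Omega>] by blast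
    have "(LINT x|lebesgue_on \<Omega>. wgrad \<Omega> \<phi> x \<bullet> wgrad \<Omega> ?v x) = (LINT x|lebesgue_on \<Omega>. wgrad \<Omega> \<phi> x \<bullet> ?\<gamma> x)"
    proof (rule integral_cong_AE)
      show "AE x in lebesgue_on \<Omega>. wgrad \<Omega> \<phi> x \<bullet> wgrad \<Omega> ?v x = wgrad \<Omega> \<phi> x \<bullet> ?\<gamma> x" using h(2) by eventually_elim simp
    qed (intro borel_measurable_inner W(4) m sq_integrable_measurable[OF H10_pair_sq_integrable(2)[OF p]])+
    also have "\<dots> = (LINT x|lebesgue_on (T R). wgrad \<Omega> \<phi> x \<bullet> ?\<gamma> x)"
      by (rule LINT_on_eq[OF L_\<Omega> L_T]) (use T_subset in auto)
    also have "\<dots> = (LINT x|lebesgue_on (T R). wgrad \<Omega> \<phi> x \<bullet> \<gamma> x)"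
      by (rule Bochner_Integration.integral_cong) auto
    finally have 1: "(LINT x|lebesgue_on \<Omega>. wgrad \<Omega> \<phi> x \<bullet> wgrad \<Omega> ?v x) = (LINT x|lebesgue_on (T R). wgrad \<Omega> \<phi> x \<bullet> \<gamma> x)" .
    have "(LINT x|lebesgue_on \<Omega>. exp (- \<phi> x) * ?v x) = (LINT x|lebesgue_on (T R). exp (- \<phi> x) * ?v x)"
      by (rule LINT_on_eq[OF L_\<Omega> L_T]) (use T_subset in auto)
    also have "\<dots> = (LINT x|lebesgue_on (T R). exp (- \<phi> x) * v x)"
      by (rule Bochner_Integration.integral_cong) auto
    finally show "(LINT x|lebesgue_on (T R). exp (- \<phi> x) * v x) \<le> (LINT x|lebesgue_on (T R). wgrad \<Omega> \<phi> x \<bullet> \<gamma> x)"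
      using le 1 by simp
  qed
qed

end

text \<open>Existence of the approximations is taken as known. Continuity fixes their
  representatives, without which a pointwise supremum of Sobolev functions would have no
  meaning.\<close>

locale exhaustion = sector_angle +
  fixes uR :: "real \<Rightarrow> real^2 \<Rightarrow> real" and u :: "real^2 \<Rightarrow> real"
  assumes sol: "\<And>R. 0 < R \<Longrightarrow> variational_solution (T R) (uR R)"
    and cont: "\<And>R. 0 < R \<Longrightarrow> continuous_on (T R) (uR R)"
    and u_eq: "\<And>x. x \<in> \<Omega> \<Longrightarrow> u x = (SUP R\<in>{R. x \<in> T R}. uR R x)"
begin

abbreviation gR :: "real \<Rightarrow> real^2 \<Rightarrow> real^2" where "gR R \<equiv> wgrad (T R) (uR R)"

lemma uR_weak_solution: "0 < R \<Longrightarrow> weak_solution (T R) (uR R) (gR R)"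
  by (rule variational_solution_weak[OF open_T sol])

lemma uR_H10_pair: "0 < R \<Longrightarrow> H10_pair (T R) (uR R) (gR R)"
  using uR_weak_solution by (simp add: weak_solution_def)

lemma T_pos: "x \<in> T R \<Longrightarrow> 0 < R"
  using le_less_trans[OF norm_ge_zero] by (auto simp: mem_T)

lemma uR_nonneg: assumes "x \<in> T R" shows "0 \<le> uR R x"
  by (rule AE_le_imp_le_on_open[OF open_T _ cont weak_solution_nonneg[OF open_T uR_weak_solution] assms])
     (use T_pos[OF assms] in auto)

text \<open>On the smaller truncation the solution with the larger radius satisfies the same
  equation, with non-negative instead of zero values on the arc.\<close>

lemma uR_mono:
  assumes x: "x \<in> T R" and "R \<le> R'" shows "uR R x \<le> uR R' x"
proof -
  have R: "0 < R" "0 < R'" using T_pos[OF x] assms(2) by auto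
  note sub = T_mono[OF \<open>R \<le> R'\<close>]
  have "AE x in lebesgue_on (T R). uR R x \<le> uR R' x"
  proof (rule comparison_H1[OF open_T bounded_T uR_weak_solution[OF R(1)]])
    show "sq_integrable (lebesgue_on (T R)) (uR R')" "sq_integrable (lebesgue_on (T R)) (gR R')"
      by (rule sq_integrable_on_subset[OF L_T L_T sub H10_pair_sq_integrable(1)[OF uR_H10_pair[OF R(2)]]],
          rule sq_integrable_on_subset[OF L_T L_T sub H10_pair_sq_integrable(2)[OF uR_H10_pair[OF R(2)]]])
    show "weak_gradient (T R) (uR R') (gR R')"
      by (rule weak_gradient_subset[OF L_T L_T sub H10_pair_weak_gradient[OF open_T uR_H10_pair[OF R(2)]]])
    show "AE x in lebesgue_on (T R). 0 \<le> uR R' x" using sub uR_nonneg by (intro AE_I2) auto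
    show "(LINT x|lebesgue_on (T R). exp (- uR R' x) * v x) \<le> (LINT x|lebesgue_on (T R). gR R' x \<bullet> \<gamma> x)"
      if "H10_pair (T R) v \<gamma>" for v \<gamma>
      using weak_solution_restrict(2)[OF open_T open_T sub uR_weak_solution[OF R(2)] that] by simp
  qed
  then show ?thesis
    by (rule AE_le_imp_le_on_open[OF open_T cont[OF R(1)] continuous_on_subset[OF cont[OF R(2)] sub] _ x])
qed

definition C0 :: real where "C0 = ln 4 + 4 * ln 2"

lemma C0_nonneg: "0 \<le> C0" by (simp add: C0_def)

lemma uR_bound: assumes "x \<in> T R" shows "uR R x \<le> C0 + 4 * ln (1 + norm x)"
  using weak_solution_le_barrier[OF \<theta>0 uR_weak_solution cont assms] T_pos[OF assms] by (simp add: C0_def)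

lemma uR_bdd_above: "bdd_above ((\<lambda>R. uR R x) ` {R. x \<in> T R})"
  using uR_bound by (intro bdd_aboveI2[where M="C0 + 4 * ln (1 + norm x)"]) auto

lemma index_nonempty: "x \<in> \<Omega> \<Longrightarrow> {R. x \<in> T R} \<noteq> {}"
  by (auto simp: mem_T intro!: exI[of _ "norm x + 1"])

lemma uR_le_u: assumes "x \<in> T R" shows "uR R x \<le> u x"
proof -
  have "x \<in> \<Omega>" using assms by (simp add: mem_T)
  then show ?thesis unfolding u_eq[OF \<open>x \<in> \<Omega>\<close>] by (intro cSUP_upper uR_bdd_above) (use assms in simp)
qed

lemma u_least: assumes "x \<in> \<Omega>" "\<And>R. x \<in> T R \<Longrightarrow> uR R x \<le> B" shows "u x \<le> B"
  unfolding u_eq[OF assms(1)] by (rule cSUP_least[OF index_nonempty[OF assms(1)]]) (use assms(2) in simp)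

lemma u_bound: "x \<in> \<Omega> \<Longrightarrow> u x \<le> C0 + 4 * ln (1 + norm x)"
  by (rule u_least) (auto intro: uR_bound)

lemma u_nonneg: assumes "x \<in> \<Omega>" shows "0 \<le> u x"
proof -
  have x: "x \<in> T (norm x + 1)" using assms by (simp add: mem_T)
  from uR_nonneg[OF x] uR_le_u[OF x] show ?thesis by linarith
qed

text \<open>Integer radii suffice for the limit, and \<open>Suc\<close> keeps them positive;
  \<open>un n\<close> is a solution on \<open>T (real (Suc n))\<close>.\<close>

definition un :: "nat \<Rightarrow> real^2 \<Rightarrow> real" where "un n = uR (real (Suc n))"
definition gn :: "nat \<Rightarrow> real^2 \<Rightarrow> real^2" where "gn n = gR (real (Suc n))"

lemma un_ws: "weak_solution (T (real (Suc n))) (un n) (gn n)"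
  unfolding un_def gn_def by (rule uR_weak_solution) simp

lemma un_pair: "H10_pair (T (real (Suc n))) (un n) (gn n)"
  unfolding un_def gn_def by (rule uR_H10_pair) simp

text \<open>By monotonicity in the radius, the integer radii attain the supremum over all radii in
  the limit.\<close>

lemma un_tendsto: assumes "x \<in> \<Omega>" shows "(\<lambda>n. un n x) \<longlonglongrightarrow> u x"
proof (rule LIMSEQ_I)
  fix e :: real assume "e > 0"
  then have "u x - e < (SUP R\<in>{R. x \<in> T R}. uR R x)" using u_eq[OF assms] by simp
  then obtain R where R: "x \<in> T R" "u x - e < uR R x"
    using less_cSUP_iff[OF index_nonempty[OF assms] uR_bdd_above] by blast
  obtain N :: nat where N: "R < real N" using reals_Archimedean2 by blast
  have "norm (un n x - u x) < e" if "n \<ge> N" for n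
  proof -
    have le: "R \<le> real (Suc n)" using N that by simp
    have "uR R x \<le> un n x" unfolding un_def by (rule uR_mono[OF R(1) le])
    moreover have "un n x \<le> u x" unfolding un_def using T_mono[OF le] R(1) by (intro uR_le_u) blast
    ultimately show ?thesis using R(2) by simp
  qed
  then show "\<exists>no. \<forall>n\<ge>no. norm (un n x - u x) < e" by blast
qed

section \<open>Strong convergence of the approximations and of their gradients on bounded
  sets\<close>

lemma un_sq_integrable: "k \<le> Suc n \<Longrightarrow> sq_integrable (lebesgue_on (T (real k))) (un n)"
  by (rule sq_integrable_on_subset[OF L_T L_T T_mono H10_pair_sq_integrable(1)[OF un_pair]]) simp

lemma gn_sq_integrable: "k \<le> Suc n \<Longrightarrow> sq_integrable (lebesgue_on (T (real k))) (gn n)"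
  by (rule sq_integrable_on_subset[OF L_T L_T T_mono H10_pair_sq_integrable(2)[OF un_pair]]) simp

text \<open>The index shift by \<open>k\<close> ensures that every member is a solution on a set
  containing \<open>T (real k)\<close>. The logarithmic bound gives a constant majorant
  there.\<close>

lemma un_L2_conv: "L2_conv (lebesgue_on (T (real k))) (\<lambda>n. un (n + k)) u"
proof (rule L2_conv_dominated[where w="\<lambda>x. (C0 + 4 * ln (1 + real k))\<^sup>2"])
  have lim: "(\<lambda>n. un (n + k) x) \<longlonglongrightarrow> u x" if "x \<in> T (real k)" for x
    using that by (intro LIMSEQ_ignore_initial_segment un_tendsto) (simp add: mem_T)
  show m: "un (n + k) \<in> borel_measurable (lebesgue_on (T (real k)))" for n by (intro sq_integrable_measurable[OF un_sq_integrable]) simp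
  show "u \<in> borel_measurable (lebesgue_on (T (real k)))"
    by (rule borel_measurable_LIMSEQ_metric[OF m]) (use lim in simp)
  show "AE x in lebesgue_on (T (real k)). (\<lambda>n. un (n + k) x) \<longlonglongrightarrow> u x" using lim by (intro AE_I2) simp
  show "AE x in lebesgue_on (T (real k)). (norm (un (n + k) x))\<^sup>2 \<le> (C0 + 4 * ln (1 + real k))\<^sup>2" for n
  proof (rule AE_I2)
    fix x assume "x \<in> space (lebesgue_on (T (real k)))"
    then have x: "x \<in> T (real k)" by simp
    then have x': "x \<in> T (real (Suc (n + k)))" using T_mono[of "real k" "real (Suc (n + k))"] by auto
    have "ln (1 + norm x) \<le> ln (1 + real k)" using x by (subst ln_le_cancel_iff) (auto simp: mem_T add_pos_nonneg)
    then have "\<bar>un (n + k) x\<bar> \<le> C0 + 4 * ln (1 + real k)"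
      using uR_bound[OF x'] uR_nonneg[OF x'] by (simp add: un_def)
    then show "(norm (un (n + k) x))\<^sup>2 \<le> (C0 + 4 * ln (1 + real k))\<^sup>2" by (intro power_mono) auto
  qed
  show "integrable (lebesgue_on (T (real k))) (\<lambda>x. (C0 + 4 * ln (1 + real k))\<^sup>2)"
    by (rule finite_measure.integrable_const[OF fin_T])
qed

text \<open>The difference is tested with \<open>\<eta>\<^sup>2 * (un m - un n)\<close>; the nonlinear terms have a good sign. This
  gives strong convergence of the gradients without any compactness.\<close>

lemma caccioppoli:
  obtains B where "B \<ge> 0"
    "\<And>m n. k + 3 \<le> m \<Longrightarrow> k + 3 \<le> n \<Longrightarrow> (LINT x|lebesgue_on (T (real k)). (norm (gn m x - gn n x))\<^sup>2)
       \<le> B * (LINT x|lebesgue_on (T (real (k + 3))). (norm (un m x - un n x))\<^sup>2)"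
proof -
  obtain \<eta> :: "real^2 \<Rightarrow> real" where \<eta>: "smooth \<eta>" "\<And>x. norm x \<le> real k \<Longrightarrow> \<eta> x = 1" "\<And>x. x \<notin> cball 0 (real k + 2) \<Longrightarrow> \<eta> x = 0"
    using smooth_cutoff[of "real k", where 'a="real^2"] by blast
  have "open (- cball (0::real^2) (real k + 2))" by (simp add: open_Compl)
  then have g0: "grad \<eta> x = 0" if "x \<notin> cball 0 (real k + 2)" for x by (rule grad_zero_open) (use that \<eta>(3) in auto)
  obtain b where b: "b > 0" "\<And>x. norm (grad \<eta> x) \<le> b"
    using cc_bounded[OF smooth_grad_continuous[OF \<eta>(1)], of "real k + 2"] g0 by (metis mem_cball_0 not_le)
  obtain c where c: "\<And>x. norm (\<eta> x) \<le> c"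
    using cc_bounded[OF smooth_continuous[OF \<eta>(1)], of "real k + 2"] \<eta>(3) by (metis mem_cball_0 not_le)
  \<comment> \<open>With the squared cutoff, the gradient \<open>2 * \<eta> * grad \<eta>\<close>
    keeps one factor \<eta>, so the mixed term can be absorbed into the squared norm of
    \<open>\<eta> x *\<^sub>R d x\<close>.\<close>
  define \<zeta> where "\<zeta> x = \<eta> x * \<eta> x" for x
  have \<zeta>: "smooth \<zeta>" "\<And>x. x \<notin> cball 0 (real k + 2) \<Longrightarrow> \<zeta> x = 0"
    unfolding \<zeta>_def[abs_def] using \<eta> by (auto intro: smooth_mult)
  have g\<zeta>: "grad \<zeta> x = (2 * \<eta> x) *\<^sub>R grad \<eta> x" for x
    unfolding \<zeta>_def[abs_def] using grad_mult[OF \<eta>(1) \<eta>(1)] by (simp add: scaleR_2[symmetric])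
  \<comment> \<open>The cutoff is supported in the closed ball of radius \<open>k + 2\<close>;
    radius \<open>k + 3\<close> leaves room around it, so multiplication by the cutoff removes the
    arc.\<close>
  let ?U = "T (real (k + 3))"
  let ?M = "lebesgue_on ?U"
  have "(LINT x|lebesgue_on (T (real k)). (norm (gn m x - gn n x))\<^sup>2) \<le> 4 * b\<^sup>2 * (LINT x|?M. (norm (un m x - un n x))\<^sup>2)"
    if mn: "k + 3 \<le> m" "k + 3 \<le> n" for m n
  proof -
    have sub: "?U \<subseteq> T (real (Suc m))" "?U \<subseteq> T (real (Suc n))" using mn by (auto intro!: T_mono)
    have cut: "H10_pair ?U (\<lambda>x. \<zeta> x * un j x) (\<lambda>x. \<zeta> x *\<^sub>R gn j x + un j x *\<^sub>R grad \<zeta> x)" if "?U \<subseteq> T (real (Suc j))" for j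
      by (rule H10_pair_cutoff[OF open_T open_T that _ compact_cball[of 0 "real k + 2"] \<zeta> un_pair]) (auto simp: mem_T)
    define w where "w x = un m x - un n x" for x
    define d where "d x = gn m x - gn n x" for x
    define v where "v x = \<zeta> x * un m x - \<zeta> x * un n x" for x
    define \<gamma> where "\<gamma> x = (\<zeta> x *\<^sub>R gn m x + un m x *\<^sub>R grad \<zeta> x) - (\<zeta> x *\<^sub>R gn n x + un n x *\<^sub>R grad \<zeta> x)" for x
    have p: "H10_pair ?U v \<gamma>" unfolding v_def[abs_def] \<gamma>_def[abs_def] by (rule H10_pair_diff[OF cut[OF sub(1)] cut[OF sub(2)]])
    note wm = weak_solution_restrict[OF open_T open_T sub(1) un_ws p] and wn = weak_solution_restrict[OF open_T open_T sub(2) un_ws p]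
    have k3: "k + 3 \<le> Suc m" "k + 3 \<le> Suc n" using mn by auto
    have sw: "sq_integrable ?M w" unfolding w_def[abs_def] by (rule sq_integrable_diff[OF un_sq_integrable[OF k3(1)] un_sq_integrable[OF k3(2)]])
    have sd: "sq_integrable ?M d" unfolding d_def[abs_def] by (rule sq_integrable_diff[OF gn_sq_integrable[OF k3(1)] gn_sq_integrable[OF k3(2)]])
    have s\<eta>: "sq_integrable ?M (\<lambda>x. \<eta> x *\<^sub>R d x)"
      by (rule sq_integrable_scaleR_bounded[where B=c, OF continuous_measurable_on[OF smooth_continuous[OF \<eta>(1)]] _ sd]) (use c in auto)
    have i: "integrable ?M (\<lambda>x. gn m x \<bullet> \<gamma> x)" "integrable ?M (\<lambda>x. gn n x \<bullet> \<gamma> x)"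
      by (rule sq_integrable_inner_integrable[OF gn_sq_integrable[OF k3(1)] H10_pair_sq_integrable(2)[OF p]], rule sq_integrable_inner_integrable[OF gn_sq_integrable[OF k3(2)] H10_pair_sq_integrable(2)[OF p]])
    have i1: "integrable ?M (\<lambda>x. (norm (\<eta> x *\<^sub>R d x))\<^sup>2)" by (rule sq_integrable_integrable[OF s\<eta>])
    have i2: "integrable ?M (\<lambda>x. (norm (w x))\<^sup>2)" by (rule sq_integrable_integrable[OF sw])
    have "(LINT x|?M. (norm (\<eta> x *\<^sub>R d x))\<^sup>2 / 2 - 2 * b\<^sup>2 * (norm (w x))\<^sup>2) \<le> (LINT x|?M. gn m x \<bullet> \<gamma> x - gn n x \<bullet> \<gamma> x)"
    proof (rule integral_mono)
      fix x
      have \<gamma>: "\<gamma> x = (\<eta> x * \<eta> x) *\<^sub>R d x + (2 * \<eta> x * w x) *\<^sub>R grad \<eta> x"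
        by (simp add: \<gamma>_def d_def w_def g\<zeta> \<zeta>_def algebra_simps)
      define q where "q = \<eta> x *\<^sub>R d x"
      define h where "h = w x *\<^sub>R grad \<eta> x"
      have "gn m x \<bullet> \<gamma> x - gn n x \<bullet> \<gamma> x = d x \<bullet> \<gamma> x" by (simp add: d_def inner_diff_left)
      also have "\<dots> = q \<bullet> q + 2 * (q \<bullet> h)" unfolding \<gamma> q_def h_def by (simp add: inner_add_right)
      \<comment> \<open>The squared norm of \<open>q + 2 *\<^sub>R h\<close> is non-negative. Half
        of the squared norm of \<open>q\<close> survives, which leads to the constant
        \<open>4 * b\<^sup>2\<close>.\<close>
      also have "\<dots> \<ge> (norm q)\<^sup>2 / 2 - 2 * (norm h)\<^sup>2"
      proof -
        have "0 \<le> (q + 2 *\<^sub>R h) \<bullet> (q + 2 *\<^sub>R h)" by simp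
        also have "\<dots> = q \<bullet> q + 4 * (q \<bullet> h) + 4 * (h \<bullet> h)"
          by (simp add: inner_add_left inner_add_right inner_commute)
        finally show ?thesis by (simp add: power2_norm_eq_inner)
      qed
      finally have 1: "(norm q)\<^sup>2 / 2 - 2 * (norm h)\<^sup>2 \<le> gn m x \<bullet> \<gamma> x - gn n x \<bullet> \<gamma> x" .
      have "(norm h)\<^sup>2 = (norm (w x))\<^sup>2 * (norm (grad \<eta> x))\<^sup>2" by (simp add: h_def power_mult_distrib)
      also have "\<dots> \<le> (norm (w x))\<^sup>2 * b\<^sup>2" using b by (intro mult_left_mono power_mono) auto
      finally have "(norm h)\<^sup>2 \<le> (norm (w x))\<^sup>2 * b\<^sup>2" .
      moreover have "2 * b\<^sup>2 * (norm (w x))\<^sup>2 = 2 * ((norm (w x))\<^sup>2 * b\<^sup>2)" by simp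
      ultimately show "(norm (\<eta> x *\<^sub>R d x))\<^sup>2 / 2 - 2 * b\<^sup>2 * (norm (w x))\<^sup>2 \<le> gn m x \<bullet> \<gamma> x - gn n x \<bullet> \<gamma> x"
        using 1 unfolding q_def by linarith
    qed (use i i1 i2 in auto)
    also have "\<dots> = (LINT x|?M. exp (- un m x) * v x - exp (- un n x) * v x)" using i wm wn by simp
    also have "\<dots> \<le> 0"
    proof (rule LINT_nonpos)
      fix x
      have v: "v x = \<zeta> x * (un m x - un n x)" by (simp add: v_def right_diff_distrib)
      have "0 \<le> \<zeta> x" by (simp add: \<zeta>_def)
      moreover have "(exp (- un m x) - exp (- un n x)) * (un m x - un n x) \<le> 0"
        by (cases "un m x \<le> un n x") (auto intro: mult_nonneg_nonpos mult_nonpos_nonneg)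
      ultimately have "\<zeta> x * ((exp (- un m x) - exp (- un n x)) * (un m x - un n x)) \<le> 0"
        by (rule mult_nonneg_nonpos)
      then show "exp (- un m x) * v x - exp (- un n x) * v x \<le> 0" unfolding v by (simp add: algebra_simps)
    qed
    finally have "(LINT x|?M. (norm (\<eta> x *\<^sub>R d x))\<^sup>2) \<le> 4 * b\<^sup>2 * (LINT x|?M. (norm (w x))\<^sup>2)"
      using i1 i2 by simp
    moreover have "(LINT x|lebesgue_on (T (real k)). (norm (d x))\<^sup>2) \<le> (LINT x|?M. (norm (\<eta> x *\<^sub>R d x))\<^sup>2)"
    proof (rule integral_mono_lebesgue_on_AE[OF i1])
      show "AE x in lebesgue_on (T (real k)). (norm (d x))\<^sup>2 \<le> (norm (\<eta> x *\<^sub>R d x))\<^sup>2"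
        using \<eta>(2) by (intro AE_I2) (simp add: mem_T)
      show "T (real k) \<subseteq> ?U" by (rule T_mono) simp
    qed (use L_T in auto)
    ultimately show ?thesis by (simp add: d_def w_def)
  qed
  with that[of "4 * b\<^sup>2"] show ?thesis by simp
qed

text \<open>The Caccioppoli estimate turns convergence of \<open>un\<close> on a slightly larger set
  into the Cauchy property of the gradients. The limit stays anonymous until \<open>u\<close> is
  known to be locally in \<open>H1\<close>.\<close>

lemma gn_L2_conv: "\<exists>G. L2_conv (lebesgue_on (T (real k))) (\<lambda>n. gn (n + (k + 3))) G"
proof (rule L2_conv_complete[OF fin_T])
  show "sq_integrable (lebesgue_on (T (real k))) (gn (n + (k + 3)))" for n by (rule gn_sq_integrable) simp
  fix e :: real assume e: "e > 0"
  obtain B where B: "B \<ge> 0" "\<And>m n. k + 3 \<le> m \<Longrightarrow> k + 3 \<le> n \<Longrightarrow> (LINT x|lebesgue_on (T (real k)). (norm (gn m x - gn n x))\<^sup>2)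
       \<le> B * (LINT x|lebesgue_on (T (real (k + 3))). (norm (un m x - un n x))\<^sup>2)"
    using caccioppoli[of k] by blast
  let ?M = "lebesgue_on (T (real (k + 3)))"
  let ?I = "\<lambda>n. LINT x|?M. (norm (un (n + (k + 3)) x - u x))\<^sup>2"
  note c = un_L2_conv[of "k + 3"]
  \<comment> \<open>The two halves of the triangle estimate add up to \<open>e / (B + 1)\<close>,
    which multiplied by \<open>B\<close> stays below \<open>e\<close>, also when
    \<open>B = 0\<close>.\<close>
  have "e / (4 * (B + 1)) > 0" using e B(1) by simp
  then have "\<forall>\<^sub>F n in sequentially. ?I n < e / (4 * (B + 1))" by (rule order_tendstoD(2)[OF L2_conv_tendsto[OF c]])
  then obtain N where N: "\<And>n. n \<ge> N \<Longrightarrow> ?I n < e / (4 * (B + 1))" by (auto simp: eventually_sequentially)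
  have "(LINT x|lebesgue_on (T (real k)). (norm (gn (i + (k + 3)) x - gn (j + (k + 3)) x))\<^sup>2) < e" if "i \<ge> N" "j \<ge> N" for i j
  proof -
    have s: "sq_integrable ?M (\<lambda>x. un (n + (k + 3)) x - u x)" for n by (rule sq_integrable_diff[OF L2_conv_sq_integrable[OF c]])
    have "(LINT x|?M. (norm (un (i + (k + 3)) x - un (j + (k + 3)) x))\<^sup>2)
        \<le> (LINT x|?M. 2 * (norm (un (i + (k + 3)) x - u x))\<^sup>2 + 2 * (norm (un (j + (k + 3)) x - u x))\<^sup>2)"
    proof (rule integral_mono)
      show "integrable ?M (\<lambda>x. (norm (un (i + (k + 3)) x - un (j + (k + 3)) x))\<^sup>2)"
        by (intro sq_integrable_integrable sq_integrable_diff L2_conv_sq_integrable(1)[OF c])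
      show "integrable ?M (\<lambda>x. 2 * (norm (un (i + (k + 3)) x - u x))\<^sup>2 + 2 * (norm (un (j + (k + 3)) x - u x))\<^sup>2)"
        using sq_integrable_integrable[OF s[of i]] sq_integrable_integrable[OF s[of j]] by simp
      show "(norm (un (i + (k + 3)) x - un (j + (k + 3)) x))\<^sup>2 \<le> 2 * (norm (un (i + (k + 3)) x - u x))\<^sup>2 + 2 * (norm (un (j + (k + 3)) x - u x))\<^sup>2" for x
        using norm_diff_sq_le[of "un (i + (k + 3)) x - u x" "un (j + (k + 3)) x - u x"] by simp
    qed
    also have "\<dots> = 2 * ?I i + 2 * ?I j" using sq_integrable_integrable[OF s[of i]] sq_integrable_integrable[OF s[of j]] by simp
    also have "\<dots> < e / (B + 1)"
    proof -
      have "e / c = 4 * (e / (4 * c))" for c by simp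
      from this[of "B + 1"] obtain q where "e / (B + 1) = 4 * q" "q = e / (4 * (B + 1))" by blast
      then show ?thesis using N[OF that(1)] N[OF that(2)] by simp
    qed
    finally have lt: "(LINT x|?M. (norm (un (i + (k + 3)) x - un (j + (k + 3)) x))\<^sup>2) < e / (B + 1)" .
    have "(LINT x|lebesgue_on (T (real k)). (norm (gn (i + (k + 3)) x - gn (j + (k + 3)) x))\<^sup>2)
        \<le> B * (LINT x|?M. (norm (un (i + (k + 3)) x - un (j + (k + 3)) x))\<^sup>2)" by (rule B(2)) auto
    also have "\<dots> \<le> B * (e / (B + 1))" using lt B(1) by (intro mult_left_mono) auto
    also have "\<dots> < e" using e B(1) by (simp add: field_simps)
    finally show ?thesis .
  qed
  then show "\<exists>N. \<forall>i\<ge>N. \<forall>j\<ge>N. (LINT x|lebesgue_on (T (real k)). (norm (gn (i + (k + 3)) x - gn (j + (k + 3)) x))\<^sup>2) < e"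
    by blast
qed

section \<open>Regularity, equation and boundary values of the limit\<close>

lemma un_L2_conv_shift: "L2_conv (lebesgue_on (T (real k))) (\<lambda>n. un (n + (k + j))) u"
proof -
  have "strict_mono (\<lambda>n. n + j)" by (rule strict_monoI) simp
  from L2_conv_subseq[OF un_L2_conv[of k] this] show ?thesis by (simp add: ac_simps)
qed

lemma u_local_H1: "u \<in> local_H1 \<Omega>"
  unfolding local_H1_def
proof (safe)
  fix V :: "(real^2) set" assume V: "open V" "bounded V" "V \<subseteq> \<Omega>"
  obtain k :: nat where k: "V \<subseteq> T (real k)" using bounded_subset_T[OF V(2,3)] by blast
  obtain G where G: "L2_conv (lebesgue_on (T (real k))) (\<lambda>n. gn (n + (k + 3))) G" using gn_L2_conv by blast
  have w: "weak_gradient (T (real k)) u G"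
  proof (rule L2_conv_weak_gradient[OF L_T un_L2_conv_shift G])
    show "weak_gradient (T (real k)) (un (n + (k + 3))) (gn (n + (k + 3)))" for n
      by (rule weak_gradient_subset[OF L_T L_T T_mono H10_pair_weak_gradient[OF open_T un_pair]]) simp
  qed
  note LV = open_in_lebesgue[OF V(1)]
  show "u \<in> H1 V"
    by (rule H1I[OF sq_integrable_on_subset[OF LV L_T k L2_conv_sq_integrable(2)[OF un_L2_conv]] sq_integrable_on_subset[OF LV L_T k L2_conv_sq_integrable(2)[OF G]]
          weak_gradient_subset[OF L_T LV k w]])
qed

lemmas u_wgrad = local_H1_wgrad[OF u_local_H1]

text \<open>Uniqueness of the weak gradient on each truncation identifies all the local limits with
  one global function.\<close>

lemma gn_L2_conv_wgrad: "L2_conv (lebesgue_on (T (real k))) (\<lambda>n. gn (n + (k + 3))) (wgrad \<Omega> u)"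
proof -
  obtain G where G: "L2_conv (lebesgue_on (T (real k))) (\<lambda>n. gn (n + (k + 3))) G" using gn_L2_conv by blast
  have w: "weak_gradient (T (real k)) u G"
  proof (rule L2_conv_weak_gradient[OF L_T un_L2_conv_shift G])
    show "weak_gradient (T (real k)) (un (n + (k + 3))) (gn (n + (k + 3)))" for n
      by (rule weak_gradient_subset[OF L_T L_T T_mono H10_pair_weak_gradient[OF open_T un_pair]]) simp
  qed
  have "AE x in lebesgue_on (T (real k)). G x = wgrad \<Omega> u x"
    by (rule weak_gradient_unique[OF open_T w weak_gradient_subset[OF L_\<Omega> L_T T_subset u_wgrad(1)]])
  from L2_conv_limit_AE[OF L_T G this] show ?thesis .
qed

text \<open>The test functions approximating \<open>v\<close> on the sector need not have uniformly
  bounded supports. Multiplication by a cutoff that is 1 where \<open>v\<close> lives changes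
  \<open>v\<close> only on a null set and places it in \<open>H10\<close> of a truncation, where the
  equations of all later \<open>un\<close> can be used.\<close>

lemma u_equation:
  assumes v: "v \<in> H10 \<Omega>" "bounded_support_on \<Omega> v"
  shows "integrable (lebesgue_on \<Omega>) (\<lambda>x. exp (- u x) * v x)"
    and "(LINT x|lebesgue_on \<Omega>. wgrad \<Omega> u x \<bullet> wgrad \<Omega> v x) = (LINT x|lebesgue_on \<Omega>. exp (- u x) * v x)"
proof -
  obtain M where M: "AE x in lebesgue_on \<Omega>. M < norm x \<longrightarrow> v x = 0" using v(2) by (auto simp: bounded_support_on_def)
  obtain k :: nat where k: "M < real k" using reals_Archimedean2 by blast
  obtain \<eta> :: "real^2 \<Rightarrow> real" where \<eta>: "smooth \<eta>" "\<And>x. norm x \<le> real k \<Longrightarrow> \<eta> x = 1" "\<And>x. x \<notin> cball 0 (real k + 2) \<Longrightarrow> \<eta> x = 0"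
    using smooth_cutoff[of "real k", where 'a="real^2"] by blast
  have "open (- cball (0::real^2) (real k + 2))" by (simp add: open_Compl)
  then have g0: "grad \<eta> x = 0" if "x \<notin> cball 0 (real k + 2)" for x by (rule grad_zero_open) (use that \<eta>(3) in auto)
  have p: "H10_pair \<Omega> v (wgrad \<Omega> v)" using v(1) by (simp add: H10_iff[OF open_\<Omega>])
  define v' where "v' x = \<eta> x * v x" for x
  define \<gamma> where "\<gamma> x = \<eta> x *\<^sub>R wgrad \<Omega> v x + v x *\<^sub>R grad \<eta> x" for x
  have z: "v' x = 0" "\<gamma> x = 0" if "x \<notin> cball 0 (real k + 2)" for x
    using that \<eta>(3) g0 by (auto simp: v'_def \<gamma>_def)
  let ?U = "T (real (k + 3))"
  have zU: "v' x = 0" "\<gamma> x = 0" if "x \<in> \<Omega> - ?U" for x using that z[of x] by (auto simp: mem_T)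
  have p1: "H10_pair \<Omega> v' \<gamma>" unfolding v'_def[abs_def] \<gamma>_def[abs_def]
    by (rule H10_pair_cutoff[OF open_\<Omega> open_\<Omega> _ _ compact_cball[of 0 "real k + 2"] \<eta>(1,3) p]) auto
  have p2: "H10_pair ?U v' \<gamma>" unfolding v'_def[abs_def] \<gamma>_def[abs_def]
    by (rule H10_pair_cutoff[OF open_T open_\<Omega> T_subset _ compact_cball[of 0 "real k + 2"] \<eta>(1,3) p]) (auto simp: mem_T)
  have vv': "AE x in lebesgue_on \<Omega>. v' x = v x"
    using M
  proof eventually_elim
    case (elim x)
    then show ?case using \<eta>(2)[of x] k by (cases "norm x \<le> real k") (auto simp: v'_def)
  qed
  \<comment> \<open>Both \<gamma> and \<open>wgrad \<Omega> v\<close> are now gradients of the same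
    function, hence equal almost everywhere.\<close>
  have "H10_pair \<Omega> v \<gamma>" by (rule H10_pair_AE[OF L_\<Omega> p1 vv']) auto
  note wv = H10_pair_wgrad(2)[OF open_\<Omega> this]
  let ?M = "lebesgue_on ?U"
  have sub: "?U \<subseteq> T (real (Suc (n + (k + 6))))" for n by (rule T_mono) simp
  note ws' = weak_solution_restrict[OF open_T open_T sub un_ws p2]
  \<comment> \<open>The truncation has radius \<open>k + 3\<close>, and convergence of gradients on
    it is available from index \<open>(k + 3) + 3\<close> on.\<close>
  have g6: "L2_conv ?M (\<lambda>n. gn (n + (k + 6))) (wgrad \<Omega> u)" using gn_L2_conv_wgrad[of "k + 3"] by (simp add: ac_simps)
  have u6: "L2_conv ?M (\<lambda>n. un (n + (k + 6))) u" using un_L2_conv_shift[of "k + 3" 3] by (simp add: ac_simps)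
  have l1: "(\<lambda>n. LINT x|?M. gn (n + (k + 6)) x \<bullet> \<gamma> x) \<longlonglongrightarrow> (LINT x|?M. wgrad \<Omega> u x \<bullet> \<gamma> x)"
    by (rule L2_conv_inner[OF g6 L2_conv_const[OF H10_pair_sq_integrable(2)[OF p2]]])
  have iv: "integrable ?M v'" by (rule sq_integrable_finite_integrable[OF fin_T H10_pair_sq_integrable(1)[OF p2]])
  have um: "u \<in> borel_measurable ?M" by (rule sq_integrable_measurable[OF L2_conv_sq_integrable(2)[OF u6]])
  have iuv: "integrable ?M (\<lambda>x. exp (- u x) * v' x)"
  proof (rule Bochner_Integration.integrable_bound[OF iv])
    show "(\<lambda>x. exp (- u x) * v' x) \<in> borel_measurable ?M" using um borel_measurable_integrable[OF iv] by measurable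
    show "AE x in ?M. norm (exp (- u x) * v' x) \<le> norm (v' x)"
      using u_nonneg by (intro AE_I2) (simp add: mem_T abs_mult mult_left_le_one_le)
  qed
  have l2: "(\<lambda>n. LINT x|?M. exp (- un (n + (k + 6)) x) * v' x) \<longlonglongrightarrow> (LINT x|?M. exp (- u x) * v' x)"
  proof (rule integral_dominated_convergence[where w="\<lambda>x. \<bar>v' x\<bar>"])
    show "(\<lambda>x. exp (- u x) * v' x) \<in> borel_measurable ?M" using iuv by (rule borel_measurable_integrable)
    show "(\<lambda>x. exp (- un (n + (k + 6)) x) * v' x) \<in> borel_measurable ?M" for n
      by (rule borel_measurable_integrable[OF ws'(1)])
    show "integrable ?M (\<lambda>x. \<bar>v' x\<bar>)" using iv by simp
    show "AE x in ?M. (\<lambda>n. exp (- un (n + (k + 6)) x) * v' x) \<longlonglongrightarrow> exp (- u x) * v' x"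
    proof (rule AE_I2)
      fix x assume "x \<in> space ?M"
      then have "x \<in> \<Omega>" by (simp add: mem_T)
      then show "(\<lambda>n. exp (- un (n + (k + 6)) x) * v' x) \<longlonglongrightarrow> exp (- u x) * v' x"
        by (intro tendsto_intros LIMSEQ_ignore_initial_segment un_tendsto)
    qed
    show "AE x in ?M. norm (exp (- un (n + (k + 6)) x) * v' x) \<le> \<bar>v' x\<bar>" for n
    proof (rule AE_I2)
      fix x assume "x \<in> space ?M"
      then have "x \<in> T (real (Suc (n + (k + 6))))" using sub by auto
      then have "0 \<le> un (n + (k + 6)) x" unfolding un_def by (rule uR_nonneg)
      then show "norm (exp (- un (n + (k + 6)) x) * v' x) \<le> \<bar>v' x\<bar>" by (simp add: abs_mult mult_left_le_one_le)
    qed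
  qed
  have main: "(LINT x|?M. wgrad \<Omega> u x \<bullet> \<gamma> x) = (LINT x|?M. exp (- u x) * v' x)"
    using LIMSEQ_unique[OF l1] l2 unfolding ws'(2) by blast
  have sub3: "?U \<subseteq> \<Omega>" by (rule T_subset)
  have iuv': "integrable (lebesgue_on \<Omega>) (\<lambda>x. exp (- u x) * v' x)"
    using iuv by (subst integrable_on_eq[OF L_\<Omega> L_T]) (use zU sub3 in auto)
  have vm: "v \<in> borel_measurable (lebesgue_on \<Omega>)" by (rule sq_integrable_measurable[OF H10_pair_sq_integrable(1)[OF p]])
  have m: "(\<lambda>x. exp (- u x) * v x) \<in> borel_measurable (lebesgue_on \<Omega>)" using vm u_wgrad(5) by measurable
  have ae: "AE x in lebesgue_on \<Omega>. exp (- u x) * v' x = exp (- u x) * v x" using vv' by eventually_elim simp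
  show "integrable (lebesgue_on \<Omega>) (\<lambda>x. exp (- u x) * v x)"
    using integrable_cong_AE[OF borel_measurable_integrable[OF iuv'] m ae] iuv' by blast
  have "(LINT x|lebesgue_on \<Omega>. exp (- u x) * v x) = (LINT x|lebesgue_on \<Omega>. exp (- u x) * v' x)"
    using integral_cong_AE[OF borel_measurable_integrable[OF iuv'] m ae] by simp
  also have "\<dots> = (LINT x|?M. exp (- u x) * v' x)"
    by (rule LINT_on_eq[OF L_\<Omega> L_T]) (use zU sub3 in auto)
  also have "\<dots> = (LINT x|?M. wgrad \<Omega> u x \<bullet> \<gamma> x)" by (rule main[symmetric])
  also have "\<dots> = (LINT x|lebesgue_on \<Omega>. wgrad \<Omega> u x \<bullet> \<gamma> x)"
    by (rule LINT_on_eq[OF L_T L_\<Omega>]) (use zU sub3 in auto)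
  also have "\<dots> = (LINT x|lebesgue_on \<Omega>. wgrad \<Omega> u x \<bullet> wgrad \<Omega> v x)"
  proof (rule integral_cong_AE)
    show "AE x in lebesgue_on \<Omega>. wgrad \<Omega> u x \<bullet> \<gamma> x = wgrad \<Omega> u x \<bullet> wgrad \<Omega> v x" using wv by eventually_elim simp
  qed (intro borel_measurable_inner u_wgrad(4) sq_integrable_measurable[OF H10_pair_sq_integrable(2)[OF p1]] sq_integrable_measurable[OF H10_pair_sq_integrable(2)[OF p]])+
  finally show "(LINT x|lebesgue_on \<Omega>. wgrad \<Omega> u x \<bullet> wgrad \<Omega> v x) = (LINT x|lebesgue_on \<Omega>. exp (- u x) * v x)" ..
qed

text \<open>Each \<open>un n\<close> has its own approximating sequence. Choosing one member of
  each, with error below \<open>1 / (n + 1)\<close>, gives a single diagonal sequence of test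
  functions converging to the limit.\<close>

lemma test_approximation:
  obtains \<psi> where "\<And>n. test_function (T (real (Suc n))) (\<psi> n)"
    "\<And>n. (LINT x|lebesgue_on (T (real (Suc n))). (norm (\<psi> n x - un n x))\<^sup>2) < inverse (real (Suc n))"
    "\<And>n. (LINT x|lebesgue_on (T (real (Suc n))). (norm (grad (\<psi> n) x - gn n x))\<^sup>2) < inverse (real (Suc n))"
proof -
  have "\<exists>\<psi>. test_function (T (real (Suc n))) \<psi> \<and>
    (LINT x|lebesgue_on (T (real (Suc n))). (norm (\<psi> x - un n x))\<^sup>2) < inverse (real (Suc n)) \<and>
    (LINT x|lebesgue_on (T (real (Suc n))). (norm (grad \<psi> x - gn n x))\<^sup>2) < inverse (real (Suc n))" for n
  proof -
    obtain \<psi> where \<psi>: "\<And>j. test_function (T (real (Suc n))) (\<psi> j)" "L2_conv (lebesgue_on (T (real (Suc n)))) \<psi> (un n)"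
      "L2_conv (lebesgue_on (T (real (Suc n)))) (\<lambda>j. grad (\<psi> j)) (gn n)"
      using un_pair[of n] unfolding H10_pair_def by blast
    have pos: "0 < inverse (real (Suc n))" by simp
    have "\<forall>\<^sub>F j in sequentially. (LINT x|lebesgue_on (T (real (Suc n))). (norm (\<psi> j x - un n x))\<^sup>2) < inverse (real (Suc n)) \<and>
      (LINT x|lebesgue_on (T (real (Suc n))). (norm (grad (\<psi> j) x - gn n x))\<^sup>2) < inverse (real (Suc n))"
      using order_tendstoD(2)[OF L2_conv_tendsto[OF \<psi>(2)] pos] order_tendstoD(2)[OF L2_conv_tendsto[OF \<psi>(3)] pos]
      by (rule eventually_conj)
    then obtain j where "(LINT x|lebesgue_on (T (real (Suc n))). (norm (\<psi> j x - un n x))\<^sup>2) < inverse (real (Suc n)) \<and>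
      (LINT x|lebesgue_on (T (real (Suc n))). (norm (grad (\<psi> j) x - gn n x))\<^sup>2) < inverse (real (Suc n))"
      by (auto simp: eventually_sequentially)
    with \<psi>(1)[of j] show ?thesis by blast
  qed
  then have "\<exists>\<psi>. \<forall>n. test_function (T (real (Suc n))) (\<psi> n) \<and>
    (LINT x|lebesgue_on (T (real (Suc n))). (norm (\<psi> n x - un n x))\<^sup>2) < inverse (real (Suc n)) \<and>
    (LINT x|lebesgue_on (T (real (Suc n))). (norm (grad (\<psi> n) x - gn n x))\<^sup>2) < inverse (real (Suc n))"
    by (intro choice allI)
  then show ?thesis using that by blast
qed

text \<open>The errors are measured on sets that grow with the index, so they also bound the errors
  on the fixed truncation. The shift by \<open>k + 3\<close> matches the range in which the
  gradients converge.\<close>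

lemma L2_conv_of_close:
  fixes F G :: "nat \<Rightarrow> real^2 \<Rightarrow> 'b::euclidean_space"
  assumes s: "\<And>n. sq_integrable (lebesgue_on (T (real (Suc n)))) (F n)" "\<And>n. sq_integrable (lebesgue_on (T (real (Suc n)))) (G n)"
    and close: "\<And>n. (LINT x|lebesgue_on (T (real (Suc n))). (norm (F n x - G n x))\<^sup>2) < inverse (real (Suc n))"
    and c: "L2_conv (lebesgue_on (T (real k))) (\<lambda>n. G (n + (k + 3))) g"
  shows "L2_conv (lebesgue_on (T (real k))) (\<lambda>n. F (n + (k + 3))) g"
proof -
  have sub: "T (real k) \<subseteq> T (real (Suc (n + (k + 3))))" for n by (rule T_mono) simp
  have d: "sq_integrable (lebesgue_on (T (real (Suc (n + (k + 3)))))) (\<lambda>x. F (n + (k + 3)) x - G (n + (k + 3)) x)" for n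
    by (rule sq_integrable_diff[OF s])
  have "L2_conv (lebesgue_on (T (real k))) (\<lambda>n x. F (n + (k + 3)) x - G (n + (k + 3)) x) (\<lambda>x. 0)"
    unfolding L2_conv_def
  proof (intro conjI allI sq_integrable_zero)
    show "sq_integrable (lebesgue_on (T (real k))) (\<lambda>x. F (n + (k + 3)) x - G (n + (k + 3)) x)" for n
      by (rule sq_integrable_on_subset[OF L_T L_T sub d])
    show "(\<lambda>n. LINT x|lebesgue_on (T (real k)). (norm (F (n + (k + 3)) x - G (n + (k + 3)) x - 0))\<^sup>2) \<longlonglongrightarrow> 0"
    proof (rule tendsto_sandwich[OF _ _ tendsto_const])
      show "(\<lambda>n. inverse (real (Suc (n + (k + 3))))) \<longlonglongrightarrow> 0"
        by (rule LIMSEQ_ignore_initial_segment[OF LIMSEQ_inverse_real_of_nat])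
      have "(LINT x|lebesgue_on (T (real k)). (norm (F (n + (k + 3)) x - G (n + (k + 3)) x - 0))\<^sup>2) \<le> inverse (real (Suc (n + (k + 3))))" for n
      proof -
        have "(LINT x|lebesgue_on (T (real k)). (norm (F (n + (k + 3)) x - G (n + (k + 3)) x - 0))\<^sup>2)
            \<le> (LINT x|lebesgue_on (T (real (Suc (n + (k + 3))))). (norm (F (n + (k + 3)) x - G (n + (k + 3)) x))\<^sup>2)"
          by (rule integral_mono_lebesgue_on_AE[OF sq_integrable_integrable[OF d] _ _ sub L_T L_T]) auto
        with close[of "n + (k + 3)"] show ?thesis by linarith
      qed
      then show "\<forall>\<^sub>F n in sequentially. (LINT x|lebesgue_on (T (real k)). (norm (F (n + (k + 3)) x - G (n + (k + 3)) x - 0))\<^sup>2) \<le> inverse (real (Suc (n + (k + 3))))"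
        by (intro always_eventually allI)
    qed simp
  qed
  from L2_conv_add[OF this c] show ?thesis by simp
qed

lemma u_zero_trace: "zero_trace \<theta>0 u"
  unfolding zero_trace_def has_ray_trace_def
proof (intro ballI allI impI)
  fix \<sigma> R :: real assume \<sigma>: "\<sigma> \<in> {-1, 1}" and R: "0 < R"
  let ?D = "half_sector \<theta>0 \<sigma> R"
  note D = open_half_sector[OF \<theta>0 \<sigma>, of R]
  note LD = open_in_lebesgue[OF D]
  obtain k :: nat where "R < real k" using reals_Archimedean2 by blast
  then have Dk: "?D \<subseteq> T (real k)" using half_sector_subset[OF \<theta>0 \<sigma>, of R] T_mono[of R "real k"] by auto
  have D\<Omega>: "?D \<subseteq> \<Omega>" using Dk T_subset by blast
  have uH: "u \<in> H1 ?D"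
    by (rule local_H1D[OF u_local_H1 D bounded_subset[OF bounded_T Dk] D\<Omega>])
  obtain \<psi> where \<psi>: "\<And>n. test_function (T (real (Suc n))) (\<psi> n)"
    "\<And>n. (LINT x|lebesgue_on (T (real (Suc n))). (norm (\<psi> n x - un n x))\<^sup>2) < inverse (real (Suc n))"
    "\<And>n. (LINT x|lebesgue_on (T (real (Suc n))). (norm (grad (\<psi> n) x - gn n x))\<^sup>2) < inverse (real (Suc n))"
    using test_approximation by blast
  have 1: "L2_conv (lebesgue_on (T (real k))) (\<lambda>n. \<psi> (n + (k + 3))) u"
    by (rule L2_conv_of_close[OF test_sq_integrable(1)[OF \<psi>(1) L_T] H10_pair_sq_integrable(1)[OF un_pair] \<psi>(2) un_L2_conv_shift])
  have 2: "L2_conv (lebesgue_on (T (real k))) (\<lambda>n. grad (\<psi> (n + (k + 3)))) (wgrad \<Omega> u)"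
    by (rule L2_conv_of_close[OF test_sq_integrable(2)[OF \<psi>(1) L_T] H10_pair_sq_integrable(2)[OF un_pair] \<psi>(3) gn_L2_conv_wgrad])
  \<comment> \<open>\<open>H1_converges\<close> refers to the gradient chosen on the half sector, so
    the limit found on the whole sector has to be identified with it.\<close>
  have "weak_gradient ?D u (wgrad \<Omega> u)" by (rule weak_gradient_subset[OF L_\<Omega> LD D\<Omega> u_wgrad(1)])
  from wgrad_AE_eq[OF D this] have ae: "AE x in lebesgue_on ?D. wgrad \<Omega> u x = wgrad ?D u x"
    by eventually_elim simp
  have H: "H1_converges ?D (\<lambda>n. \<psi> (n + (k + 3))) u"
  proof (subst H1_converges_iff[OF D uH])
    show "sq_integrable (lebesgue_on ?D) (\<psi> (n + (k + 3)))" "sq_integrable (lebesgue_on ?D) (grad (\<psi> (n + (k + 3))))" for n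
      using test_sq_integrable[OF \<psi>(1) LD] by auto
    show "L2_conv (lebesgue_on ?D) (\<lambda>n. \<psi> (n + (k + 3))) u \<and> L2_conv (lebesgue_on ?D) (\<lambda>n. grad (\<psi> (n + (k + 3)))) (wgrad ?D u)"
      using L2_conv_on_subset[OF LD L_T Dk 1] L2_conv_limit_AE[OF LD L2_conv_on_subset[OF LD L_T Dk 2] ae] by blast
  qed
  \<comment> \<open>The rays lie outside the open sector, whereas each support lies inside it: the
    approximants have exact value 0 there, from whichever side of the slit the trace is
    taken.\<close>
  have z: "\<psi> n (polar r (\<sigma> * \<theta>0)) = 0" if "0 < r" for n r
  proof -
    have "polar r (\<sigma> * \<theta>0) \<notin> \<Omega>" by (rule ray_notin_sector[OF \<theta>0 that \<sigma>])
    moreover obtain K where "K \<subseteq> T (real (Suc n))" "\<forall>x. x \<notin> K \<longrightarrow> \<psi> n x = 0" using \<psi>(1)[of n] unfolding test_function_def by blast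
    ultimately show ?thesis using T_subset by blast
  qed
  have "(LINT t|lebesgue_on {0<..<R}. (\<psi> (n + (k + 3)) (polar t (\<sigma> * \<theta>0)) - 0)\<^sup>2) = (LINT t|lebesgue_on {0<..<R}. 0)" for n
    by (rule Bochner_Integration.integral_cong) (auto simp: z)
  then have tr: "(\<lambda>n. LINT t|lebesgue_on {0<..<R}. (\<psi> (n + (k + 3)) (polar t (\<sigma> * \<theta>0)) - 0)\<^sup>2) \<longlonglongrightarrow> 0" by simp
  show "has_trace_along ?D (\<lambda>r. polar r (\<sigma> * \<theta>0)) {0<..<R} u (\<lambda>r. 0)"
    unfolding has_trace_along_def
  proof (intro conjI exI[of _ "\<lambda>n. \<psi> (n + (k + 3))"] allI uH H tr)
    show "L2_on {0<..<R} (\<lambda>r. 0::real)" by (simp add: L2_on_def)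
    show "smooth (\<psi> (n + (k + 3)))" for n using \<psi>(1) by (simp add: test_function_def)
  qed
qed

section \<open>The limit as a solution; symmetry, minimality and uniqueness\<close>

lemma u_solution: "local_variational_solution \<theta>0 u"
  unfolding local_variational_solution_def Let_def
  using u_local_H1 u_zero_trace u_equation by blast

lemma u_nonneg_solution: "nonneg_solution \<theta>0 u"
  unfolding nonneg_solution_def using u_solution u_nonneg by (auto intro!: AE_I2)

text \<open>Each truncation is invariant under \<open>flip\<close>, so the suprema at a point and at
  its mirror image range over the same radii and the same values.\<close>

lemma u_symmetric:
  assumes "0 < r" "\<bar>\<theta>\<bar> < \<theta>0" shows "u (polar r (- \<theta>)) = u (polar r \<theta>)"
proof -
  let ?x = "polar r \<theta>"
  have x: "?x \<in> \<Omega>" using assms unfolding sector_def by blast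
  have fx: "flip ?x \<in> \<Omega>" by (rule flip_sector_imp[OF x])
  have "uR R (flip ?x) = uR R ?x" if "?x \<in> T R" for R
    by (rule flip.weak_solution_symmetric[OF open_T bounded_T flip_sector_trunc uR_weak_solution cont that]) (use T_pos[OF that] in auto)
  then have "(SUP R\<in>{R. ?x \<in> T R}. uR R (flip ?x)) = (SUP R\<in>{R. ?x \<in> T R}. uR R ?x)" by (intro SUP_cong) auto
  then have "u (flip ?x) = u ?x" unfolding u_eq[OF x] u_eq[OF fx] by (simp add: flip_sector_trunc)
  then show ?thesis by (simp add: flip_polar)
qed

text \<open>For the almost everywhere part only integer radii are used, since countably many
  exceptional sets still form a null set. For continuous \<phi> each inequality holds everywhere on
  its truncation, and all radii may be used.\<close>

lemma u_le_supersol: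
  assumes \<phi>: "supersol \<phi>" shows "le_on \<Omega> u \<phi>"
  unfolding le_on_def
proof (intro conjI impI ballI)
  have "AE x in lebesgue. x \<in> T (real (Suc n)) \<longrightarrow> un n x \<le> \<phi> x" for n
    using weak_solution_le_supersol[OF un_ws \<phi>] by (simp add: AE_on_iff[OF L_T])
  then have "AE x in lebesgue. \<forall>n. x \<in> T (real (Suc n)) \<longrightarrow> un n x \<le> \<phi> x" by (subst AE_all_countable) blast
  then show "AE x in lebesgue_on \<Omega>. u x \<le> \<phi> x"
    unfolding AE_on_iff[OF L_\<Omega>]
  proof eventually_elim
    case (elim x)
    show ?case
    proof
      assume x: "x \<in> \<Omega>"
      obtain N :: nat where N: "norm x < real N" using reals_Archimedean2 by blast
      have "un n x \<le> \<phi> x" if "n \<ge> N" for n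
      proof -
        have "x \<in> T (real (Suc n))" using x N that by (simp add: mem_T)
        with elim show ?thesis by blast
      qed
      then show "u x \<le> \<phi> x" by (intro LIMSEQ_le_const2[OF un_tendsto[OF x]]) blast
    qed
  qed
  fix x assume c: "continuous_on \<Omega> \<phi>" and x: "x \<in> \<Omega>"
  show "u x \<le> \<phi> x"
  proof (rule u_least[OF x])
    fix R assume xR: "x \<in> T R"
    note R = T_pos[OF xR]
    show "uR R x \<le> \<phi> x"
      by (rule AE_le_imp_le_on_open[OF open_T cont[OF R] continuous_on_subset[OF c T_subset] weak_solution_le_supersol[OF uR_weak_solution[OF R] \<phi>] xR])
  qed
qed

lemma u_unique:
  assumes "nonneg_solution \<theta>0 w" "\<And>\<phi>. nonneg_solution \<theta>0 \<phi> \<Longrightarrow> AE x in lebesgue_on \<Omega>. w x \<le> \<phi> x"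
  shows "AE x in lebesgue_on \<Omega>. w x = u x"
proof -
  have "AE x in lebesgue_on \<Omega>. u x \<le> w x"
    using u_le_supersol[OF nonneg_solution_supersol[OF assms(1)]] by (simp add: le_on_def)
  with assms(2)[OF u_nonneg_solution] show ?thesis by eventually_elim simp
qed

end

theorem mainTheorem1:
  fixes \<theta>0 :: real and uR :: "real \<Rightarrow> real^2 \<Rightarrow> real" and u :: "real^2 \<Rightarrow> real"
  assumes "0 < \<theta>0" and "\<theta>0 \<le> pi"
    and "\<And>R. 0 < R \<Longrightarrow> variational_solution (sector_trunc \<theta>0 R) (uR R)"
    and "\<And>R. 0 < R \<Longrightarrow> continuous_on (sector_trunc \<theta>0 R) (uR R)"
    and "\<And>x. x \<in> sector \<theta>0 \<Longrightarrow> u x = (SUP R\<in>{R. x \<in> sector_trunc \<theta>0 R}. uR R x)"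
  shows "(\<forall>x\<in>sector \<theta>0. bdd_above ((\<lambda>R. uR R x) ` {R. x \<in> sector_trunc \<theta>0 R})) \<and>
    local_variational_solution \<theta>0 u \<and>
    (\<forall>x\<in>sector \<theta>0. 0 \<le> u x) \<and>
    (\<forall>r \<theta>. 0 < r \<and> \<bar>\<theta>\<bar> < \<theta>0 \<longrightarrow> u (polar r (- \<theta>)) = u (polar r \<theta>)) \<and>
    (\<forall>\<phi>. nonneg_solution \<theta>0 \<phi> \<longrightarrow> le_on (sector \<theta>0) u \<phi>) \<and>
    (\<forall>w. nonneg_solution \<theta>0 w \<and>
         (\<forall>\<phi>. nonneg_solution \<theta>0 \<phi> \<longrightarrow> (AE x in lebesgue_on (sector \<theta>0). w x \<le> \<phi> x)) \<longrightarrow>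
         (AE x in lebesgue_on (sector \<theta>0). w x = u x)) \<and>
    (\<forall>\<phi>. nonneg_supersolution \<theta>0 \<phi> \<longrightarrow> le_on (sector \<theta>0) u \<phi>) \<and>
    (\<exists>C\<ge>0. \<forall>x\<in>sector \<theta>0. u x \<le> C + 4 * ln (1 + norm x))"
proof -
  interpret exhaustion \<theta>0 uR u by unfold_locales (fact assms)+
  show ?thesis
  proof (intro conjI ballI allI impI exI[of _ C0])
    show "AE x in lebesgue_on (sector \<theta>0). w x = u x"
      if "nonneg_solution \<theta>0 w \<and> (\<forall>\<phi>. nonneg_solution \<theta>0 \<phi> \<longrightarrow> (AE x in lebesgue_on (sector \<theta>0). w x \<le> \<phi> x))" for w
      using u_unique[of w] that by blast
  qed (auto intro: uR_bdd_above u_solution u_nonneg u_symmetric C0_nonneg u_bound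
        u_le_supersol nonneg_solution_supersol nonneg_supersolution_supersol)
qed

end
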